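(* Let $k\ge 1$ and let $\mathbf u=(u_1,\dots,u_k)\in(\mathbb C\setminus\{0\})^k$ with all $u_i$ distinct. Let $\eta:\mathcal H\to\mathbb C$ be a linear functional with $O_{\mathbf u}\subset\ker\eta$. Then for all homogeneous $\psi_1,\dots,\psi_l\in V$ (with $\psi_a\in V^{h_a}$), the formal series $\langle\prod_{a=1}^l V(\psi_a,z_a)\rangle_{\eta,R}$, for the $l!$ different regions $R$, each converge on some domain and can be analytically continued to a single function $\langle\prod_{a=1}^l V(\psi_a,z_a)\rangle_{\eta}$ (independent of $R$) which is meromorphic on $\mathbb C^l$. This function has poles only at $z_i=z_j$ ($i\neq j$) or $z_i=u_j$, and $\langle\prod_{a=1}^l V(\psi_a,z_a)\rangle_\eta\, dz_i^{\otimes h_i}$ is nonsingular at $z_i=\infty$ for each $i$. Furthermore, for all $i\ne j$ in $\{1,\dots,l\}$ the operator product expansion $$\Big\langle\prod_{a=1}^l V(\psi_a,z_a)\Big\rangle_{\eta}=\sum_{n=-h_i-h_j}^\infty (z_i-z_j)^n\Big\langle V(V_{-n-h_i}(\psi_i)\psi_j,z_j)\prod_{a\ne i,j}V(\psi_a,z_a)\Big\rangle_\eta$$ holds for $z_i$ sufficiently close to $z_j$.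
   Context: **Chiral theory.** $\mathbb P=\mathbb C\cup\{\infty\}$ is the Riemann sphere; $\oint$ denotes a contour integral normalized by $1/(2\pi i)$. Fix a chiral bosonic conformal field theory on $\mathbb P$ in the sense of Gaberdiel and Goddard. It is given by a graded complex vector space $V=\bigoplus_{h=0}^\infty V^h$ with each $V^h$ finite-dimensional, together with amplitudes $\langle\prod_{a=1}^l V(\psi_a,z_a)\rangle$ for homogeneous $\psi_a\in V^{h_a}$. The amplitudes are multilinear in the $\psi_a$, invariant under permutations of the pairs $(\psi_a,z_a)$, and such that $\langle\prod_a V(\psi_a,z_a)\rangle\prod_a dz_a^{\otimes h_a}$ is meromorphic on $\mathbb P^l$ with poles only at $z_a=z_b$, and Möbius invariant. They are nondegenerate (a $\psi$ all of whose amplitudes vanish is $0$) and satisfy cluster decomposition: $\lambda^{\sum_j h_j}\langle\prod_i V(\phi_i,\zeta_i)\prod_j V(\psi_j,\lambda z_j)\rangle\to\langle\prod_i V(\phi_i,\zeta_i)\rangle\langle\prod_j V(\psi_j,z_j)\rangle$ as $\lambda\to0$. The modes are $V_n(\psi)=\oint_0 z^{n+h_\psi-1}V(\psi,z)\,dz$, i.e. $V(\psi,z)=\sum_n V_n(\psi)z^{-n-h_\psi}$. The Fock space at $0$, $\mathcal H$, is spanned by $V_{n_1}(\psi_1)\cdots V_{n_r}(\psi_r)\Omega$ ($\psi_i\in V$, $\Omega$ the vacuum; contours $|z_1|>\dots>|z_r|$), where two linear combinations are identified iff they agree in all amplitudes with vertex operators inserted away from $0$. It is graded by conformal weight $h\ge0$,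 $V_n(\psi)$ lowers weight by $n$, and $V\subset\mathcal H$ via $\psi=V_{-h_\psi}(\psi)\Omega$. Vertex operators $V(\chi,z)=\sum_nV_n(\chi)z^{-n-h_\chi}$ are defined for all homogeneous $\chi\in\mathcal H$, with $V(\phi,z)V(\chi,w)=\sum_n (z-w)^nV(V_{-n-h_\phi}(\phi)\chi,w)$ inside amplitudes. There is a Virasoro field $L(z)=\sum_n L_nz^{-n-2}$, the vertex operator of a state in $V^2$, whose modes satisfy the Virasoro algebra; $L_0$ gives the grading, and $V(L_{-1}\chi,z)=\partial_zV(\chi,z)$. $V$ is the space of all quasiprimary states ($L_1\psi=0$) in $\mathcal H$, and $\mathcal H$ is spanned by the $L_{-1}^n\psi$, $\psi\in V$. **Divisors.** For a meromorphic function $f$ and $m\in\mathbb Z$, the divisor of $f\,dz^{\otimes m}$ is $\mathrm{div}(f\,dz^{\otimes m})=\sum_{P}\nu_P(f)[P]-2m[\infty]$, $\nu_P$ being order of vanishing; $D\ge D'$ means all coefficients of $D-D'$ are $\ge0$. **The subspace $O_{\mathbf u}$.** For $\mathbf u\in(\mathbb P\setminus\{0\})^k$, $$O_{\mathbf u}=\mathrm{Span}\Big\{\oint_0dz\,g(z)V(\psi,z)\chi\ \Big|\ \chi\in\mathcal H,\ \psi\in V\text{ homogeneous},\ \mathrm{div}\big(g\,dz^{\otimes(1-h_\psi)}\big)\ge -N[0]+\sum_{i=1}^kh_\psi[u_i]\text{ for some }N\Big\}\subset\mathcal H,$$ with $g$ meromorphic on $\mathbb P$. **Formal series.** A permutation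 $R$ of $\{1,\dots,l\}$ is identified with the region $\{|z_{R(1)}|>\dots>|z_{R(l)}|\}\subset\mathbb C^l$. For a linear functional $\eta$ on $\mathcal H$ and homogeneous $\psi_a$ of weight $h_a$, $$\Big\langle\prod_{a=1}^lV(\psi_a,z_a)\Big\rangle_{\eta,R}=\sum_{\mathbf j\in\mathbb Z^l}\eta\Big(V_{j_{R(1)}}(\psi_{R(1)})\cdots V_{j_{R(l)}}(\psi_{R(l)})\Omega\Big)\prod_{i=1}^lz_i^{-j_i-h_i}.$$ The same formula defines the series for homogeneous $\psi_a\in\mathcal H$; the functions $\langle\cdots\rangle_\eta$ with insertions from $\mathcal H$ (as on the right of the operator product expansion) are the corresponding analytic continuations, equivalently are obtained from those with insertions in $V$ by linearity and $V(L_{-1}\chi,z)=\partial_zV(\chi,z)$. *)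

theory Defs
  imports "HOL-Complex_Analysis.Complex_Analysis" "HOL-Combinatorics.Permutations"
begin

section \<open>Functions of several complex variables\<close>

text \<open>
  \<open>\<complex>\<^sup>l\<close> is the space of sequences supported in \<open>{..<l}\<close>, with the product topology
  (the convention of \<open>Euclidean_space\<close> in HOL-Analysis).  The index \<open>l\<close> is a term because the
  statements below relate amplitudes with different numbers of insertions.
\<close>

definition cspace :: "nat \<Rightarrow> (nat \<Rightarrow> complex) set" where
  "cspace l = {z. \<forall>i\<ge>l. z i = 0}"

definition open_cspace :: "nat \<Rightarrow> (nat \<Rightarrow> complex) set \<Rightarrow> bool" where
  "open_cspace l U \<longleftrightarrow> openin (top_of_set (cspace l)) U"

text \<open>Holomorphy: continuous, and complex differentiable in each variable (Osgood).\<close>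

definition holomorphic_cspace ::
    "nat \<Rightarrow> ((nat \<Rightarrow> complex) \<Rightarrow> complex) \<Rightarrow> (nat \<Rightarrow> complex) set \<Rightarrow> bool" where
  "holomorphic_cspace l f U \<longleftrightarrow>
     open_cspace l U \<and> continuous_on U f \<and>
     (\<forall>z\<in>U. \<forall>i<l. (\<lambda>t. f (z(i := t))) field_differentiable (at (z i)))"

text \<open>
  \<open>f\<close> is meromorphic on \<open>U\<close> with poles only on \<open>D\<close>: it is holomorphic on \<open>U - D\<close>, and near every
  point of \<open>U\<close> it is a quotient \<open>g / q\<close> of holomorphic functions, \<open>q\<close> not vanishing identically
  on any nonempty open set.  The values of \<open>f\<close> on \<open>D\<close> (always nowhere dense below) are irrelevant.
\<close>

definition meromorphic_cspace ::
    "nat \<Rightarrow> ((nat \<Rightarrow> complex) \<Rightarrow> complex) \<Rightarrow> (nat \<Rightarrow> complex) set \<Rightarrow> (nat \<Rightarrow> complex) set \<Rightarrow> bool"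
  where
  "meromorphic_cspace l f U D \<longleftrightarrow>
     holomorphic_cspace l f (U - D) \<and>
     (\<forall>p\<in>U. \<exists>W g q. p \<in> W \<and> W \<subseteq> U \<and> holomorphic_cspace l g W \<and> holomorphic_cspace l q W \<and>
        (\<forall>W'. open_cspace l W' \<and> W' \<subseteq> W \<and> W' \<noteq> {} \<longrightarrow> (\<exists>z\<in>W'. q z \<noteq> 0)) \<and>
        (\<forall>z\<in>W - D. f z * q z = g z))"


section \<open>The Riemann sphere and divisors\<close>

text \<open>A point of the Riemann sphere is \<open>Some z\<close> with \<open>z\<close> complex, or \<open>None\<close>, the point at infinity.\<close>

type_synonym sphere = "complex option"

definition meromorphic_sphere :: "(complex \<Rightarrow> complex) \<Rightarrow> bool" where
  "meromorphic_sphere g \<longleftrightarrow>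
     g meromorphic_on UNIV \<and> (\<lambda>w. g (inverse w)) meromorphic_on {0}"

definition vanishing_order :: "(complex \<Rightarrow> complex) \<Rightarrow> sphere \<Rightarrow> int" where
  "vanishing_order g P =
     (case P of Some z \<Rightarrow> zorder g z | None \<Rightarrow> zorder (\<lambda>w. g (inverse w)) 0)"

text \<open>The divisor of \<open>g dz\<^sup>\<otimes>\<^sup>m\<close>.\<close>

definition divisor :: "(complex \<Rightarrow> complex) \<Rightarrow> int \<Rightarrow> sphere \<Rightarrow> int" where
  "divisor g m P = vanishing_order g P - (if P = None then 2 * m else 0)"

text \<open>
  The \<open>2\<^sup>l\<close> standard charts of the \<open>l\<close>-fold product of the sphere: coordinate \<open>a\<close> is \<open>w = z\<close> if
  \<open>a \<notin> S\<close>, and \<open>w = 1/z\<close> if \<open>a \<in> S\<close>.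
\<close>

definition chart_point :: "nat set \<Rightarrow> (nat \<Rightarrow> complex) \<Rightarrow> nat \<Rightarrow> sphere" where
  "chart_point S w a =
     (if a \<in> S then (if w a = 0 then None else Some (inverse (w a))) else Some (w a))"

definition chart_collisions :: "nat \<Rightarrow> nat set \<Rightarrow> (nat \<Rightarrow> complex) set" where
  "chart_collisions l S =
     {w \<in> cspace l. \<exists>a<l. \<exists>b<l. a \<noteq> b \<and> chart_point S w a = chart_point S w b}"

text \<open>
  \<open>f \<Otimes>dz\<^sub>a\<^sup>h\<^sup>a\<close> is meromorphic on the product of spheres, with poles only where two points
  coincide.  The factor is the transition function \<open>dz = - w\<^sup>-\<^sup>2 dw\<close> for \<open>z = 1/w\<close>.
\<close>

definition meromorphic_form ::
    "nat \<Rightarrow> (nat \<Rightarrow> nat) \<Rightarrow> ((nat \<Rightarrow> complex) \<Rightarrow> complex) \<Rightarrow> bool" where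
  "meromorphic_form l h f \<longleftrightarrow>
     (\<forall>S\<subseteq>{..<l}. \<exists>G. meromorphic_cspace l G (cspace l) (chart_collisions l S) \<and>
        (\<forall>w \<in> cspace l - chart_collisions l S. (\<forall>a\<in>S. w a \<noteq> 0) \<longrightarrow>
           G w = f (\<lambda>a. if a \<in> S then inverse (w a) else w a) *
                 (\<Prod>a\<in>S. (- inverse ((w a)\<^sup>2)) ^ h a)))"


section \<open>Chiral conformal field theories\<close>

text \<open>
  A product of vertex operators \<open>\<Prod>\<^sub>a V(\<psi>\<^sub>a, z\<^sub>a)\<close> is encoded as the list of the pairs
  \<open>(\<psi>\<^sub>a, z\<^sub>a)\<close>.  It is admissible if the states lie in \<open>A\<close> and the points in \<open>P\<close>, and the points are
  distinct; values of amplitudes on other lists are irrelevant.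
\<close>

definition insertions :: "nat \<Rightarrow> (nat \<Rightarrow> 'h) \<Rightarrow> (nat \<Rightarrow> complex) \<Rightarrow> ('h \<times> complex) list" where
  "insertions l \<psi> z = map (\<lambda>a. (\<psi> a, z a)) [0..<l]"

definition admissible :: "'h set \<Rightarrow> complex set \<Rightarrow> ('h \<times> complex) list \<Rightarrow> bool" where
  "admissible A P ps \<longleftrightarrow> fst ` set ps \<subseteq> A \<and> snd ` set ps \<subseteq> P \<and> distinct (map snd ps)"

text \<open>
  The amplitudes of the theory.  The graded space \<open>V = \<Oplus>V\<^sup>h\<close> is an internal direct sum of
  subspaces \<open>V h\<close> of an ambient vector space, which below is the Fock space.
\<close>

locale chiral_amplitudes = vector_space smul
  for smul :: "complex \<Rightarrow> 'h::ab_group_add \<Rightarrow> 'h" +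
  fixes V :: "nat \<Rightarrow> 'h set"
    and amp :: "('h \<times> complex) list \<Rightarrow> complex"
  assumes V_subspace: "subspace (V h)"
    and V_finite_dim: "\<exists>B. finite B \<and> V h \<subseteq> span B"
    and V_direct: "finite H \<Longrightarrow> (\<And>h. h \<in> H \<Longrightarrow> v h \<in> V h) \<Longrightarrow> (\<Sum>h\<in>H. v h) = 0 \<Longrightarrow>
          h \<in> H \<Longrightarrow> v h = 0"
    and amp_V_linear: "admissible (span (\<Union>h. V h)) UNIV ((x, z) # ps) \<Longrightarrow> y \<in> span (\<Union>h. V h) \<Longrightarrow>
          amp ((smul a x + y, z) # ps) = a * amp ((x, z) # ps) + amp ((y, z) # ps)"
    and amp_V_symmetric: "admissible (span (\<Union>h. V h)) UNIV ps \<Longrightarrow> mset ps = mset qs \<Longrightarrow>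
          amp ps = amp qs"
    and amp_meromorphic: "(\<And>a. a < l \<Longrightarrow> \<psi> a \<in> V (d a)) \<Longrightarrow>
          meromorphic_form l d (\<lambda>z. amp (insertions l \<psi> z))"
    and amp_Moebius: "(\<And>a. a < l \<Longrightarrow> \<psi> a \<in> V (d a)) \<Longrightarrow> inj_on \<zeta> {..<l} \<Longrightarrow>
          p * s - q * r \<noteq> 0 \<Longrightarrow> (\<And>a. a < l \<Longrightarrow> r * \<zeta> a + s \<noteq> 0) \<Longrightarrow>
          amp (insertions l \<psi> \<zeta>) =
            (\<Prod>a<l. ((p * s - q * r) / (r * \<zeta> a + s)\<^sup>2) ^ d a) *
            amp (insertions l \<psi> (\<lambda>a. (p * \<zeta> a + q) / (r * \<zeta> a + s)))"
    and amp_nondegenerate: "\<phi> \<in> span (\<Union>h. V h) \<Longrightarrow>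
          (\<And>z ps. admissible (span (\<Union>h. V h)) UNIV ((\<phi>, z) # ps) \<Longrightarrow> amp ((\<phi>, z) # ps) = 0) \<Longrightarrow>
          \<phi> = 0"
    and amp_cluster: "admissible (\<Union>h. V h) (- {0}) ps \<Longrightarrow>
          (\<And>j. j < m \<Longrightarrow> \<psi> j \<in> V (d j)) \<Longrightarrow> inj_on \<zeta> {..<m} \<Longrightarrow>
          ((\<lambda>t. t ^ (\<Sum>j<m. d j) * amp (ps @ insertions m \<psi> (\<lambda>j. t * \<zeta> j)))
             \<longlongrightarrow> amp ps * amp (insertions m \<psi> \<zeta>)) (at 0)"

text \<open>
  \<open>vop \<psi> n\<close> is the mode \<open>V\<^sub>n(\<psi>)\<close> for homogeneous \<open>\<psi>\<close>, extended linearly in \<open>\<psi>\<close>.  The Virasoro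
  modes are \<open>L\<^sub>n = vop \<omega> n\<close>, and the states of conformal weight \<open>n\<close> are the \<open>L\<^sub>0\<close>-eigenvectors of
  eigenvalue \<open>n\<close>.
\<close>

definition weight_space ::
    "(complex \<Rightarrow> 'h \<Rightarrow> 'h) \<Rightarrow> ('h \<Rightarrow> int \<Rightarrow> 'h \<Rightarrow> 'h) \<Rightarrow> 'h \<Rightarrow> nat \<Rightarrow> 'h set" where
  "weight_space smul vop \<omega> n = {\<xi>. vop \<omega> 0 \<xi> = smul (of_nat n) \<xi>}"

text \<open>
  The type \<open>'h\<close> is the Fock space.  It is not built as a quotient but described by the properties
  that determine it from the amplitudes: it is spanned by the words \<open>fock_span\<close>, two states agree if
  all their amplitudes with vertex operators away from \<open>0\<close> do (\<open>fock_eq\<close>), and the amplitudes of a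
  word are the iterated contour integrals around \<open>0\<close> (\<open>amp_mode\<close>, one contour at a time; \<open>residue\<close>
  is \<open>1/(2\<pi>i)\<close> times the integral over a small circle, so operators further to the right lie inside it).
  Here \<open>amp\<close> is extended to vertex operators of all states, and \<open>(\<xi>, 0)\<close> inserts
  the state \<open>\<xi> = V(\<xi>, 0)\<Omega>\<close>.
\<close>

locale chiral_cft = chiral_amplitudes smul V amp
  for smul :: "complex \<Rightarrow> 'h::ab_group_add \<Rightarrow> 'h"
    and V :: "nat \<Rightarrow> 'h set"
    and amp :: "('h \<times> complex) list \<Rightarrow> complex" +
  fixes \<Omega> :: 'h
    and vop :: "'h \<Rightarrow> int \<Rightarrow> 'h \<Rightarrow> 'h"
    and \<omega> :: 'h
    and c :: complex
  assumes amp_linear: "admissible UNIV UNIV ((x, z) # ps) \<Longrightarrow>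
          amp ((smul a x + y, z) # ps) = a * amp ((x, z) # ps) + amp ((y, z) # ps)"
    and amp_symmetric: "admissible UNIV UNIV ps \<Longrightarrow> mset ps = mset qs \<Longrightarrow> amp ps = amp qs"
    and vop_linear: "Vector_Spaces.linear smul smul (vop \<psi> n)"
    and vop_linear_state: "Vector_Spaces.linear smul smul (\<lambda>\<psi>. vop \<psi> n \<xi>)"
    and vacuum_in_V: "\<Omega> \<in> V 0"
    and amp_vacuum: "admissible UNIV UNIV ((\<Omega>, z) # ps) \<Longrightarrow> amp ((\<Omega>, z) # ps) = amp ps"
    and amp_mode: "\<psi> \<in> weight_space smul vop \<omega> h \<Longrightarrow> admissible UNIV (- {0}) ps \<Longrightarrow>
          amp ((vop \<psi> n \<xi>, 0) # ps) =
            residue (\<lambda>z. z powi (n + int h - 1) * amp ((\<psi>, z) # (\<xi>, 0) # ps)) 0"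
    and fock_span: "span {foldr (\<lambda>(\<psi>, n). vop \<psi> n) ws \<Omega> | ws. fst ` set ws \<subseteq> (\<Union>h. V h)} = UNIV"
    and fock_eq: "(\<And>ps. admissible (span (\<Union>h. V h)) (- {0}) ps \<Longrightarrow>
            amp ((\<xi>, 0) # ps) = amp ((\<xi>', 0) # ps)) \<Longrightarrow> \<xi> = \<xi>'"
    and weight_span: "span (\<Union>n. weight_space smul vop \<omega> n) = UNIV"
    and vop_weight: "\<psi> \<in> weight_space smul vop \<omega> h \<Longrightarrow> \<xi> \<in> weight_space smul vop \<omega> m \<Longrightarrow>
          n \<le> int m \<Longrightarrow> vop \<psi> n \<xi> \<in> weight_space smul vop \<omega> (nat (int m - n))"
    and vop_weight_neg: "\<psi> \<in> weight_space smul vop \<omega> h \<Longrightarrow> \<xi> \<in> weight_space smul vop \<omega> m \<Longrightarrow>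
          n > int m \<Longrightarrow> vop \<psi> n \<xi> = 0"
    and vop_vacuum: "\<psi> \<in> V h \<Longrightarrow> vop \<psi> (- int h) \<Omega> = \<psi>"
    and amp_OPE: "\<phi> \<in> weight_space smul vop \<omega> h \<Longrightarrow> \<xi> \<in> weight_space smul vop \<omega> m \<Longrightarrow>
          admissible UNIV (- {w}) ps \<Longrightarrow>
          eventually (\<lambda>z. ((\<lambda>n. (z - w) powi n * amp ((vop \<phi> (- n - int h) \<xi>, w) # ps))
                            has_sum amp ((\<phi>, z) # (\<xi>, w) # ps)) UNIV) (at w)"
    and conformal_vector: "\<omega> \<in> V 2"
    and Virasoro: "vop \<omega> i (vop \<omega> j \<xi>) - vop \<omega> j (vop \<omega> i \<xi>) =
          smul (of_int (i - j)) (vop \<omega> (i + j) \<xi>) +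
          smul (if i + j = 0 then c / 12 * of_int (i ^ 3 - i) else 0) \<xi>"
    and amp_derivative: "admissible UNIV UNIV ((\<xi>, z) # ps) \<Longrightarrow>
          ((\<lambda>w. amp ((\<xi>, w) # ps)) has_field_derivative amp ((vop \<omega> (-1) \<xi>, z) # ps)) (at z)"
    and V_quasiprimary: "V h = {\<psi> \<in> weight_space smul vop \<omega> h. vop \<omega> 1 \<psi> = 0}"
    and descendants_span: "span {(vop \<omega> (-1) ^^ n) \<psi> | n \<psi>. \<psi> \<in> (\<Union>h. V h)} = UNIV"


section \<open>The subspace \<open>O\<^sub>u\<close>\<close>

text \<open>
  The contour integral of \<open>g(z) V(\<psi>, z) \<xi>\<close> around \<open>0\<close>, where \<open>V(\<psi>, z) = \<Sum>\<^sub>n V\<^sub>n(\<psi>) z\<^sup>-\<^sup>n\<^sup>-\<^sup>h\<close>.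
  For \<open>g\<close> meromorphic only finitely many terms are nonzero.
\<close>

definition contour_mode ::
    "(complex \<Rightarrow> 'h \<Rightarrow> 'h) \<Rightarrow> ('h \<Rightarrow> int \<Rightarrow> 'h \<Rightarrow> 'h) \<Rightarrow> (complex \<Rightarrow> complex) \<Rightarrow> nat \<Rightarrow>
      'h::ab_group_add \<Rightarrow> 'h \<Rightarrow> 'h" where
  "contour_mode smul vop g h \<psi> \<xi> =
     (let coef = (\<lambda>n. residue (\<lambda>z. g z * z powi (- n - int h)) 0)
      in \<Sum>n | coef n \<noteq> 0 \<and> vop \<psi> n \<xi> \<noteq> 0. smul (coef n) (vop \<psi> n \<xi>))"

text \<open>
  If \<open>g\<close> vanishes identically, \<open>zorder\<close> is unspecified, but then the integral is \<open>0\<close>.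
\<close>

definition O_space ::
    "(complex \<Rightarrow> 'h::ab_group_add \<Rightarrow> 'h) \<Rightarrow> (nat \<Rightarrow> 'h set) \<Rightarrow> ('h \<Rightarrow> int \<Rightarrow> 'h \<Rightarrow> 'h) \<Rightarrow>
      sphere list \<Rightarrow> 'h set" where
  "O_space smul V vop us = module.span smul
     {contour_mode smul vop g h \<psi> \<xi> | g h \<psi> \<xi>.
        \<psi> \<in> V h \<and> meromorphic_sphere g \<and>
        (\<exists>N::int. \<forall>P. divisor g (1 - int h) P \<ge>
           - N * of_bool (P = Some 0) + int h * int (count_list us P))}"


section \<open>Formal series and their continuations\<close>

definition series_region :: "nat \<Rightarrow> (nat \<Rightarrow> nat) \<Rightarrow> (nat \<Rightarrow> complex) set" where
  "series_region l R = {z \<in> cspace l. \<forall>i j. i < j \<and> j < l \<longrightarrow> cmod (z (R i)) > cmod (z (R j))}"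

definition eta_series_term ::
    "('h \<Rightarrow> complex) \<Rightarrow> ('h \<Rightarrow> int \<Rightarrow> 'h \<Rightarrow> 'h) \<Rightarrow> 'h \<Rightarrow> nat \<Rightarrow> (nat \<Rightarrow> nat) \<Rightarrow> (nat \<Rightarrow> 'h) \<Rightarrow>
      (nat \<Rightarrow> nat) \<Rightarrow> (nat \<Rightarrow> complex) \<Rightarrow> (nat \<Rightarrow> int) \<Rightarrow> complex" where
  "eta_series_term \<eta> vop \<Omega> l R \<psi> h z j =
     \<eta> (foldr (\<lambda>i. vop (\<psi> (R i)) (j (R i))) [0..<l] \<Omega>) * (\<Prod>i<l. z i powi (- j i - int (h i)))"

definition eta_singularities :: "complex list \<Rightarrow> nat \<Rightarrow> (nat \<Rightarrow> complex) set" where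
  "eta_singularities us l =
     {z \<in> cspace l. \<exists>i<l. z i \<in> set us \<or> (\<exists>j<l. i \<noteq> j \<and> z i = z j)}"

text \<open>
  For every ordering \<open>R\<close>, the formal series converges on some domain of the region \<open>R\<close>, and \<open>f\<close>,
  holomorphic off the singularities, is its analytic continuation from there.  As the complement of
  the singularities is connected, this determines \<open>f\<close> there.
\<close>

definition continues_eta_series ::
    "('h \<Rightarrow> complex) \<Rightarrow> ('h \<Rightarrow> int \<Rightarrow> 'h \<Rightarrow> 'h) \<Rightarrow> 'h \<Rightarrow> complex list \<Rightarrow> nat \<Rightarrow> (nat \<Rightarrow> 'h) \<Rightarrow>
      (nat \<Rightarrow> nat) \<Rightarrow> ((nat \<Rightarrow> complex) \<Rightarrow> complex) \<Rightarrow> bool" where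
  "continues_eta_series \<eta> vop \<Omega> us l \<psi> h f \<longleftrightarrow>
     holomorphic_cspace l f (cspace l - eta_singularities us l) \<and>
     (\<forall>R. R permutes {..<l} \<longrightarrow>
        (\<exists>D. open_cspace l D \<and> connected D \<and> D \<noteq> {} \<and>
             D \<subseteq> series_region l R - eta_singularities us l \<and>
             (\<forall>z\<in>D. (eta_series_term \<eta> vop \<Omega> l R \<psi> h z has_sum f z) ({..<l} \<rightarrow>\<^sub>E UNIV))))"

text \<open>In the coordinate \<open>w = 1/z\<^sub>i\<close> the form \<open>f dz\<^sub>i\<^sup>h\<close> has a removable singularity at \<open>w = 0\<close>.\<close>

definition nonsingular_at_infinity ::
    "((nat \<Rightarrow> complex) \<Rightarrow> complex) \<Rightarrow> (nat \<Rightarrow> complex) \<Rightarrow> nat \<Rightarrow> nat \<Rightarrow> bool" where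
  "nonsingular_at_infinity f z i h \<longleftrightarrow>
     (\<exists>L. ((\<lambda>w. f (z(i := inverse w)) * (- inverse (w\<^sup>2)) ^ h) \<longlongrightarrow> L) (at 0))"

end

theory Submission
  imports Defs "HOL-Library.Function_Algebras"
begin

text \<open>
  Both orders of a product of two modes expand the same amplitude, so multiplication by
  \<open>(z - w)\<^sup>h\<^sup>+\<^sup>m\<close> makes \<open>V(\<phi>, z)\<close> and \<open>V(\<xi>, w)\<close> commute as formal series.  For \<open>\<psi> \<in> V\<^sup>h\<close> the functions
  \<open>g(z) = z\<^sup>-\<^sup>M \<Prod>\<^sub>i (z - u\<^sub>i)\<^sup>h\<close> with \<open>M\<close> large are admissible in \<open>O\<^sub>u\<close>, so \<open>\<Prod>\<^sub>i (z - u\<^sub>i)\<^sup>h \<eta>(V(\<psi>, z)\<xi>)\<close> has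
  no powers of \<open>z\<close> beyond a bound independent of \<open>\<xi>\<close>; derivatives of \<open>V(\<psi>, z)\<close> need higher powers of the
  \<open>z - u\<^sub>i\<close>.  By locality any operator may be moved to the far left, where it meets \<open>\<eta>\<close>, or to the far
  right, where it creates a state from \<open>\<Omega>\<close>.  Hence the series of all orderings, multiplied by a common
  product of factors \<open>z\<^sub>a - z\<^sub>b\<close> and \<open>z\<^sub>a - u\<^sub>i\<close>, become the same polynomial; dividing by these factors
  in the region of an ordering, each series converges to the same rational function.  The bound on the
  powers of \<open>z\<close> gives regularity at infinity.

  In a region where \<open>z\<^sub>i\<close>, \<open>z\<^sub>j\<close> are the outermost points, associativity of the modes identifies the Taylor
  coefficients at \<open>z\<^sub>i = z\<^sub>j\<close> of \<open>(z\<^sub>i - z\<^sub>j)\<^sup>h\<^sup>+\<^sup>m\<close> times the function with the amplitudes of the states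
  \<open>V\<^sub>n(\<psi>\<^sub>i)\<psi>\<^sub>j\<close>.  Both depend rationally on the remaining points, so the identity extends along complex
  lines to all of them.
\<close>

section \<open>Laurent series in one variable\<close>

text \<open>The axiom \<open>amp_OPE\<close> expands in one variable at a time and only on some
  punctured disc, so it says nothing about joint convergence of two mode expansions. Joint
  convergence is recovered from Cauchy estimates on tori |z| = s, |w| = t, which need a bound for
  the amplitude there. Joint continuity is given by \<open>amp_meromorphic\<close>, but only for
  states in V; for all other states it is replaced by local boundedness, which Cauchy's inequality
  carries from a state to its L_{-1} descendants.

  A second obstacle is that formal series in both directions have zero divisors: z - w kills the sum
  of all z^n w^(-n-1). So a series cannot be recovered from its product with a denominator by
  algebra alone. The missing information is the support of the series, a cone attached to the
  ordering of the points: in the region of that ordering, the geometric expansion of each factor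
  runs out of the cone. Multiplication itself is harmless: the factors commute, so the value
  numerator / denominator does not depend on the denominator, and every argument may use the
  truncation that suits it.\<close>

lemma has_sum_int_nat:
  fixes g :: "int \<Rightarrow> 'a::{comm_monoid_add,topological_space}"
  assumes "\<And>n. n < N \<Longrightarrow> g n = 0"
  shows "(g has_sum S) UNIV \<longleftrightarrow> ((\<lambda>n::nat. g (int n + N)) has_sum S) UNIV"
proof -
  have "(g has_sum S) UNIV \<longleftrightarrow> (g has_sum S) {N..}"
    by (rule has_sum_cong_neutral) (use assms in auto)
  also have "\<dots> \<longleftrightarrow> ((\<lambda>n::nat. g (int n + N)) has_sum S) UNIV"
    by (rule has_sum_reindex_bij_witness[of _ "\<lambda>n. int n + N" "\<lambda>n. nat (n - N)"]) auto
  finally show ?thesis .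
qed

lemma powi_series_conv_radius:
  fixes c :: "int \<Rightarrow> complex"
  assumes c0: "\<And>n. n < K \<Longrightarrow> c n = 0"
    and sm: "(\<lambda>n. z powi n * c n) summable_on UNIV"
  shows "fls_conv_radius (Abs_fls c) \<ge> norm z" "fls_nth (Abs_fls c) = c"
proof -
  have nth: "fls_nth (Abs_fls c) = c"
    by (intro ext nth_Abs_fls_ex_lower_bound exI[of _ K]) (simp add: c0)
  have "(\<lambda>n. z powi n * c n) summable_on range int"
    using sm by (rule summable_on_subset_banach) auto
  hence "((\<lambda>n. z powi n * c n) \<circ> int) summable_on UNIV"
    by (subst (asm) summable_on_reindex) auto
  hence "summable (\<lambda>n. c (int n) * z ^ n)"
    by (intro summable_on_imp_summable) (simp add: o_def mult_ac)
  from conv_radius_geI[OF this] show "fls_conv_radius (Abs_fls c) \<ge> norm z"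
    by (simp add: fls_conv_radius_def fps_conv_radius_def nth)
  show "fls_nth (Abs_fls c) = c" by (fact nth)
qed

lemma powi_series_eval_fls:
  fixes c :: "int \<Rightarrow> complex"
  assumes c0: "\<And>n. n < K \<Longrightarrow> c n = 0"
    and hs: "((\<lambda>n. z powi n * c n) has_sum S) UNIV" and z: "z \<noteq> 0"
  shows "eval_fls (Abs_fls c) z = S"
proof -
  have nth: "fls_nth (Abs_fls c) = c"
    by (intro ext nth_Abs_fls_ex_lower_bound exI[of _ K]) (simp add: c0)
  define N where "N = min K 0"
  have "N \<le> fls_subdegree (Abs_fls c)"
  proof (cases "Abs_fls c = 0")
    case False
    thus ?thesis using c0 nth unfolding N_def
      by (metis linorder_le_less_linear min.coboundedI1 nth_fls_subdegree_nonzero)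
  qed (simp add: N_def)
  moreover have "((\<lambda>n::nat. z powi (int n + N) * c (int n + N)) has_sum S) UNIV"
    by (subst has_sum_int_nat[symmetric]) (use hs c0 in \<open>auto simp: N_def\<close>)
  hence "(\<lambda>n. c (int n + N) * z powi (int n + N)) sums S"
    by (intro has_sum_imp_sums) (simp add: mult_ac)
  ultimately show ?thesis
    using z by (intro eval_fls_eq[of N]) (auto simp: nth)
qed

lemma eventually_at_0_obtain_ball:
  fixes P :: "complex \<Rightarrow> bool"
  assumes "eventually P (at 0)"
  obtains e where "e > 0" "\<And>z. z \<noteq> 0 \<Longrightarrow> norm z < e \<Longrightarrow> P z"
  using assms unfolding eventually_at by (auto simp: dist_norm)

text \<open>Bridge from the unordered sums in which the axioms are phrased to the analytic theory of
  Laurent expansions. The lower bound K makes c a formal Laurent series, and convergence at a single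
  point of the disc already gives a positive radius.\<close>

lemma has_laurent_expansion_of_has_sum:
  fixes c :: "int \<Rightarrow> complex"
  assumes c0: "\<And>n. n < K \<Longrightarrow> c n = 0"
    and ev: "eventually (\<lambda>z. ((\<lambda>n. z powi n * c n) has_sum f z) UNIV) (at 0)"
  shows "f has_laurent_expansion Abs_fls c" "fls_nth (Abs_fls c) = c"
proof -
  show nth: "fls_nth (Abs_fls c) = c"
    by (intro ext nth_Abs_fls_ex_lower_bound exI[of _ K]) (simp add: c0)
  obtain e where e: "e > 0" "\<And>z. z \<noteq> 0 \<Longrightarrow> norm z < e \<Longrightarrow> ((\<lambda>n. z powi n * c n) has_sum f z) UNIV"
    using eventually_at_0_obtain_ball[OF ev] by blast
  have "((\<lambda>n. of_real (e/2) powi n * c n) has_sum f (of_real (e/2))) UNIV"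
    by (rule e) (use e(1) in auto)
  from powi_series_conv_radius(1)[OF c0 has_sum_imp_summable[OF this]]
  have "fls_conv_radius (Abs_fls c) \<ge> ereal (e/2)" using e(1) by auto
  hence "fls_conv_radius (Abs_fls c) > 0"
    using e(1) by (auto intro: less_le_trans[rotated])
  moreover have "eventually (\<lambda>z. eval_fls (Abs_fls c) z = f z) (at 0)"
  proof -
    have "eventually (\<lambda>z::complex. z \<noteq> 0) (at 0)"
      by (simp add: eventually_at_filter)
    with ev show ?thesis
      by eventually_elim (use powi_series_eval_fls[OF c0] in auto)
  qed
  ultimately show "f has_laurent_expansion Abs_fls c"
    unfolding has_laurent_expansion_def by blast
qed

lemma powi_series_unique:
  fixes c d :: "int \<Rightarrow> complex"
  assumes "\<And>n. n < K \<Longrightarrow> c n = 0" "\<And>n. n < L \<Longrightarrow> d n = 0"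
    and "eventually (\<lambda>z. ((\<lambda>n. z powi n * c n) has_sum f z) UNIV) (at 0)"
    and "eventually (\<lambda>z. ((\<lambda>n. z powi n * d n) has_sum f z) UNIV) (at 0)"
  shows "c = d"
proof -
  have "Abs_fls c = Abs_fls d"
    using has_laurent_expansion_of_has_sum(1)[OF assms(1,3)]
      has_laurent_expansion_of_has_sum(1)[OF assms(2,4)]
    by (rule has_laurent_expansion_unique)
  thus ?thesis
    using has_laurent_expansion_of_has_sum(2)[OF assms(1,3)]
      has_laurent_expansion_of_has_sum(2)[OF assms(2,4)] by metis
qed

lemma has_sum_fls:
  assumes "norm z < fls_conv_radius F" "z \<noteq> 0"
  shows "((\<lambda>n. z powi n * fls_nth F n) has_sum eval_fls F z) UNIV"
proof -
  define N where "N = fls_subdegree F"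
  have "summable (\<lambda>n. norm (z powi N) * norm (fls_nth F (int n + N) * z ^ n))"
    using norm_summable_fls'[OF assms(1)] unfolding N_def by (intro summable_mult)
  hence "summable (\<lambda>n. norm (z powi (int n + N) * fls_nth F (int n + N)))"
    using assms(2) by (simp add: norm_mult power_int_add mult_ac)
  moreover have "(\<lambda>n. z powi (int n + N) * fls_nth F (int n + N)) sums eval_fls F z"
    using sums_eval_fls[OF assms(1)] assms(2) by (simp add: N_def mult_ac)
  ultimately have "((\<lambda>n. z powi (int n + N) * fls_nth F (int n + N)) has_sum eval_fls F z) UNIV"
    by (rule norm_summable_imp_has_sum)
  thus ?thesis
    by (subst has_sum_int_nat[where N = N]) (auto simp: N_def)
qed

lemma laurent_has_sum_on_ball:
  assumes "f has_laurent_expansion F" "f holomorphic_on ball 0 r - {0}" "norm z < r" "z \<noteq> 0"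
  shows "((\<lambda>n. z powi n * fls_nth F n) has_sum f z) UNIV"
proof -
  have "fls_conv_radius F \<ge> ereal r"
    using assms(1,2) by (intro fls_conv_radius_ge) auto
  hence "ereal (norm z) < fls_conv_radius F"
    using assms(3) by (metis ereal_less_eq(3) less_ereal.simps(1) less_le_trans)
  moreover have "eval_fls F z = f z"
    by (rule eval_fls_eqI[OF assms(1), of r]) (use assms in auto)
  ultimately show ?thesis
    using has_sum_fls[of z F] assms(4) by simp
qed

text \<open>The singularity at p is removable, so filling in the limit makes f holomorphic on the
  whole punctured disc and its Laurent series converges beyond |p|. In the application p is the
  position of a second operator, and the pole there has been cancelled by a power of z - w.\<close>

lemma powi_series_extend:
  fixes c :: "int \<Rightarrow> complex"
  assumes c0: "\<And>n. n < K \<Longrightarrow> c n = 0"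
    and ev: "eventually (\<lambda>z. ((\<lambda>n. z powi n * c n) has_sum f z) UNIV) (at 0)"
    and hol: "f holomorphic_on ball 0 r - {0} - {p}"
    and lim: "(f \<longlongrightarrow> L) (at p)" and p: "p \<noteq> 0"
    and z: "norm z < r" "z \<noteq> 0" "z \<noteq> p"
  shows "((\<lambda>n. z powi n * c n) has_sum f z) UNIV"
proof -
  define g where "g = f(p := L)"
  have "g holomorphic_on (ball 0 r - {0})"
  proof (rule no_isolated_singularity'[where K = "{p}"])
    fix q assume "q \<in> {p}"
    hence [simp]: "q = p" by simp
    have "(g \<longlongrightarrow> L) (at p)"
      using lim by (rule Lim_transform_eventually) (auto simp: g_def eventually_at_filter)
    thus "(g \<longlongrightarrow> g q) (at q within ball 0 r - {0})"
      by (auto simp: g_def intro: tendsto_within_subset)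
  next
    show "g holomorphic_on ball 0 r - {0} - {p}"
      using hol by (rule holomorphic_transform) (auto simp: g_def)
  qed auto
  moreover have "eventually (\<lambda>z. z \<noteq> p) (at 0)"
    using p eventually_neq_at_within by blast
  with ev have "eventually (\<lambda>z. ((\<lambda>n. z powi n * c n) has_sum g z) UNIV) (at 0)"
    by eventually_elim (auto simp: g_def)
  from has_laurent_expansion_of_has_sum[OF c0 this]
  have "g has_laurent_expansion Abs_fls c" "fls_nth (Abs_fls c) = c" by auto
  ultimately have "((\<lambda>n. z powi n * c n) has_sum g z) UNIV"
    using laurent_has_sum_on_ball[of g "Abs_fls c" r z] z by auto
  thus ?thesis using z by (simp add: g_def)
qed

lemma powi_series_Cauchy_estimate:
  fixes c :: "int \<Rightarrow> complex"
  assumes c0: "\<And>n. n < K \<Longrightarrow> c n = 0"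
    and hs: "\<And>z. 0 < norm z \<Longrightarrow> norm z < r \<Longrightarrow> z \<noteq> p \<Longrightarrow> ((\<lambda>n. z powi n * c n) has_sum f z) UNIV"
    and s: "0 < s" "s < r" "norm p \<noteq> s"
    and bd: "\<And>z. norm z = s \<Longrightarrow> norm (f z) \<le> C"
  shows "norm (c n) \<le> C * s powi (-n)"
proof -
  have nth: "fls_nth (Abs_fls c) = c"
    by (intro ext nth_Abs_fls_ex_lower_bound exI[of _ K]) (simp add: c0)
  have rad: "fls_conv_radius (Abs_fls c) \<ge> ereal r"
  proof (rule ccontr)
    assume "\<not> fls_conv_radius (Abs_fls c) \<ge> ereal r"
    then obtain t where t: "fls_conv_radius (Abs_fls c) < ereal t" "ereal t < ereal r"
      by (meson ereal_dense2 not_le)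
    have "0 \<le> fls_conv_radius (Abs_fls c)"
      unfolding fls_conv_radius_def fps_conv_radius_def by (rule conv_radius_nonneg)
    also note t(1)
    finally have "t > 0" by (simp add: zero_ereal_def)
    \<comment> \<open>The sum is not known at p, but every circle contains a point different from p,
      and one point of convergence suffices; hence the choice between t and -t.\<close>
    define z where "z = (if complex_of_real t = p then - complex_of_real t else complex_of_real t)"
    have "norm z = t" "z \<noteq> p" using \<open>t > 0\<close> by (auto simp: z_def)
    have "((\<lambda>n. z powi n * c n) has_sum f z) UNIV"
      by (rule hs) (use t \<open>t > 0\<close> \<open>norm z = t\<close> \<open>z \<noteq> p\<close> in auto)
    from powi_series_conv_radius(1)[OF c0 has_sum_imp_summable[OF this]]
    have "ereal t \<le> fls_conv_radius (Abs_fls c)" using \<open>norm z = t\<close> by simp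
    with t(1) show False by simp
  qed
  define g where "g = eval_fls (Abs_fls c)"
  have g: "g z = f z" if "0 < norm z" "norm z < r" "z \<noteq> p" for z
    unfolding g_def using that by (intro powi_series_eval_fls[OF c0 hs]) auto
  have lau: "g has_laurent_expansion Abs_fls c"
    unfolding g_def
  proof (rule eval_fls_has_laurent_expansion)
    have "(0::ereal) < ereal r" using s by simp
    also note rad
    finally show "0 < fls_conv_radius (Abs_fls c)" .
  qed
  have hol: "g holomorphic_on ball 0 r - {0}"
    unfolding g_def
  proof (rule holomorphic_on_subset[OF holomorphic_on_eval_fls[OF order_refl]], rule subsetI)
    fix x :: complex assume x: "x \<in> ball 0 r - {0}"
    hence "ereal (norm x) < ereal r" by simp
    also note rad
    finally show "x \<in> eball 0 (fls_conv_radius (Abs_fls c)) - (if 0 \<le> fls_subdegree (Abs_fls c) then {} else {0})"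
      using x by simp
  qed
  have C: "C \<ge> 0" using order_trans[OF norm_ge_zero bd[of "of_real s"]] s by simp
  have "norm (complex_of_real (2 * pi) * \<i> * fls_nth (Abs_fls c) n) \<le> (C * s powi (-(n+1))) * (2 * pi * s)"
  proof (rule has_contour_integral_bound_circlepath[OF fls_nth_as_contour_integral[OF lau hol]])
    fix x :: complex assume "norm (x - 0) = s"
    hence x: "norm x = s" by simp
    have "x \<noteq> p" using x s by auto
    hence "norm (g x) \<le> C" using g[of x] s bd[of x] x by simp
    thus "norm (g x * x powi - (n + 1)) \<le> C * s powi - (n + 1)"
      using x s by (auto simp: norm_mult norm_power_int intro!: mult_right_mono)
  qed (use s C in auto)
  hence "2 * pi * norm (c n) \<le> 2 * pi * (C * (s powi (-(n+1)) * s))"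
    by (simp add: nth norm_mult mult_ac)
  hence "norm (c n) \<le> C * (s powi (-(n+1)) * s)" by simp
  also have "s powi (-(n+1)) * s = s powi (-n)"
    using s power_int_add_1[of s "-(n+1)"] by simp
  finally show ?thesis .
qed

lemma powi_series_limit:
  fixes c :: "int \<Rightarrow> complex"
  assumes c0: "\<And>n. n < - int N \<Longrightarrow> c n = 0"
    and ev: "eventually (\<lambda>z. ((\<lambda>n. (z - p) powi n * c n) has_sum f z) UNIV) (at p)"
  shows "((\<lambda>z. (z - p) ^ N * f z) \<longlongrightarrow> c (- int N)) (at p)"
proof -
  define d where "d = (\<lambda>n. c (n - int N))"
  have "eventually (\<lambda>y. ((\<lambda>n. y powi n * c n) has_sum f (p + y)) UNIV) (at 0)"
    using ev by (subst (asm) at_to_0) (simp add: eventually_filtermap add_ac)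
  moreover have "eventually (\<lambda>z::complex. z \<noteq> 0) (at 0)"
    by (simp add: eventually_at_filter)
  ultimately have "eventually (\<lambda>y. ((\<lambda>n. y powi n * d n) has_sum y ^ N * f (p + y)) UNIV) (at 0)"
  proof eventually_elim
    case (elim y)
    have "((\<lambda>n. y ^ N * (y powi n * c n)) has_sum y ^ N * f (p + y)) UNIV"
      by (intro has_sum_cmult_right elim)
    also have "?this \<longleftrightarrow> ((\<lambda>n. y powi n * d n) has_sum y ^ N * f (p + y)) UNIV"
      by (rule has_sum_reindex_bij_witness[of _ "\<lambda>n. n - int N" "\<lambda>n. n + int N"])
         (use elim in \<open>auto simp: d_def power_int_add\<close>)
    finally show ?case .
  qed
  from has_laurent_expansion_of_has_sum[OF _ this, of 0]
  have l: "(\<lambda>y. y ^ N * f (p + y)) has_laurent_expansion Abs_fls d" and nth: "fls_nth (Abs_fls d) = d"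
    using c0 by (auto simp: d_def)
  have "0 \<le> fls_subdegree (Abs_fls d)"
    using nth c0 by (intro fls_subdegree_ge0I) (auto simp: d_def)
  from has_laurent_expansion_imp_tendsto_0[OF l this]
  have "((\<lambda>y. y ^ N * f (p + y)) \<longlongrightarrow> c (- int N)) (at 0)"
    unfolding nth by (simp add: d_def)
  thus ?thesis
    by (subst at_to_0) (simp add: filterlim_filtermap add_ac)
qed

section \<open>Laurent series in two variables\<close>

lemma eventually_punctured_disc:
  assumes "r > 0"
  shows "eventually (\<lambda>z::complex. 0 < norm z \<and> norm z < r) (at 0)"
  using assms unfolding eventually_at by (auto simp: dist_norm)

lemma summable_on_powi_geometric:
  fixes x :: real
  assumes "0 \<le> x" "x < 1"
  shows "(\<lambda>n::int. if n < K then 0 else x powi (n - K)) summable_on UNIV"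
proof -
  have "((\<lambda>n::int. if n < K then 0 else x powi (n - K)) has_sum S) UNIV \<longleftrightarrow>
      ((\<lambda>n::nat. x ^ n) has_sum S) UNIV" for S
    by (subst has_sum_int_nat[where N = K]) auto
  moreover have "(\<lambda>n::nat. x ^ n) summable_on UNIV"
    using assms by (intro norm_summable_imp_summable_on) (simp add: summable_geometric)
  ultimately show ?thesis unfolding summable_on_def by blast
qed

lemma summable_on_product:
  fixes f :: "'a \<Rightarrow> real" and g :: "'b \<Rightarrow> real"
  assumes "f summable_on A" "g summable_on B" "\<And>x. f x \<ge> 0" "\<And>x. g x \<ge> 0"
  shows "(\<lambda>(x, y). f x * g y) summable_on A \<times> B"
proof (rule summable_on_SigmaI)
  show "((\<lambda>y. case (x, y) of (x, y) \<Rightarrow> f x * g y) has_sum f x * infsum g B) B" for x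
    using assms(2) by (auto intro: has_sum_cmult_right)
  show "(\<lambda>x. f x * infsum g B) summable_on A"
    using assms(1) by (rule summable_on_cmult_left)
qed (use assms in auto)

text \<open>f is expanded first in w and then in z (coefficients A, then \<beta>), and also first in
  z and then in w (A', then \<beta>'). Cauchy estimates on tori make the double series of \<beta>
  absolutely convergent; summing it in the other order gives the second expansion, and uniqueness
  identifies \<beta> with \<beta>'.\<close>

lemma double_laurent:
  fixes f :: "complex \<Rightarrow> complex \<Rightarrow> complex"
  assumes A0: "\<And>b z. b < K2 \<Longrightarrow> A b z = 0" and A'0: "\<And>a w. a < K1 \<Longrightarrow> A' a w = 0"
    and fA: "\<And>z w. 0 < norm z \<Longrightarrow> norm z < r \<Longrightarrow> 0 < norm w \<Longrightarrow> norm w < r \<Longrightarrow> w \<noteq> z \<Longrightarrow>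
      ((\<lambda>b. w powi b * A b z) has_sum f z w) UNIV"
    and fA': "\<And>z w. 0 < norm z \<Longrightarrow> norm z < r \<Longrightarrow> 0 < norm w \<Longrightarrow> norm w < r \<Longrightarrow> z \<noteq> w \<Longrightarrow>
      ((\<lambda>a. z powi a * A' a w) has_sum f z w) UNIV"
    and B: "\<And>b z. 0 < norm z \<Longrightarrow> norm z < r \<Longrightarrow> ((\<lambda>a. z powi a * \<beta> a b) has_sum A b z) UNIV"
    and B': "\<And>a w. 0 < norm w \<Longrightarrow> norm w < r \<Longrightarrow> ((\<lambda>b. w powi b * \<beta>' a b) has_sum A' a w) UNIV"
    and B0: "\<And>b. \<exists>k. \<forall>a<k. \<beta> a b = 0" and B'0: "\<And>a. \<exists>k. \<forall>b<k. \<beta>' a b = 0"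
    and bounded: "\<And>s t. 0 < s \<Longrightarrow> s < t \<Longrightarrow> t < r \<Longrightarrow>
       \<exists>M. \<forall>z w. norm z = s \<longrightarrow> norm w = t \<longrightarrow> norm (f z w) \<le> M"
    and r: "r > 0"
  shows "\<beta> = \<beta>'" and "\<And>a b. a < K1 \<Longrightarrow> \<beta> a b = 0" and "\<And>a b. b < K2 \<Longrightarrow> \<beta> a b = 0"
    and "\<And>z w. 0 < norm z \<Longrightarrow> norm z < r \<Longrightarrow> 0 < norm w \<Longrightarrow> norm w < r \<Longrightarrow> z \<noteq> w \<Longrightarrow>
      ((\<lambda>(a, b). z powi a * w powi b * \<beta> a b) has_sum f z w) UNIV"
    and "\<And>s t. 0 < s \<Longrightarrow> s < r \<Longrightarrow> 0 < t \<Longrightarrow> t < r \<Longrightarrow>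
      (\<lambda>(a, b). s powi a * t powi b * norm (\<beta> a b)) summable_on UNIV"
proof -
  have ext_A: "norm (A b z) \<le> C * t powi (- b)"
    if "0 < norm z" "norm z < t" "t < r" "0 < t" "\<And>w. norm w = t \<Longrightarrow> norm (f z w) \<le> C" for b z t C
    by (rule powi_series_Cauchy_estimate[of K2 _ r z "f z"]) (use A0 fA that in auto)
  have ext_A': "norm (A' a w) \<le> C * s powi (- a)"
    if "0 < s" "s < norm w" "norm w < r" "\<And>z. norm z = s \<Longrightarrow> norm (f z w) \<le> C" for a w s C
    by (rule powi_series_Cauchy_estimate[of K1 "\<lambda>a. A' a w" r w "\<lambda>z. f z w"])
       (use A'0 fA' that order.strict_trans[OF that(1,2)] in auto)
  have est: "\<exists>M\<ge>0. \<forall>a b. norm (\<beta> a b) \<le> M * s powi (- a) * t powi (- b) \<and> (a < K1 \<longrightarrow> \<beta> a b = 0)"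
    if st: "0 < s" "s < t" "t < r" for s t
  proof -
    obtain M where M: "\<And>z w. norm z = s \<Longrightarrow> norm w = t \<Longrightarrow> norm (f z w) \<le> M"
      using bounded[OF st] by blast
    have M0: "M \<ge> 0"
      using M[of "of_real s" "of_real t"] st by (smt (verit) norm_ge_zero norm_of_real)
    have 1: "norm (\<beta> a b) \<le> M * s powi (- a) * t powi (- b)" for a b
    proof -
      obtain k where k: "\<And>a. a < k \<Longrightarrow> \<beta> a b = 0" using B0 by blast
      have "norm (\<beta> a b) \<le> (M * t powi (- b)) * s powi (- a)"
      proof (rule powi_series_Cauchy_estimate[of k "\<lambda>a. \<beta> a b" r 0 "A b"])
        show "norm (A b z) \<le> M * t powi (- b)" if "norm z = s" for z
          by (rule ext_A) (use that st M in auto)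
      qed (use k B st in auto)
      thus ?thesis by (simp add: mult_ac)
    qed
    \<comment> \<open>B0 only bounds the exponents of z below for each b separately. The uniform
      bound K1 is inherited from the other order: f is O(|z|^K1) as z tends to 0, uniformly on |w| =
      t, hence so is each \<open>A b z\<close>, and its Laurent coefficients below K1
      vanish.\<close>
    have 2: "\<beta> a b = 0" if a: "a < K1" for a b
    proof (rule ccontr)
      assume nz: "\<beta> a b \<noteq> 0"
      \<comment> \<open>The factor 2 bounds the geometric sum 1 / (1 - x) for the ratio x = |z| / s
        < 1/2.\<close>
      define C where "C = 2 * M * s powi (-K1) * t powi (- b)"
      have Ab: "norm (A b z) \<le> C * norm z powi K1" if z: "0 < norm z" "norm z < s / 2" for z
      proof -
        have "norm (f z w) \<le> 2 * M * s powi (-K1) * norm z powi K1" if w: "norm w = t" for w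
        proof -
          define x where "x = norm z / s"
          have x: "0 < x" "x < 1/2" using z st by (auto simp: x_def field_simps)
          have "((\<lambda>n::nat. x ^ n) has_sum (1 / (1 - x))) UNIV"
            using x by (intro norm_summable_imp_has_sum)
               (auto simp: summable_geometric intro: geometric_sums)
          hence hs: "((\<lambda>n::nat. M * x powi K1 * x ^ n) has_sum M * x powi K1 * (1 / (1 - x))) UNIV"
            by (rule has_sum_cmult_right)
          have fz: "((\<lambda>n::nat. z powi (int n + K1) * A' (int n + K1) w) has_sum f z w) UNIV"
          proof (subst has_sum_int_nat[symmetric])
            have "norm z < norm w" using z st w by linarith
            thus "((\<lambda>a. z powi a * A' a w) has_sum f z w) UNIV"
              by (intro fA') (use z st w in auto)
          qed (use A'0 in auto)
          have "norm (f z w) \<le> M * x powi K1 * (1 / (1 - x))"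
          proof (rule norm_infsum_le[OF fz hs])
            fix n :: nat
            have "norm (A' (int n + K1) w) \<le> M * s powi (- (int n + K1))"
              by (rule ext_A') (use M w st in auto)
            hence "norm (z powi (int n + K1) * A' (int n + K1) w)
                 \<le> norm z powi (int n + K1) * (M * s powi (- (int n + K1)))"
              by (simp add: norm_mult norm_power_int mult_left_mono)
            also have "\<dots> = M * x powi (K1 + int n)"
              unfolding x_def power_int_divide_distrib add.commute[of "int n"] power_int_minus
              by (simp add: field_simps)
            finally show "norm (z powi (int n + K1) * A' (int n + K1) w) \<le> M * x powi K1 * x ^ n"
              using x by (simp add: power_int_add mult_ac)
          qed
          also have "\<dots> \<le> M * x powi K1 * 2"
            using x M0 by (intro mult_left_mono) (auto simp: field_simps)
          also have "\<dots> = 2 * M * s powi (-K1) * norm z powi K1"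
            using st z by (simp add: x_def power_int_divide_distrib power_int_minus field_simps)
          finally show ?thesis .
        qed
        from ext_A[of z t, OF _ _ _ _ this] z st show ?thesis
          by (simp add: C_def mult_ac)
      qed
      obtain k where k: "\<And>a. a < k \<Longrightarrow> \<beta> a b = 0" using B0 by blast
      have small: "norm (\<beta> a b) \<le> C * x" if x: "0 < x" "x < s / 2" "x < 1" for x
      proof -
        have "norm (\<beta> a b) \<le> (C * x powi K1) * x powi (- a)"
          by (rule powi_series_Cauchy_estimate[of k "\<lambda>a. \<beta> a b" r 0 "A b"])
             (use k B st x Ab in auto)
        also have "\<dots> = C * x ^ nat (K1 - a)"
        proof -
          have "x powi K1 * x powi (- a) = x powi (K1 - a)"
            using x power_int_add[of x K1 "-a"] by simp
          also have "\<dots> = x ^ nat (K1 - a)" using a by (simp add: power_int_def)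
          finally show ?thesis by simp
        qed
        also have "\<dots> \<le> C * x ^ 1"
          using x a M0 st by (intro mult_left_mono power_decreasing) (auto simp: C_def)
        finally show ?thesis by simp
      qed
      have "((\<lambda>x. C * x) \<longlongrightarrow> C * 0) (at_right 0)" by (intro tendsto_intros)
      moreover have "eventually (\<lambda>x. x \<in> {0<..<min 1 (s/2)}) (at_right 0)"
        using st by (intro eventually_at_right_real) auto
      hence "eventually (\<lambda>x. norm (\<beta> a b) \<le> C * x) (at_right 0)"
        by eventually_elim (use small in auto)
      ultimately have "norm (\<beta> a b) \<le> C * 0"
        by (intro tendsto_lowerbound[where F = "at_right (0::real)"]) auto
      with nz show False by simp
    qed
    from 1 2 M0 show ?thesis by blast
  qed
  show B1: "\<beta> a b = 0" if "a < K1" for a b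
    using est[of "r/3" "r/2"] r that by auto
  show B2: "\<beta> a b = 0" if "b < K2" for a b
  proof -
    obtain k where k: "\<And>a. a < k \<Longrightarrow> \<beta> a b = 0" using B0 by blast
    have "(\<lambda>a. \<beta> a b) = (\<lambda>_. 0)"
    proof (rule powi_series_unique[of k _ 0])
      show "eventually (\<lambda>z. ((\<lambda>a. z powi a * \<beta> a b) has_sum A b z) UNIV) (at 0)"
        using eventually_punctured_disc[OF r] by eventually_elim (use B in auto)
      show "eventually (\<lambda>z. ((\<lambda>a. z powi a * 0) has_sum A b z) UNIV) (at 0)"
        using A0 that by simp
    qed (use k in auto)
    thus ?thesis by metis
  qed
  show summ: "(\<lambda>(a, b). s powi a * t powi b * norm (\<beta> a b)) summable_on UNIV"
    if st: "0 < s" "s < r" "0 < t" "t < r" for s t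
  proof -
    \<comment> \<open>\<open>est\<close> asks for a first radius smaller than the second, while s
      and t are arbitrary. Both are enlarged to s' < t' < r above max s t; the ratios s/s' and t/t'
      are then below 1 and give a geometric majorant.\<close>
    define s' where "s' = (max s t + r) / 2"
    define t' where "t' = (s' + r) / 2"
    have s': "s < s'" "t < s'" "s' < t'" "t' < r" using st by (auto simp: s'_def t'_def field_simps)
    obtain M where M: "M \<ge> 0" "\<And>a b. norm (\<beta> a b) \<le> M * s' powi (- a) * t' powi (- b)"
      using est[of s' t'] s' st by auto
    have "(\<lambda>(a, b). (if a < K1 then 0 else (s/s') powi (a - K1)) *
          (if b < K2 then 0 else (t/t') powi (b - K2))) summable_on UNIV \<times> UNIV"
      by (intro summable_on_product summable_on_powi_geometric) (use st s' in auto)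
    hence "(\<lambda>ab. (M * (s/s') powi K1 * (t/t') powi K2) *
       (case ab of (a, b) \<Rightarrow> (if a < K1 then 0 else (s/s') powi (a - K1)) *
          (if b < K2 then 0 else (t/t') powi (b - K2)))) summable_on UNIV"
      by (intro summable_on_cmult_right) simp
    thus ?thesis
    proof (rule summable_on_comparison_test)
      fix x :: "int \<times> int"
      obtain a b where [simp]: "x = (a, b)" by force
      show "(case x of (a, b) \<Rightarrow> s powi a * t powi b * norm (\<beta> a b)) \<le>
        (M * (s/s') powi K1 * (t/t') powi K2) *
       (case x of (a, b) \<Rightarrow> (if a < K1 then 0 else (s/s') powi (a - K1)) *
          (if b < K2 then 0 else (t/t') powi (b - K2)))"
      proof (cases "a < K1 \<or> b < K2")
        case False
        have "s powi a * t powi b * norm (\<beta> a b) \<le>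
            s powi a * t powi b * (M * s' powi (- a) * t' powi (- b))"
          using M st by (intro mult_left_mono) auto
        also have "\<dots> = M * (s/s') powi a * (t/t') powi b"
          using s' st by (simp add: power_int_divide_distrib power_int_minus field_simps)
        also have "(s/s') powi a = (s/s') powi K1 * (s/s') powi (a - K1)"
          using s' st by (subst power_int_add[symmetric]) auto
        also have "(t/t') powi b = (t/t') powi K2 * (t/t') powi (b - K2)"
          using s' st by (subst power_int_add[symmetric]) auto
        finally show ?thesis using False by (simp add: mult_ac)
      qed (use B1 B2 in auto)
    qed (use st in auto)
  qed
  show hs: "((\<lambda>(a, b). z powi a * w powi b * \<beta> a b) has_sum f z w) UNIV"
    if zw: "0 < norm z" "norm z < r" "0 < norm w" "norm w < r" "z \<noteq> w" for z w
  proof -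
    have "(\<lambda>(a, b). z powi a * w powi b * \<beta> a b) summable_on UNIV"
      unfolding summable_on_iff_abs_summable_on_complex
      using summ[of "norm z" "norm w"] zw
      by (simp add: case_prod_unfold norm_mult norm_power_int)
    hence "(\<lambda>(b, a). z powi a * w powi b * \<beta> a b) summable_on (UNIV \<times> UNIV)"
      by (subst summable_on_swap) (simp add: case_prod_unfold)
    hence "((\<lambda>(b, a). z powi a * w powi b * \<beta> a b) has_sum f z w) (UNIV \<times> UNIV)"
    proof (rule has_sum_SigmaI[rotated 2])
      show "((\<lambda>b. w powi b * A b z) has_sum f z w) UNIV" using fA zw by auto
      show "((\<lambda>a. case (b, a) of (b, a) \<Rightarrow> z powi a * w powi b * \<beta> a b) has_sum w powi b * A b z) UNIV" for b
        using has_sum_cmult_right[OF B[of z b], of "w powi b"] zw by (simp add: mult_ac)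
    qed
    thus ?thesis
      by (subst (asm) has_sum_swap) (simp add: case_prod_unfold)
  qed
  have A'B: "((\<lambda>b. w powi b * \<beta> a b) has_sum A' a w) UNIV" if w: "0 < norm w" "norm w < r" for a w
  proof -
    have sb: "(\<lambda>b. w powi b * \<beta> a b) summable_on UNIV" for a
    proof -
      have "(\<lambda>b. (r/2) powi a * (norm w powi b * norm (\<beta> a b))) summable_on UNIV"
        using summable_on_SigmaD1[of "\<lambda>a b. (r/2) powi a * norm w powi b * norm (\<beta> a b)" UNIV "\<lambda>_. UNIV" a]
          summ[of "r/2" "norm w"] w r by (simp add: mult_ac)
      hence "(\<lambda>b. norm w powi b * norm (\<beta> a b)) summable_on UNIV"
        by (subst (asm) summable_on_cmult_right') (use r in auto)
      thus ?thesis
        unfolding summable_on_iff_abs_summable_on_complex by (simp add: norm_mult norm_power_int)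
    qed
    define D where "D = (\<lambda>a. infsum (\<lambda>b. w powi b * \<beta> a b) UNIV)"
    have D: "((\<lambda>b. w powi b * \<beta> a b) has_sum D a) UNIV" for a
      unfolding D_def using sb by auto
    \<comment> \<open>Summing the double series over b first yields a second Laurent expansion in z
      of f at fixed w, valid for small z, where z differs from w automatically.\<close>
    have "(\<lambda>a. A' a w) = D"
    proof (rule powi_series_unique[of K1 _ K1])
      have "min r (norm w) > 0" using w r by simp
      from eventually_punctured_disc[OF this]
      have ev: "eventually (\<lambda>z. 0 < norm z \<and> norm z < r \<and> z \<noteq> w) (at 0)"
        by eventually_elim auto
      thus "eventually (\<lambda>z. ((\<lambda>a. z powi a * A' a w) has_sum f z w) UNIV) (at 0)"
        by eventually_elim (use fA' w in auto)
      show "eventually (\<lambda>z. ((\<lambda>a. z powi a * D a) has_sum f z w) UNIV) (at 0)"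
        using ev
      proof eventually_elim
        case (elim z)
        have "((\<lambda>(a, b). z powi a * w powi b * \<beta> a b) has_sum f z w) (UNIV \<times> UNIV)"
          using hs[of z w] elim w by simp
        thus ?case
        proof (rule has_sum_SigmaD)
          show "((\<lambda>b. case (a, b) of (a, b) \<Rightarrow> z powi a * w powi b * \<beta> a b) has_sum z powi a * D a) UNIV" for a
            using has_sum_cmult_right[OF D[of a], of "z powi a"] by (simp add: mult_ac)
        qed
      qed
    qed (use A'0 B1 in \<open>auto simp: D_def\<close>)
    with D show ?thesis by metis
  qed
  show "\<beta> = \<beta>'"
  proof
    fix a
    obtain k where k: "\<And>b. b < k \<Longrightarrow> \<beta>' a b = 0" using B'0 by blast
    show "\<beta> a = \<beta>' a"
    proof (rule powi_series_unique[of K2 _ k])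
      show "eventually (\<lambda>z. ((\<lambda>b. z powi b * \<beta> a b) has_sum A' a z) UNIV) (at 0)"
        using eventually_punctured_disc[OF r] by eventually_elim (use A'B in auto)
      show "eventually (\<lambda>z. ((\<lambda>b. z powi b * \<beta>' a b) has_sum A' a z) UNIV) (at 0)"
        using eventually_punctured_disc[OF r] by eventually_elim (use B' in auto)
    qed (use k B2 in auto)
  qed
qed

section \<open>Binomial re-expansion of Laurent series at a shifted point\<close>

lemma gbinomial_powi_has_sum:
  fixes w y :: complex
  assumes "norm y < norm w"
  shows "((\<lambda>q::nat. y ^ q * ((of_int a gchoose q) * w powi (a - int q))) has_sum (w + y) powi a) UNIV"
    and "((\<lambda>q::nat. norm (y ^ q * ((of_int a gchoose q) * w powi (a - int q)))) has_sum
       (if a \<ge> 0 then (norm w + norm y) powi a else (norm w - norm y) powi a)) UNIV"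
proof -
  have sums: "(\<lambda>q::nat. y ^ q * ((of_int a gchoose q) * w powi (a - int q))) sums (w + y) powi a"
    if "norm y < norm w" for w y :: complex
  proof -
    have w: "w \<noteq> 0" using that by auto
    have "norm (y / w) < 1" using that w by (simp add: norm_divide)
    hence nz: "1 + y / w \<noteq> 0" 
      by (metis add.inverse_inverse add_eq_0_iff norm_minus_cancel norm_one order_less_irrefl)
    have "(\<lambda>q. w powi a * ((of_int a gchoose q) * (y / w) ^ q)) sums (w powi a * (1 + y / w) powr of_int a)"
      by (intro sums_mult gen_binomial_complex) fact
    also have "w powi a * (1 + y / w) powr of_int a = (w + y) powi a"
    proof -
      have "w * (1 + y / w) = w + y" using w by (simp add: distrib_left)
      thus ?thesis using nz by (subst complex_powr_of_int) (auto simp: power_int_mult_distrib[symmetric])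
    qed
    also have "(\<lambda>q. w powi a * ((of_int a gchoose q) * (y / w) ^ q)) =
       (\<lambda>q::nat. y ^ q * ((of_int a gchoose q) * w powi (a - int q)))"
      using w by (auto simp: power_int_diff power_divide field_simps)
    finally show ?thesis .
  qed
  have w: "norm w > 0" using assms le_less_trans norm_ge_zero by blast
  define S where "S = (if a \<ge> 0 then (norm w + norm y) powi a else (norm w - norm y) powi a)"
  have "(\<lambda>q::nat. complex_of_real (norm (y ^ q * ((of_int a gchoose q) * w powi (a - int q))))) sums of_real S"
  proof (cases "a \<ge> 0")
    case True
    then obtain n where n: "a = int n" by (metis nonneg_int_cases)
    have "norm (of_int a gchoose q :: complex) = real (n choose q)" for q
      by (simp add: n binomial_gbinomial[symmetric])
    moreover have "of_int a gchoose q = (of_nat (n choose q) :: complex)" for q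
      by (simp add: n binomial_gbinomial)
    ultimately show ?thesis
      using sums[of "of_real (norm y)" "of_real (norm w)"] assms True
      by (simp add: S_def norm_mult norm_power norm_power_int)
  next
    \<comment> \<open>For negative a the binomial coefficients alternate in sign. Replacing y by
      -|y| therefore makes all terms nonnegative, and the sum of absolute values is the value of the
      power at |w| - |y|.\<close>
    case False
    then obtain m where m: "a = - int (Suc m)" by (cases a rule: int_cases) auto
    have eq: "of_int a gchoose q = ((-1) ^ q * of_nat ((m + q) choose q) :: complex)" for q
    proof -
      have "of_int a gchoose q = (-1) ^ q * ((of_nat (Suc m) + of_nat q - 1) gchoose q :: complex)"
        unfolding m of_int_minus gbinomial_minus by simp
      also have "of_nat (Suc m) + of_nat q - 1 = (of_nat (m + q) :: complex)" by simp
      finally show ?thesis by (simp only: binomial_gbinomial)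
    qed
    have "norm (of_int a gchoose q :: complex) = real ((m + q) choose q)" for q
      unfolding eq by (simp add: norm_mult norm_power)
    hence "complex_of_real (norm (y ^ q * ((of_int a gchoose q) * w powi (a - int q)))) =
        (- of_real (norm y)) ^ q * ((of_int a gchoose q) * of_real (norm w) powi (a - int q))" for q
      unfolding eq power_minus[of "complex_of_real (norm y)"]
      by (simp add: norm_mult norm_power norm_power_int)
    moreover have "of_real (norm w) + - complex_of_real (norm y) = of_real (norm w - norm y)" by simp
    hence "complex_of_real S = (of_real (norm w) + - of_real (norm y)) powi a"
      using False by (simp only: S_def if_False of_real_power_int)
    ultimately show ?thesis
      using sums[of "- of_real (norm y)" "of_real (norm w)"] assms by simp
  qed
  hence S: "(\<lambda>q::nat. norm (y ^ q * ((of_int a gchoose q) * w powi (a - int q)))) sums S"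
    by (subst (asm) sums_of_real_iff)
  show "((\<lambda>q::nat. norm (y ^ q * ((of_int a gchoose q) * w powi (a - int q)))) has_sum
       (if a \<ge> 0 then (norm w + norm y) powi a else (norm w - norm y) powi a)) UNIV"
    using S unfolding S_def by (rule sums_nonneg_imp_has_sum) auto
  show "((\<lambda>q::nat. y ^ q * ((of_int a gchoose q) * w powi (a - int q))) has_sum (w + y) powi a) UNIV"
    using S sums[OF assms] by (intro norm_summable_imp_has_sum) (auto simp: sums_iff)
qed

text \<open>Every power of w + y is expanded binomially and the two summations are exchanged. The
  absolute binomial sums equal the power at |w| + |y| or at |w| - |y|, according to the sign of the
  exponent, which is why summability is assumed at both radii.\<close>

lemma shifted_series_expansion:
  fixes w y :: complex
  assumes y: "norm y < norm w" "y \<noteq> 0"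
    and hs: "((\<lambda>e. k e * (w + y) powi A e) has_sum S) E"
    and s1: "(\<lambda>e. norm (k e) * (norm w + norm y) powi A e) summable_on E"
    and s2: "(\<lambda>e. norm (k e) * (norm w - norm y) powi A e) summable_on E"
  shows "(\<lambda>e. k e * ((of_int (A e) gchoose q) * w powi (A e - int q))) summable_on E"
    and "((\<lambda>q::nat. y ^ q * infsum (\<lambda>e. k e * ((of_int (A e) gchoose q) * w powi (A e - int q))) E)
         has_sum S) UNIV"
proof -
  define g where "g = (\<lambda>q e. k e * ((of_int (A e) gchoose q) * w powi (A e - int q)))"
  let ?T = "\<lambda>(e, q). y ^ q * g q e"
  have "(\<lambda>eq. norm (?T eq)) summable_on E \<times> UNIV"
  proof (rule summable_on_SigmaI)
    fix e
    show "((\<lambda>q. norm (?T (e, q))) has_sum norm (k e) *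
       (if A e \<ge> 0 then (norm w + norm y) powi A e else (norm w - norm y) powi A e)) UNIV"
      using has_sum_cmult_right[OF gbinomial_powi_has_sum(2)[OF y(1), of "A e"], of "norm (k e)"]
      by (simp add: g_def norm_mult mult_ac)
  next
    show "(\<lambda>e. norm (k e) * (if A e \<ge> 0 then (norm w + norm y) powi A e
        else (norm w - norm y) powi A e)) summable_on E"
      by (rule summable_on_comparison_test[OF summable_on_add[OF s1 s2]])
         (use y in \<open>auto intro!: mult_nonneg_nonneg\<close>)
  qed auto
  hence T: "?T summable_on E \<times> UNIV"
    by (rule abs_summable_summable)
  have T': "(\<lambda>(q, e). y ^ q * g q e) summable_on UNIV \<times> E"
    by (subst summable_on_swap) (use T in \<open>simp add: case_prod_unfold\<close>)
  have "(\<lambda>e. y ^ q * g q e) summable_on E" for q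
    using summable_on_SigmaD1[OF T', of q] by simp
  hence gs: "g q summable_on E" for q
    using y(2) by (subst (asm) summable_on_cmult_right') auto
  thus "(\<lambda>e. k e * ((of_int (A e) gchoose q) * w powi (A e - int q))) summable_on E" for q
    by (simp add: g_def)
  have "(?T has_sum S) (E \<times> UNIV)"
  proof (rule has_sum_SigmaI[OF _ hs T])
    fix e
    show "((\<lambda>q. ?T (e, q)) has_sum k e * (w + y) powi A e) UNIV"
      using has_sum_cmult_right[OF gbinomial_powi_has_sum(1)[OF y(1), of "A e"], of "k e"]
      by (simp add: g_def mult_ac)
  qed
  hence "((\<lambda>(q, e). y ^ q * g q e) has_sum S) (UNIV \<times> E)"
    by (subst has_sum_swap) (simp add: case_prod_unfold)
  hence "((\<lambda>q. y ^ q * infsum (g q) E) has_sum S) UNIV"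
    by (rule has_sum_SigmaD) (use gs in \<open>auto intro!: has_sum_cmult_right\<close>)
  thus "((\<lambda>q::nat. y ^ q * infsum (\<lambda>e. k e * ((of_int (A e) gchoose q) * w powi (A e - int q))) E)
         has_sum S) UNIV"
    by (simp add: g_def)
qed

section \<open>Local boundedness of the amplitudes\<close>

lemma open_fun_box:
  fixes A :: "('a \<Rightarrow> 'b::metric_space) set"
  assumes "open A" "P \<in> A"
  obtains e where "e > 0" "\<And>Q. (\<And>i. dist (Q i) (P i) < e) \<Longrightarrow> Q \<in> A"
proof -
  have "openin (product_topology (\<lambda>i. euclidean) UNIV) A"
    using assms(1) by (simp add: euclidean_product_topology)
  from product_topology_open_contains_basis[OF this assms(2)] obtain X where
    X: "P \<in> (\<Pi>\<^sub>E i\<in>UNIV. X i)" "\<And>i. openin euclidean (X i)"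
       "finite {i. X i \<noteq> topspace euclidean}" "(\<Pi>\<^sub>E i\<in>UNIV. X i) \<subseteq> A"
    by blast
  define I where "I = {i. X i \<noteq> UNIV}"
  have "finite I" using X(3) by (simp add: I_def)
  have "\<exists>e>0. ball (P i) e \<subseteq> X i" for i
    using X(1) X(2)[of i] by (auto simp: open_contains_ball PiE_iff)
  then obtain e where e: "\<And>i. e i > 0" "\<And>i. ball (P i) (e i) \<subseteq> X i" by metis
  define d where "d = Min (insert 1 (e ` I))"
  have "d > 0" unfolding d_def using \<open>finite I\<close> e(1) by (subst Min_gr_iff) auto
  moreover have "Q \<in> A" if Q: "\<And>i. dist (Q i) (P i) < d" for Q
  proof -
    have "Q i \<in> X i" for i
    proof (cases "i \<in> I")
      case True
      hence "d \<le> e i" unfolding d_def using \<open>finite I\<close> by (intro Min_le) auto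
      with Q[of i] have "Q i \<in> ball (P i) (e i)" by (simp add: dist_commute)
      thus ?thesis using e(2) by blast
    qed (simp add: I_def)
    thus ?thesis using X(4) by auto
  qed
  ultimately show ?thesis using that by blast
qed

lemma distinct_nearby:
  fixes p :: "complex list"
  assumes "distinct p"
  obtains e where "e > 0"
    "\<And>q. length q = length p \<Longrightarrow> (\<And>k. k < length p \<Longrightarrow> norm (q ! k - p ! k) < e) \<Longrightarrow> distinct q"
proof -
  define D where "D = (\<lambda>(i, j). norm (p ! i - p ! j)) ` {(i, j). i < length p \<and> j < length p \<and> i \<noteq> j}"
  have "{(i, j). i < length p \<and> j < length p \<and> i \<noteq> j} \<subseteq> {..<length p} \<times> {..<length p}" by auto
  hence fin: "finite (insert 1 D)" unfolding D_def using finite_subset by blast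
  define e where "e = Min (insert 1 D) / 2"
  have "e > 0" unfolding e_def using fin assms
    by (auto simp: D_def nth_eq_iff_index_eq)
  moreover have "distinct q" if len: "length q = length p"
    and q: "\<And>k. k < length p \<Longrightarrow> norm (q ! k - p ! k) < e" for q
    unfolding distinct_conv_nth
  proof (intro allI impI notI)
    fix i j assume ij: "i < length q" "j < length q" "i \<noteq> j" "q ! i = q ! j"
    have "norm (p ! i - p ! j) \<in> D" using ij len by (force simp: D_def)
    hence "2 * e \<le> norm (p ! i - p ! j)" unfolding e_def using fin by simp
    also have "\<dots> = norm ((q ! j - p ! j) - (q ! i - p ! i))" using ij by simp
    also have "\<dots> \<le> norm (q ! j - p ! j) + norm (q ! i - p ! i)" by (rule norm_triangle_ineq4)
    also have "\<dots> < e + e" using q[of i] q[of j] ij len by (intro add_strict_mono) auto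
    finally show False by simp
  qed
  ultimately show ?thesis using that by blast
qed

lemma compact_locally_bounded:
  fixes f :: "'a::topological_space \<Rightarrow> real"
  assumes "compact K" "\<And>x. x \<in> K \<Longrightarrow> \<exists>U M. open U \<and> x \<in> U \<and> (\<forall>y\<in>U \<inter> K. f y \<le> M)"
  shows "\<exists>M. \<forall>y\<in>K. f y \<le> M"
proof -
  obtain U M where U: "\<And>x. x \<in> K \<Longrightarrow> open (U x) \<and> x \<in> U x \<and> (\<forall>y\<in>U x \<inter> K. f y \<le> M x)"
    using assms(2) by metis
  obtain C where C: "C \<subseteq> K" "finite C" "K \<subseteq> (\<Union>c\<in>C. U c)"
    using compactE_image[OF assms(1), of K U] U by blast
  have "f y \<le> Max (M ` C)" if y: "y \<in> K" for y
  proof -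
    obtain c where c: "c \<in> C" "y \<in> U c" using C y by blast
    hence "f y \<le> M c" using U[of c] y C by blast
    also have "\<dots> \<le> Max (M ` C)" using c C by simp
    finally show ?thesis .
  qed
  thus ?thesis by blast
qed

context chiral_cft
begin

abbreviation Lm :: "'h \<Rightarrow> 'h" where "Lm \<equiv> vop \<omega> (-1)"

text \<open>Weaker than joint continuity, which the axioms provide for states in V only, but stable
  under L_{-1} in any slot, and sufficient for Cauchy estimates on compact sets. States and points
  are kept in separate lists so that the points can be perturbed while the states stay
  fixed.\<close>

definition loc_bounded :: "'h list \<Rightarrow> bool" where
  "loc_bounded xs \<longleftrightarrow> (\<forall>p. length p = length xs \<longrightarrow> distinct p \<longrightarrow>
     (\<exists>e>0. \<exists>M. \<forall>q. length q = length xs \<longrightarrow> (\<forall>k<length xs. norm (q ! k - p ! k) < e) \<longrightarrow>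
        norm (amp (zip xs q)) \<le> M))"

lemma amp_perm: "distinct (map snd ps) \<Longrightarrow> mset ps = mset qs \<Longrightarrow> amp ps = amp qs"
  by (rule amp_symmetric) (auto simp: admissible_def)

lemma amp_add_smul:
  "distinct (z # map snd ps) \<Longrightarrow> amp ((smul a x + y, z) # ps) = a * amp ((x, z) # ps) + amp ((y, z) # ps)"
  by (rule amp_linear) (auto simp: admissible_def)

lemma amp_add: "distinct (z # map snd ps) \<Longrightarrow> amp ((x + y, z) # ps) = amp ((x, z) # ps) + amp ((y, z) # ps)"
  using amp_add_smul[of z ps 1 x y] by simp

lemma amp_zero: "distinct (z # map snd ps) \<Longrightarrow> amp ((0, z) # ps) = 0"
  using amp_add[of z ps 0 0] by simp

lemma amp_smul: "distinct (z # map snd ps) \<Longrightarrow> amp ((smul a x, z) # ps) = a * amp ((x, z) # ps)"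
  using amp_add_smul[of z ps a x 0] amp_zero[of z ps] by simp

lemma amp_diff: "distinct (z # map snd ps) \<Longrightarrow> amp ((x - y, z) # ps) = amp ((x, z) # ps) - amp ((y, z) # ps)"
  using amp_add[of z ps "x - y" y] by simp

lemma amp_sum:
  "distinct (z # map snd ps) \<Longrightarrow> amp ((\<Sum>i\<in>I. f i, z) # ps) = (\<Sum>i\<in>I. amp ((f i, z) # ps))"
  by (induction I rule: infinite_finite_induct) (simp_all add: amp_zero amp_add)

lemma amp_deriv:
  "distinct (z # map snd ps) \<Longrightarrow>
    ((\<lambda>w. amp ((\<xi>, w) # ps)) has_field_derivative amp ((Lm \<xi>, z) # ps)) (at z)"
  by (rule amp_derivative) (auto simp: admissible_def)

lemma amp_holomorphic:
  assumes "distinct (map snd ps)" "open A" "A \<inter> snd ` set ps = {}"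
  shows "(\<lambda>w. amp ((\<xi>, w) # ps)) holomorphic_on A"
  unfolding holomorphic_on_def
proof
  fix x assume "x \<in> A"
  hence "distinct (x # map snd ps)" using assms by auto
  from amp_deriv[OF this] show "(\<lambda>w. amp ((\<xi>, w) # ps)) field_differentiable at x within A"
    by (meson field_differentiable_at_within field_differentiable_def)
qed

text \<open>Symmetry of the amplitudes brings an arbitrary slot to the front, the only place where
  linearity and the derivative rule are stated.\<close>

lemma zip_insert:
  assumes "length q = length (ys @ x # zs)" "distinct q"
  obtains b ps where "distinct (b # map snd ps)" "b = q ! length ys"
    "\<And>x'. amp (zip (ys @ x' # zs) q) = amp ((x', b) # ps)"
    "\<And>x' w. w \<notin> set (map snd ps) \<Longrightarrow> amp (zip (ys @ x' # zs) (q[length ys := w])) = amp ((x', w) # ps)"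
    "\<And>w. distinct (q[length ys := w]) \<Longrightarrow> w \<notin> set (map snd ps)"
proof -
  define q1 where "q1 = take (length ys) q"
  define q2 where "q2 = drop (Suc (length ys)) q"
  define b where "b = q ! length ys"
  have q: "q = q1 @ b # q2" unfolding q1_def q2_def b_def
    using assms(1) by (intro id_take_nth_drop) auto
  have l1: "length q1 = length ys" using assms(1) by (auto simp: q1_def)
  have l2: "length q2 = length zs" using assms(1) by (auto simp: q2_def)
  define ps where "ps = zip ys q1 @ zip zs q2"
  have snds: "map snd ps = q1 @ q2" using l1 l2 by (simp add: ps_def)
  have d: "distinct (b # map snd ps)" using assms(2) unfolding snds q by auto
  have upd: "q[length ys := w] = q1 @ w # q2" for w
    unfolding q l1[symmetric] by simp
  have *: "amp (zip (ys @ x' # zs) (q[length ys := w])) = amp ((x', w) # ps)"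
    if "w \<notin> set (map snd ps)" for x' w
  proof -
    have "zip (ys @ x' # zs) (q[length ys := w]) = zip ys q1 @ (x', w) # zip zs q2"
      using l1 l2 by (simp add: upd)
    moreover have "amp (zip ys q1 @ (x', w) # zip zs q2) = amp ((x', w) # ps)"
      by (rule amp_perm) (use d that snds l1 l2 in \<open>auto simp: ps_def\<close>)
    ultimately show ?thesis by simp
  qed
  show ?thesis
  proof (rule that[of b ps])
    show "amp (zip (ys @ x' # zs) q) = amp ((x', b) # ps)" for x'
      using *[of b x'] d by (simp add: b_def)
    show "w \<notin> set (map snd ps)" if "distinct (q[length ys := w])" for w
      using that unfolding upd snds by auto
  qed (use d b_def * in auto)
qed

lemma loc_bounded_V:
  assumes "set xs \<subseteq> (\<Union>h. V h)"
  shows "loc_bounded xs"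
  unfolding loc_bounded_def
proof (intro allI impI)
  fix p :: "complex list"
  assume p: "length p = length xs" "distinct p"
  define l where "l = length xs"
  have "\<forall>a<l. \<exists>d. xs ! a \<in> V d" using assms nth_mem[of _ xs] by (force simp: l_def)
  then obtain d where d: "\<And>a. a < l \<Longrightarrow> xs ! a \<in> V (d a)" by metis
  have "meromorphic_form l d (\<lambda>z. amp (insertions l (\<lambda>a. xs ! a) z))"
    by (rule amp_meromorphic) (use d in auto)
  \<comment> \<open>The empty set of indices selects the affine chart, in which the product of
    transition factors is empty and G is the amplitude itself.\<close>
  then obtain G where G: "meromorphic_cspace l G (cspace l) (chart_collisions l {})"
    "\<And>w. w \<in> cspace l - chart_collisions l {} \<Longrightarrow> G w = amp (insertions l (\<lambda>a. xs ! a) w)"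
    unfolding meromorphic_form_def by force
  let ?U = "cspace l - chart_collisions l {}"
  have cont: "continuous_on ?U G"
    using G(1) by (simp add: meromorphic_cspace_def holomorphic_cspace_def)
  define pt where "pt = (\<lambda>q i. if i < l then q ! i else (0::complex))"
  have ptU: "pt q \<in> ?U" if "length q = l" "distinct q" for q
    using that by (auto simp: pt_def cspace_def chart_collisions_def chart_point_def nth_eq_iff_index_eq)
  have ins: "insertions l (\<lambda>a. xs ! a) (pt q) = zip xs q" if "length q = l" for q
    by (rule nth_equalityI) (use that in \<open>auto simp: insertions_def l_def pt_def\<close>)
  have "\<exists>A. open A \<and> A \<inter> ?U = G -` ball (G (pt p)) 1 \<inter> ?U"
    using cont unfolding continuous_on_open_invariant by auto
  then obtain A where A: "open A" "A \<inter> ?U = G -` ball (G (pt p)) 1 \<inter> ?U" by blast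
  have "pt p \<in> A" using A(2) ptU[of p] p by (auto simp: l_def)
  then obtain e where e: "e > 0" "\<And>Q. (\<And>i. dist (Q i) (pt p i) < e) \<Longrightarrow> Q \<in> A"
    using open_fun_box[OF A(1)] by blast
  obtain e' where e': "e' > 0" "\<And>q. length q = length p \<Longrightarrow>
      (\<And>k. k < length p \<Longrightarrow> norm (q ! k - p ! k) < e') \<Longrightarrow> distinct q"
    using distinct_nearby[OF p(2)] by blast
  show "\<exists>e>0. \<exists>M. \<forall>q. length q = length xs \<longrightarrow> (\<forall>k<length xs. norm (q ! k - p ! k) < e) \<longrightarrow>
        norm (amp (zip xs q)) \<le> M"
  proof (rule exI[of _ "min e e'"], intro conjI exI[of _ "norm (G (pt p)) + 1"] allI impI)
    fix q assume q: "length q = length xs" "\<forall>k<length xs. norm (q ! k - p ! k) < min e e'"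
    have "distinct q" using e'(2)[of q] q p by auto
    hence U: "pt q \<in> ?U" using ptU q by (simp add: l_def)
    have "pt q \<in> A" by (rule e(2)) (use q e(1) in \<open>auto simp: pt_def dist_norm l_def\<close>)
    hence "G (pt q) \<in> ball (G (pt p)) 1" using A(2) U by blast
    hence "norm (G (pt q)) \<le> norm (G (pt p)) + 1"
      by (simp add: dist_norm) (smt (verit) norm_minus_commute norm_triangle_sub)
    thus "norm (amp (zip xs q)) \<le> norm (G (pt p)) + 1"
      using G(2)[OF U] ins[of q] q by (simp add: l_def)
  qed (use e e' in auto)
qed

text \<open>L_{-1} differentiates in the position of the insertion, so a bound on a small disc
  bounds the derivative at its centre by Cauchy's inequality.\<close>

lemma loc_bounded_Lm:
  assumes "loc_bounded (ys @ x # zs)"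
  shows "loc_bounded (ys @ Lm x # zs)"
  unfolding loc_bounded_def
proof (intro allI impI)
  fix p :: "complex list"
  assume p: "length p = length (ys @ Lm x # zs)" "distinct p"
  then obtain e M where e: "e > 0" "\<And>q. length q = length p \<Longrightarrow>
      (\<And>k. k < length p \<Longrightarrow> norm (q ! k - p ! k) < e) \<Longrightarrow> norm (amp (zip (ys @ x # zs) q)) \<le> M"
    using assms unfolding loc_bounded_def by (metis length_append length_Cons)
  obtain e' where e': "e' > 0" "\<And>q. length q = length p \<Longrightarrow>
      (\<And>k. k < length p \<Longrightarrow> norm (q ! k - p ! k) < e') \<Longrightarrow> distinct q"
    using distinct_nearby[OF p(2)] by blast
  \<comment> \<open>Half of the available room: q stays within d of p, and the selected point may
    move by another d, so the perturbed configuration is within 2 d of p, where the bound and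
    distinctness both hold.\<close>
  define d where "d = min e e' / 2"
  have d: "d > 0" using e e' by (simp add: d_def)
  show "\<exists>e>0. \<exists>M. \<forall>q. length q = length (ys @ Lm x # zs) \<longrightarrow>
      (\<forall>k<length (ys @ Lm x # zs). norm (q ! k - p ! k) < e) \<longrightarrow>
        norm (amp (zip (ys @ Lm x # zs) q)) \<le> M"
  proof (rule exI[of _ d], intro conjI exI[of _ "M / (d / 2)"] allI impI)
    fix q assume q: "length q = length (ys @ Lm x # zs)"
      "\<forall>k<length (ys @ Lm x # zs). norm (q ! k - p ! k) < d"
    have dq: "distinct q" using e'(2)[of q] q p e' d e by (force simp: d_def)
    obtain b ps where ps: "distinct (b # map snd ps)" "b = q ! length ys"
      "\<And>x'. amp (zip (ys @ x' # zs) q) = amp ((x', b) # ps)"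
      "\<And>x' w. w \<notin> set (map snd ps) \<Longrightarrow> amp (zip (ys @ x' # zs) (q[length ys := w])) = amp ((x', w) # ps)"
      "\<And>w. distinct (q[length ys := w]) \<Longrightarrow> w \<notin> set (map snd ps)"
      by (rule zip_insert[OF q(1) dq], rule that)
    have near: "norm ((q[length ys := w]) ! k - p ! k) < 2 * d"
      if "k < length p" "norm (w - b) < d" for w k
    proof (cases "k = length ys")
      case True
      have "norm (w - p ! k) \<le> norm (w - b) + norm (q ! k - p ! k)"
        using norm_triangle_ineq[of "w - b" "b - p ! k"] True ps(2) by simp
      also have "\<dots> < d + d" using that q p by (intro add_strict_mono) auto
      finally show ?thesis using True q p by simp
    next
      case False
      have "norm (q ! k - p ! k) < d" using q(2) that(1) p(1) by simp
      thus ?thesis using False d by simp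
    qed
    have dis: "distinct (q[length ys := w])" if "norm (w - b) < d" for w
    proof (rule e'(2))
      fix k assume "k < length p"
      from near[OF this that] show "norm (q[length ys := w] ! k - p ! k) < e'" by (simp add: d_def)
    qed (use q p in auto)
    have nin: "w \<notin> set (map snd ps)" if w: "norm (w - b) < d" for w
      by (rule ps(5)) (rule dis[OF w])
    have bd: "norm (amp ((x, w) # ps)) \<le> M" if w: "norm (w - b) < d" for w
      unfolding ps(4)[OF nin[OF w], of x, symmetric]
    proof (rule e(2))
      fix k assume "k < length p"
      from near[OF this w] show "norm (q[length ys := w] ! k - p ! k) < e" by (simp add: d_def)
    qed (use q p in auto)
    have hol: "(\<lambda>w. amp ((x, w) # ps)) holomorphic_on ball b d"
      by (rule amp_holomorphic) (use ps(1) nin in \<open>force simp: dist_norm norm_minus_commute\<close>)+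
    have "norm ((deriv ^^ 1) (\<lambda>w. amp ((x, w) # ps)) b) \<le> fact 1 * M / (d / 2) ^ 1"
    proof (rule Cauchy_inequality)
      show "(\<lambda>w. amp ((x, w) # ps)) holomorphic_on ball b (d / 2)"
        using hol by (rule holomorphic_on_subset) (use d in auto)
      show "continuous_on (cball b (d / 2)) (\<lambda>w. amp ((x, w) # ps))"
        by (intro holomorphic_on_imp_continuous_on holomorphic_on_subset[OF hol])
           (use d in auto)
    qed (use d bd in \<open>auto simp: norm_minus_commute\<close>)
    moreover have "deriv (\<lambda>w. amp ((x, w) # ps)) b = amp ((Lm x, b) # ps)"
      using amp_deriv[OF ps(1)] by (rule DERIV_imp_deriv)
    ultimately show "norm (amp (zip (ys @ Lm x # zs) q)) \<le> M / (d / 2)"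
      by (simp add: ps(3))
  qed (use d in auto)
qed

lemma loc_bounded_subspace: "subspace {x. loc_bounded (ys @ x # zs)}"
proof -
  have comb: "loc_bounded (ys @ (smul a x + smul b y) # zs)"
    if xy: "loc_bounded (ys @ x # zs)" "loc_bounded (ys @ y # zs)" for a b x y
    unfolding loc_bounded_def
  proof (intro allI impI)
    fix p :: "complex list"
    assume p: "length p = length (ys @ (smul a x + smul b y) # zs)" "distinct p"
    obtain e M where e: "e > 0" "\<And>q. length q = length p \<Longrightarrow>
        (\<And>k. k < length p \<Longrightarrow> norm (q ! k - p ! k) < e) \<Longrightarrow> norm (amp (zip (ys @ x # zs) q)) \<le> M"
      using xy(1) p unfolding loc_bounded_def by (metis length_append length_Cons)
    obtain f N where f: "f > 0" "\<And>q. length q = length p \<Longrightarrow>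
        (\<And>k. k < length p \<Longrightarrow> norm (q ! k - p ! k) < f) \<Longrightarrow> norm (amp (zip (ys @ y # zs) q)) \<le> N"
      using xy(2) p unfolding loc_bounded_def by (metis length_append length_Cons)
    obtain g where g: "g > 0" "\<And>q. length q = length p \<Longrightarrow>
        (\<And>k. k < length p \<Longrightarrow> norm (q ! k - p ! k) < g) \<Longrightarrow> distinct q"
      using distinct_nearby[OF p(2)] by blast
    show "\<exists>e>0. \<exists>M. \<forall>q. length q = length (ys @ (smul a x + smul b y) # zs) \<longrightarrow>
        (\<forall>k<length (ys @ (smul a x + smul b y) # zs). norm (q ! k - p ! k) < e) \<longrightarrow>
          norm (amp (zip (ys @ (smul a x + smul b y) # zs) q)) \<le> M"
    proof (rule exI[of _ "min e (min f g)"], intro conjI exI[of _ "norm a * M + norm b * N"] allI impI)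
      fix q assume q: "length q = length (ys @ (smul a x + smul b y) # zs)"
        "\<forall>k<length (ys @ (smul a x + smul b y) # zs). norm (q ! k - p ! k) < min e (min f g)"
      have "distinct q" by (rule g(2)) (use q p in auto)
      obtain z ps where ps: "distinct (z # map snd ps)"
        "\<And>x'. amp (zip (ys @ x' # zs) q) = amp ((x', z) # ps)"
        by (rule zip_insert[OF q(1) \<open>distinct q\<close>], rule that)
      have "norm (amp (zip (ys @ x # zs) q)) \<le> M" by (rule e(2)) (use q p in auto)
      moreover have "norm (amp (zip (ys @ y # zs) q)) \<le> N" by (rule f(2)) (use q p in auto)
      ultimately have "norm (a * amp (zip (ys @ x # zs) q)) + norm (b * amp (zip (ys @ y # zs) q))
          \<le> norm a * M + norm b * N"
        by (simp add: norm_mult add_mono mult_left_mono)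
      moreover have "amp (zip (ys @ (smul a x + smul b y) # zs) q) =
          a * amp (zip (ys @ x # zs) q) + b * amp (zip (ys @ y # zs) q)"
        unfolding ps(2) using ps(1) by (simp add: amp_add amp_smul)
      ultimately show "norm (amp (zip (ys @ (smul a x + smul b y) # zs) q)) \<le> norm a * M + norm b * N"
        by (metis norm_triangle_ineq order_trans)
    qed (use e f g in auto)
  qed
  have 0: "loc_bounded (ys @ 0 # zs)"
    unfolding loc_bounded_def
  proof (intro allI impI)
    fix p :: "complex list"
    assume p: "length p = length (ys @ 0 # zs)" "distinct p"
    obtain g where g: "g > 0" "\<And>q. length q = length p \<Longrightarrow>
        (\<And>k. k < length p \<Longrightarrow> norm (q ! k - p ! k) < g) \<Longrightarrow> distinct q"
      using distinct_nearby[OF p(2)] by blast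
    show "\<exists>e>0. \<exists>M. \<forall>q. length q = length (ys @ 0 # zs) \<longrightarrow>
        (\<forall>k<length (ys @ 0 # zs). norm (q ! k - p ! k) < e) \<longrightarrow>
          norm (amp (zip (ys @ 0 # zs) q)) \<le> M"
    proof (rule exI[of _ g], intro conjI exI[of _ 0] allI impI)
      fix q assume q: "length q = length (ys @ 0 # zs)"
        "\<forall>k<length (ys @ 0 # zs). norm (q ! k - p ! k) < g"
      have "distinct q" by (rule g(2)) (use q p in auto)
      obtain z ps where ps: "distinct (z # map snd ps)"
        "\<And>x'. amp (zip (ys @ x' # zs) q) = amp ((x', z) # ps)"
        by (rule zip_insert[OF q(1) \<open>distinct q\<close>], rule that)
      show "norm (amp (zip (ys @ 0 # zs) q)) \<le> 0"
        unfolding ps(2) using ps(1) by (simp add: amp_zero)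
    qed (use g in auto)
  qed
  show ?thesis
  proof (rule subspaceI)
    fix x y assume "x \<in> {x. loc_bounded (ys @ x # zs)}" "y \<in> {x. loc_bounded (ys @ x # zs)}"
    thus "x + y \<in> {x. loc_bounded (ys @ x # zs)}" using comb[of x y 1 1] by simp
  next
    fix a x assume "x \<in> {x. loc_bounded (ys @ x # zs)}"
    thus "smul a x \<in> {x. loc_bounded (ys @ x # zs)}" using comb[of x x a 0] by simp
  qed (use 0 in simp)
qed

lemma states_spanned_by_descendants:
  assumes "subspace S" "\<And>h. V h \<subseteq> S" "\<And>x. x \<in> S \<Longrightarrow> Lm x \<in> S"
  shows "S = UNIV"
proof -
  have "(Lm ^^ n) \<psi> \<in> S" if "\<psi> \<in> V h" for n \<psi> h
    by (induction n) (use assms that in auto)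
  hence "{(Lm ^^ n) \<psi> | n \<psi>. \<psi> \<in> (\<Union>h. V h)} \<subseteq> S" by auto
  from span_minimal[OF this assms(1)] descendants_span show ?thesis by auto
qed

text \<open>The slots are freed from V one after the other. The list \<open>zs\<close> holds the
  states still confined to V, and in the slot just before it the property passes from V to all
  states through L_{-1} and linear combinations.\<close>

lemma loc_bounded: "loc_bounded xs"
proof -
  have "\<forall>zs. set zs \<subseteq> (\<Union>h. V h) \<longrightarrow> loc_bounded (xs @ zs)"
  proof (induction xs rule: rev_induct)
    case Nil
    thus ?case by (auto intro: loc_bounded_V)
  next
    case (snoc x xs)
    show ?case
    proof (intro allI impI)
      fix zs assume zs: "set zs \<subseteq> (\<Union>h. V h)"
      have "{x. loc_bounded (xs @ x # zs)} = UNIV"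
      proof (rule states_spanned_by_descendants[OF loc_bounded_subspace])
        fix h show "V h \<subseteq> {x. loc_bounded (xs @ x # zs)}"
        proof
          fix x assume "x \<in> V h"
          with snoc.IH[rule_format, of "x # zs"] zs show "x \<in> {x. loc_bounded (xs @ x # zs)}" by auto
        qed
      qed (auto intro: loc_bounded_Lm)
      thus "loc_bounded ((xs @ [x]) @ zs)" by auto
    qed
  qed
  from this[rule_format, of "[]"] show ?thesis by simp
qed

end

section \<open>Locality and associativity of modes\<close>

text \<open>Multiplication by z - w of the formal double series in which f a b is the coefficient of
  z^a w^b.\<close>

definition dif :: "(int \<Rightarrow> int \<Rightarrow> 'a::ab_group_add) \<Rightarrow> int \<Rightarrow> int \<Rightarrow> 'a" where
  "dif f = (\<lambda>a b. f (a - 1) b - f a (b - 1))"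

lemma dif_Suc: "(dif ^^ Suc n) f a b = (dif ^^ n) f (a - 1) b - (dif ^^ n) f a (b - 1)"
  by (simp add: dif_def)

lemma dif_additive:
  assumes "\<And>x y. L (x - y) = L x - L y"
  shows "L ((dif ^^ n) f a b) = (dif ^^ n) (\<lambda>a b. L (f a b)) a b"
  by (induction n arbitrary: a b) (simp_all add: dif_def assms)

lemma dif_transpose:
  fixes f :: "int \<Rightarrow> int \<Rightarrow> complex"
  shows "(dif ^^ n) (\<lambda>b a. f a b) b a = (-1) ^ n * (dif ^^ n) f a b"
  by (induction n arbitrary: a b) (simp_all add: dif_def algebra_simps)

lemma dif_bounded_below:
  fixes f :: "int \<Rightarrow> int \<Rightarrow> 'a::ab_group_add"
  assumes "\<And>b. \<exists>k. \<forall>a<k. f a b = 0"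
  shows "\<exists>k. \<forall>a<k. (dif ^^ n) f a b = 0"
proof (induction n arbitrary: b)
  case (Suc n)
  obtain k1 k2 where "\<forall>a<k1. (dif ^^ n) f a b = 0" "\<forall>a<k2. (dif ^^ n) f a (b - 1) = 0"
    using Suc by metis
  hence "\<forall>a<min k1 k2. (dif ^^ Suc n) f a b = 0" by (simp add: dif_def)
  thus ?case by blast
qed (use assms in auto)

lemma has_sum_times_linear:
  fixes c :: "int \<Rightarrow> complex"
  assumes "((\<lambda>b. w powi b * c b) has_sum S) UNIV" "w \<noteq> 0"
  shows "((\<lambda>b. w powi b * (z * c b - c (b - 1))) has_sum (z - w) * S) UNIV"
proof -
  have "((\<lambda>b. w * (w powi b * c b)) has_sum w * S) UNIV"
    using assms(1) by (rule has_sum_cmult_right)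
  also have "?this \<longleftrightarrow> ((\<lambda>b. w powi b * c (b - 1)) has_sum w * S) UNIV"
    by (rule has_sum_reindex_bij_witness[of _ "\<lambda>b. b - 1" "\<lambda>b. b + 1"])
       (use assms(2) in \<open>auto simp: power_int_add\<close>)
  finally have "((\<lambda>b. z * (w powi b * c b) + - (w powi b * c (b - 1))) has_sum z * S + - (w * S)) UNIV"
    by (intro has_sum_add has_sum_cmult_right has_sum_uminusI assms(1))
  thus ?thesis by (simp add: algebra_simps)
qed

lemma powi_series_extend0:
  fixes c :: "int \<Rightarrow> complex"
  assumes "\<And>n. n < K \<Longrightarrow> c n = 0"
    and "eventually (\<lambda>z. ((\<lambda>n. z powi n * c n) has_sum f z) UNIV) (at 0)"
    and "f holomorphic_on ball 0 r - {0}" "norm z < r" "z \<noteq> 0"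
  shows "((\<lambda>n. z powi n * c n) has_sum f z) UNIV"
  using laurent_has_sum_on_ball[OF has_laurent_expansion_of_has_sum(1)[OF assms(1,2)] assms(3-5)]
  by (simp add: has_laurent_expansion_of_has_sum(2)[OF assms(1,2)])

context chiral_cft
begin

abbreviation wt :: "nat \<Rightarrow> 'h set" where "wt h \<equiv> weight_space smul vop \<omega> h"

text \<open>The coefficient of \<open>z\<^sup>e\<close> in \<open>V(\<psi>, z)\<close> for \<open>\<psi>\<close> of weight \<open>h\<close>.\<close>

definition md :: "'h \<Rightarrow> nat \<Rightarrow> int \<Rightarrow> 'h \<Rightarrow> 'h" where
  "md \<psi> h e = vop \<psi> (- e - int h)"

lemma md_diff: "md \<psi> h e (x - y) = md \<psi> h e x - md \<psi> h e y"
  and md_add: "md \<psi> h e (x + y) = md \<psi> h e x + md \<psi> h e y"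
  and md_smul: "md \<psi> h e (smul a x) = smul a (md \<psi> h e x)"
  and md_zero [simp]: "md \<psi> h e 0 = 0"
proof -
  interpret l: Vector_Spaces.linear smul smul "vop \<psi> (- e - int h)" by (rule vop_linear)
  show "md \<psi> h e (x - y) = md \<psi> h e x - md \<psi> h e y" "md \<psi> h e (x + y) = md \<psi> h e x + md \<psi> h e y"
    "md \<psi> h e (smul a x) = smul a (md \<psi> h e x)" "md \<psi> h e 0 = 0"
    by (simp_all add: md_def l.diff l.add l.scale l.zero)
qed

lemma md_low: "\<psi> \<in> wt h \<Longrightarrow> \<zeta> \<in> wt p \<Longrightarrow> e < - int (h + p) \<Longrightarrow> md \<psi> h e \<zeta> = 0"
  unfolding md_def by (rule vop_weight_neg) auto

lemma md_weight:
  "\<psi> \<in> wt h \<Longrightarrow> \<zeta> \<in> wt p \<Longrightarrow> - int (h + p) \<le> e \<Longrightarrow> md \<psi> h e \<zeta> \<in> wt (nat (e + int h + int p))"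
  using vop_weight[of \<psi> h \<zeta> p "- e - int h"] by (simp add: md_def algebra_simps)

lemma zero_weight: "0 \<in> wt n"
proof -
  interpret l: Vector_Spaces.linear smul smul "vop \<omega> 0" by (rule vop_linear)
  show ?thesis by (simp add: weight_space_def l.zero)
qed

lemma md_homogeneous: "\<psi> \<in> wt h \<Longrightarrow> \<zeta> \<in> wt p \<Longrightarrow> \<exists>p'. md \<psi> h e \<zeta> \<in> wt p'"
  using md_low[of \<psi> h \<zeta> p e] md_weight[of \<psi> h \<zeta> p e] zero_weight by (metis linorder_not_le)

lemma state_eqI:
  assumes "\<And>ps. distinct (0 # map snd ps) \<Longrightarrow> amp ((\<xi>, 0) # ps) = amp ((\<xi>', 0) # ps)"
  shows "\<xi> = \<xi>'"
  by (rule fock_eq, rule assms) (auto simp: admissible_def image_image)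

section \<open>Mode expansions of amplitudes around the state at 0\<close>

lemma insertion_radius:
  assumes "distinct (0 # map snd ps)"
  obtains r where "r > 0" "\<And>x. x \<in> snd ` set ps \<Longrightarrow> r \<le> norm (x :: complex)"
proof -
  define r where "r = Min (insert 1 (norm ` snd ` set ps))"
  have "r > 0" unfolding r_def using assms by (subst Min_gr_iff) auto
  moreover have "r \<le> norm x" if "x \<in> snd ` set ps" for x
    unfolding r_def using that by (intro Min_le) auto
  ultimately show ?thesis using that by blast
qed

lemma amp_expansion_at_0:
  assumes "\<phi> \<in> wt h" "\<zeta> \<in> wt p" "distinct (0 # map snd ps)"
    and r: "\<And>x. x \<in> snd ` set ps \<Longrightarrow> r \<le> norm x" and z: "0 < norm z" "norm z < r"
  shows "((\<lambda>a. z powi a * amp ((md \<phi> h a \<zeta>, 0) # ps)) has_sum amp ((\<phi>, z) # (\<zeta>, 0) # ps)) UNIV"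
proof (rule powi_series_extend0[where r = r and K = "- int (h + p)"])
  show "amp ((md \<phi> h a \<zeta>, 0) # ps) = 0" if "a < - int (h + p)" for a
    using md_low[OF assms(1,2) that] amp_zero[OF assms(3)] by simp
  show "eventually (\<lambda>z. ((\<lambda>a. z powi a * amp ((md \<phi> h a \<zeta>, 0) # ps)) has_sum
      amp ((\<phi>, z) # (\<zeta>, 0) # ps)) UNIV) (at 0)"
    using amp_OPE[OF assms(1,2), of 0 ps] assms(3) by (auto simp: admissible_def md_def)
  show "(\<lambda>z. amp ((\<phi>, z) # (\<zeta>, 0) # ps)) holomorphic_on ball 0 r - {0}"
    by (rule amp_holomorphic) (use assms(3) r in \<open>force+\<close>)
qed (use z in auto)

text \<open>The coefficient of w^b in (z - w)^n times the amplitude of V(\<phi>, z) V(\<xi>, w) on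
  \<zeta>, with z kept as a complex number; the recursion multiplies by one more factor z -
  w.\<close>

fun twisted :: "'h \<Rightarrow> 'h \<Rightarrow> nat \<Rightarrow> 'h \<Rightarrow> ('h \<times> complex) list \<Rightarrow> nat \<Rightarrow> int \<Rightarrow> complex \<Rightarrow> complex" where
  "twisted \<phi> \<xi> m \<zeta> ps 0 b z = amp ((\<phi>, z) # (md \<xi> m b \<zeta>, 0) # ps)"
| "twisted \<phi> \<xi> m \<zeta> ps (Suc n) b z = z * twisted \<phi> \<xi> m \<zeta> ps n b z - twisted \<phi> \<xi> m \<zeta> ps n (b - 1) z"

lemma twisted_expansion:
  assumes \<phi>: "\<phi> \<in> wt h" and \<xi>: "\<xi> \<in> wt m" and \<zeta>: "\<zeta> \<in> wt p" and ps: "distinct (0 # map snd ps)"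
    and r: "\<And>x. x \<in> snd ` set ps \<Longrightarrow> r \<le> norm x" and z: "0 < norm z" "norm z < r"
  shows "((\<lambda>a. z powi a * amp (((dif ^^ n) (\<lambda>a b. md \<phi> h a (md \<xi> m b \<zeta>)) a b, 0) # ps))
     has_sum twisted \<phi> \<xi> m \<zeta> ps n b z) UNIV"
proof (induction n arbitrary: b)
  case 0
  obtain p' where "md \<xi> m b \<zeta> \<in> wt p'" using md_homogeneous[OF \<xi> \<zeta>] by blast
  from amp_expansion_at_0[OF \<phi> this ps r z] show ?case by simp
next
  case (Suc n)
  have "((\<lambda>a. z powi (a - 1 + 1) * amp (((dif ^^ n) (\<lambda>a b. md \<phi> h a (md \<xi> m b \<zeta>)) (a - 1) b, 0) # ps))
     has_sum z * twisted \<phi> \<xi> m \<zeta> ps n b z) UNIV"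
  proof -
    have "((\<lambda>a. z * (z powi a * amp (((dif ^^ n) (\<lambda>a b. md \<phi> h a (md \<xi> m b \<zeta>)) a b, 0) # ps)))
     has_sum z * twisted \<phi> \<xi> m \<zeta> ps n b z) UNIV"
      by (intro has_sum_cmult_right Suc)
    also have "?this \<longleftrightarrow> ?thesis"
      by (rule has_sum_reindex_bij_witness[of _ "\<lambda>b. b - 1" "\<lambda>b. b + 1"])
         (use z in \<open>auto simp: power_int_add\<close>)
    finally show ?thesis .
  qed
  from has_sum_add[OF this has_sum_uminusI[OF Suc[of "b - 1"]]]
  have "((\<lambda>a. z powi a * amp (((dif ^^ n) (\<lambda>a b. md \<phi> h a (md \<xi> m b \<zeta>)) (a - 1) b, 0) # ps)
      - z powi a * amp (((dif ^^ n) (\<lambda>a b. md \<phi> h a (md \<xi> m b \<zeta>)) a (b - 1), 0) # ps))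
     has_sum twisted \<phi> \<xi> m \<zeta> ps (Suc n) b z) UNIV"
    by simp
  thus ?case
    unfolding dif_Suc amp_diff[OF ps] right_diff_distrib .
qed

lemma twisted_low:
  assumes "\<xi> \<in> wt m" "\<zeta> \<in> wt p" "distinct (z # 0 # map snd ps)" "b < - int (m + p)"
  shows "twisted \<phi> \<xi> m \<zeta> ps n b z = 0"
  using assms(4)
proof (induction n arbitrary: b)
  case 0
  have "amp ((\<phi>, z) # (0, 0) # ps) = amp ((0, 0) # (\<phi>, z) # ps)"
    by (rule amp_perm) (use assms(3) in auto)
  also have "\<dots> = 0" by (rule amp_zero) (use assms(3) in auto)
  finally show ?case using md_low[OF assms(1,2)] 0 by simp
qed auto

text \<open>The expansion in w is given only near 0. Weights limit the order of the pole at w = z to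
  h + m, so the prefactor cancels it and the expansion extends to the whole disc of radius r, also
  to |w| > |z|. This overlap is what allows the two operator orders to be compared.\<close>

lemma amp_double_expansion:
  assumes \<phi>: "\<phi> \<in> wt h" and \<xi>: "\<xi> \<in> wt m" and \<zeta>: "\<zeta> \<in> wt p" and ps: "distinct (0 # map snd ps)"
    and r: "\<And>x. x \<in> snd ` set ps \<Longrightarrow> r \<le> norm x"
    and z: "0 < norm z" "norm z < r" and w: "0 < norm w" "norm w < r" "w \<noteq> z"
  shows "((\<lambda>b. w powi b * twisted \<phi> \<xi> m \<zeta> ps (h + m) b z) has_sum
     (z - w) ^ (h + m) * amp ((\<phi>, z) # (\<xi>, w) # (\<zeta>, 0) # ps)) UNIV"
proof -
  have zps: "z \<notin> snd ` set ps" using r z by force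
  define f where "f = (\<lambda>w. amp ((\<xi>, w) # (\<zeta>, 0) # (\<phi>, z) # ps))"
  have f: "f w = amp ((\<phi>, z) # (\<xi>, w) # (\<zeta>, 0) # ps)"
    if "0 < norm w" "norm w < r" "w \<noteq> z" for w
    unfolding f_def by (rule amp_perm) (use that z ps zps r in force)+
  have "((\<lambda>b. w powi b * twisted \<phi> \<xi> m \<zeta> ps (h + m) b z) has_sum (z - w) ^ (h + m) * f w) UNIV"
  proof (rule powi_series_extend[where r = r and p = z and f = "\<lambda>w. (z - w) ^ (h + m) * f w"
         and K = "- int (m + p)"])
    show "twisted \<phi> \<xi> m \<zeta> ps (h + m) b z = 0" if "b < - int (m + p)" for b
      by (rule twisted_low[OF \<xi> \<zeta> _ that]) (use z zps ps in auto)
    have "eventually (\<lambda>w. ((\<lambda>b. w powi b * twisted \<phi> \<xi> m \<zeta> ps 0 b z) has_sum f w) UNIV) (at 0)"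
    proof -
      have "eventually (\<lambda>w. ((\<lambda>b. w powi b * amp ((md \<xi> m b \<zeta>, 0) # (\<phi>, z) # ps)) has_sum f w) UNIV) (at 0)"
        unfolding f_def using amp_OPE[OF \<xi> \<zeta>, of 0 "(\<phi>, z) # ps"] ps zps z
        by (auto simp: admissible_def md_def)
      moreover have "amp ((md \<xi> m b \<zeta>, 0) # (\<phi>, z) # ps) = twisted \<phi> \<xi> m \<zeta> ps 0 b z" for b
        by (simp, rule amp_perm) (use z zps ps in auto)
      ultimately show ?thesis by simp
    qed
    moreover have "eventually (\<lambda>w::complex. w \<noteq> 0) (at 0)"
      by (simp add: eventually_at_filter)
    ultimately show "eventually (\<lambda>w. ((\<lambda>b. w powi b * twisted \<phi> \<xi> m \<zeta> ps (h + m) b z) has_sum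
        (z - w) ^ (h + m) * f w) UNIV) (at 0)"
    proof eventually_elim
      case (elim w)
      have "((\<lambda>b. w powi b * twisted \<phi> \<xi> m \<zeta> ps n b z) has_sum (z - w) ^ n * f w) UNIV" for n
      proof (induction n)
        case (Suc n)
        from has_sum_times_linear[OF this, of z] elim show ?case by (simp add: mult.assoc)
      qed (use elim in simp)
      thus ?case .
    qed
    show "(\<lambda>w. (z - w) ^ (h + m) * f w) holomorphic_on ball 0 r - {0} - {z}"
      unfolding f_def
      by (intro holomorphic_intros amp_holomorphic) (use z zps ps r in \<open>force+\<close>)
    \<comment> \<open>With \<phi> moved next to \<xi>, the operator product of V(\<xi>, w) around
      the position z of \<phi> applies and yields the limit at w = z. The sign (-1)^(h + m) accounts
      for w - z in place of z - w.\<close>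
    define g where "g = (\<lambda>w. amp ((\<xi>, w) # (\<phi>, z) # (\<zeta>, 0) # ps))"
    have fg: "f w = g w" if "w \<notin> snd ` set ps" "w \<noteq> 0" "w \<noteq> z" for w
      unfolding f_def g_def by (rule amp_perm) (use that z ps zps in auto)
    have "((\<lambda>w. (w - z) ^ (h + m) * g w) \<longlongrightarrow> amp ((vop \<xi> (- (- int (h + m)) - int m) \<phi>, z) # (\<zeta>, 0) # ps)) (at z)"
    proof (rule powi_series_limit)
      show "amp ((vop \<xi> (- n - int m) \<phi>, z) # (\<zeta>, 0) # ps) = 0" if "n < - int (h + m)" for n
      proof -
        have "vop \<xi> (- n - int m) \<phi> = 0" by (rule vop_weight_neg[OF \<xi> \<phi>]) (use that in auto)
        thus ?thesis using z zps ps by (auto intro: amp_zero)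
      qed
      show "eventually (\<lambda>w. ((\<lambda>n. (w - z) powi n * amp ((vop \<xi> (- n - int m) \<phi>, z) # (\<zeta>, 0) # ps))
          has_sum g w) UNIV) (at z)"
        unfolding g_def by (rule amp_OPE[OF \<xi> \<phi>]) (use z zps ps in \<open>auto simp: admissible_def\<close>)
    qed
    hence "((\<lambda>w. (-1) ^ (h + m) * ((w - z) ^ (h + m) * g w)) \<longlongrightarrow>
       (-1) ^ (h + m) * amp ((vop \<xi> (- (- int (h + m)) - int m) \<phi>, z) # (\<zeta>, 0) # ps)) (at z)"
      by (intro tendsto_intros)
    moreover have "eventually (\<lambda>w. w \<in> - (insert 0 (snd ` set ps))) (at z)"
      by (rule eventually_at_in_open') (use z zps in \<open>auto intro!: open_Compl finite_imp_closed\<close>)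
    hence "eventually (\<lambda>w. (-1) ^ (h + m) * ((w - z) ^ (h + m) * g w) = (z - w) ^ (h + m) * f w) (at z)"
      using eventually_neq_at_within[of z z UNIV]
    proof eventually_elim
      case (elim w)
      hence "f w = g w" by (intro fg) auto
      moreover have "(z - w) ^ (h + m) = (-1) ^ (h + m) * (w - z) ^ (h + m)"
        by (subst power_mult_distrib[symmetric]) simp
      ultimately show ?case by simp
    qed
    ultimately show "((\<lambda>w. (z - w) ^ (h + m) * f w) \<longlongrightarrow>
       (-1) ^ (h + m) * amp ((vop \<xi> (- (- int (h + m)) - int m) \<phi>, z) # (\<zeta>, 0) # ps)) (at z)"
      by (rule Lim_transform_eventually)
  qed (use z w in auto)
  thus ?thesis using f[of w] w by simp
qed

text \<open>The torus is compact, and s < t keeps the two moving points apart from each other, from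
  0 and from the remaining insertions, so local boundedness covers it.\<close>

lemma amp_bounded_on_torus:
  assumes ps: "distinct (0 # map snd ps)" and r: "\<And>x. x \<in> snd ` set ps \<Longrightarrow> r \<le> norm x"
    and st: "0 < s" "s < t" "t < r"
  shows "\<exists>M. \<forall>z w. norm z = s \<longrightarrow> norm w = t \<longrightarrow>
     norm ((z - w) ^ n * amp ((\<phi>, z) # (\<xi>, w) # (\<zeta>, 0) # ps)) \<le> M"
proof -
  define K where "K = sphere (0::complex) s \<times> sphere (0::complex) t"
  have "\<exists>M. \<forall>y\<in>K. (\<lambda>(z, w). norm (amp ((\<phi>, z) # (\<xi>, w) # (\<zeta>, 0) # ps))) y \<le> M"
  proof (rule compact_locally_bounded)
    show "compact K" unfolding K_def by (intro compact_Times compact_sphere)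
    fix x assume "x \<in> K"
    then obtain z w where x: "x = (z, w)" "norm z = s" "norm w = t" by (auto simp: K_def)
    define p where "p = z # w # 0 # map snd ps"
    define xs where "xs = \<phi> # \<xi> # \<zeta> # map fst ps"
    have "distinct p" using x st ps r by (force simp: p_def)
    moreover have "length p = length xs" by (simp add: p_def xs_def)
    ultimately obtain e M where e: "e > 0" "\<And>q. length q = length xs \<Longrightarrow>
        (\<And>k. k < length xs \<Longrightarrow> norm (q ! k - p ! k) < e) \<Longrightarrow> norm (amp (zip xs q)) \<le> M"
      using loc_bounded[of xs] unfolding loc_bounded_def by blast
    have "norm (amp ((\<phi>, z') # (\<xi>, w') # (\<zeta>, 0) # ps)) \<le> M"
      if "z' \<in> ball z e" "w' \<in> ball w e" for z' w'
    proof -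
      have "norm (amp (zip xs (z' # w' # 0 # map snd ps))) \<le> M"
        by (rule e(2)) (use that e(1) in \<open>auto simp: xs_def p_def nth_Cons dist_norm norm_minus_commute split: nat.splits\<close>)
      thus ?thesis by (simp add: xs_def zip_map_fst_snd)
    qed
    thus "\<exists>U M. open U \<and> x \<in> U \<and> (\<forall>y\<in>U \<inter> K. (\<lambda>(z, w). norm (amp ((\<phi>, z) # (\<xi>, w) # (\<zeta>, 0) # ps))) y \<le> M)"
      using e(1) x by (intro exI[of _ "ball z e \<times> ball w e"] exI[of _ M]) (auto intro: open_Times)
  qed
  then obtain M where "\<forall>y\<in>K. (\<lambda>(z, w). norm (amp ((\<phi>, z) # (\<xi>, w) # (\<zeta>, 0) # ps))) y \<le> M"
    by blast
  hence M: "norm (amp ((\<phi>, z) # (\<xi>, w) # (\<zeta>, 0) # ps)) \<le> M" if "norm z = s" "norm w = t" for z w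
    using that by (auto simp: K_def)
  have "norm ((z - w) ^ n * amp ((\<phi>, z) # (\<xi>, w) # (\<zeta>, 0) # ps)) \<le> (s + t) ^ n * M"
    if "norm z = s" "norm w = t" for z w
  proof -
    have "norm (z - w) ^ n \<le> (s + t) ^ n"
      using norm_triangle_ineq4[of z w] that by (intro power_mono) auto
    thus ?thesis unfolding norm_mult norm_power using M[OF that] st by (intro mult_mono) auto
  qed
  thus ?thesis by blast
qed

text \<open>Both orders of the two mode expansions of \<open>(z - w)\<^sup>h\<^sup>+\<^sup>m \<langle>V(\<phi>, z) V(\<xi>, w) \<dots>\<rangle>\<close> are Laurent
  expansions of the same function, which is regular at \<open>z = w\<close>.\<close>

lemma
  assumes \<phi>: "\<phi> \<in> wt h" and \<xi>: "\<xi> \<in> wt m" and \<zeta>: "\<zeta> \<in> wt p" and ps: "distinct (0 # map snd ps)"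
    and r: "\<And>x. x \<in> snd ` set ps \<Longrightarrow> r \<le> norm x" and r0: "r > 0"
  defines "\<beta> \<equiv> \<lambda>a b. amp (((dif ^^ (h + m)) (\<lambda>a b. md \<phi> h a (md \<xi> m b \<zeta>)) a b, 0) # ps)"
  shows amp_locality:
      "\<beta> = (\<lambda>a b. amp (((dif ^^ (h + m)) (\<lambda>a b. md \<xi> m b (md \<phi> h a \<zeta>)) a b, 0) # ps))"
    and amp_locality_low1: "a < - int (h + p) \<Longrightarrow> \<beta> a b = 0"
    and amp_locality_low2: "b < - int (m + p) \<Longrightarrow> \<beta> a b = 0"
    and amp_locality_has_sum: "0 < norm z \<Longrightarrow> norm z < r \<Longrightarrow> 0 < norm w \<Longrightarrow> norm w < r \<Longrightarrow> z \<noteq> w \<Longrightarrow>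
      ((\<lambda>(a, b). z powi a * w powi b * \<beta> a b) has_sum
        (z - w) ^ (h + m) * amp ((\<phi>, z) # (\<xi>, w) # (\<zeta>, 0) # ps)) UNIV"
    and amp_locality_summable: "0 < s \<Longrightarrow> s < r \<Longrightarrow> 0 < t \<Longrightarrow> t < r \<Longrightarrow>
      (\<lambda>(a, b). s powi a * t powi b * norm (\<beta> a b)) summable_on UNIV"
proof -
  define N where "N = h + m"
  define G where "G = (\<lambda>a b. md \<phi> h a (md \<xi> m b \<zeta>))"
  define G' where "G' = (\<lambda>a b. md \<xi> m b (md \<phi> h a \<zeta>))"
  define lam where "lam = (\<lambda>x. amp ((x, 0) # ps))"
  define \<beta>' where "\<beta>' = (\<lambda>a b. lam ((dif ^^ N) G' a b))"
  have lam_diff: "lam (x - y) = lam x - lam y" for x y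
    unfolding lam_def by (rule amp_diff[OF ps])
  have \<beta>: "\<beta> = (\<lambda>a b. lam ((dif ^^ N) G a b))"
    by (simp add: \<beta>_def lam_def G_def N_def)
  \<comment> \<open>Exchanging the roles of the two operators replaces z - w by w - z, hence the
    sign.\<close>
  have tr: "\<beta>' a b = (-1) ^ N * lam ((dif ^^ N) (\<lambda>b a. G' a b) b a)" for a b
  proof -
    have "lam ((dif ^^ N) (\<lambda>b a. G' a b) b a) = (dif ^^ N) (\<lambda>b a. lam (G' a b)) b a"
      by (rule dif_additive[OF lam_diff])
    also have "\<dots> = (-1) ^ N * (dif ^^ N) (\<lambda>a b. lam (G' a b)) a b"
      by (rule dif_transpose)
    also have "(dif ^^ N) (\<lambda>a b. lam (G' a b)) a b = \<beta>' a b"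
      unfolding \<beta>'_def by (rule dif_additive[OF lam_diff, symmetric])
    finally show ?thesis by (simp flip: mult.assoc power_mult_distrib)
  qed
  have lam0: "lam 0 = 0" unfolding lam_def by (rule amp_zero[OF ps])
  have low: "\<exists>k. \<forall>a<k. lam ((dif ^^ n) (\<lambda>a b. md x i a (md y j b \<zeta>)) a b) = 0"
    if xy: "x \<in> wt i" "y \<in> wt j" for x i y j n b
  proof -
    have "\<exists>k. \<forall>a<k. (dif ^^ n) (\<lambda>a b. md x i a (md y j b \<zeta>)) a b = 0"
    proof (rule dif_bounded_below)
      fix b
      obtain p' where "md y j b \<zeta> \<in> wt p'" using md_homogeneous[OF xy(2) \<zeta>] by blast
      from md_low[OF xy(1) this] show "\<exists>k. \<forall>a<k. md x i a (md y j b \<zeta>) = 0" by blast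
    qed
    thus ?thesis using lam0 by metis
  qed
  \<comment> \<open>The coefficient functions are set to 0 outside the punctured disc:
    \<open>double_laurent\<close> demands the lower bound on exponents at every point, whereas
    \<open>twisted_low\<close> needs the point to differ from 0 and from the other
    insertions.\<close>
  note DL = double_laurent[of "- int (m + p)" "\<lambda>b z. if 0 < norm z \<and> norm z < r then twisted \<phi> \<xi> m \<zeta> ps N b z else 0"
     "- int (h + p)" "\<lambda>a w. if 0 < norm w \<and> norm w < r then (-1) ^ N * twisted \<xi> \<phi> h \<zeta> ps N a w else 0" r
     "\<lambda>z w. (z - w) ^ N * amp ((\<phi>, z) # (\<xi>, w) # (\<zeta>, 0) # ps)" \<beta> \<beta>']
  have np: "z \<notin> snd ` set ps" if "norm z < r" for z using r that by force
  have 1: "(if 0 < norm z \<and> norm z < r then twisted \<phi> \<xi> m \<zeta> ps N b z else 0) = 0" if "b < - int (m + p)" for b z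
    using twisted_low[OF \<xi> \<zeta> _ that, of z ps \<phi> N] np[of z] ps by auto
  have 2: "(if 0 < norm w \<and> norm w < r then (-1) ^ N * twisted \<xi> \<phi> h \<zeta> ps N a w else 0) = 0" if "a < - int (h + p)" for a w
    using twisted_low[OF \<phi> \<zeta> _ that, of w ps \<xi> N] np[of w] ps by auto
  have 3: "((\<lambda>b. w powi b * (if 0 < norm z \<and> norm z < r then twisted \<phi> \<xi> m \<zeta> ps N b z else 0)) has_sum
      (z - w) ^ N * amp ((\<phi>, z) # (\<xi>, w) # (\<zeta>, 0) # ps)) UNIV"
    if "0 < norm z" "norm z < r" "0 < norm w" "norm w < r" "w \<noteq> z" for z w
    using amp_double_expansion[OF \<phi> \<xi> \<zeta> ps r that] that by (simp add: N_def)
  have 4: "((\<lambda>a. z powi a * (if 0 < norm w \<and> norm w < r then (-1) ^ N * twisted \<xi> \<phi> h \<zeta> ps N a w else 0)) has_sum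
      (z - w) ^ N * amp ((\<phi>, z) # (\<xi>, w) # (\<zeta>, 0) # ps)) UNIV"
    if "0 < norm z" "norm z < r" "0 < norm w" "norm w < r" "z \<noteq> w" for z w
  proof -
    have "((\<lambda>a. (-1) ^ N * (z powi a * twisted \<xi> \<phi> h \<zeta> ps N a w)) has_sum
        (-1) ^ N * ((w - z) ^ N * amp ((\<xi>, w) # (\<phi>, z) # (\<zeta>, 0) # ps))) UNIV"
      using amp_double_expansion[OF \<xi> \<phi> \<zeta> ps r that(3,4,1,2,5)]
      by (intro has_sum_cmult_right) (simp add: N_def add.commute)
    also have "amp ((\<xi>, w) # (\<phi>, z) # (\<zeta>, 0) # ps) = amp ((\<phi>, z) # (\<xi>, w) # (\<zeta>, 0) # ps)"
      by (rule amp_perm) (use that np ps in auto)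
    also have "(-1) ^ N * ((w - z) ^ N * amp ((\<phi>, z) # (\<xi>, w) # (\<zeta>, 0) # ps)) =
        (z - w) ^ N * amp ((\<phi>, z) # (\<xi>, w) # (\<zeta>, 0) # ps)"
      by (simp flip: mult.assoc power_mult_distrib)
    finally show ?thesis using that by (simp add: mult_ac)
  qed
  have 5: "((\<lambda>a. z powi a * \<beta> a b) has_sum
       (if 0 < norm z \<and> norm z < r then twisted \<phi> \<xi> m \<zeta> ps N b z else 0)) UNIV"
    if "0 < norm z" "norm z < r" for b z
    using twisted_expansion[OF \<phi> \<xi> \<zeta> ps r that] that by (simp add: \<beta>_def N_def)
  have 6: "((\<lambda>b. w powi b * \<beta>' a b) has_sum
       (if 0 < norm w \<and> norm w < r then (-1) ^ N * twisted \<xi> \<phi> h \<zeta> ps N a w else 0)) UNIV"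
    if "0 < norm w" "norm w < r" for a w
  proof -
    have "((\<lambda>b. (-1) ^ N * (w powi b * lam ((dif ^^ N) (\<lambda>b a. G' a b) b a))) has_sum
       (-1) ^ N * twisted \<xi> \<phi> h \<zeta> ps N a w) UNIV"
      using twisted_expansion[OF \<xi> \<phi> \<zeta> ps r that, of N a]
      by (intro has_sum_cmult_right) (simp add: lam_def G'_def)
    thus ?thesis using that by (simp add: tr mult_ac)
  qed
  have 7: "\<exists>k. \<forall>a<k. \<beta> a b = 0" for b
    unfolding \<beta> G_def by (rule low[OF \<phi> \<xi>])
  have 8: "\<exists>k. \<forall>b<k. \<beta>' a b = 0" for a
    using low[OF \<xi> \<phi>, of N a] unfolding tr G'_def by auto
  have 9: "\<exists>M. \<forall>z w. norm z = s \<longrightarrow> norm w = t \<longrightarrow>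
      norm ((z - w) ^ N * amp ((\<phi>, z) # (\<xi>, w) # (\<zeta>, 0) # ps)) \<le> M" if "0 < s" "s < t" "t < r" for s t
    by (rule amp_bounded_on_torus[OF ps r that])
  note DL' = DL[OF 1 2 3 4 5 6 7 8 9 r0]
  show "\<beta> = (\<lambda>a b. amp (((dif ^^ (h + m)) (\<lambda>a b. md \<xi> m b (md \<phi> h a \<zeta>)) a b, 0) # ps))"
    using DL'(1) by (simp add: \<beta>'_def lam_def N_def G'_def)
  show "a < - int (h + p) \<Longrightarrow> \<beta> a b = 0" by (rule DL'(2))
  show "b < - int (m + p) \<Longrightarrow> \<beta> a b = 0" by (rule DL'(3))
  show "0 < norm z \<Longrightarrow> norm z < r \<Longrightarrow> 0 < norm w \<Longrightarrow> norm w < r \<Longrightarrow> z \<noteq> w \<Longrightarrow>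
      ((\<lambda>(a, b). z powi a * w powi b * \<beta> a b) has_sum
        (z - w) ^ (h + m) * amp ((\<phi>, z) # (\<xi>, w) # (\<zeta>, 0) # ps)) UNIV"
    using DL'(4)[of z w] by (simp add: N_def)
  show "0 < s \<Longrightarrow> s < r \<Longrightarrow> 0 < t \<Longrightarrow> t < r \<Longrightarrow>
      (\<lambda>(a, b). s powi a * t powi b * norm (\<beta> a b)) summable_on UNIV"
    by (rule DL'(5))
qed

section \<open>Identities between modes, read off from all amplitudes\<close>

lemma mode_locality:
  assumes "\<phi> \<in> wt h" "\<xi> \<in> wt m" "\<zeta> \<in> wt p"
  shows "(dif ^^ (h + m)) (\<lambda>a b. md \<phi> h a (md \<xi> m b \<zeta>)) a b =
         (dif ^^ (h + m)) (\<lambda>a b. md \<xi> m b (md \<phi> h a \<zeta>)) a b"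
proof (rule state_eqI)
  fix ps :: "('h \<times> complex) list" assume ps: "distinct (0 # map snd ps)"
  obtain r where r: "r > 0" "\<And>x. x \<in> snd ` set ps \<Longrightarrow> r \<le> norm x" using insertion_radius[OF ps] by blast
  show "amp (((dif ^^ (h + m)) (\<lambda>a b. md \<phi> h a (md \<xi> m b \<zeta>)) a b, 0) # ps) =
        amp (((dif ^^ (h + m)) (\<lambda>a b. md \<xi> m b (md \<phi> h a \<zeta>)) a b, 0) # ps)"
    using fun_cong[OF fun_cong[OF amp_locality[OF assms ps r(2) r(1)]]] .
qed

text \<open>Without the factor (z - w)^(h + m), the lowest exponent of V(\<phi>, z) depends on b
  through the weight of the state on which it acts. With the factor, the reversed order gives the
  bound for \<phi> acting directly on \<zeta>. This uniformity makes the sum in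
  \<open>mode_associativity\<close> finite.\<close>

lemma mode_locality_low:
  assumes "\<phi> \<in> wt h" "\<xi> \<in> wt m" "\<zeta> \<in> wt p" "a < - int (h + p) \<or> b < - int (m + p)"
  shows "(dif ^^ (h + m)) (\<lambda>a b. md \<phi> h a (md \<xi> m b \<zeta>)) a b = 0"
proof (rule state_eqI)
  fix ps :: "('h \<times> complex) list" assume ps: "distinct (0 # map snd ps)"
  obtain r where r: "r > 0" "\<And>x. x \<in> snd ` set ps \<Longrightarrow> r \<le> norm x" using insertion_radius[OF ps] by blast
  show "amp (((dif ^^ (h + m)) (\<lambda>a b. md \<phi> h a (md \<xi> m b \<zeta>)) a b, 0) # ps) = amp ((0, 0) # ps)"
    using amp_locality_low1[OF assms(1-3) ps r(2) r(1)] amp_locality_low2[OF assms(1-3) ps r(2) r(1)]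
      assms(4) amp_zero[OF ps] by auto
qed

text \<open>The Taylor coefficients at \<open>z = w\<close> of \<open>(z - w)\<^sup>h\<^sup>+\<^sup>m V(\<phi>, z) V(\<xi>, w)\<close> are, by the operator product
  expansion, the vertex operators of the states \<open>\<theta>\<close>.\<close>

lemma mode_associativity:
  assumes \<phi>: "\<phi> \<in> wt h" and \<xi>: "\<xi> \<in> wt m" and \<zeta>: "\<zeta> \<in> wt p"
  defines "\<theta> \<equiv> \<lambda>q. md \<phi> h (int q - int (h + m)) \<xi>"
  shows "md (\<theta> q) q s \<zeta> = (\<Sum>a = - int (h + p)..s + int q + int (m + p).
     smul (of_int a gchoose q) ((dif ^^ (h + m)) (\<lambda>a b. md \<phi> h a (md \<xi> m b \<zeta>)) a (s + int q - a)))"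
proof (rule state_eqI)
  fix ps :: "('h \<times> complex) list" assume ps: "distinct (0 # map snd ps)"
  obtain r where r: "r > 0" "\<And>x. x \<in> snd ` set ps \<Longrightarrow> r \<le> norm x" using insertion_radius[OF ps] by blast
  define N where "N = h + m"
  define \<beta> where "\<beta> = (\<lambda>a b. amp (((dif ^^ (h + m)) (\<lambda>a b. md \<phi> h a (md \<xi> m b \<zeta>)) a b, 0) # ps))"
  have facts: "\<And>a b. a < - int (h + p) \<Longrightarrow> \<beta> a b = 0" "\<And>a b. b < - int (m + p) \<Longrightarrow> \<beta> a b = 0"
    "\<And>z w. 0 < norm z \<Longrightarrow> norm z < r \<Longrightarrow> 0 < norm w \<Longrightarrow> norm w < r \<Longrightarrow> z \<noteq> w \<Longrightarrow>
      ((\<lambda>(a, b). z powi a * w powi b * \<beta> a b) has_sum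
        (z - w) ^ (h + m) * amp ((\<phi>, z) # (\<xi>, w) # (\<zeta>, 0) # ps)) UNIV"
    "\<And>s t. 0 < s \<Longrightarrow> s < r \<Longrightarrow> 0 < t \<Longrightarrow> t < r \<Longrightarrow>
      (\<lambda>(a, b). s powi a * t powi b * norm (\<beta> a b)) summable_on UNIV"
    unfolding \<beta>_def
    by (rule amp_locality_low1[OF \<phi> \<xi> \<zeta> ps r(2,1)] amp_locality_low2[OF \<phi> \<xi> \<zeta> ps r(2,1)]
      amp_locality_has_sum[OF \<phi> \<xi> \<zeta> ps r(2,1)] amp_locality_summable[OF \<phi> \<xi> \<zeta> ps r(2,1)]; assumption)+
  have \<theta>: "\<theta> q \<in> wt q" for q
    using md_weight[OF \<phi> \<xi>, of "int q - int (h + m)"] by (simp add: \<theta>_def)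
  \<comment> \<open>\<open>J w q\<close> is the coefficient of y^q after substituting z = w + y in
    the double series with coefficients \<beta>.\<close>
  define J where "J = (\<lambda>w q. infsum (\<lambda>ab. (w powi snd ab * \<beta> (fst ab) (snd ab)) *
      ((of_int (fst ab) gchoose q) * w powi (fst ab - int q))) UNIV)"
  have J: "amp ((\<theta> q, w) # (\<zeta>, 0) # ps) = J w q"
      "(\<lambda>ab. (w powi snd ab * \<beta> (fst ab) (snd ab)) *
      ((of_int (fst ab) gchoose q) * w powi (fst ab - int q))) summable_on UNIV"
    if w: "0 < norm w" "norm w < r" for w :: complex and q
  proof -
    have wps: "distinct (w # 0 # map snd ps)" using w r(2) ps by force
    \<comment> \<open>|y| < d ensures both |y| < |w|, for the binomial series, and |w| + |y| < r,
      for convergence of the double series.\<close>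
    define d where "d = min (norm w) (r - norm w)"
    have d: "d > 0" using w by (simp add: d_def)
    have yw: "0 < norm (w + y) \<and> norm (w + y) < r \<and> norm y < norm w \<and> norm w + norm y < r"
      if "0 < norm y" "norm y < d" for y
    proof -
      have "norm (w + y) \<le> norm w + norm y" by (rule norm_triangle_ineq)
      moreover have "norm w - norm y \<le> norm (w + y)" by (rule norm_diff_ineq)
      moreover have "norm y < norm w" "norm y < r - norm w" using that by (simp_all add: d_def)
      ultimately show ?thesis by linarith
    qed
    have SE: "(\<lambda>ab. (w powi snd ab * \<beta> (fst ab) (snd ab)) *
      ((of_int (fst ab) gchoose q) * w powi (fst ab - int q))) summable_on UNIV"
      "((\<lambda>q::nat. y ^ q * J w q) has_sum y ^ N * amp ((\<phi>, w + y) # (\<xi>, w) # (\<zeta>, 0) # ps)) UNIV"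
      if y: "0 < norm y" "norm y < d" for y q
    proof -
      note y' = yw[OF y]
      have h1: "((\<lambda>ab. (w powi snd ab * \<beta> (fst ab) (snd ab)) * (w + y) powi fst ab) has_sum
         y ^ N * amp ((\<phi>, w + y) # (\<xi>, w) # (\<zeta>, 0) # ps)) UNIV"
        using facts(3)[of "w + y" w] w y y' by (simp add: case_prod_unfold N_def mult_ac)
      have h2: "(\<lambda>ab. norm (w powi snd ab * \<beta> (fst ab) (snd ab)) * (norm w + norm y) powi fst ab) summable_on UNIV"
        using facts(4)[of "norm w + norm y" "norm w"] w y y'
        by (simp add: case_prod_unfold norm_mult norm_power_int mult_ac)
      have h3: "(\<lambda>ab. norm (w powi snd ab * \<beta> (fst ab) (snd ab)) * (norm w - norm y) powi fst ab) summable_on UNIV"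
        using facts(4)[of "norm w - norm y" "norm w"] w y y'
        by (simp add: case_prod_unfold norm_mult norm_power_int mult_ac)
      show "(\<lambda>ab. (w powi snd ab * \<beta> (fst ab) (snd ab)) *
      ((of_int (fst ab) gchoose q) * w powi (fst ab - int q))) summable_on UNIV"
        by (rule shifted_series_expansion(1)[OF _ _ h1 h2 h3]) (use y y' in auto)
      show "((\<lambda>q::nat. y ^ q * J w q) has_sum y ^ N * amp ((\<phi>, w + y) # (\<xi>, w) # (\<zeta>, 0) # ps)) UNIV"
        unfolding J_def by (rule shifted_series_expansion(2)[OF _ _ h1 h2 h3]) (use y y' in auto)
    qed
    from SE(1)[of "of_real (d / 2)" q] d show "(\<lambda>ab. (w powi snd ab * \<beta> (fst ab) (snd ab)) *
      ((of_int (fst ab) gchoose q) * w powi (fst ab - int q))) summable_on UNIV" by simp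
    define C where "C = (\<lambda>n::int. amp ((md \<phi> h (n - int N) \<xi>, w) # (\<zeta>, 0) # ps))"
    have C0: "C n = 0" if "n < 0" for n
    proof -
      have "md \<phi> h (n - int N) \<xi> = 0" by (rule md_low[OF \<phi> \<xi>]) (use that in \<open>simp add: N_def\<close>)
      thus ?thesis using amp_zero[of w "(\<zeta>, 0) # ps"] wps by (simp add: C_def)
    qed
    have "C = (\<lambda>n. if n < 0 then 0 else J w (nat n))"
    proof (rule powi_series_unique[of 0 _ 0])
      have "eventually (\<lambda>z. ((\<lambda>n. (z - w) powi n * amp ((md \<phi> h n \<xi>, w) # (\<zeta>, 0) # ps)) has_sum
          amp ((\<phi>, z) # (\<xi>, w) # (\<zeta>, 0) # ps)) UNIV) (at w)"
        unfolding md_def by (rule amp_OPE[OF \<phi> \<xi>]) (use wps in \<open>auto simp: admissible_def\<close>)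
      hence "eventually (\<lambda>y. ((\<lambda>n. y powi n * amp ((md \<phi> h n \<xi>, w) # (\<zeta>, 0) # ps)) has_sum
          amp ((\<phi>, w + y) # (\<xi>, w) # (\<zeta>, 0) # ps)) UNIV) (at 0)"
        by (subst (asm) at_to_0) (simp add: eventually_filtermap add_ac)
      thus "eventually (\<lambda>y. ((\<lambda>n. y powi n * C n) has_sum
          y ^ N * amp ((\<phi>, w + y) # (\<xi>, w) # (\<zeta>, 0) # ps)) UNIV) (at 0)"
        using eventually_punctured_disc[OF d]
      proof eventually_elim
        case (elim y)
        have "((\<lambda>n. y ^ N * (y powi n * amp ((md \<phi> h n \<xi>, w) # (\<zeta>, 0) # ps))) has_sum
          y ^ N * amp ((\<phi>, w + y) # (\<xi>, w) # (\<zeta>, 0) # ps)) UNIV"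
          by (intro has_sum_cmult_right elim)
        also have "?this \<longleftrightarrow> ((\<lambda>n. y powi n * C n) has_sum
          y ^ N * amp ((\<phi>, w + y) # (\<xi>, w) # (\<zeta>, 0) # ps)) UNIV"
          by (rule has_sum_reindex_bij_witness[of _ "\<lambda>n. n - int N" "\<lambda>n. n + int N"])
             (use elim in \<open>auto simp: C_def power_int_add\<close>)
        finally show ?case .
      qed
      show "eventually (\<lambda>y. ((\<lambda>n. y powi n * (if n < 0 then 0 else J w (nat n))) has_sum
          y ^ N * amp ((\<phi>, w + y) # (\<xi>, w) # (\<zeta>, 0) # ps)) UNIV) (at 0)"
        using eventually_punctured_disc[OF d]
      proof eventually_elim
        case (elim y)
        show ?case
          by (subst has_sum_int_nat[where N = 0]) (use SE(2)[of y] elim in auto)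
      qed
    qed (use C0 in auto)
    from fun_cong[OF this, of "int q"] show "amp ((\<theta> q, w) # (\<zeta>, 0) # ps) = J w q"
      by (simp add: C_def \<theta>_def N_def)
  qed
  \<comment> \<open>A term contributes w^(a + b - q), so the power w^s collects b = s + q - a. The
    lower bounds on a and b leave the finite range of summation.\<close>
  define \<delta> where "\<delta> = (\<lambda>s. \<Sum>a = - int (h + p)..s + int q + int (m + p).
     (of_int a gchoose q) * \<beta> a (s + int q - a))"
  have "(\<lambda>s. amp ((md (\<theta> q) q s \<zeta>, 0) # ps)) = \<delta>"
  proof (rule powi_series_unique)
    show "amp ((md (\<theta> q) q s \<zeta>, 0) # ps) = 0" if "s < - int (q + p)" for s
      using md_low[OF \<theta> \<zeta> that] amp_zero[OF ps] by simp
    show "\<delta> s = 0" if "s < - int (h + p) - int q - int (m + p)" for s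
      unfolding \<delta>_def using that by (intro sum.neutral) auto
    show "eventually (\<lambda>w. ((\<lambda>s. w powi s * amp ((md (\<theta> q) q s \<zeta>, 0) # ps)) has_sum
        amp ((\<theta> q, w) # (\<zeta>, 0) # ps)) UNIV) (at 0)"
      using eventually_punctured_disc[OF r(1)]
      by eventually_elim (use amp_expansion_at_0[OF \<theta> \<zeta> ps r(2)] in auto)
    show "eventually (\<lambda>w. ((\<lambda>s. w powi s * \<delta> s) has_sum amp ((\<theta> q, w) # (\<zeta>, 0) # ps)) UNIV) (at 0)"
      using eventually_punctured_disc[OF r(1)]
    proof eventually_elim
      case (elim w)
      hence w: "0 < norm w" "norm w < r" by auto
      have "((\<lambda>ab. (w powi snd ab * \<beta> (fst ab) (snd ab)) *
          ((of_int (fst ab) gchoose q) * w powi (fst ab - int q))) has_sum amp ((\<theta> q, w) # (\<zeta>, 0) # ps)) UNIV"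
        unfolding J(1)[OF w] J_def using J(2)[OF w] by (rule has_sum_infsum)
      also have "?this \<longleftrightarrow> ((\<lambda>(s, a). w powi s * ((of_int a gchoose q) * \<beta> a (s + int q - a))) has_sum
          amp ((\<theta> q, w) # (\<zeta>, 0) # ps)) (UNIV \<times> UNIV)"
        by (rule has_sum_reindex_bij_witness[of _ "\<lambda>(s, a). (a, s + int q - a)" "\<lambda>(a, b). (a + b - int q, a)"])
           (use w in \<open>auto simp: power_int_add power_int_diff field_simps\<close>)
      finally show ?case
      proof (rule has_sum_SigmaD)
        fix s
        have "((\<lambda>a. (of_int a gchoose q) * \<beta> a (s + int q - a)) has_sum \<delta> s) UNIV"
          unfolding \<delta>_def
          by (rule has_sum_finite_neutralI) (use facts(1,2) in auto)
        thus "((\<lambda>a. case (s, a) of (s, a) \<Rightarrow> w powi s * ((of_int a gchoose q) * \<beta> a (s + int q - a)))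
           has_sum w powi s * \<delta> s) UNIV"
          by (simp add: has_sum_cmult_right)
      qed
    qed
  qed
  from fun_cong[OF this, of s] show "amp ((md (\<theta> q) q s \<zeta>, 0) # ps) =
      amp ((\<Sum>a = - int (h + p)..s + int q + int (m + p).
     smul (of_int a gchoose q) ((dif ^^ (h + m)) (\<lambda>a b. md \<phi> h a (md \<xi> m b \<zeta>)) a (s + int q - a)), 0) # ps)"
    by (simp add: amp_sum[OF ps] amp_smul[OF ps] \<delta>_def \<beta>_def)
qed

section \<open>Modes acting on the vacuum and modes of L_{-1} descendants\<close>

lemma md_vacuum:
  assumes "\<psi> \<in> wt h" "e < 0"
  shows "md \<psi> h e \<Omega> = 0"
proof (rule state_eqI)
  fix ps :: "('h \<times> complex) list" assume ps: "distinct (0 # map snd ps)"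
  obtain r where r: "r > 0" "\<And>x. x \<in> snd ` set ps \<Longrightarrow> r \<le> norm x" using insertion_radius[OF ps] by blast
  define k where "k = nat (- e - 1)"
  have "amp ((md \<psi> h e \<Omega>, 0) # ps) =
      residue (\<lambda>z. z powi (- e - int h + int h - 1) * amp ((\<psi>, z) # (\<Omega>, 0) # ps)) 0"
    unfolding md_def by (rule amp_mode[OF assms(1)]) (use ps in \<open>auto simp: admissible_def\<close>)
  also have "\<dots> = residue (\<lambda>z. z ^ k * amp ((\<psi>, z) # ps)) 0"
  proof (rule residue_cong)
    show "eventually (\<lambda>z. z powi (- e - int h + int h - 1) * amp ((\<psi>, z) # (\<Omega>, 0) # ps) =
        z ^ k * amp ((\<psi>, z) # ps)) (at 0)"
      using eventually_punctured_disc[OF r(1)]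
    proof eventually_elim
      case (elim z)
      hence "distinct (0 # map snd ((\<psi>, z) # ps))" using r(2) ps by force
      hence "amp ((\<Omega>, 0) # (\<psi>, z) # ps) = amp ((\<psi>, z) # ps)"
        by (intro amp_vacuum) (auto simp: admissible_def)
      moreover have "amp ((\<psi>, z) # (\<Omega>, 0) # ps) = amp ((\<Omega>, 0) # (\<psi>, z) # ps)"
        by (rule amp_perm) (use elim r(2) ps in force)+
      moreover have "z powi (- e - int h + int h - 1) = z ^ k"
        using assms(2) by (simp add: k_def power_int_def)
      ultimately show ?case by simp
    qed
  qed simp
  \<comment> \<open>With \<Omega> removed nothing is inserted at 0, and the exponent k = -e - 1 is
    nonnegative, so the integrand is holomorphic at 0.\<close>
  also have "\<dots> = 0"
  proof (rule residue_holo[of "ball 0 r"])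
    show "(\<lambda>z. z ^ k * amp ((\<psi>, z) # ps)) holomorphic_on ball 0 r"
      by (intro holomorphic_intros amp_holomorphic) (use ps r in force)+
  qed (use r(1) in auto)
  finally show "amp ((md \<psi> h e \<Omega>, 0) # ps) = amp ((0, 0) # ps)"
    using amp_zero[OF ps] by simp
qed

lemma Lm_weight: "\<psi> \<in> wt h \<Longrightarrow> Lm \<psi> \<in> wt (Suc h)"
proof -
  assume "\<psi> \<in> wt h"
  moreover have "\<omega> \<in> wt 2" using conformal_vector V_quasiprimary by blast
  ultimately show ?thesis using vop_weight[of \<omega> 2 \<psi> h "-1"] by (simp add: nat_add_distrib)
qed

text \<open>Coefficient comparison in the rule that V(L_{-1} \<psi>, z) is the derivative of
  V(\<psi>, z). It is carried out on homogeneous \<zeta>, where expansions are available, and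
  extended by \<open>weight_span\<close>.\<close>

lemma vop_Lm:
  assumes \<psi>: "\<psi> \<in> wt h"
  shows "vop (Lm \<psi>) n \<xi> = smul (- of_int (n + int h)) (vop \<psi> n \<xi>)"
proof -
  interpret l1: Vector_Spaces.linear smul smul "vop (Lm \<psi>) n" by (rule vop_linear)
  interpret l2: Vector_Spaces.linear smul smul "vop \<psi> n" by (rule vop_linear)
  have *: "vop (Lm \<psi>) n \<zeta> = smul (- of_int (n + int h)) (vop \<psi> n \<zeta>)" if \<zeta>: "\<zeta> \<in> wt p" for \<zeta> p
  proof (rule state_eqI)
    fix ps :: "('h \<times> complex) list" assume ps: "distinct (0 # map snd ps)"
    obtain r where r: "r > 0" "\<And>x. x \<in> snd ` set ps \<Longrightarrow> r \<le> norm x" using insertion_radius[OF ps] by blast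
    define c where "c = (\<lambda>e. amp ((md \<psi> h e \<zeta>, 0) # ps))"
    define d where "d = (\<lambda>e. amp ((md (Lm \<psi>) (Suc h) e \<zeta>, 0) # ps))"
    have c0: "c e = 0" if "e < - int (h + p)" for e
      using md_low[OF \<psi> \<zeta> that] amp_zero[OF ps] by (simp add: c_def)
    have d0: "d e = 0" if "e < - int (Suc h + p)" for e
      using md_low[OF Lm_weight[OF \<psi>] \<zeta> that] amp_zero[OF ps] by (simp add: d_def)
    define f where "f = (\<lambda>z. amp ((\<psi>, z) # (\<zeta>, 0) # ps))"
    define g where "g = (\<lambda>z. amp ((Lm \<psi>, z) # (\<zeta>, 0) # ps))"
    have "eventually (\<lambda>z. ((\<lambda>e. z powi e * c e) has_sum f z) UNIV) (at 0)"
      using eventually_punctured_disc[OF r(1)]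
      by eventually_elim (use amp_expansion_at_0[OF \<psi> \<zeta> ps r(2)] in \<open>auto simp: c_def f_def\<close>)
    note c = has_laurent_expansion_of_has_sum[OF c0 this]
    have "eventually (\<lambda>z. ((\<lambda>e. z powi e * d e) has_sum g z) UNIV) (at 0)"
      using eventually_punctured_disc[OF r(1)]
      by eventually_elim (use amp_expansion_at_0[OF Lm_weight[OF \<psi>] \<zeta> ps r(2)] in \<open>auto simp: d_def g_def\<close>)
    note d = has_laurent_expansion_of_has_sum[OF d0 this]
    have "deriv f has_laurent_expansion fls_deriv (Abs_fls c)"
      by (rule has_laurent_expansion_deriv[OF c(1)])
    moreover have "eventually (\<lambda>z. deriv f z = g z) (at 0)"
      using eventually_punctured_disc[OF r(1)]
    proof eventually_elim
      case (elim z)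
      have "distinct (z # map snd ((\<zeta>, 0) # ps))" using elim r(2) ps by force
      from amp_deriv[OF this] show ?case unfolding f_def g_def by (rule DERIV_imp_deriv)
    qed
    ultimately have "g has_laurent_expansion fls_deriv (Abs_fls c)"
      using has_laurent_expansion_cong by blast
    hence "Abs_fls d = fls_deriv (Abs_fls c)"
      using d(1) has_laurent_expansion_unique by blast
    hence "fls_nth (Abs_fls d) (- n - int (Suc h)) = fls_nth (fls_deriv (Abs_fls c)) (- n - int (Suc h))" by simp
    hence "d (- n - int (Suc h)) = of_int (- n - int h) * c (- n - int h)"
      by (simp add: d(2) c(2))
    thus "amp ((vop (Lm \<psi>) n \<zeta>, 0) # ps) = amp ((smul (- of_int (n + int h)) (vop \<psi> n \<zeta>), 0) # ps)"
      by (simp add: amp_smul[OF ps] c_def d_def md_def)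
  qed
  have "{\<xi>. vop (Lm \<psi>) n \<xi> = smul (- of_int (n + int h)) (vop \<psi> n \<xi>)} = UNIV"
  proof -
    have "span (\<Union>n. wt n) \<subseteq> {\<xi>. vop (Lm \<psi>) n \<xi> = smul (- of_int (n + int h)) (vop \<psi> n \<xi>)}"
      by (rule span_minimal)
         (use * in \<open>auto intro!: subspaceI simp: l1.zero l2.zero l1.add l2.add l1.scale l2.scale scale_right_distrib\<close>)
    thus ?thesis using weight_span by auto
  qed
  thus ?thesis by auto
qed

end

section \<open>Coefficient functions of several variables\<close>

type_synonym idx = "nat \<Rightarrow> int"

text \<open>\<open>(\<alpha>, x, \<beta>, y)\<close> encodes the binomial \<open>\<alpha> z\<^sup>x - \<beta> z\<^sup>y\<close>, which acts on formal series by multiplication.\<close>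

type_synonym binom = "complex \<times> idx \<times> complex \<times> idx"

definition bin_op :: "binom \<Rightarrow> (idx \<Rightarrow> complex) \<Rightarrow> idx \<Rightarrow> complex" where
  "bin_op = (\<lambda>(\<alpha>, x, \<beta>, y) c e. \<alpha> * c (e - x) - \<beta> * c (e - y))"

interpretation bin_op: comp_fun_commute bin_op
  by unfold_locales
     (auto simp: bin_op_def fun_eq_iff algebra_simps)

text \<open>Multiplication by the product of all binomials in M. A multiset fits because the factors
  commute and the product of two denominators becomes a sum of multisets.\<close>

definition acts :: "binom multiset \<Rightarrow> (idx \<Rightarrow> complex) \<Rightarrow> idx \<Rightarrow> complex" where
  "acts M c = fold_mset bin_op c M"

lemma acts_empty [simp]: "acts {#} c = c"
  by (simp add: acts_def)

lemma acts_add_mset [simp]: "acts (add_mset b M) c = bin_op b (acts M c)"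
  by (simp add: acts_def)

lemma acts_union: "acts (M + N) c = acts M (acts N c)"
  by (simp add: acts_def union_commute[of M N])

section \<open>Monomials, polynomials and their evaluation\<close>

definition uv :: "nat \<Rightarrow> idx" where "uv a = (\<lambda>i. of_bool (i = a))"

definition mon :: "nat set \<Rightarrow> (nat \<Rightarrow> complex) \<Rightarrow> idx \<Rightarrow> complex" where
  "mon A z e = (\<Prod>a\<in>A. z a powi e a)"

fun bin_val :: "nat set \<Rightarrow> (nat \<Rightarrow> complex) \<Rightarrow> binom \<Rightarrow> complex" where
  "bin_val A z (\<alpha>, x, \<beta>, y) = \<alpha> * mon A z x - \<beta> * mon A z y"

abbreviation bins_val :: "nat set \<Rightarrow> (nat \<Rightarrow> complex) \<Rightarrow> binom multiset \<Rightarrow> complex" where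
  "bins_val A z M \<equiv> prod_mset (image_mset (bin_val A z) M)"

fun bin_ok :: "nat set \<Rightarrow> binom \<Rightarrow> bool" where
  "bin_ok A (\<alpha>, x, \<beta>, y) \<longleftrightarrow> (\<forall>i. 0 \<le> x i \<and> 0 \<le> y i \<and> (i \<notin> A \<longrightarrow> x i = 0 \<and> y i = 0))"

definition supp_in :: "nat set \<Rightarrow> idx \<Rightarrow> bool" where
  "supp_in A e \<longleftrightarrow> (\<forall>i. i \<notin> A \<longrightarrow> e i = 0)"

text \<open>Exponents are integers throughout, but these are ordinary polynomials: nonnegativity
  makes \<open>pval\<close> entire, also where coordinates vanish.\<close>

definition lpoly :: "nat set \<Rightarrow> (idx \<Rightarrow> complex) \<Rightarrow> bool" where
  "lpoly A c \<longleftrightarrow> finite {e. c e \<noteq> 0} \<and> (\<forall>e. c e \<noteq> 0 \<longrightarrow> supp_in A e \<and> (\<forall>i. 0 \<le> e i))"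

definition pval :: "nat set \<Rightarrow> (idx \<Rightarrow> complex) \<Rightarrow> (nat \<Rightarrow> complex) \<Rightarrow> complex" where
  "pval A c z = (\<Sum>e | c e \<noteq> 0. c e * mon A z e)"

lemma mon_add_nonneg:
  assumes "\<And>i. 0 \<le> x i" "\<And>i. 0 \<le> y i"
  shows "mon A z (x + y) = mon A z x * mon A z y"
  unfolding mon_def prod.distrib[symmetric]
  by (rule prod.cong) (use assms in \<open>auto simp: power_int_def nat_add_distrib power_add\<close>)

lemma mon_add:
  assumes "\<And>a. a \<in> A \<Longrightarrow> z a \<noteq> 0"
  shows "mon A z (x + y) = mon A z x * mon A z y"
  unfolding mon_def prod.distrib[symmetric]
  by (rule prod.cong) (use assms in \<open>auto simp: power_int_add\<close>)

lemma mon_nonzero: "finite A \<Longrightarrow> (\<And>a. a \<in> A \<Longrightarrow> z a \<noteq> 0) \<Longrightarrow> mon A z x \<noteq> 0"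
  by (auto simp: mon_def)

lemma mon_uv [simp]: "finite A \<Longrightarrow> a \<in> A \<Longrightarrow> mon A z (uv a) = z a"
  by (simp add: mon_def uv_def of_bool_def if_distrib[of "\<lambda>n. _ powi n"] prod.If_cases cong: if_cong)

lemma mon_0 [simp]: "mon A z 0 = 1"
  by (simp add: mon_def)

lemma mon_cong: "(\<And>a. a \<in> A \<Longrightarrow> z a = z' a) \<Longrightarrow> mon A z e = mon A z' e"
  unfolding mon_def by (rule prod.cong) auto

lemma pval_has_sum: "lpoly A c \<Longrightarrow> ((\<lambda>e. c e * mon A z e) has_sum pval A c z) UNIV"
  by (rule has_sum_finite_neutralI[of "{e. c e \<noteq> 0}"]) (auto simp: lpoly_def pval_def)

lemma lpoly_shift:
  assumes c: "lpoly A c" and x: "\<And>i. 0 \<le> x i" "supp_in A x"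
  shows "lpoly A (\<lambda>e. c (e - x))" and "pval A (\<lambda>e. c (e - x)) z = mon A z x * pval A c z"
proof -
  have eq: "{e. c (e - x) \<noteq> 0} = (\<lambda>e. e + x) ` {e. c e \<noteq> 0}"
    by (force simp: image_iff intro: exI[of _ "_ - x"])
  show l: "lpoly A (\<lambda>e. c (e - x))"
    unfolding lpoly_def
  proof (intro conjI allI impI)
    show "finite {e. c (e - x) \<noteq> 0}" using c unfolding eq lpoly_def by simp
    fix e assume "c (e - x) \<noteq> 0"
    hence *: "supp_in A (e - x)" "\<And>i. 0 \<le> (e - x) i" using c by (auto simp: lpoly_def)
    show "supp_in A e" using *(1) x(2) by (auto simp: supp_in_def)
    show "0 \<le> e i" for i using *(2)[of i] x(1)[of i] by simp
  qed
  have "((\<lambda>e. mon A z x * (c e * mon A z e)) has_sum mon A z x * pval A c z) UNIV"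
    by (intro has_sum_cmult_right pval_has_sum c)
  also have "?this \<longleftrightarrow> ((\<lambda>e. c (e - x) * mon A z e) has_sum mon A z x * pval A c z) UNIV"
  proof (rule has_sum_reindex_bij_witness[of _ "\<lambda>e. e - x" "\<lambda>e. e + x"])
    fix e
    show "c (e + x - x) * mon A z (e + x) = mon A z x * (c e * mon A z e)"
    proof (cases "c e = 0")
      case False
      hence "\<And>i. 0 \<le> e i" using c by (auto simp: lpoly_def)
      thus ?thesis using x(1) by (simp add: mon_add_nonneg)
    qed simp
  qed auto
  finally show "pval A (\<lambda>e. c (e - x)) z = mon A z x * pval A c z"
    using pval_has_sum[OF l, of z] has_sum_unique by blast
qed

lemma lpoly_bin_op:
  assumes c: "lpoly A c" and b: "bin_ok A b"
  shows "lpoly A (bin_op b c)" and "pval A (bin_op b c) z = bin_val A z b * pval A c z"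
proof -
  obtain \<alpha> x \<beta> y where [simp]: "b = (\<alpha>, x, \<beta>, y)" by (metis prod_cases4)
  have x: "\<And>i. 0 \<le> x i" "supp_in A x" and y: "\<And>i. 0 \<le> y i" "supp_in A y"
    using b by (auto simp: supp_in_def)
  note sx = lpoly_shift[OF c x] and sy = lpoly_shift[OF c y]
  have sub: "{e. bin_op b c e \<noteq> 0} \<subseteq> {e. c (e - x) \<noteq> 0} \<union> {e. c (e - y) \<noteq> 0}"
    by (auto simp: bin_op_def)
  show l: "lpoly A (bin_op b c)"
    unfolding lpoly_def
  proof (intro conjI allI impI)
    show "finite {e. bin_op b c e \<noteq> 0}"
      by (rule finite_subset[OF sub]) (use sx sy in \<open>auto simp: lpoly_def\<close>)
  qed (use sub sx(1) sy(1) in \<open>auto simp: lpoly_def\<close>)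
  have "((\<lambda>e. \<alpha> * (c (e - x) * mon A z e) + - (\<beta> * (c (e - y) * mon A z e))) has_sum
      \<alpha> * (mon A z x * pval A c z) + - (\<beta> * (mon A z y * pval A c z))) UNIV"
    unfolding sx(2)[symmetric] sy(2)[symmetric]
    by (intro has_sum_add has_sum_uminusI has_sum_cmult_right pval_has_sum sx sy)
  hence "((\<lambda>e. bin_op b c e * mon A z e) has_sum bin_val A z b * pval A c z) UNIV"
    by (simp add: bin_op_def algebra_simps)
  thus "pval A (bin_op b c) z = bin_val A z b * pval A c z"
    using pval_has_sum[OF l, of z] has_sum_unique by blast
qed

lemma lpoly_acts:
  assumes "lpoly A c" "\<forall>b\<in>#M. bin_ok A b"
  shows "lpoly A (acts M c)" and "pval A (acts M c) z = bins_val A z M * pval A c z"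
proof -
  have "lpoly A (acts M c) \<and> pval A (acts M c) z = bins_val A z M * pval A c z"
    using assms(2)
    by (induction M) (use assms(1) in \<open>auto simp: lpoly_bin_op\<close>)
  thus "lpoly A (acts M c)" "pval A (acts M c) z = bins_val A z M * pval A c z" by auto
qed

text \<open>\<open>M\<close> is a denominator of the series \<open>c\<close>, which thereby is the expansion of a rational function.\<close>

definition denominator :: "nat set \<Rightarrow> (idx \<Rightarrow> complex) \<Rightarrow> binom multiset \<Rightarrow> bool" where
  "denominator A c M \<longleftrightarrow> (\<forall>b\<in>#M. bin_ok A b) \<and> lpoly A (acts M c)"

definition rval :: "nat set \<Rightarrow> (idx \<Rightarrow> complex) \<Rightarrow> (nat \<Rightarrow> complex) \<Rightarrow> complex" where
  "rval A c z = (THE v. \<exists>M. denominator A c M \<and> bins_val A z M \<noteq> 0 \<and>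
     v = pval A (acts M c) z / bins_val A z M)"

text \<open>The operators of two denominators commute, so \<open>acts M' (acts M c)\<close> can be
  evaluated in two ways; this is cross multiplication. The value thus does not depend on the
  denominator, and truncations may be chosen separately in each argument.\<close>

lemma rval_eq:
  assumes M: "denominator A c M" "bins_val A z M \<noteq> 0"
  shows "rval A c z = pval A (acts M c) z / bins_val A z M"
  unfolding rval_def
proof (rule the_equality)
  fix v assume "\<exists>M'. denominator A c M' \<and> bins_val A z M' \<noteq> 0 \<and>
     v = pval A (acts M' c) z / bins_val A z M'"
  then obtain M' where M': "denominator A c M'" "bins_val A z M' \<noteq> 0"
    "v = pval A (acts M' c) z / bins_val A z M'" by blast
  have "acts M' (acts M c) = acts M (acts M' c)"
    by (metis acts_union union_commute)
  hence "bins_val A z M' * pval A (acts M c) z = bins_val A z M * pval A (acts M' c) z"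
    using lpoly_acts(2)[of A "acts M c" M' z] lpoly_acts(2)[of A "acts M' c" M z] M(1) M'(1)
    by (simp add: denominator_def)
  also have "pval A (acts M' c) z = v * bins_val A z M'" using M'(2,3) by simp
  finally have "bins_val A z M' * pval A (acts M c) z = bins_val A z M' * (v * bins_val A z M)" by (simp only: mult_ac)
  hence "pval A (acts M c) z = v * bins_val A z M" using M'(2) by (simp only: mult_cancel_left) simp
  thus "v = pval A (acts M c) z / bins_val A z M" using M(2) by (simp only: nonzero_mult_div_cancel_right) simp
qed (use M in blast)

text \<open>Variables carry arbitrary labels in the arguments below, but positions in a list in
  \<open>eta_amp\<close>; this lemma translates between them. The map \<rho> transports exponent
  vectors along f, and \<sigma> is its inverse on supported vectors.\<close>

lemma rval_relabel:
  assumes f: "bij_betw f A' A" and A: "finite A"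
    and c0: "\<And>e. \<not> supp_in A e \<Longrightarrow> c e = 0" and c'0: "\<And>e. \<not> supp_in A' e \<Longrightarrow> c' e = 0"
    and cc': "\<And>e. supp_in A e \<Longrightarrow> c e = c' (\<lambda>i. if i \<in> A' then e (f i) else 0)"
    and zz': "\<And>i. i \<in> A' \<Longrightarrow> z' i = z (f i)"
    and M: "denominator A c M" "bins_val A z M \<noteq> 0"
  shows "rval A' c' z' = rval A c z"
proof -
  define \<rho> :: "idx \<Rightarrow> idx" where "\<rho> = (\<lambda>e i. if i \<in> A' then e (f i) else 0)"
  define \<sigma> :: "idx \<Rightarrow> idx" where "\<sigma> = (\<lambda>e a. if a \<in> A then e (inv_into A' f a) else 0)"
  define \<rho>b :: "binom \<Rightarrow> binom" where "\<rho>b = (\<lambda>(\<alpha>, x, \<beta>, y). (\<alpha>, \<rho> x, \<beta>, \<rho> y))"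
  have fA: "f i \<in> A" if "i \<in> A'" for i using f that by (auto simp: bij_betw_def)
  have inv: "inv_into A' f a \<in> A'" "f (inv_into A' f a) = a" if "a \<in> A" for a
    using f that by (auto simp: bij_betw_def inv_into_into f_inv_into_f)
  have inv': "inv_into A' f (f i) = i" if "i \<in> A'" for i
    using f that by (auto simp: bij_betw_def)
  have \<sigma>\<rho>: "\<sigma> (\<rho> e) = e" if "supp_in A e" for e
    using that inv by (auto simp: \<sigma>_def \<rho>_def supp_in_def)
  have \<rho>\<sigma>: "\<rho> (\<sigma> e) = e" if "supp_in A' e" for e
    using that fA inv' by (auto simp: \<sigma>_def \<rho>_def supp_in_def)
  have supp\<rho>: "supp_in A' (\<rho> e)" for e by (auto simp: \<rho>_def supp_in_def)
  have supp\<sigma>: "supp_in A (\<sigma> e)" for e by (auto simp: \<sigma>_def supp_in_def)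
  have \<rho>_diff: "\<rho> (e - x) = \<rho> e - \<rho> x" for e x by (auto simp: \<rho>_def)
  have mon\<rho>: "mon A' z' (\<rho> e) = mon A z e" for e
    unfolding mon_def prod.reindex_bij_betw[OF f, symmetric]
    by (rule prod.cong) (auto simp: \<rho>_def zz')
  have val: "bin_val A' z' (\<rho>b b) = bin_val A z b" for b
    by (cases b) (auto simp: \<rho>b_def mon\<rho>)
  have ok: "bin_ok A' (\<rho>b b)" if "bin_ok A b" for b
    using that by (cases b) (auto simp: \<rho>b_def \<rho>_def)
  have act: "(supp_in A e \<longrightarrow> acts (image_mset \<rho>b M) c' (\<rho> e) = acts M c e) \<and>
      (\<not> supp_in A e \<longrightarrow> acts M c e = 0) \<and> (\<not> supp_in A' e' \<longrightarrow> acts (image_mset \<rho>b M) c' e' = 0)"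
    if "\<forall>b\<in>#M. bin_ok A b" for M e e'
    using that
  proof (induction M arbitrary: e e')
    case empty
    thus ?case using cc' c0 c'0 by (simp add: \<rho>_def)
  next
    case (add b M)
    obtain \<alpha> x \<beta> y where b: "b = (\<alpha>, x, \<beta>, y)" by (metis prod_cases4)
    have xy: "supp_in A x" "supp_in A y" using add.prems by (auto simp: b supp_in_def)
    have s: "supp_in A (e - x) \<longleftrightarrow> supp_in A e" "supp_in A (e - y) \<longleftrightarrow> supp_in A e" for e
      using xy by (auto simp: supp_in_def)
    have s': "supp_in A' (e - \<rho> x) \<longleftrightarrow> supp_in A' e" "supp_in A' (e - \<rho> y) \<longleftrightarrow> supp_in A' e" for e
      by (auto simp: supp_in_def \<rho>_def)
    note IH = add.IH[THEN conjunct1, rule_format] add.IH[THEN conjunct2, THEN conjunct1, rule_format]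
      add.IH[THEN conjunct2, THEN conjunct2, rule_format]
    show ?case
      using IH(1)[of "e - x"] IH(1)[of "e - y"] IH(2)[of "e - x"] IH(2)[of "e - y"]
        IH(3)[of "e' - \<rho> x"] IH(3)[of "e' - \<rho> y"] add.prems s s'
      by (auto simp: b \<rho>b_def bin_op_def \<rho>_diff)
  qed
  define P where "P = acts M c"
  define P' where "P' = acts (image_mset \<rho>b M) c'"
  have Mok: "\<forall>b\<in>#M. bin_ok A b" using M by (simp add: denominator_def)
  have P: "lpoly A P" using M by (simp add: denominator_def P_def)
  have PP': "P' (\<rho> e) = P e" if "supp_in A e" for e using act[OF Mok] that by (simp add: P_def P'_def)
  have P'0: "supp_in A' e" if "P' e \<noteq> 0" for e using act[OF Mok, of 0 e] that by (auto simp: P'_def)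
  have bij: "bij_betw \<rho> {e. P e \<noteq> 0} {e. P' e \<noteq> 0}"
  proof (rule bij_betwI[of _ _ _ \<sigma>])
    show "\<rho> \<in> {e. P e \<noteq> 0} \<rightarrow> {e. P' e \<noteq> 0}" using P PP' by (auto simp: lpoly_def)
    show "\<sigma> \<in> {e. P' e \<noteq> 0} \<rightarrow> {e. P e \<noteq> 0}"
    proof
      fix e assume "e \<in> {e. P' e \<noteq> 0}"
      thus "\<sigma> e \<in> {e. P e \<noteq> 0}" using PP'[OF supp\<sigma>, of e] \<rho>\<sigma>[OF P'0, of e] by simp
    qed
  qed (use P \<sigma>\<rho> \<rho>\<sigma> P'0 in \<open>auto simp: lpoly_def\<close>)
  have P': "lpoly A' P'"
    unfolding lpoly_def
  proof (intro conjI allI impI)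
    show "finite {e. P' e \<noteq> 0}" using bij P bij_betw_finite by (auto simp: lpoly_def)
    fix e assume "P' e \<noteq> 0"
    thus "supp_in A' e" by (rule P'0)
    obtain e' where "e = \<rho> e'" "P e' \<noteq> 0"
      using bij \<open>P' e \<noteq> 0\<close> by (force simp: bij_betw_def)
    thus "0 \<le> e i" for i using P by (auto simp: lpoly_def \<rho>_def)
  qed
  have "pval A' P' z' = (\<Sum>e | P e \<noteq> 0. P' (\<rho> e) * mon A' z' (\<rho> e))"
    unfolding pval_def by (rule sum.reindex_bij_betw[OF bij, symmetric])
  also have "\<dots> = pval A P z"
    unfolding pval_def by (rule sum.cong) (use P in \<open>auto simp: lpoly_def PP' mon\<rho>\<close>)
  finally have pv: "pval A' P' z' = pval A P z" .
  have bv: "bins_val A' z' (image_mset \<rho>b M) = bins_val A z M"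
    by (simp add: image_mset.compositionality o_def val)
  have "denominator A' c' (image_mset \<rho>b M)"
    using ok Mok P' by (auto simp: denominator_def P'_def)
  thus ?thesis
    using rval_eq[OF M] rval_eq[of A' c' "image_mset \<rho>b M" z'] M(2) pv bv
    by (simp add: P_def P'_def)
qed

text \<open>\<open>1 / (\<alpha> z\<^sup>x - \<beta> z\<^sup>y)\<close> is expanded geometrically where the first term dominates; \<open>van\<close> makes the
  formal quotient unique.\<close>

lemma division_step:
  fixes \<mu> :: "idx \<Rightarrow> complex"
  assumes \<mu>: "\<And>x y. \<mu> (x + y) = \<mu> x * \<mu> y" "\<And>x. \<mu> x \<noteq> 0"
    and hs: "((\<lambda>e. bin_op (\<alpha>, x, \<beta>, y) c e * \<mu> e) has_sum D) UNIV"
    and dom: "norm (\<beta> * \<mu> y) < norm (\<alpha> * \<mu> x)"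
    and van: "\<And>e. \<exists>T. \<forall>t\<ge>T. c (\<lambda>i. e i + int t * (x i - y i)) = 0"
  shows "((\<lambda>e. c e * \<mu> e) has_sum D / (\<alpha> * \<mu> x - \<beta> * \<mu> y)) UNIV"
proof -
  have nz: "\<alpha> * \<mu> x \<noteq> 0" using dom by auto
  hence \<alpha>: "\<alpha> \<noteq> 0" by auto
  define sh :: "nat \<Rightarrow> idx" where "sh = (\<lambda>t i. int t * (x i - y i))"
  have sh0: "sh 0 = 0" by (auto simp: sh_def)
  have shSuc: "sh (Suc t) + y = sh t + x" for t by (auto simp: sh_def algebra_simps)
  have \<mu>0: "\<mu> 0 = 1" using \<mu>(1)[of 0 0] \<mu>(2)[of 0] by simp
  have \<mu>sh: "\<mu> (sh t) * \<mu> y ^ t = \<mu> x ^ t" for t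
  proof (induction t)
    case (Suc t)
    have "\<mu> (sh (Suc t)) * \<mu> y = \<mu> (sh t) * \<mu> x"
      using shSuc[of t] \<mu>(1) by metis
    hence "\<mu> (sh (Suc t)) * \<mu> y ^ Suc t = \<mu> x * (\<mu> (sh t) * \<mu> y ^ t)"
      by (simp only: power_Suc mult.assoc[symmetric]) (simp only: mult_ac)
    thus ?case by (simp only: Suc power_Suc)
  qed (simp only: sh0 \<mu>0 power_0 mult_1_right)
  define d where "d = bin_op (\<alpha>, x, \<beta>, y) c"
  define q where "q = \<beta> * \<mu> y / (\<alpha> * \<mu> x)"
  have q: "norm q < 1" using dom nz by (simp add: q_def norm_divide)
  \<comment> \<open>\<open>K t e\<close> is the contribution at exponent e of the t-th term of the
    geometric series of 1 / (\<alpha> z^x - \<beta> z^y), applied to the product d. Summed over e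
    first, the K form a convergent geometric series; summed over t first, they telescope to c
    e.\<close>
  define K where "K = (\<lambda>t e. (\<beta> / \<alpha>) ^ t / \<alpha> * d (e + (x + sh t)) * \<mu> e)"
  have \<mu>xt: "(\<beta> / \<alpha>) ^ t / \<alpha> / \<mu> (x + sh t) = q ^ t / (\<alpha> * \<mu> x)" for t
    using \<mu>sh[of t] \<mu>(2) \<alpha> by (simp add: \<mu>(1) q_def power_divide power_mult_distrib field_simps)
  have K: "((\<lambda>e. K t e) has_sum q ^ t / (\<alpha> * \<mu> x) * D) UNIV" for t
  proof -
    have "((\<lambda>e. q ^ t / (\<alpha> * \<mu> x) * (d e * \<mu> e)) has_sum q ^ t / (\<alpha> * \<mu> x) * D) UNIV"
      unfolding d_def by (intro has_sum_cmult_right hs)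
    also have "?this \<longleftrightarrow> ?thesis"
    proof (rule has_sum_reindex_bij_witness[of _ "\<lambda>e. e + (x + sh t)" "\<lambda>e. e - (x + sh t)"])
      fix e
      have "\<mu> e = \<mu> (e - (x + sh t)) * \<mu> (x + sh t)" by (subst \<mu>(1)[symmetric]) simp
      thus "K t (e - (x + sh t)) = q ^ t / (\<alpha> * \<mu> x) * (d e * \<mu> e)"
        unfolding K_def \<mu>xt[symmetric] using \<mu>(2)[of "x + sh t"] by simp
    qed auto
    finally show ?thesis .
  qed
  have sumK: "(\<lambda>(t, e). K t e) summable_on UNIV \<times> UNIV"
  proof -
    define D' where "D' = infsum (\<lambda>e. norm (d e * \<mu> e)) UNIV"
    have "(\<lambda>e. norm (d e * \<mu> e)) summable_on UNIV"
      using has_sum_imp_summable[OF hs] unfolding summable_on_iff_abs_summable_on_complex d_def .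
    hence D': "((\<lambda>e. norm (d e * \<mu> e)) has_sum D') UNIV" by (simp add: D'_def)
    have "(\<lambda>te. norm (case te of (t, e) \<Rightarrow> K t e)) summable_on UNIV \<times> UNIV"
    proof (rule summable_on_SigmaI)
      fix t :: nat
      have "((\<lambda>e. norm (q ^ t / (\<alpha> * \<mu> x)) * norm (d e * \<mu> e)) has_sum norm (q ^ t / (\<alpha> * \<mu> x)) * D') UNIV"
        by (intro has_sum_cmult_right D')
      also have "?this \<longleftrightarrow> ((\<lambda>e. norm (K t e)) has_sum norm (q ^ t / (\<alpha> * \<mu> x)) * D') UNIV"
      proof (rule has_sum_reindex_bij_witness[of _ "\<lambda>e. e + (x + sh t)" "\<lambda>e. e - (x + sh t)"])
        fix e
        have "\<mu> e = \<mu> (e - (x + sh t)) * \<mu> (x + sh t)" by (subst \<mu>(1)[symmetric]) simp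
        thus "norm (K t (e - (x + sh t))) = norm (q ^ t / (\<alpha> * \<mu> x)) * norm (d e * \<mu> e)"
          unfolding K_def \<mu>xt[symmetric] norm_mult[symmetric] using \<mu>(2)[of "x + sh t"]
          by (simp add: mult.assoc)
      qed auto
      finally show "((\<lambda>e. norm (case (t, e) of (t, e) \<Rightarrow> K t e)) has_sum norm (q ^ t / (\<alpha> * \<mu> x)) * D') UNIV"
        by simp
      have "(\<lambda>t. norm q ^ t) summable_on UNIV"
        using q by (intro norm_summable_imp_summable_on) (simp add: summable_geometric)
      from summable_on_cmult_left[OF this, of "1 / norm (\<alpha> * \<mu> x) * D'"]
      show "(\<lambda>t. norm (q ^ t / (\<alpha> * \<mu> x)) * D') summable_on UNIV"
        by (simp add: norm_divide norm_power)
    qed auto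
    thus ?thesis by (rule abs_summable_summable)
  qed
  have geo: "((\<lambda>t. q ^ t / (\<alpha> * \<mu> x) * D) has_sum D / (\<alpha> * \<mu> x - \<beta> * \<mu> y)) UNIV"
  proof -
    have "((\<lambda>t. q ^ t) has_sum 1 / (1 - q)) UNIV"
      using q by (intro norm_summable_imp_has_sum) (auto simp: norm_power summable_geometric intro: geometric_sums)
    hence "((\<lambda>t. q ^ t * (D / (\<alpha> * \<mu> x))) has_sum 1 / (1 - q) * (D / (\<alpha> * \<mu> x))) UNIV"
      by (rule has_sum_cmult_left)
    moreover have "1 / (1 - q) * (D / (\<alpha> * \<mu> x)) = D / ((1 - q) * (\<alpha> * \<mu> x))" by simp
    moreover have "(1 - q) * (\<alpha> * \<mu> x) = \<alpha> * \<mu> x - \<beta> * \<mu> y"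
      using nz by (simp add: q_def left_diff_distrib)
    ultimately show ?thesis by (simp add: mult_ac)
  qed
  have "((\<lambda>(t, e). K t e) has_sum D / (\<alpha> * \<mu> x - \<beta> * \<mu> y)) (UNIV \<times> UNIV)"
    by (rule has_sum_SigmaI[OF _ geo sumK]) (use K in simp)
  hence "((\<lambda>(e, t). K t e) has_sum D / (\<alpha> * \<mu> x - \<beta> * \<mu> y)) (UNIV \<times> UNIV)"
    by (subst has_sum_swap) (simp add: case_prod_unfold)
  thus ?thesis
  proof (rule has_sum_SigmaD)
    fix e
    obtain T where T: "\<And>t. t \<ge> T \<Longrightarrow> c (e + sh t) = 0"
      using van[of e] by (auto simp: sh_def plus_fun_def)
    \<comment> \<open>Inserting the definition of d turns K into a difference of consecutive values
      of g; \<open>van\<close> makes the boundary term g T vanish.\<close>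
    define g where "g = (\<lambda>t. (\<beta> / \<alpha>) ^ t * c (e + sh t))"
    have Kg: "K t e = (g t - g (Suc t)) * \<mu> e" for t
    proof -
      have "e + (x + sh t) - x = e + sh t" by simp
      moreover have "e + (x + sh t) - y = e + sh (Suc t)"
        using shSuc[of t] by (simp add: algebra_simps)
      ultimately show ?thesis
        using \<alpha> by (simp add: K_def g_def d_def bin_op_def field_simps)
    qed
    have "((\<lambda>t. K t e) has_sum (\<Sum>t<T. K t e)) UNIV"
      by (rule has_sum_finite_neutralI[of "{..<T}"]) (auto simp: Kg g_def T)
    also have "(\<Sum>t<T. K t e) = (\<Sum>t<T. g t - g (Suc t)) * \<mu> e"
      by (simp add: Kg sum_distrib_right)
    also have "(\<Sum>t<T. g t - g (Suc t)) = g 0 - g T" by (rule sum_lessThan_telescope')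
    also have "\<dots> = c e" using T[of T] by (simp add: g_def sh0)
    finally show "((\<lambda>t. case (e, t) of (e, t) \<Rightarrow> K t e) has_sum c e * \<mu> e) UNIV" by simp
  qed
qed

text \<open>One factor is removed at a time. C is a class of series stable under all factors, so
  that every intermediate numerator still satisfies the vanishing condition; which term of the
  binomial is expanded may change from factor to factor.\<close>

lemma division_acts:
  fixes \<mu> :: "idx \<Rightarrow> complex"
  assumes \<mu>: "\<And>x y. \<mu> (x + y) = \<mu> x * \<mu> y" "\<And>x. \<mu> x \<noteq> 0"
    and closed: "\<And>c b. C c \<Longrightarrow> b \<in># M \<Longrightarrow> C (bin_op b c)"
    and dom: "\<And>c \<alpha> x \<beta> y. C c \<Longrightarrow> (\<alpha>, x, \<beta>, y) \<in># M \<Longrightarrow>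
       norm (\<beta> * \<mu> y) < norm (\<alpha> * \<mu> x) \<and> (\<forall>e. \<exists>T. \<forall>t\<ge>T. c (\<lambda>i. e i + int t * (x i - y i)) = 0) \<or>
       norm (\<alpha> * \<mu> x) < norm (\<beta> * \<mu> y) \<and> (\<forall>e. \<exists>T. \<forall>t\<ge>T. c (\<lambda>i. e i + int t * (y i - x i)) = 0)"
    and "C c"
    and "((\<lambda>e. acts M c e * \<mu> e) has_sum D) UNIV"
  shows "((\<lambda>e. c e * \<mu> e) has_sum D / (\<Prod>(\<alpha>, x, \<beta>, y)\<in>#M. \<alpha> * \<mu> x - \<beta> * \<mu> y)) UNIV"
  using assms(3-)
proof (induction M arbitrary: D)
  case (add b M)
  obtain \<alpha> x \<beta> y where b: "b = (\<alpha>, x, \<beta>, y)" by (metis prod_cases4)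
  have "C (acts N c)" if "N \<subseteq># M" for N
    using that
  proof (induction N)
    case (add b' N)
    have "b' \<in># M" using add.prems by (meson insert_subset_eq_iff)
    moreover have "C (acts N c)" using add by (meson mset_subset_eq_insertD subset_mset.less_imp_le)
    ultimately show ?case using \<open>\<And>c b'. C c \<Longrightarrow> b' \<in># add_mset b M \<Longrightarrow> C (bin_op b' c)\<close> by simp
  qed (use add.prems in simp)
  hence C: "C (acts M c)" by simp
  have hs: "((\<lambda>e. bin_op (\<alpha>, x, \<beta>, y) (acts M c) e * \<mu> e) has_sum D) UNIV"
    using add.prems by (simp add: b)
  have mem: "(\<alpha>, x, \<beta>, y) \<in># add_mset b M" by (simp add: b)
  have "((\<lambda>e. acts M c e * \<mu> e) has_sum D / (\<alpha> * \<mu> x - \<beta> * \<mu> y)) UNIV"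
    using add.prems(2)[OF C mem]
  proof (elim disjE conjE)
    assume "norm (\<beta> * \<mu> y) < norm (\<alpha> * \<mu> x)"
      "\<forall>e. \<exists>T. \<forall>t\<ge>T. acts M c (\<lambda>i. e i + int t * (x i - y i)) = 0"
    thus ?thesis by (intro division_step[OF \<mu> hs]) auto
  next
    assume *: "norm (\<alpha> * \<mu> x) < norm (\<beta> * \<mu> y)"
      "\<forall>e. \<exists>T. \<forall>t\<ge>T. acts M c (\<lambda>i. e i + int t * (y i - x i)) = 0"
    have "((\<lambda>e. bin_op (\<beta>, y, \<alpha>, x) (acts M c) e * \<mu> e) has_sum - D) UNIV"
      using has_sum_uminusI[OF hs] by (simp add: bin_op_def algebra_simps)
    from division_step[OF \<mu> this *(1)] *(2)
    have "((\<lambda>e. acts M c e * \<mu> e) has_sum - D / (\<beta> * \<mu> y - \<alpha> * \<mu> x)) UNIV" by blast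
    also have "- D / (\<beta> * \<mu> y - \<alpha> * \<mu> x) = D / (\<alpha> * \<mu> x - \<beta> * \<mu> y)"
      by (metis minus_diff_eq minus_divide_divide)
    finally show ?thesis .
  qed
  from add.IH[OF _ _ _ this] add.prems
  show ?case by (simp add: b mult.commute)
qed simp

lemma finite_box: "finite A \<Longrightarrow> finite {e::idx. supp_in A e \<and> (\<forall>i\<in>A. 0 \<le> e i \<and> e i \<le> K)}"
  using finite_set_of_finite_funs[of A "{0..K}" 0]
  by (rule rev_finite_subset) (auto simp: supp_in_def)

section \<open>Truncation of the series of a functional annihilating \<open>O\<^sub>u\<close>\<close>

text \<open>Multiplication by z - u of the one-variable series in which f E is the coefficient of
  z^E.\<close>

definition ush :: "complex \<Rightarrow> (int \<Rightarrow> complex) \<Rightarrow> int \<Rightarrow> complex" where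
  "ush u f = (\<lambda>E. f (E - 1) - u * f E)"

abbreviation ushs :: "complex list \<Rightarrow> (int \<Rightarrow> complex) \<Rightarrow> int \<Rightarrow> complex" where
  "ushs vs f \<equiv> foldr ush vs f"

definition vanishes_above :: "int \<Rightarrow> (int \<Rightarrow> complex) \<Rightarrow> bool" where
  "vanishes_above K f \<longleftrightarrow> (\<forall>E>K. f E = 0)"

lemma ush_commute: "ush u (ush v f) = ush v (ush u f)"
  by (auto simp: ush_def fun_eq_iff algebra_simps)

lemma ushs_ush: "ushs vs (ush u f) = ush u (ushs vs f)"
  by (induction vs) (simp_all add: ush_commute)

lemma ushs_ushs: "ushs vs (ushs ws f) = ushs ws (ushs vs f)"
  by (induction vs) (simp_all add: ushs_ush)

lemma ushs_lincomb: "ushs vs (\<lambda>E. a * f E + b * g E) = (\<lambda>E. a * ushs vs f E + b * ushs vs g E)"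
  by (induction vs) (auto simp: ush_def fun_eq_iff algebra_simps)

lemma ushs_diff: "ushs vs (\<lambda>E. f E - g E) = (\<lambda>E. ushs vs f E - ushs vs g E)"
  using ushs_lincomb[of vs 1 f "-1" g] by simp

lemma ushs_shift: "ushs vs (\<lambda>E. f (E - 1)) = (\<lambda>E. ushs vs f (E - 1))"
  by (induction vs) (auto simp: ush_def fun_eq_iff algebra_simps)

lemma vanishes_above_ush: "vanishes_above K f \<Longrightarrow> vanishes_above (K + 1) (ush u f)"
  by (auto simp: vanishes_above_def ush_def)

lemma vanishes_above_ushs: "vanishes_above K f \<Longrightarrow> vanishes_above (K + int (length vs)) (ushs vs f)"
proof (induction vs)
  case (Cons v vs)
  from vanishes_above_ush[OF Cons.IH[OF Cons.prems], of v] show ?case by (simp add: add_ac)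
qed simp

text \<open>Multiplication of coefficients by E - s is the operator \<theta> = z d/dz - s, and the
  product rule with f1 = (z - u) f gives (z - u)^2 \<theta> f = (z - u) \<theta> f1 - z f1. Each
  root is therefore doubled, which covers the extra pole order caused by differentiation.\<close>

lemma vanishes_above_theta:
  assumes "vanishes_above K (ushs vs f)"
  shows "vanishes_above (K + 2 * int (length vs)) (ushs (vs @ vs) (\<lambda>E. (of_int E - s) * f E))"
  using assms
proof (induction vs arbitrary: f)
  case Nil
  thus ?case by (simp add: vanishes_above_def)
next
  case (Cons u vs)
  define f1 where "f1 = ush u f"
  have f1: "vanishes_above K (ushs vs f1)"
    using Cons.prems by (simp add: f1_def ushs_ush)
  have eq: "ush u (ush u (\<lambda>E. (of_int E - s) * f E)) =
      (\<lambda>E. ush u (\<lambda>E. (of_int E - s) * f1 E) E - f1 (E - 1))"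
    by (auto simp: ush_def f1_def fun_eq_iff algebra_simps)
  have "ushs ((u # vs) @ (u # vs)) (\<lambda>E. (of_int E - s) * f E) =
      ushs (vs @ vs) (ush u (ush u (\<lambda>E. (of_int E - s) * f E)))"
    by (simp add: ushs_ush)
  also have "\<dots> = (\<lambda>E. ush u (ushs (vs @ vs) (\<lambda>E. (of_int E - s) * f1 E)) E - ushs vs (ushs vs f1) (E - 1))"
    unfolding eq ushs_diff ushs_ush ushs_shift by simp
  finally have *: "ushs ((u # vs) @ (u # vs)) (\<lambda>E. (of_int E - s) * f E) = \<dots>" .
  have "vanishes_above (K + 2 * int (length vs) + 1) (ush u (ushs (vs @ vs) (\<lambda>E. (of_int E - s) * f1 E)))"
    by (rule vanishes_above_ush[OF Cons.IH[OF f1]])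
  moreover have "vanishes_above (K + int (length vs)) (ushs vs (ushs vs f1))"
    by (rule vanishes_above_ushs[OF f1])
  ultimately show ?case
    unfolding * by (auto simp: vanishes_above_def)
qed

section \<open>Admissible functions in \<open>O_space\<close> and their contour integrals\<close>

definition root_poly :: "complex list \<Rightarrow> complex poly" where
  "root_poly vs = prod_list (map (\<lambda>u. [:- u, 1:]) vs)"

lemma root_poly_simps [simp]:
  "root_poly [] = 1" "root_poly (u # vs) = [:- u, 1:] * root_poly vs"
  by (simp_all add: root_poly_def)

lemma degree_root_poly: "degree (root_poly vs) \<le> length vs"
proof (induction vs)
  case (Cons u vs)
  have "degree (root_poly (u # vs)) \<le> degree [:- u, 1:] + degree (root_poly vs)"
    unfolding root_poly_simps by (rule degree_mult_le)
  with Cons show ?case by simp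
qed simp

lemma ushs_eq_sum:
  "ushs vs f E = (\<Sum>i\<le>length vs. coeff (root_poly vs) i * f (E - int i))"
proof (induction vs arbitrary: E)
  case (Cons u vs)
  define n where "n = length vs"
  define p where "p = root_poly vs"
  have top: "coeff p (Suc n) = 0"
    using degree_root_poly[of vs] by (intro coeff_eq_0) (simp add: n_def p_def)
  have "(\<Sum>i\<le>Suc n. coeff (root_poly (u # vs)) i * f (E - int i)) =
      (\<Sum>i\<le>Suc n. coeff (pCons 0 p) i * f (E - int i)) - u * (\<Sum>i\<le>Suc n. coeff p i * f (E - int i))"
    by (simp add: p_def sum_subtractf[symmetric] sum_distrib_left algebra_simps del: sum.atMost_Suc)
  also have "(\<Sum>i\<le>Suc n. coeff (pCons 0 p) i * f (E - int i)) = (\<Sum>i\<le>n. coeff p i * f (E - 1 - int i))"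
    by (subst sum.atMost_Suc_shift) (simp add: algebra_simps)
  also have "(\<Sum>i\<le>Suc n. coeff p i * f (E - int i)) = (\<Sum>i\<le>n. coeff p i * f (E - int i))"
    using top by simp
  finally show ?case using Cons by (simp add: ush_def n_def p_def)
qed simp

lemma poly_root_poly: "poly (root_poly vs) z = prod_list (map (\<lambda>u. z - u) vs)"
  by (induction vs) (simp_all add: algebra_simps)

lemma prod_list_concat_replicate:
  fixes f :: "'a \<Rightarrow> 'b::comm_monoid_mult"
  shows "prod_list (map f (concat (replicate h us))) = prod_list (map f us) ^ h"
  by (induction h) simp_all

lemma residue_powi_poly:
  "residue (\<lambda>z. z powi M * poly p z) 0 = (if M < 0 then coeff p (nat (- 1 - M)) else 0)"
proof -
  define c where "c = (\<lambda>k. if k < M then 0 else coeff p (nat (k - M)))"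
  have "eventually (\<lambda>z. ((\<lambda>k. z powi k * c k) has_sum z powi M * poly p z) UNIV) (at 0)"
    using eventually_punctured_disc[OF zero_less_one]
  proof eventually_elim
    case (elim z)
    have "((\<lambda>k. z powi M * (z ^ k * coeff p k)) has_sum z powi M * poly p z) UNIV"
      unfolding poly_altdef
      by (intro has_sum_cmult_right has_sum_finite_neutralI[of "{..degree p}"])
         (auto simp: coeff_eq_0 mult_ac)
    thus ?case
      by (subst has_sum_int_nat[where N = M])
         (use elim in \<open>auto simp: c_def power_int_add mult_ac\<close>)
  qed
  note L = has_laurent_expansion_of_has_sum[of M c, OF _ this]
  have "residue (\<lambda>z. z powi M * poly p z) 0 = fls_residue (Abs_fls c)"
    by (rule has_laurent_expansion_residue_0[OF L(1)]) (simp add: c_def)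
  also have "\<dots> = c (-1)" using L(2) by (simp add: c_def)
  finally show ?thesis by (auto simp: c_def algebra_simps)
qed

locale cft_functional = chiral_cft smul V amp \<Omega> vop \<omega> c
  for smul :: "complex \<Rightarrow> 'h::ab_group_add \<Rightarrow> 'h" and V amp \<Omega> vop \<omega> c +
  fixes us :: "complex list" and \<eta> :: "'h \<Rightarrow> complex"
  assumes us: "distinct us" "0 \<notin> set us"
    and eta_linear: "Vector_Spaces.linear smul (*) \<eta>"
    and eta_O: "O_space smul V vop (map Some us) \<subseteq> {\<xi>. \<eta> \<xi> = 0}"
begin

sublocale eta: Vector_Spaces.linear smul "(*)" \<eta> by (rule eta_linear)

definition trunc_fun :: "nat \<Rightarrow> int \<Rightarrow> complex \<Rightarrow> complex" where
  "trunc_fun h M z = z powi (- M) * poly (root_poly (concat (replicate h us))) z"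

lemma trunc_fun_altdef: "trunc_fun h M z = z powi (- M) * (\<Prod>u\<in>set us. z - u) ^ h"
  unfolding trunc_fun_def poly_root_poly prod_list_concat_replicate
  using us(1) by (simp add: prod.distinct_set_conv_list)

text \<open>The hypothesis on M is the condition at infinity: with k the number of points in
  \<open>us\<close>, the function vanishes there to order M - h k, and the form dz^(1 - h) subtracts
  2 (1 - h). At each u the order is exactly h because the list is distinct and avoids 0.\<close>

lemma trunc_fun_divisor:
  assumes M: "M - int h * int (length us) \<ge> 2 - 2 * int h"
  shows "divisor (trunc_fun h M) (1 - int h) P \<ge>
    - M * of_bool (P = Some 0) + int h * int (count_list (map Some us) P)"
proof (cases P)
  case None
  have "zorder (\<lambda>w. trunc_fun h M (inverse w)) 0 = M - int h * int (length us)"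
  proof (rule zorder_eqI[where S = UNIV and g = "\<lambda>w. (\<Prod>u\<in>set us. 1 - u * w) ^ h"])
    fix w :: complex assume w: "w \<noteq> 0"
    have "(\<Prod>u\<in>set us. inverse w - u) = (\<Prod>u\<in>set us. inverse w * (1 - u * w))"
      by (rule prod.cong) (use w in \<open>auto simp: field_simps\<close>)
    also have "\<dots> = inverse w ^ length us * (\<Prod>u\<in>set us. 1 - u * w)"
      using us(1) by (simp add: prod.distrib distinct_card)
    finally have "trunc_fun h M (inverse w) =
        w powi M * (inverse w ^ length us * (\<Prod>u\<in>set us. 1 - u * w)) ^ h"
      by (simp add: trunc_fun_altdef power_int_minus power_int_inverse)
    also have "\<dots> = (\<Prod>u\<in>set us. 1 - u * w) ^ h * (w powi M * inverse w ^ (h * length us))"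
      by (simp add: power_mult_distrib power_mult[symmetric] mult.commute)
    also have "w powi M * inverse w ^ (h * length us) = w powi (M - int h * int (length us))"
      using w by (simp add: power_int_diff field_simps flip: power_int_of_nat of_nat_mult)
    finally show "trunc_fun h M (inverse w) =
       (\<Prod>u\<in>set us. 1 - u * w) ^ h * (w - 0) powi (M - int h * int (length us))" by simp
  qed (auto intro!: holomorphic_intros)
  moreover have "count_list (map Some us) None = 0" by (induction us) auto
  ultimately show ?thesis
    using None M by (simp add: divisor_def vanishing_order_def)
next
  case (Some z)
  have cnt: "count_list (map Some us) (Some z) = of_bool (z \<in> set us)"
    using us(1) by (induction us) auto
  show ?thesis
  proof (cases "z = 0")
    case True
    have "zorder (trunc_fun h M) 0 = - M"
    proof (rule zorder_eqI[where S = UNIV and g = "\<lambda>w. (\<Prod>u\<in>set us. w - u) ^ h"])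
      show "(\<Prod>u\<in>set us. 0 - u) ^ h \<noteq> 0" using us(2) by auto
    qed (auto intro!: holomorphic_intros simp: trunc_fun_altdef mult_ac)
    thus ?thesis using Some True cnt us(2) by (simp add: divisor_def vanishing_order_def)
  next
    case False
    have "zorder (trunc_fun h M) z = int (h * of_bool (z \<in> set us))"
    proof (rule zorder_eqI[where S = "- {0}" and g = "\<lambda>w. w powi (- M) * (\<Prod>u\<in>set us - {z}. w - u) ^ h"])
      show "z powi (- M) * (\<Prod>u\<in>set us - {z}. z - u) ^ h \<noteq> 0" using False by auto
      show "(\<lambda>w. w powi (- M) * (\<Prod>u\<in>set us - {z}. w - u) ^ h) holomorphic_on - {0}"
        by (intro holomorphic_intros) auto
      fix w :: complex
      have "(\<Prod>u\<in>set us. w - u) = (\<Prod>u\<in>set us - {z}. w - u) * (w - z) ^ of_bool (z \<in> set us)"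
        by (cases "z \<in> set us") (simp_all add: prod.remove mult.commute)
      thus "trunc_fun h M w = w powi (- M) * (\<Prod>u\<in>set us - {z}. w - u) ^ h *
           (w - z) powi int (h * of_bool (z \<in> set us))"
        by (simp add: trunc_fun_altdef power_mult_distrib power_mult[symmetric] mult_ac)
    qed (use False in auto)
    thus ?thesis using Some False cnt by (simp add: divisor_def vanishing_order_def)
  qed
qed

lemma trunc_fun_meromorphic: "meromorphic_sphere (trunc_fun h M)"
  unfolding meromorphic_sphere_def trunc_fun_altdef
  by (intro conjI meromorphic_intros)

text \<open>Each exponent E above the bound belongs to one admissible function, and the vanishing of
  \<eta> on its contour integral is the vanishing of the coefficient at E. Here E labels the mode
  V_{-E}, which multiplies z^(E - h); the bound h (k - 1), for k points, is the condition at
  infinity rewritten for E.\<close>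

lemma V_truncation:
  assumes \<psi>: "\<psi> \<in> V h"
  shows "vanishes_above (int h * (int (length us) - 1))
     (ushs (concat (replicate h us)) (\<lambda>E. \<eta> (vop \<psi> (- E) \<xi>)))"
  unfolding vanishes_above_def
proof (intro allI impI)
  fix E assume E: "E > int h * (int (length us) - 1)"
  \<comment> \<open>With this M the residue in front of V_n is the coefficient of index E + n of the
    root polynomial, so n = i - E runs through exactly the modes entering \<open>ushs\<close> at
    E.\<close>
  define M where "M = E - int h + 1"
  define vs where "vs = concat (replicate h us)"
  define q where "q = root_poly vs"
  have M: "M - int h * int (length us) \<ge> 2 - 2 * int h"
    using E by (simp add: M_def algebra_simps)
  have "\<eta> (contour_mode smul vop (trunc_fun h M) h \<psi> \<xi>) = 0"
  proof -
    have "contour_mode smul vop (trunc_fun h M) h \<psi> \<xi> \<in> O_space smul V vop (map Some us)"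
      unfolding O_space_def using \<psi> trunc_fun_meromorphic trunc_fun_divisor[OF M]
      by (intro span_base) blast
    thus ?thesis using eta_O by auto
  qed
  define coef where "coef = (\<lambda>n. residue (\<lambda>z. trunc_fun h M z * z powi (- n - int h)) 0)"
  have coef: "coef n = (if E \<ge> - n then coeff q (nat (E + n)) else 0)" for n
  proof -
    have "coef n = residue (\<lambda>z. z powi (- M - n - int h) * poly q z) 0"
      unfolding coef_def
    proof (rule residue_cong)
      show "eventually (\<lambda>z. trunc_fun h M z * z powi (- n - int h) = z powi (- M - n - int h) * poly q z) (at 0)"
        using eventually_punctured_disc[OF zero_less_one]
      proof eventually_elim
        case (elim z)
        have "z powi (- M - n - int h) = z powi (- M) * z powi (- n - int h)"
          using elim by (subst power_int_add[symmetric]) (auto simp: algebra_simps)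
        thus ?case by (simp add: trunc_fun_def q_def vs_def)
      qed
    qed simp
    thus ?thesis unfolding residue_powi_poly by (auto simp: M_def algebra_simps)
  qed
  have "0 = \<eta> (\<Sum>n | coef n \<noteq> 0 \<and> vop \<psi> n \<xi> \<noteq> 0. smul (coef n) (vop \<psi> n \<xi>))"
    using \<open>\<eta> (contour_mode smul vop (trunc_fun h M) h \<psi> \<xi>) = 0\<close>
    by (simp add: contour_mode_def Let_def coef_def)
  also have "\<dots> = (\<Sum>n | coef n \<noteq> 0 \<and> vop \<psi> n \<xi> \<noteq> 0. coef n * \<eta> (vop \<psi> n \<xi>))"
    by (simp add: eta.sum eta.scale)
  also have "\<dots> = (\<Sum>n\<in>(\<lambda>i. int i - E) ` {..length vs}. coef n * \<eta> (vop \<psi> n \<xi>))"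
  proof (rule sum.mono_neutral_left)
    show "{n. coef n \<noteq> 0 \<and> vop \<psi> n \<xi> \<noteq> 0} \<subseteq> (\<lambda>i. int i - E) ` {..length vs}"
    proof
      fix n assume "n \<in> {n. coef n \<noteq> 0 \<and> vop \<psi> n \<xi> \<noteq> 0}"
      hence "E \<ge> - n" "coeff q (nat (E + n)) \<noteq> 0" by (auto simp: coef split: if_splits)
      hence "nat (E + n) \<le> length vs"
        using degree_root_poly[of vs] le_degree unfolding q_def by (meson order_trans)
      thus "n \<in> (\<lambda>i. int i - E) ` {..length vs}"
        using \<open>E \<ge> - n\<close> by (intro image_eqI[of _ _ "nat (E + n)"]) auto
    qed
  qed (auto simp: eta.zero)
  also have "\<dots> = (\<Sum>i\<le>length vs. coef (int i - E) * \<eta> (vop \<psi> (int i - E) \<xi>))"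
    by (subst sum.reindex) (auto simp: inj_on_def)
  also have "\<dots> = ushs vs (\<lambda>E. \<eta> (vop \<psi> (- E) \<xi>)) E"
    unfolding ushs_eq_sum by (rule sum.cong) (auto simp: coef q_def)
  finally show "ushs (concat (replicate h us)) (\<lambda>E. \<eta> (vop \<psi> (- E) \<xi>)) E = 0"
    by (simp add: vs_def)
qed

text \<open>K does not depend on \<xi>, so the bound persists when \<xi> is produced by further
  operators. The roots are confined to \<open>us\<close> so that the resulting denominators vanish
  only at the permitted poles.\<close>

definition truncates :: "complex list \<Rightarrow> int \<Rightarrow> 'h \<Rightarrow> bool" where
  "truncates vs K \<psi> \<longleftrightarrow> set vs \<subseteq> set us \<and>
     (\<forall>\<xi>. vanishes_above K (ushs vs (\<lambda>E. \<eta> (vop \<psi> (- E) \<xi>))))"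

lemma truncates_V: "\<psi> \<in> V h \<Longrightarrow> truncates (concat (replicate h us)) (int h * (int (length us) - 1)) \<psi>"
  using V_truncation by (auto simp: truncates_def)

lemma descendant_weight: "\<psi> \<in> V h \<Longrightarrow> (Lm ^^ n) \<psi> \<in> wt (h + n)"
proof (induction n)
  case (Suc n)
  from Lm_weight[OF Suc.IH[OF Suc.prems]] show ?case by simp
qed (use V_quasiprimary in auto)

text \<open>For descendants, \<open>vop_Lm\<close> multiplies the coefficient at E by E minus the
  weight, and \<open>vanishes_above_theta\<close> applies. For a linear combination the lists are
  concatenated; each summand absorbs the factors of the other at the cost of their number in the
  bound.\<close>

lemma truncates_exists: "\<exists>vs K. truncates vs K \<psi>"
proof -
  have desc: "\<exists>vs K. truncates vs K ((Lm ^^ n) \<psi>)" if \<psi>: "\<psi> \<in> V h" for n \<psi> h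
  proof (induction n)
    case 0
    thus ?case using truncates_V[OF \<psi>] by auto
  next
    case (Suc n)
    then obtain vs K where vs: "truncates vs K ((Lm ^^ n) \<psi>)" by blast
    have "truncates (vs @ vs) (K + 2 * int (length vs)) ((Lm ^^ Suc n) \<psi>)"
      unfolding truncates_def
    proof (intro conjI allI)
      fix \<xi>
      have "\<eta> (vop ((Lm ^^ Suc n) \<psi>) (- E) \<xi>) =
          (of_int E - of_nat (h + n)) * \<eta> (vop ((Lm ^^ n) \<psi>) (- E) \<xi>)" for E
        unfolding funpow.simps o_apply vop_Lm[OF descendant_weight[OF \<psi>, of n], of "- E" \<xi>] eta.scale
        by (simp add: algebra_simps)
      thus "vanishes_above (K + 2 * int (length vs))
          (ushs (vs @ vs) (\<lambda>E. \<eta> (vop ((Lm ^^ Suc n) \<psi>) (- E) \<xi>)))"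
        using vanishes_above_theta[of K vs "\<lambda>E. \<eta> (vop ((Lm ^^ n) \<psi>) (- E) \<xi>)"] vs
        by (simp only: truncates_def)
    qed (use vs in \<open>auto simp: truncates_def\<close>)
    thus ?case by blast
  qed
  have "subspace {\<psi>. \<exists>vs K. truncates vs K \<psi>}"
  proof -
    have comb: "\<exists>vs K. truncates vs K (smul a x + smul b y)"
      if xy: "\<exists>vs K. truncates vs K x" "\<exists>vs K. truncates vs K y" for a b x y
    proof -
      obtain vs K ws L where vw: "truncates vs K x" "truncates ws L y" using xy by blast
      have "truncates (vs @ ws) (max (K + int (length ws)) (L + int (length vs))) (smul a x + smul b y)"
        unfolding truncates_def
      proof (intro conjI allI)
        fix \<xi>
        define f where "f = (\<lambda>E. \<eta> (vop x (- E) \<xi>))"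
        define g where "g = (\<lambda>E. \<eta> (vop y (- E) \<xi>))"
        have "\<eta> (vop (smul a x + smul b y) (- E) \<xi>) = a * f E + b * g E" for E
        proof -
          interpret l: Vector_Spaces.linear smul smul "\<lambda>\<psi>. vop \<psi> (- E) \<xi>" by (rule vop_linear_state)
          show ?thesis by (simp add: l.add l.scale eta.add eta.scale f_def g_def)
        qed
        hence eq: "ushs (vs @ ws) (\<lambda>E. \<eta> (vop (smul a x + smul b y) (- E) \<xi>)) =
            (\<lambda>E. a * ushs ws (ushs vs f) E + b * ushs vs (ushs ws g) E)"
          by (simp add: ushs_lincomb ushs_ushs[of vs ws f])
        have "vanishes_above (K + int (length ws)) (ushs ws (ushs vs f))"
          "vanishes_above (L + int (length vs)) (ushs vs (ushs ws g))"
          using vw by (auto simp: truncates_def f_def g_def intro!: vanishes_above_ushs)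
        thus "vanishes_above (max (K + int (length ws)) (L + int (length vs)))
          (ushs (vs @ ws) (\<lambda>E. \<eta> (vop (smul a x + smul b y) (- E) \<xi>)))"
          unfolding eq by (auto simp: vanishes_above_def)
      qed (use vw in \<open>auto simp: truncates_def\<close>)
      thus ?thesis by blast
    qed
    have ex: "\<exists>x vs K. truncates vs K x"
      using truncates_V[OF vacuum_in_V] by blast
    show ?thesis
    proof (rule subspaceI)
      show "0 \<in> {\<psi>. \<exists>vs K. truncates vs K \<psi>}"
        using ex comb[of _ _ 0 0] by (metis (no_types, lifting) add.right_neutral mem_Collect_eq scale_zero_left)
    next
      fix x y assume "x \<in> {\<psi>. \<exists>vs K. truncates vs K \<psi>}" "y \<in> {\<psi>. \<exists>vs K. truncates vs K \<psi>}"
      thus "x + y \<in> {\<psi>. \<exists>vs K. truncates vs K \<psi>}" using comb[of x y 1 1] by simp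
    next
      fix a x assume "x \<in> {\<psi>. \<exists>vs K. truncates vs K \<psi>}"
      thus "smul a x \<in> {\<psi>. \<exists>vs K. truncates vs K \<psi>}" using comb[of x x a 0] by simp
    qed
  qed
  moreover have "{(Lm ^^ n) \<psi> | n \<psi>. \<psi> \<in> (\<Union>h. V h)} \<subseteq> {\<psi>. \<exists>vs K. truncates vs K \<psi>}"
    using desc by auto
  ultimately have "span {(Lm ^^ n) \<psi> | n \<psi>. \<psi> \<in> (\<Union>h. V h)} \<subseteq> {\<psi>. \<exists>vs K. truncates vs K \<psi>}"
    by (intro span_minimal)
  thus ?thesis using descendants_span by auto
qed

end

section \<open>Rationality of the series\<close>

text \<open>Adjacent transpositions generate all rearrangements. Fixing the multiset M lets the swap
  hypothesis rely on properties shared by all rearrangements, such as distinctness.\<close>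

lemma prefix_invariant_of_adjacent_swaps:
  assumes swap: "\<And>xs a b ys. mset (xs @ a # b # ys) = M \<Longrightarrow> f (xs @ a # b # ys) = f (xs @ b # a # ys)"
    and "mset os = M" "mset os' = M"
  shows "f os = f os'"
proof -
  have move: "f (xs @ ys @ a # zs) = f (xs @ a # ys @ zs)" if "mset (xs @ ys @ a # zs) = M" for xs ys a zs
    using that
  proof (induction ys arbitrary: zs rule: rev_induct)
    case (snoc y ys)
    have "f (xs @ (ys @ [y]) @ a # zs) = f (xs @ ys @ a # y # zs)"
      using swap[of "xs @ ys" y a zs] snoc.prems by simp
    also have "\<dots> = f (xs @ a # ys @ y # zs)"
      using snoc.IH[of "y # zs"] snoc.prems by (simp add: add_mset_commute)
    finally show ?case by simp
  qed simp
  have "f (xs @ os) = f (xs @ os')" if "mset (xs @ os) = M" "mset os = mset os'" for xs os os'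
    using that
  proof (induction os arbitrary: xs os')
    case (Cons a os)
    hence "a \<in> set os'" by (metis list.set_intros(1) mset_eq_setD)
    then obtain ys zs where os': "os' = ys @ a # zs" by (meson split_list)
    have m: "mset os = mset (ys @ zs)" using Cons.prems(2) by (simp add: os')
    have "f (xs @ os') = f (xs @ a # ys @ zs)"
      unfolding os' by (rule move) (use Cons.prems(1) m in \<open>simp add: add_ac\<close>)
    also have "\<dots> = f ((xs @ [a]) @ (ys @ zs))" by simp
    also have "\<dots> = f ((xs @ [a]) @ os)"
      by (rule Cons.IH[symmetric]) (use Cons.prems(1) m in simp_all)
    finally show ?case by simp
  qed simp
  from this[of "[]" os os'] assms(2,3) show ?thesis by simp
qed

section \<open>The common denominator and its action on coefficient functions\<close>

definition pair_bin :: "nat \<Rightarrow> nat \<Rightarrow> binom" where "pair_bin a b = (1, uv a, 1, uv b)"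

definition point_bin :: "nat \<Rightarrow> complex \<Rightarrow> binom" where "point_bin a u = (1, uv a, u, 0)"

definition ordered_pairs :: "nat set \<Rightarrow> (nat \<times> nat) set" where
  "ordered_pairs A = {(a, b). a \<in> A \<and> b \<in> A \<and> a < b}"

definition pair_bins :: "(nat \<Rightarrow> nat) \<Rightarrow> nat set \<Rightarrow> binom multiset" where
  "pair_bins h A = (\<Sum>(a, b)\<in>ordered_pairs A. replicate_mset (h a + h b) (pair_bin a b))"

definition point_bins :: "(nat \<Rightarrow> complex list) \<Rightarrow> nat \<Rightarrow> binom multiset" where
  "point_bins vs a = image_mset (point_bin a) (mset (vs a))"

definition den :: "(nat \<Rightarrow> nat) \<Rightarrow> (nat \<Rightarrow> complex list) \<Rightarrow> nat set \<Rightarrow> binom multiset" where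
  "den h vs A = pair_bins h A + (\<Sum>a\<in>A. point_bins vs a)"

lemma finite_ordered_pairs: "finite A \<Longrightarrow> finite (ordered_pairs A)"
  by (rule finite_subset[of _ "A \<times> A"]) (auto simp: ordered_pairs_def)

lemma in_pair_bins:
  assumes "finite A" "b \<in># pair_bins h A"
  shows "\<exists>i j. i \<in> A \<and> j \<in> A \<and> i \<noteq> j \<and> b = pair_bin i j"
proof -
  obtain i j where "(i, j) \<in> ordered_pairs A" "b \<in># replicate_mset (h i + h j) (pair_bin i j)"
    using assms(2) unfolding pair_bins_def set_mset_sum[OF finite_ordered_pairs[OF assms(1)]] by force
  hence "i \<in> A" "j \<in> A" "i \<noteq> j" "b = pair_bin i j" by (auto simp: ordered_pairs_def split: if_splits)
  thus ?thesis by blast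
qed

lemma in_den:
  assumes "finite A" "b \<in># den h vs A"
  shows "(\<exists>i j. i \<in> A \<and> j \<in> A \<and> i \<noteq> j \<and> b = pair_bin i j) \<or> (\<exists>i u. i \<in> A \<and> u \<in> set (vs i) \<and> b = point_bin i u)"
  using assms in_pair_bins[OF assms(1), of b h]
  by (auto simp: den_def set_mset_sum point_bins_def)

lemma bin_ok_pair: "i \<in> A \<Longrightarrow> j \<in> A \<Longrightarrow> bin_ok A (pair_bin i j)"
  and bin_ok_point: "i \<in> A \<Longrightarrow> bin_ok A (point_bin i u)"
  by (auto simp: pair_bin_def point_bin_def uv_def)

lemma bin_val_pair: "finite A \<Longrightarrow> i \<in> A \<Longrightarrow> j \<in> A \<Longrightarrow> bin_val A z (pair_bin i j) = z i - z j"
  and bin_val_point: "finite A \<Longrightarrow> i \<in> A \<Longrightarrow> bin_val A z (point_bin i u) = z i - u"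
  by (simp_all add: pair_bin_def point_bin_def)

lemma den_ok: "finite A \<Longrightarrow> \<forall>b\<in>#den h vs A. bin_ok A b"
  using in_den bin_ok_pair bin_ok_point by blast

lemma den_val_nonzero:
  assumes "finite A" "inj_on z A" "\<And>a u. a \<in> A \<Longrightarrow> u \<in> set (vs a) \<Longrightarrow> z a \<noteq> u"
  shows "bins_val A z (den h vs A) \<noteq> 0"
proof -
  have "bin_val A z b \<noteq> 0" if "b \<in># den h vs A" for b
    using in_den[OF assms(1) that] assms
    by (auto simp: bin_val_pair bin_val_point inj_on_eq_iff)
  thus ?thesis by (auto simp: prod_mset_zero_iff)
qed

text \<open>Only the two exponents at a and b are moved, which reduces the action in several
  variables to the two-variable operator for which \<open>mode_locality\<close> is stated.\<close>

lemma acts_replicate_pair: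
  assumes "a \<noteq> b"
  shows "acts (replicate_mset n (pair_bin a b)) c e = (dif ^^ n) (\<lambda>p q. c (e(a := p, b := q))) (e a) (e b)"
proof (induction n arbitrary: e)
  case (Suc n)
  have up: "(e - uv a)(a := p, b := q) = e(a := p, b := q)" "(e - uv b)(a := p, b := q) = e(a := p, b := q)" for p q
    using assms by (auto simp: uv_def fun_eq_iff)
  have at: "(e - uv a) a = e a - 1" "(e - uv a) b = e b" "(e - uv b) a = e a" "(e - uv b) b = e b - 1"
    using assms by (auto simp: uv_def)
  have "acts (replicate_mset (Suc n) (pair_bin a b)) c e =
      acts (replicate_mset n (pair_bin a b)) c (e - uv a) - acts (replicate_mset n (pair_bin a b)) c (e - uv b)"
    unfolding replicate_mset_Suc acts_add_mset by (subst pair_bin_def) (simp only: bin_op_def case_prod_conv mult_1)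
  thus ?case unfolding Suc up at dif_Suc .
qed simp

definition bin_deg :: "nat \<Rightarrow> binom \<Rightarrow> int" where
  "bin_deg i = (\<lambda>(\<alpha>, x, \<beta>, y). max (x i) (y i))"

lemma acts_upper_bound:
  assumes "\<And>e. c e \<noteq> 0 \<Longrightarrow> e i \<le> K" "acts M c e \<noteq> 0"
  shows "e i \<le> K + (\<Sum>b\<in>#M. bin_deg i b)"
  using assms(2)
proof (induction M arbitrary: e)
  case (add b M)
  obtain \<alpha> x \<beta> y where b: "b = (\<alpha>, x, \<beta>, y)" by (metis prod_cases4)
  have "acts M c (e - x) \<noteq> 0 \<or> acts M c (e - y) \<noteq> 0"
    using add.prems by (auto simp: b bin_op_def)
  hence "(e - x) i \<le> K + (\<Sum>b\<in>#M. bin_deg i b) \<or> (e - y) i \<le> K + (\<Sum>b\<in>#M. bin_deg i b)"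
    using add.IH by blast
  moreover have "bin_deg i b = max (x i) (y i)" by (simp add: b bin_deg_def)
  ultimately show ?case by auto
qed (use assms(1) in simp)

lemma acts_support:
  assumes "\<And>e. c e \<noteq> 0 \<Longrightarrow> S e" "\<forall>b\<in>#M. bin_ok A b" "acts M c e \<noteq> 0"
    and "\<And>e x. S e \<Longrightarrow> supp_in A x \<Longrightarrow> (\<And>i. 0 \<le> x i) \<Longrightarrow> S (e + x)"
  shows "S e"
  using assms(2,3)
proof (induction M arbitrary: e)
  case (add b M)
  obtain \<alpha> x \<beta> y where b: "b = (\<alpha>, x, \<beta>, y)" by (metis prod_cases4)
  have "acts M c (e - x) \<noteq> 0 \<or> acts M c (e - y) \<noteq> 0"
    using add.prems by (auto simp: b bin_op_def)
  moreover have "\<forall>b\<in>#M. bin_ok A b" using add.prems(1) by auto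
  ultimately have "S (e - x) \<or> S (e - y)" using add.IH by blast
  moreover have "supp_in A x" "supp_in A y" "\<And>i. 0 \<le> x i" "\<And>i. 0 \<le> y i"
    using add.prems(1) by (auto simp: b supp_in_def)
  ultimately show ?case using assms(4)[of "e - x" x] assms(4)[of "e - y" y] by auto
qed (use assms(1) in simp)

text \<open>The support of the iterated expansion in the region \<open>|z\<^sub>o\<^sub>s\<^sub>0| > |z\<^sub>o\<^sub>s\<^sub>1| > \<dots>\<close>.\<close>

definition in_cone :: "nat list \<Rightarrow> int \<Rightarrow> idx \<Rightarrow> bool" where
  "in_cone os K e \<longleftrightarrow> supp_in (set os) e \<and> (\<forall>pre suf. os = pre @ suf \<longrightarrow> sum_list (map e suf) \<ge> - K)"

lemma in_cone_add:
  assumes "in_cone os K e" "supp_in (set os) x" "\<And>i. 0 \<le> x i"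
  shows "in_cone os K (e + x)"
proof -
  have "- K \<le> sum_list (map (e + x) suf)" if "os = pre @ suf" for pre suf
  proof -
    have "- K \<le> sum_list (map e suf)" using assms(1) that unfolding in_cone_def by blast
    also have "\<dots> \<le> sum_list (map (e + x) suf)" by (rule sum_list_mono) (use assms(3) in simp)
    finally show ?thesis .
  qed
  moreover have "supp_in (set os) (e + x)" using assms by (auto simp: in_cone_def supp_in_def)
  ultimately show ?thesis unfolding in_cone_def by blast
qed

text \<open>Along the direction x - y the sum of the exponents over \<open>suf\<close> drops by one
  per step, while the cone bounds this sum from below.\<close>

lemma cone_escape:
  assumes "distinct os" "os = pre @ suf" "b \<in> set suf" "\<And>i. i \<in> set suf \<Longrightarrow> x i = 0" "\<And>i. i \<in> set suf \<Longrightarrow> y i = of_bool (i = b)"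
    and "\<And>e. c e \<noteq> 0 \<Longrightarrow> in_cone os K e"
  shows "\<exists>T. \<forall>t\<ge>T. c (\<lambda>i. e i + int t * (x i - y i)) = 0"
proof (intro exI allI impI)
  fix t assume t: "t \<ge> nat (sum_list (map e suf) + K + 1)"
  show "c (\<lambda>i. e i + int t * (x i - y i)) = 0"
  proof (rule ccontr)
    assume "c (\<lambda>i. e i + int t * (x i - y i)) \<noteq> 0"
    hence "- K \<le> sum_list (map (\<lambda>i. e i + int t * (x i - y i)) suf)"
      using assms(2,6) unfolding in_cone_def by blast
    also have "\<dots> = sum_list (map (\<lambda>i. e i + - int t * of_bool (i = b)) suf)"
      by (intro arg_cong[where f = sum_list] map_cong) (use assms(4,5) in auto)
    also have "\<dots> = sum_list (map e suf) - int t * sum_list (map (\<lambda>i. of_bool (i = b)) suf)"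
      by (induction suf) (auto simp: algebra_simps)
    also have "sum_list (map (\<lambda>i. of_bool (i = b)) suf) = (1::int)"
    proof -
      have "distinct suf" using assms(1,2) by auto
      hence "sum_list (map (\<lambda>i. of_bool (i = b)) suf) = (\<Sum>i\<in>set suf. of_bool (i = b) :: int)"
        by (simp add: sum_list_distinct_conv_sum_set)
      also have "\<dots> = 1" using assms(3) by (simp add: of_bool_def)
      finally show ?thesis .
    qed
    finally show False using t by simp
  qed
qed

context cft_functional
begin

section \<open>Words of modes and their coefficient functions\<close>

definition word :: "(nat \<Rightarrow> 'h) \<Rightarrow> (nat \<Rightarrow> nat) \<Rightarrow> nat list \<Rightarrow> idx \<Rightarrow> 'h \<Rightarrow> 'h" where
  "word \<psi> h os e X = foldr (\<lambda>i. md (\<psi> i) (h i) (e i)) os X"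

text \<open>Exponent vectors are total functions; setting the coefficient to 0 unless the labels
  outside \<open>os\<close> have exponent 0 counts each monomial once.\<close>

definition cf :: "(nat \<Rightarrow> 'h) \<Rightarrow> (nat \<Rightarrow> nat) \<Rightarrow> nat list \<Rightarrow> idx \<Rightarrow> complex" where
  "cf \<psi> h os e = (if supp_in (set os) e then \<eta> (word \<psi> h os e \<Omega>) else 0)"

lemma word_append: "word \<psi> h (xs @ ys) e X = word \<psi> h xs e (word \<psi> h ys e X)"
  and word_Cons: "word \<psi> h (a # ys) e X = md (\<psi> a) (h a) (e a) (word \<psi> h ys e X)"
  and word_Nil [simp]: "word \<psi> h [] e X = X"
  by (simp_all add: word_def)

lemma word_zero [simp]: "word \<psi> h os e 0 = 0"
  by (induction os) (simp_all add: word_Cons)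

lemma word_diff: "word \<psi> h os e (X - Y) = word \<psi> h os e X - word \<psi> h os e Y"
  by (induction os arbitrary: X Y) (simp_all add: word_Cons md_diff)

lemma word_cong:
  "(\<And>a. a \<in> set os \<Longrightarrow> \<psi> a = \<psi>' a \<and> h a = h' a \<and> e a = e' a) \<Longrightarrow> word \<psi> h os e X = word \<psi>' h' os e' X"
  unfolding word_def by (rule foldr_cong) auto

lemma vacuum_weight: "\<Omega> \<in> wt 0"
  using vacuum_in_V V_quasiprimary by blast

lemma word_weight:
  assumes "\<forall>a\<in>set os. \<psi> a \<in> wt (h a)" "word \<psi> h os e \<Omega> \<noteq> 0"
  shows "0 \<le> sum_list (map (\<lambda>a. e a + int (h a)) os) \<and>
     word \<psi> h os e \<Omega> \<in> wt (nat (sum_list (map (\<lambda>a. e a + int (h a)) os)))"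
  using assms
proof (induction os)
  case Nil
  thus ?case using vacuum_weight by simp
next
  case (Cons a os)
  let ?S = "sum_list (map (\<lambda>a. e a + int (h a)) os)"
  have nz: "word \<psi> h os e \<Omega> \<noteq> 0" using Cons.prems(2) by (auto simp: word_Cons)
  with Cons have IH: "0 \<le> ?S" "word \<psi> h os e \<Omega> \<in> wt (nat ?S)" by auto
  have \<psi>: "\<psi> a \<in> wt (h a)" using Cons.prems(1) by simp
  have ge: "- int (h a + nat ?S) \<le> e a"
    using md_low[OF \<psi> IH(2), of "e a"] Cons.prems(2) by (force simp: word_Cons not_less[symmetric])
  from md_weight[OF \<psi> IH(2) ge] ge IH(1) show ?case by (simp add: word_Cons)
qed

lemma word_homogeneous:
  assumes "\<forall>a\<in>set os. \<psi> a \<in> wt (h a)"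
  obtains p where "word \<psi> h os e \<Omega> \<in> wt p"
  using word_weight[OF assms, of e] zero_weight by (cases "word \<psi> h os e \<Omega> = 0") auto

text \<open>If the whole word is nonzero, each suffix applied to \<Omega> is a nonzero state, and
  its weight, the sum of e a + h a over the suffix, cannot be negative.\<close>

lemma cf_in_cone:
  assumes "\<forall>a\<in>set os. \<psi> a \<in> wt (h a)" "cf \<psi> h os e \<noteq> 0"
  shows "in_cone os (sum_list (map (\<lambda>a. int (h a)) os)) e"
  unfolding in_cone_def
proof (intro conjI allI impI)
  show "supp_in (set os) e" using assms(2) by (auto simp: cf_def split: if_splits)
  fix pre suf assume os: "os = pre @ suf"
  have "word \<psi> h os e \<Omega> \<noteq> 0" using assms(2) by (auto simp: cf_def eta.zero split: if_splits)
  hence "word \<psi> h suf e \<Omega> \<noteq> 0" by (auto simp: os word_append)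
  with word_weight[of suf \<psi> h e] assms(1) os have "0 \<le> sum_list (map (\<lambda>a. e a + int (h a)) suf)" by auto
  also have "\<dots> = sum_list (map e suf) + sum_list (map (\<lambda>a. int (h a)) suf)"
    by (simp add: sum_list_addf)
  also have "sum_list (map (\<lambda>a. int (h a)) suf) \<le> sum_list (map (\<lambda>a. int (h a)) os)"
    by (auto simp: os intro!: sum_list_nonneg)
  finally show "- sum_list (map (\<lambda>a. int (h a)) os) \<le> sum_list (map e suf)" by simp
qed

text \<open>The suffix applied to \<Omega> is a homogeneous state, the prefix followed by \<eta> is
  a linear functional L, and locality of the two adjacent modes holds between them.\<close>

lemma cf_swap:
  assumes wts: "\<forall>i\<in>set (xs @ a # b # ys). \<psi> i \<in> wt (h i)" and dist: "distinct (xs @ a # b # ys)"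
  shows "acts (replicate_mset (h a + h b) (pair_bin a b)) (cf \<psi> h (xs @ a # b # ys)) =
         acts (replicate_mset (h a + h b) (pair_bin a b)) (cf \<psi> h (xs @ b # a # ys))"
proof
  fix e
  have ab: "a \<noteq> b" using dist by simp
  obtain p where X: "word \<psi> h ys e \<Omega> \<in> wt p"
    by (rule word_homogeneous[of ys \<psi> h e]) (use wts in auto)
  define L where "L = (\<lambda>Y. if supp_in (set (xs @ a # b # ys)) e then \<eta> (word \<psi> h xs e Y) else 0)"
  have Ldiff: "L (Y - Z) = L Y - L Z" for Y Z
    by (simp add: L_def word_diff eta.diff)
  define X where "X = word \<psi> h ys e \<Omega>"
  have supp: "supp_in (set (xs @ a # b # ys)) (e(a := q, b := r)) = supp_in (set (xs @ a # b # ys)) e" for q r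
    by (auto simp: supp_in_def)
  have wd: "word \<psi> h xs (e(a := q, b := r)) Y = word \<psi> h xs e Y" "word \<psi> h ys (e(a := q, b := r)) Y = word \<psi> h ys e Y" for q r Y
    by (rule word_cong; use dist in auto)+
  have 1: "cf \<psi> h (xs @ a # b # ys) (e(a := q, b := r)) = L (md (\<psi> a) (h a) q (md (\<psi> b) (h b) r X))" for q r
    unfolding cf_def supp L_def word_append word_Cons wd X_def using ab by simp
  have set: "set (xs @ b # a # ys) = set (xs @ a # b # ys)" by auto
  have 2: "cf \<psi> h (xs @ b # a # ys) (e(a := q, b := r)) = L (md (\<psi> b) (h b) r (md (\<psi> a) (h a) q X))" for q r
    unfolding cf_def set supp L_def word_append word_Cons wd X_def using ab by simp
  have "acts (replicate_mset (h a + h b) (pair_bin a b)) (cf \<psi> h (xs @ a # b # ys)) e =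
      L ((dif ^^ (h a + h b)) (\<lambda>q r. md (\<psi> a) (h a) q (md (\<psi> b) (h b) r X)) (e a) (e b))"
    unfolding acts_replicate_pair[OF ab] 1 by (rule dif_additive[OF Ldiff, symmetric])
  also have "\<dots> = L ((dif ^^ (h a + h b)) (\<lambda>q r. md (\<psi> b) (h b) r (md (\<psi> a) (h a) q X)) (e a) (e b))"
    by (subst mode_locality[of _ _ _ _ _ p]) (use wts X in \<open>auto simp: X_def\<close>)
  also have "\<dots> = acts (replicate_mset (h a + h b) (pair_bin a b)) (cf \<psi> h (xs @ b # a # ys)) e"
    unfolding acts_replicate_pair[OF ab] 2 by (rule dif_additive[OF Ldiff])
  finally show "acts (replicate_mset (h a + h b) (pair_bin a b)) (cf \<psi> h (xs @ a # b # ys)) e =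
      acts (replicate_mset (h a + h b) (pair_bin a b)) (cf \<psi> h (xs @ b # a # ys)) e" .
qed

lemma pair_bins_split:
  assumes "finite A" "(a, b) \<in> ordered_pairs A"
  obtains N where "pair_bins h A = N + replicate_mset (h a + h b) (pair_bin a b)"
proof
  show "pair_bins h A = (\<Sum>(a, b)\<in>ordered_pairs A - {(a, b)}. replicate_mset (h a + h b) (pair_bin a b))
      + replicate_mset (h a + h b) (pair_bin a b)"
    unfolding pair_bins_def
    by (subst sum.remove[OF finite_ordered_pairs[OF assms(1)] assms(2)]) (simp add: add.commute)
qed

lemma pair_bins_cf_swap:
  assumes wts: "\<forall>a\<in>A. \<psi> a \<in> wt (h a)" and A: "distinct (xs @ a # b # ys)" "set (xs @ a # b # ys) = A"
  shows "acts (pair_bins h A) (cf \<psi> h (xs @ a # b # ys)) = acts (pair_bins h A) (cf \<psi> h (xs @ b # a # ys))"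
proof -
  have fin: "finite A" using A(2) by auto
  have "a \<noteq> b" using A(1) by simp
  hence "a < b \<or> b < a" by auto
  thus ?thesis
  proof
    assume "a < b"
    hence "(a, b) \<in> ordered_pairs A" using A(2) by (auto simp: ordered_pairs_def)
    then obtain N where N: "pair_bins h A = N + replicate_mset (h a + h b) (pair_bin a b)"
      using pair_bins_split[OF fin] by blast
    show ?thesis unfolding N acts_union
      by (subst cf_swap) (use wts A in auto)
  next
    assume "b < a"
    hence "(b, a) \<in> ordered_pairs A" using A(2) by (auto simp: ordered_pairs_def)
    then obtain N where N: "pair_bins h A = N + replicate_mset (h b + h a) (pair_bin b a)"
      using pair_bins_split[OF fin] by blast
    show ?thesis unfolding N acts_union
      by (subst cf_swap[of xs b a ys]) (use wts A in auto)
  qed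
qed

lemma pair_bins_cf_perm:
  assumes wts: "\<forall>a\<in>A. \<psi> a \<in> wt (h a)" and A: "distinct os" "set os = A" "mset os' = mset os"
  shows "acts (pair_bins h A) (cf \<psi> h os) = acts (pair_bins h A) (cf \<psi> h os')"
proof (rule prefix_invariant_of_adjacent_swaps[where M = "mset os"])
  fix xs a b ys assume *: "mset (xs @ a # b # ys) = mset os"
  have "distinct (xs @ a # b # ys)" "set (xs @ a # b # ys) = A"
    using mset_eq_imp_distinct_iff[OF *] mset_eq_setD[OF *] A by auto
  from pair_bins_cf_swap[OF wts this]
  show "acts (pair_bins h A) (cf \<psi> h (xs @ a # b # ys)) = acts (pair_bins h A) (cf \<psi> h (xs @ b # a # ys))" .
qed (use A in auto)

lemma den_cf_perm:
  assumes "\<forall>a\<in>A. \<psi> a \<in> wt (h a)" "distinct os" "set os = A" "mset os' = mset os"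
  shows "acts (den h vs A) (cf \<psi> h os) = acts (den h vs A) (cf \<psi> h os')"
  unfolding den_def union_commute[of "pair_bins h A"] acts_union
  by (simp only: pair_bins_cf_perm[OF assms])

lemma point_bins_cf:
  assumes "i \<notin> set os"
  shows "acts (image_mset (point_bin i) (mset vs)) (cf \<psi> h (i # os)) e =
    (if supp_in (set (i # os)) e then ushs vs (\<lambda>E. \<eta> (vop (\<psi> i) (- E) (word \<psi> h os e \<Omega>))) (e i + int (h i)) else 0)"
proof (induction vs arbitrary: e)
  case Nil
  have "- (e i + int (h i)) = - e i - int (h i)" by simp
  thus ?case by (simp add: cf_def word_Cons md_def)
next
  case (Cons v vs)
  have wd: "word \<psi> h os (e - uv i) \<Omega> = word \<psi> h os e \<Omega>"
    by (rule word_cong) (use assms in \<open>auto simp: uv_def\<close>)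
  have sp: "supp_in (set (i # os)) (e - uv i) = supp_in (set (i # os)) e"
    by (auto simp: supp_in_def uv_def)
  have ar: "(e - uv i) i + int (h i) = e i + int (h i) - 1" by (simp add: uv_def)
  have "acts (image_mset (point_bin i) (mset (v # vs))) (cf \<psi> h (i # os)) e =
      acts (image_mset (point_bin i) (mset vs)) (cf \<psi> h (i # os)) (e - uv i) -
      v * acts (image_mset (point_bin i) (mset vs)) (cf \<psi> h (i # os)) e"
    unfolding mset.simps image_mset_add_mset acts_add_mset
    by (subst point_bin_def) (simp only: bin_op_def case_prod_conv mult_1 diff_zero)
  thus ?case unfolding Cons wd sp ar by (simp add: ush_def[of v])
qed

text \<open>With i moved to the far left its operator meets \<eta> directly, and the factors in
  \<open>vs i\<close> cut off its exponent; every remaining factor raises the exponent by at most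
  its degree in that variable. The behaviour at infinity rests on this estimate.\<close>

lemma den_bound:
  assumes wts: "\<forall>a\<in>set os. \<psi> a \<in> wt (h a)" and os: "distinct os" and i: "i \<in> set os"
    and tr: "truncates (vs i) K (\<psi> i)" and nz: "acts (den h vs (set os)) (cf \<psi> h os) e \<noteq> 0"
  shows "e i \<le> K - int (h i) + (\<Sum>b\<in>#den h vs (set os) - point_bins vs i. bin_deg i b)"
proof -
  define A where "A = set os"
  define os' where "os' = i # remove1 i os"
  have os': "mset os' = mset os" using i by (simp add: os'_def)
  have nin: "i \<notin> set (remove1 i os)" using os by simp
  have "point_bins vs i \<subseteq># (\<Sum>a\<in>A. point_bins vs a)"
    using i by (subst sum.remove[of _ i]) (auto simp: A_def)
  hence sub: "point_bins vs i \<subseteq># den h vs A" unfolding den_def by (meson mset_subset_eq_add_right subset_mset.order_trans)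
  have nz': "acts (den h vs A - point_bins vs i) (acts (point_bins vs i) (cf \<psi> h os')) e \<noteq> 0"
    using nz den_cf_perm[OF wts os refl os', of vs] sub
    unfolding acts_union[symmetric] by (simp add: A_def)
  show ?thesis unfolding A_def[symmetric]
  proof (rule acts_upper_bound[OF _ nz'])
    fix e assume "acts (point_bins vs i) (cf \<psi> h os') e \<noteq> 0"
    hence "ushs (vs i) (\<lambda>E. \<eta> (vop (\<psi> i) (- E) (word \<psi> h (remove1 i os) e \<Omega>))) (e i + int (h i)) \<noteq> 0"
      unfolding point_bins_def os'_def point_bins_cf[OF nin] by (auto split: if_splits)
    hence "\<not> e i + int (h i) > K"
      using tr unfolding truncates_def vanishes_above_def by blast
    thus "e i \<le> K - int (h i)" by simp
  qed
qed

lemma den_lpoly: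
  assumes wts: "\<forall>a\<in>set os. \<psi> a \<in> wt (h a)" and os: "distinct os"
    and tr: "\<And>a. a \<in> set os \<Longrightarrow> truncates (vs a) (K a) (\<psi> a)"
  shows "denominator (set os) (cf \<psi> h os) (den h vs (set os))"
proof -
  define A where "A = set os"
  define P where "P = acts (den h vs A) (cf \<psi> h os)"
  have fin: "finite A" by (simp add: A_def)
  have supp: "supp_in A e" if "P e \<noteq> 0" for e
  proof (rule acts_support[where S = "supp_in A" and M = "den h vs A" and A = A])
    show "\<forall>b\<in>#den h vs A. bin_ok A b" by (rule den_ok[OF fin])
    show "acts (den h vs A) (cf \<psi> h os) e \<noteq> 0" using that by (simp add: P_def)
  qed (auto simp: cf_def A_def supp_in_def split: if_splits)
  have nonneg: "0 \<le> e i" if Pe: "P e \<noteq> 0" for e i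
  proof (cases "i \<in> A")
    case True
    \<comment> \<open>With i at the far right its operator acts on \<Omega> and produces no negative
      powers, and the factors have nonnegative exponents. Together with \<open>den_bound\<close>
      this confines the exponents of the product to a finite box.\<close>
    define os' where "os' = remove1 i os @ [i]"
    have os': "mset os' = mset os" using True by (simp add: os'_def A_def)
    have nz: "acts (den h vs A) (cf \<psi> h os') e \<noteq> 0"
      using Pe den_cf_perm[OF wts os refl os', of vs] by (simp add: A_def P_def)
    show ?thesis
    proof (rule acts_support[where S = "\<lambda>e. 0 \<le> e i", OF _ den_ok[OF fin] nz])
      fix e assume "cf \<psi> h os' e \<noteq> 0"
      hence "word \<psi> h os' e \<Omega> \<noteq> 0" by (auto simp: cf_def eta.zero split: if_splits)
      hence "md (\<psi> i) (h i) (e i) \<Omega> \<noteq> 0" by (auto simp: os'_def word_append word_Cons)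
      thus "0 \<le> e i" using md_vacuum[of "\<psi> i" "h i" "e i"] wts True by (force simp: A_def)
    qed auto
  next
    case False
    thus ?thesis using supp[OF Pe] by (simp add: supp_in_def)
  qed
  define B where "B = (\<lambda>i. K i - int (h i) + (\<Sum>b\<in>#den h vs A - point_bins vs i. bin_deg i b))"
  define Bm where "Bm = Max (insert 0 (B ` A))"
  have bound: "e i \<le> Bm" if "P e \<noteq> 0" "i \<in> A" for e i
  proof -
    have "e i \<le> B i" unfolding B_def A_def
      by (rule den_bound[OF wts os _ tr]) (use that in \<open>auto simp: A_def P_def\<close>)
    also have "\<dots> \<le> Bm" unfolding Bm_def using that fin by (intro Max_ge) auto
    finally show ?thesis .
  qed
  have "finite {e. P e \<noteq> 0}"
    by (rule finite_subset[OF _ finite_box[OF fin, of Bm]]) (use supp nonneg bound in auto)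
  thus ?thesis
    using supp nonneg den_ok[OF fin] unfolding denominator_def lpoly_def by (simp add: A_def P_def)
qed

end

section \<open>Convergence of the series\<close>

definition decreasing :: "(nat \<Rightarrow> complex) \<Rightarrow> nat list \<Rightarrow> bool" where
  "decreasing z os \<longleftrightarrow> sorted_wrt (\<lambda>a b. norm (z b) < norm (z a)) os"

lemma sorted_wrt_order:
  assumes "sorted_wrt R os" "i \<in> set os" "j \<in> set os" "i \<noteq> j"
  obtains pre suf where "os = pre @ i # suf" "j \<in> set suf" "R i j"
  | pre suf where "os = pre @ j # suf" "i \<in> set suf" "R j i"
proof -
  obtain pre suf where os: "os = pre @ i # suf" using assms(2) by (meson split_list)
  hence "j \<in> set pre \<or> j \<in> set suf" using assms(3,4) by auto
  thus ?thesis
  proof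
    assume "j \<in> set suf"
    moreover have "R i j" using assms(1) calculation by (auto simp: os sorted_wrt_append)
    ultimately show ?thesis using that(1) os by blast
  next
    assume "j \<in> set pre"
    then obtain p1 p2 where p: "pre = p1 @ j # p2" by (meson split_list)
    hence "os = p1 @ j # (p2 @ i # suf)" by (simp add: os)
    moreover have "R j i" using assms(1) by (auto simp: os p sorted_wrt_append)
    ultimately show ?thesis using that(2)[of p1 "p2 @ i # suf"] by auto
  qed
qed

context cft_functional
begin

text \<open>In each factor the dominating term is the one whose geometric expansion leaves the cone.
  For a pair it is the label further left, and the escaping suffix contains only the other label;
  for a point it is the constant u, and the suffix starts at the label itself.\<close>

lemma cone_division:
  assumes os: "distinct os" and z0: "\<And>a. a \<in> set os \<Longrightarrow> z a \<noteq> 0"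
    and cone: "\<And>e. g e \<noteq> 0 \<Longrightarrow> in_cone os K e"
    and M: "\<And>b. b \<in># M \<Longrightarrow> (\<exists>i j pre suf. (b = pair_bin i j \<or> b = pair_bin j i) \<and> os = pre @ i # suf \<and> j \<in> set suf \<and>
         norm (z j) < norm (z i)) \<or> (\<exists>i u. i \<in> set os \<and> norm (z i) < norm u \<and> b = point_bin i u)"
    and hs: "((\<lambda>e. acts M g e * mon (set os) z e) has_sum D) UNIV"
  shows "((\<lambda>e. g e * mon (set os) z e) has_sum D / bins_val (set os) z M) UNIV"
proof -
  let ?A = "set os"
  let ?\<mu> = "mon ?A z"
  define C where "C = (\<lambda>g::idx \<Rightarrow> complex. \<forall>e. g e \<noteq> 0 \<longrightarrow> in_cone os K e)"
  have ok: "bin_ok ?A b" if "b \<in># M" for b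
    using M[OF that] by (auto simp: bin_ok_pair bin_ok_point)
  have closed: "C (bin_op b g)" if "C g" "b \<in># M" for g b
    unfolding C_def
  proof (intro allI impI)
    fix e assume nz: "bin_op b g e \<noteq> 0"
    show "in_cone os K e"
    proof (rule acts_support[where M = "{#b#}" and c = g and A = ?A])
      show "acts {#b#} g e \<noteq> 0" using nz by simp
      show "\<forall>b\<in>#{#b#}. bin_ok ?A b" using that(2) ok by simp
      show "in_cone os K e" if "g e \<noteq> 0" for e using \<open>C g\<close> that by (simp add: C_def)
    qed (rule in_cone_add)
  qed
  have pair: "?\<mu> (uv i) = z i" if "i \<in> ?A" for i using that by simp
  have dom: "norm (\<beta> * ?\<mu> y) < norm (\<alpha> * ?\<mu> x) \<and> (\<forall>e. \<exists>T. \<forall>t\<ge>T. g (\<lambda>i. e i + int t * (x i - y i)) = 0) \<or>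
       norm (\<alpha> * ?\<mu> x) < norm (\<beta> * ?\<mu> y) \<and> (\<forall>e. \<exists>T. \<forall>t\<ge>T. g (\<lambda>i. e i + int t * (y i - x i)) = 0)"
    if Cc: "C g" and b: "(\<alpha>, x, \<beta>, y) \<in># M" for g \<alpha> x \<beta> y
    using M[OF b]
  proof (elim disjE exE conjE)
    fix i j pre suf
    assume *: "os = pre @ i # suf" "j \<in> set suf" "norm (z j) < norm (z i)"
    have esc: "\<exists>T. \<forall>t\<ge>T. g (\<lambda>k. e k + int t * (uv i k - uv j k)) = 0" for e
      by (rule cone_escape[OF os, of "pre @ [i]" suf j _ _ _ K])
         (use * os Cc in \<open>auto simp: uv_def C_def\<close>)
    have ij: "?\<mu> (uv i) = z i" "?\<mu> (uv j) = z j" using * by (auto intro!: pair)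
    { assume "(\<alpha>, x, \<beta>, y) = pair_bin i j"
      thus ?thesis using esc ij * by (simp add: pair_bin_def) }
    { assume "(\<alpha>, x, \<beta>, y) = pair_bin j i"
      thus ?thesis using esc ij * by (simp add: pair_bin_def) }
  next
    fix i u assume *: "i \<in> ?A" "norm (z i) < norm u" "(\<alpha>, x, \<beta>, y) = point_bin i u"
    obtain pre suf where split: "os = pre @ i # suf" using *(1) by (meson split_list)
    have "\<exists>T. \<forall>t\<ge>T. g (\<lambda>k. e k + int t * ((0::idx) k - uv i k)) = 0" for e
      by (rule cone_escape[OF os split, of i _ _ _ K])
         (use os Cc in \<open>auto simp: uv_def C_def split\<close>)
    moreover have "?\<mu> (uv i) = z i" using * by (auto intro!: pair)
    ultimately show ?thesis using * by (simp add: point_bin_def)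
  qed
  have "((\<lambda>e. g e * ?\<mu> e) has_sum D / (\<Prod>(\<alpha>, x, \<beta>, y)\<in>#M. \<alpha> * ?\<mu> x - \<beta> * ?\<mu> y)) UNIV"
  proof (rule division_acts[where C = C, OF _ _ closed dom _ hs])
    show "mon ?A z (x + y) = mon ?A z x * mon ?A z y" for x y by (rule mon_add) (use z0 in auto)
    show "mon ?A z x \<noteq> 0" for x by (rule mon_nonzero) (use z0 in auto)
    show "C g" using cone by (simp add: C_def)
  qed
  also have "(\<Prod>(\<alpha>, x, \<beta>, y)\<in>#M. \<alpha> * ?\<mu> x - \<beta> * ?\<mu> y) = bins_val ?A z M"
    by (intro arg_cong[where f = prod_mset] image_mset_cong) auto
  finally show ?thesis .
qed

section \<open>Regular points and the values of the continuation\<close>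

definition trunc_data :: "(nat \<Rightarrow> 'h) \<Rightarrow> (nat \<Rightarrow> complex list) \<Rightarrow> (nat \<Rightarrow> int) \<Rightarrow> nat set \<Rightarrow> bool" where
  "trunc_data \<psi> vs K A \<longleftrightarrow> (\<forall>a\<in>A. truncates (vs a) (K a) (\<psi> a))"

lemma trunc_data_exists: "\<exists>vs K. trunc_data \<psi> vs K A"
proof -
  have "\<forall>a. \<exists>p. truncates (fst p) (snd p) (\<psi> a)"
    using truncates_exists by (metis fst_conv snd_conv)
  then obtain f where "\<And>a. truncates (fst (f a)) (snd (f a)) (\<psi> a)" by metis
  hence "trunc_data \<psi> (\<lambda>a. fst (f a)) (\<lambda>a. snd (f a)) A" by (simp add: trunc_data_def)
  thus ?thesis by blast
qed

definition regular_pt :: "nat set \<Rightarrow> (nat \<Rightarrow> complex) \<Rightarrow> bool" where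
  "regular_pt A z \<longleftrightarrow> inj_on z A \<and> (\<forall>a\<in>A. z a \<notin> set us)"

lemma den_val_regular:
  assumes "finite A" "trunc_data \<psi> vs K A" "regular_pt A z"
  shows "bins_val A z (den h vs A) \<noteq> 0"
  by (rule den_val_nonzero) (use assms in \<open>auto simp: trunc_data_def truncates_def regular_pt_def\<close>)

lemma rval_cf:
  assumes "\<forall>a\<in>set os. \<psi> a \<in> wt (h a)" "distinct os" "trunc_data \<psi> vs K (set os)" "regular_pt (set os) z"
  shows "rval (set os) (cf \<psi> h os) z =
    pval (set os) (acts (den h vs (set os)) (cf \<psi> h os)) z / bins_val (set os) z (den h vs (set os))"
  by (rule rval_eq[OF den_lpoly den_val_regular]) (use assms in \<open>auto simp: trunc_data_def\<close>)

lemma rval_cf_perm: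
  assumes "\<forall>a\<in>set os. \<psi> a \<in> wt (h a)" "distinct os" "regular_pt (set os) z" "mset os' = mset os"
  shows "rval (set os) (cf \<psi> h os) z = rval (set os) (cf \<psi> h os') z"
proof -
  obtain vs K where vs: "trunc_data \<psi> vs K (set os)" using trunc_data_exists by blast
  have s: "set os' = set os" "distinct os'"
    using assms(2,4) mset_eq_setD mset_eq_imp_distinct_iff by blast+
  have "rval (set os') (cf \<psi> h os') z =
      pval (set os') (acts (den h vs (set os')) (cf \<psi> h os')) z / bins_val (set os') z (den h vs (set os'))"
    by (rule rval_cf) (use assms vs s in auto)
  thus ?thesis
    using rval_cf[OF assms(1,2) vs assms(3)] den_cf_perm[OF assms(1,2) refl assms(4), of vs] s by simp
qed

text \<open>All points lie inside the smallest |u|, so every factor z - u is expanded in powers of z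
  / u, and the decreasing moduli decide each pair. These are exactly the expansions allowed by the
  cone of the ordering.\<close>

lemma cf_has_sum:
  assumes wts: "\<forall>a\<in>set os. \<psi> a \<in> wt (h a)" and os: "distinct os"
    and dec: "decreasing z os" and z: "\<And>a. a \<in> set os \<Longrightarrow> z a \<noteq> 0"
    and zu: "\<And>a u. a \<in> set os \<Longrightarrow> u \<in> set us \<Longrightarrow> norm (z a) < norm u"
  shows "((\<lambda>e. cf \<psi> h os e * mon (set os) z e) has_sum rval (set os) (cf \<psi> h os) z) UNIV"
proof -
  obtain vs K where vs: "trunc_data \<psi> vs K (set os)" using trunc_data_exists by blast
  have reg: "regular_pt (set os) z"
    unfolding regular_pt_def
  proof (intro conjI ballI)
    show "inj_on z (set os)"
    proof (rule inj_onI, rule ccontr)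
      fix i j assume ij: "i \<in> set os" "j \<in> set os" "z i = z j" "i \<noteq> j"
      show False
        by (rule sorted_wrt_order[OF dec[unfolded decreasing_def] ij(1,2,4)]) (use ij in auto)
    qed
  qed (use zu in force)
  show ?thesis unfolding rval_cf[OF wts os vs reg]
  proof (rule cone_division[OF os z cf_in_cone[OF wts]])
    fix b assume "b \<in># den h vs (set os)"
    from in_den[OF finite_set this]
    show "(\<exists>i j pre suf. (b = pair_bin i j \<or> b = pair_bin j i) \<and> os = pre @ i # suf \<and> j \<in> set suf \<and>
         norm (z j) < norm (z i)) \<or> (\<exists>i u. i \<in> set os \<and> norm (z i) < norm u \<and> b = point_bin i u)"
    proof (elim disjE exE conjE)
      fix i j assume ij: "i \<in> set os" "j \<in> set os" "i \<noteq> j" "b = pair_bin i j"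
      show ?thesis
        by (rule sorted_wrt_order[OF dec[unfolded decreasing_def] ij(1-3)]) (use ij in blast)+
    next
      fix i u assume "i \<in> set os" "u \<in> set (vs i)" "b = point_bin i u"
      thus ?thesis using vs zu unfolding trunc_data_def truncates_def by blast
    qed
  next
    show "((\<lambda>e. acts (den h vs (set os)) (cf \<psi> h os) e * mon (set os) z e) has_sum
       pval (set os) (acts (den h vs (set os)) (cf \<psi> h os)) z) UNIV"
      by (rule pval_has_sum) (use den_lpoly[OF wts os, of vs K] vs in \<open>auto simp: trunc_data_def denominator_def\<close>)
  qed
qed

text \<open>The amplitude \<open>\<langle>\<Prod> V(\<psi>\<^sub>a, z\<^sub>a)\<rangle>\<^sub>\<eta>\<close>, as a function of the list of insertions; the variables are labelled
  by the positions in the list.  The weight is ambiguous only for a zero state, where the value is \<open>0\<close>.\<close>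

definition eta_amp :: "('h \<times> complex) list \<Rightarrow> complex" where
  "eta_amp ps = rval {..<length ps} (cf (\<lambda>a. fst (ps ! a)) (\<lambda>a. SOME h. fst (ps ! a) \<in> wt h) [0..<length ps])
     (\<lambda>a. snd (ps ! a))"

lemma weight_unique: "\<psi> \<in> wt h \<Longrightarrow> \<psi> \<in> wt h' \<Longrightarrow> \<psi> \<noteq> 0 \<Longrightarrow> h = h'"
  unfolding weight_space_def by (metis (mono_tags, lifting) mem_Collect_eq of_nat_eq_iff scale_cancel_right)

lemma md_zero_state [simp]: "md 0 h e \<xi> = 0"
proof -
  interpret l: Vector_Spaces.linear smul smul "\<lambda>\<psi>. vop \<psi> (- e - int h) \<xi>" by (rule vop_linear_state)
  show ?thesis by (simp add: md_def l.zero)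
qed

lemma word_zero_state: "a \<in> set os \<Longrightarrow> \<psi> a = 0 \<Longrightarrow> word \<psi> h os e X = 0"
  by (induction os) (auto simp: word_Cons)

text \<open>Frees the amplitude from list positions and from the chosen weights: from here on any
  injective labelling and any valid weights may be used.\<close>

lemma eta_amp_eq:
  assumes wts: "\<forall>a\<in>set os. \<psi> a \<in> wt (h a)" and os: "distinct os" and reg: "regular_pt (set os) z"
  shows "eta_amp (map (\<lambda>a. (\<psi> a, z a)) os) = rval (set os) (cf \<psi> h os) z"
proof -
  define l where "l = length os"
  define ps where "ps = map (\<lambda>a. (\<psi> a, z a)) os"
  define \<psi>' where "\<psi>' = (\<lambda>a. fst (ps ! a))"
  define h' where "h' = (\<lambda>a. SOME h. \<psi>' a \<in> wt h)"
  obtain vs K where vs: "trunc_data \<psi> vs K (set os)" using trunc_data_exists by blast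
  have len: "length ps = l" by (simp add: ps_def l_def)
  have \<psi>': "\<psi>' i = \<psi> (os ! i)" if "i < l" for i using that by (simp add: \<psi>'_def ps_def l_def)
  have h': "h' i = h (os ! i)" if "i < l" "\<psi> (os ! i) \<noteq> 0" for i
  proof (rule weight_unique)
    have "\<psi>' i \<in> wt (h (os ! i))" using wts that by (simp add: \<psi>' l_def)
    thus "\<psi>' i \<in> wt (h' i)" unfolding h'_def by (rule someI)
    show "\<psi>' i \<in> wt (h (os ! i))" by fact
  qed (use that \<psi>' in auto)
  have "rval {..<l} (cf \<psi>' h' [0..<l]) (\<lambda>a. snd (ps ! a)) = rval (set os) (cf \<psi> h os) z"
  proof (rule rval_relabel[where f = "\<lambda>i. os ! i" and M = "den h vs (set os)"])
    show "bij_betw ((!) os) {..<l} (set os)"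
      using bij_betw_nth[OF os, of "{..<l}" "set os"] by (simp add: l_def)
    show "cf \<psi> h os e = 0" if "\<not> supp_in (set os) e" for e using that by (simp add: cf_def)
    show "cf \<psi>' h' [0..<l] e = 0" if "\<not> supp_in {..<l} e" for e
      using that by (simp add: cf_def atLeast0LessThan)
    fix e assume e: "supp_in (set os) e"
    define e' where "e' = (\<lambda>i. if i \<in> {..<l} then e (os ! i) else 0)"
    have "word \<psi> h os e \<Omega> = word \<psi>' h' [0..<l] e' \<Omega>"
    proof (cases "\<exists>a\<in>set os. \<psi> a = 0")
      case True
      then obtain i where i: "i < l" "\<psi> (os ! i) = 0" by (auto simp: in_set_conv_nth l_def)
      have "word \<psi> h os e \<Omega> = 0" using True word_zero_state by blast
      moreover have "word \<psi>' h' [0..<l] e' \<Omega> = 0"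
        by (rule word_zero_state[of i]) (use i \<psi>' in auto)
      ultimately show ?thesis by simp
    next
      case False
      have "word \<psi> h os e \<Omega> = foldr (\<lambda>i. md (\<psi> i) (h i) (e i)) (map ((!) os) [0..<l]) \<Omega>"
        by (simp add: word_def l_def map_nth)
      also have "\<dots> = foldr (\<lambda>i. md (\<psi>' i) (h' i) (e' i)) [0..<l] \<Omega>"
        unfolding foldr_map by (rule foldr_cong) (use False h' \<psi>' in \<open>auto simp: e'_def l_def o_def\<close>)
      finally show ?thesis by (simp add: word_def)
    qed
    moreover have "supp_in {..<l} e'" by (simp add: supp_in_def e'_def)
    ultimately show "cf \<psi> h os e = cf \<psi>' h' [0..<l] (\<lambda>i. if i \<in> {..<l} then e (os ! i) else 0)"
      unfolding e'_def[symmetric] using e by (simp add: cf_def atLeast0LessThan)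
  next
    show "denominator (set os) (cf \<psi> h os) (den h vs (set os))"
      by (rule den_lpoly[OF wts os]) (use vs in \<open>auto simp: trunc_data_def\<close>)
    show "bins_val (set os) z (den h vs (set os)) \<noteq> 0"
      by (rule den_val_regular[OF _ vs reg]) auto
  qed (auto simp: ps_def l_def)
  thus ?thesis
    by (simp only: eta_amp_def ps_def[symmetric] len \<psi>'_def h'_def)
qed

end

section \<open>Holomorphy of the continuation\<close>

text \<open>The ingredients of \<open>holomorphic_cspace\<close> without its domain: numerators and
  denominators are entire, so openness enters only when a quotient is formed.\<close>

definition sep_entire :: "((nat \<Rightarrow> complex) \<Rightarrow> complex) \<Rightarrow> bool" where
  "sep_entire f \<longleftrightarrow> continuous_on UNIV f \<and> (\<forall>z i. (\<lambda>t. f (z(i := t))) holomorphic_on UNIV)"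

lemma sep_entire_const: "sep_entire (\<lambda>z. k)"
  by (simp add: sep_entire_def)

lemma sep_entire_coordinate: "sep_entire (\<lambda>z. z a)"
proof -
  have "(\<lambda>t. (z(i := t)) a) holomorphic_on UNIV" for z :: "nat \<Rightarrow> complex" and i
    by (cases "a = i") (auto intro: holomorphic_intros)
  thus ?thesis
    using continuous_on_product_then_coordinatewise[OF continuous_on_id] by (auto simp: sep_entire_def)
qed

lemma sep_entire_mult: "sep_entire f \<Longrightarrow> sep_entire g \<Longrightarrow> sep_entire (\<lambda>z. f z * g z)"
  and sep_entire_diff: "sep_entire f \<Longrightarrow> sep_entire g \<Longrightarrow> sep_entire (\<lambda>z. f z - g z)"
  and sep_entire_power: "sep_entire f \<Longrightarrow> sep_entire (\<lambda>z. f z ^ n)"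
  by (auto simp: sep_entire_def intro!: continuous_intros holomorphic_intros)

lemma sep_entire_sum: "(\<And>i. i \<in> I \<Longrightarrow> sep_entire (f i)) \<Longrightarrow> sep_entire (\<lambda>z. \<Sum>i\<in>I. f i z)"
  and sep_entire_prod: "(\<And>i. i \<in> I \<Longrightarrow> sep_entire (f i)) \<Longrightarrow> sep_entire (\<lambda>z. \<Prod>i\<in>I. f i z)"
  by (auto simp: sep_entire_def intro!: continuous_intros holomorphic_intros)

lemma mon_nonneg: "(\<And>i. 0 \<le> x i) \<Longrightarrow> mon A z x = (\<Prod>a\<in>A. z a ^ nat (x a))"
  by (simp add: mon_def power_int_def)

lemma sep_entire_mon:
  assumes "\<And>i. 0 \<le> x i"
  shows "sep_entire (\<lambda>z. mon A z x)"
  unfolding mon_nonneg[OF assms] by (intro sep_entire_prod sep_entire_power sep_entire_coordinate)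

lemma sep_entire_pval: "lpoly A c \<Longrightarrow> sep_entire (pval A c)"
  unfolding pval_def
  by (intro sep_entire_sum sep_entire_mult sep_entire_const sep_entire_mon) (auto simp: lpoly_def)

lemma sep_entire_bins_val: "\<forall>b\<in>#M. bin_ok A b \<Longrightarrow> sep_entire (\<lambda>z. bins_val A z M)"
proof (induction M)
  case (add b M)
  obtain \<alpha> x \<beta> y where b: "b = (\<alpha>, x, \<beta>, y)" by (metis prod_cases4)
  have "sep_entire (\<lambda>z. bin_val A z b)"
    unfolding b bin_val.simps
    by (intro sep_entire_diff sep_entire_mult sep_entire_const sep_entire_mon) (use add.prems in \<open>auto simp: b\<close>)
  with add show ?case by (simp add: sep_entire_mult)
qed (simp add: sep_entire_const)

lemma holomorphic_cspace_quotient: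
  assumes "sep_entire p" "sep_entire q" "open_cspace l U" "\<And>z. z \<in> U \<Longrightarrow> q z \<noteq> 0"
    and "\<And>z. z \<in> U \<Longrightarrow> f z = p z / q z"
  shows "holomorphic_cspace l f U"
  unfolding holomorphic_cspace_def
proof (intro conjI ballI allI impI)
  show "continuous_on U f"
  proof (rule continuous_on_eq)
    show "continuous_on U (\<lambda>z. p z / q z)"
    proof (rule continuous_on_divide)
      show "continuous_on U p" "continuous_on U q"
        using assms(1,2) continuous_on_subset[OF _ subset_UNIV] by (auto simp: sep_entire_def)
    qed (use assms(4) in blast)
  qed (use assms in auto)
  fix z i assume z: "z \<in> U" "i < l"
  have U: "U \<subseteq> cspace l" using assms(3) openin_imp_subset unfolding open_cspace_def by blast
  obtain T where T: "open T" "U = cspace l \<inter> T"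
    using assms(3) unfolding open_cspace_def openin_open by blast
  have "continuous_on UNIV (\<lambda>t. (z(i := t)) j)" for j
    by (cases "j = i") (simp_all add: continuous_on_id)
  hence "continuous_on UNIV (\<lambda>t. z(i := t))"
    by (rule continuous_on_coordinatewise_then_product)
  hence "open ((\<lambda>t. z(i := t)) -` T)" using T(1) by (simp add: continuous_on_open_vimage)
  hence ev: "eventually (\<lambda>t. t \<in> (\<lambda>t. z(i := t)) -` T) (nhds (z i))"
    by (rule eventually_nhds_in_open) (use z T in simp)
  have inU: "z(i := t) \<in> U" if "t \<in> (\<lambda>t. z(i := t)) -` T" for t
    using that z U T by (auto simp: cspace_def)
  have "((\<lambda>t. p (z(i := t)) / q (z(i := t)))) field_differentiable at (z i)"
  proof (rule field_differentiable_divide)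
    show "(\<lambda>t. p (z(i := t))) field_differentiable at (z i)" "(\<lambda>t. q (z(i := t))) field_differentiable at (z i)"
      by (rule holomorphic_on_imp_differentiable_at[OF _ open_UNIV UNIV_I],
          use assms(1,2) in \<open>simp add: sep_entire_def\<close>)+
  qed (use assms(4) z in auto)
  then obtain D where D: "((\<lambda>t. p (z(i := t)) / q (z(i := t))) has_field_derivative D) (at (z i))"
    by (auto simp: field_differentiable_def)
  have ev2: "eventually (\<lambda>t. p (z(i := t)) / q (z(i := t)) = f (z(i := t))) (nhds (z i))"
    using ev by eventually_elim (use inU assms(5) in auto)
  from D have "((\<lambda>t. f (z(i := t))) has_field_derivative D) (at (z i))"
    unfolding DERIV_cong_ev[OF refl ev2 refl] .
  thus "(\<lambda>t. f (z(i := t))) field_differentiable at (z i)"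
    by (auto simp: field_differentiable_def)
qed (use assms in auto)

context cft_functional
begin

lemma regular_iff: "z \<in> cspace l - eta_singularities us l \<longleftrightarrow> z \<in> cspace l \<and> regular_pt {..<l} z"
  unfolding eta_singularities_def regular_pt_def inj_on_def by simp blast

lemma open_regular: "open_cspace l (cspace l - eta_singularities us l)"
proof -
  define Q where "Q = (\<lambda>z::nat \<Rightarrow> complex. (\<Prod>i<l. \<Prod>u\<in>set us. z i - u) * (\<Prod>i<l. \<Prod>j\<in>{..<l} - {i}. z i - z j))"
  have "sep_entire Q"
    unfolding Q_def
    by (intro sep_entire_mult sep_entire_prod sep_entire_diff sep_entire_coordinate sep_entire_const)
  hence "continuous_on (cspace l) Q"
    by (auto simp: sep_entire_def intro: continuous_on_subset)
  from continuous_openin_preimage_gen[OF this, of "- {0}"]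
  have "openin (top_of_set (cspace l)) (cspace l \<inter> Q -` (- {0}))" by auto
  also have "cspace l \<inter> Q -` (- {0}) = cspace l - eta_singularities us l"
    by (auto simp: eta_singularities_def Q_def) blast+
  finally show ?thesis by (simp add: open_cspace_def)
qed

lemma eta_amp_insertions:
  assumes "\<forall>a<l. \<psi> a \<in> wt (h a)" "regular_pt {..<l} z"
  shows "eta_amp (insertions l \<psi> z) = rval {..<l} (cf \<psi> h [0..<l]) z"
  unfolding insertions_def
  using eta_amp_eq[of "[0..<l]" \<psi> h z] assms by (simp add: atLeast0LessThan)

lemma eta_amp_holomorphic:
  assumes "\<forall>a<l. \<psi> a \<in> wt (h a)"
  shows "holomorphic_cspace l (\<lambda>z. eta_amp (insertions l \<psi> z)) (cspace l - eta_singularities us l)"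
proof -
  obtain vs K where vs: "trunc_data \<psi> vs K {..<l}" using trunc_data_exists by blast
  have wts: "\<forall>a\<in>set [0..<l]. \<psi> a \<in> wt (h a)" using assms by auto
  have dn: "denominator {..<l} (cf \<psi> h [0..<l]) (den h vs {..<l})"
    using den_lpoly[OF wts, of vs K] vs by (auto simp: trunc_data_def atLeast0LessThan)
  show ?thesis
  proof (rule holomorphic_cspace_quotient[OF _ _ open_regular])
    show "sep_entire (pval {..<l} (acts (den h vs {..<l}) (cf \<psi> h [0..<l])))"
      by (rule sep_entire_pval) (use dn in \<open>simp add: denominator_def\<close>)
    show "sep_entire (\<lambda>z. bins_val {..<l} z (den h vs {..<l}))"
      by (rule sep_entire_bins_val) (use dn in \<open>simp add: denominator_def\<close>)
    fix z assume z: "z \<in> cspace l - eta_singularities us l"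
    show "bins_val {..<l} z (den h vs {..<l}) \<noteq> 0"
      by (rule den_val_regular[OF _ vs]) (use z regular_iff in auto)
    show "eta_amp (insertions l \<psi> z) = pval {..<l} (acts (den h vs {..<l}) (cf \<psi> h [0..<l])) z /
        bins_val {..<l} z (den h vs {..<l})"
      using rval_cf[OF wts, of vs K z] eta_amp_insertions[OF assms, of z] z vs regular_iff[of z l]
      by (simp add: atLeast0LessThan)
  qed
qed

lemma eta_amp_meromorphic:
  assumes "\<forall>a<l. \<psi> a \<in> wt (h a)"
  shows "meromorphic_cspace l (\<lambda>z. eta_amp (insertions l \<psi> z)) (cspace l) (eta_singularities us l)"
  unfolding meromorphic_cspace_def
proof (intro conjI ballI)
  show "holomorphic_cspace l (\<lambda>z. eta_amp (insertions l \<psi> z)) (cspace l - eta_singularities us l)"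
    by (rule eta_amp_holomorphic[OF assms])
  fix p assume p: "p \<in> cspace l"
  obtain vs K where vs: "trunc_data \<psi> vs K {..<l}" using trunc_data_exists by blast
  have wts: "\<forall>a\<in>set [0..<l]. \<psi> a \<in> wt (h a)" using assms by auto
  have dn: "denominator {..<l} (cf \<psi> h [0..<l]) (den h vs {..<l})"
    using den_lpoly[OF wts, of vs K] vs by (auto simp: trunc_data_def atLeast0LessThan)
  define P where "P = pval {..<l} (acts (den h vs {..<l}) (cf \<psi> h [0..<l]))"
  define Q where "Q = (\<lambda>z. bins_val {..<l} z (den h vs {..<l}))"
  have ent: "sep_entire P" "sep_entire Q"
    unfolding P_def Q_def by (rule sep_entire_pval sep_entire_bins_val, use dn in \<open>simp add: denominator_def\<close>)+
  have op: "open_cspace l (cspace l)" by (simp add: open_cspace_def)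
  show "\<exists>W g q. p \<in> W \<and> W \<subseteq> cspace l \<and> holomorphic_cspace l g W \<and> holomorphic_cspace l q W \<and>
        (\<forall>W'. open_cspace l W' \<and> W' \<subseteq> W \<and> W' \<noteq> {} \<longrightarrow> (\<exists>z\<in>W'. q z \<noteq> 0)) \<and>
        (\<forall>z\<in>W - eta_singularities us l. eta_amp (insertions l \<psi> z) * q z = g z)"
  proof (rule exI[of _ "cspace l"], rule exI[of _ P], rule exI[of _ Q], intro conjI allI impI ballI)
    show "holomorphic_cspace l P (cspace l)"
      by (rule holomorphic_cspace_quotient[OF ent(1) sep_entire_const[of 1] op]) auto
    show "holomorphic_cspace l Q (cspace l)"
      by (rule holomorphic_cspace_quotient[OF ent(2) sep_entire_const[of 1] op]) auto
  next
    fix z assume z: "z \<in> cspace l - eta_singularities us l"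
    have "Q z \<noteq> 0"
      unfolding Q_def by (rule den_val_regular[OF _ vs]) (use z regular_iff in auto)
    moreover have "eta_amp (insertions l \<psi> z) = P z / Q z"
      using rval_cf[OF wts, of vs K z] eta_amp_insertions[OF assms, of z] z vs regular_iff[of z l]
      by (simp add: atLeast0LessThan P_def Q_def)
    ultimately show "eta_amp (insertions l \<psi> z) * Q z = P z" by simp
  next
    fix W' assume W': "open_cspace l W' \<and> W' \<subseteq> cspace l \<and> W' \<noteq> {}"
    then obtain T z where T: "open T" "W' = cspace l \<inter> T" "z \<in> W'"
      unfolding open_cspace_def openin_open by blast
    hence z: "z \<in> cspace l" "z \<in> T" by auto
    obtain e where e: "e > 0" "\<And>y. (\<And>i. dist (y i) (z i) < e) \<Longrightarrow> y \<in> T"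
      using open_fun_box[OF T(1) z(2)] by blast
    \<comment> \<open>z is moved in the direction (1, 2, ..., l), whose distinct nonzero entries
      separate all coordinates for every t outside this finite set. The entries with i = j are 0 / 0
      = 0 and merely exclude t = 0.\<close>
    define bad where "bad = (\<lambda>(i, j). (z i - z j) / (of_nat j - of_nat i)) ` ({..<l} \<times> {..<l}) \<union>
        (\<lambda>(i, u). (u - z i) / of_nat (Suc i)) ` ({..<l} \<times> set us)"
    have "finite bad" by (auto simp: bad_def)
    moreover have "infinite (ball (0::complex) (e / (real l + 1)))"
      using e(1) uncountable_ball[of "e / (real l + 1)" "0::complex"] countable_finite by auto
    ultimately have "infinite (ball (0::complex) (e / (real l + 1)) - bad)" by simp
    then obtain t where t: "norm t < e / (real l + 1)" "t \<notin> bad"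
      by (metis Diff_iff finite.emptyI ex_in_conv mem_ball_0)
    define y where "y = (\<lambda>i. if i < l then z i + t * of_nat (Suc i) else 0)"
    have "dist (y i) (z i) < e" for i
    proof (cases "i < l")
      case True
      have "dist (y i) (z i) = norm t * real (Suc i)" using True by (simp add: y_def dist_norm norm_mult del: of_nat_Suc)
      also have "\<dots> \<le> norm t * (real l + 1)" using True by (intro mult_left_mono) auto
      also have "\<dots> < e" using t(1) by (simp add: field_simps)
      finally show ?thesis .
    qed (use z e in \<open>auto simp: y_def cspace_def\<close>)
    hence "y \<in> T" by (rule e(2))
    moreover have "y \<in> cspace l" by (simp add: y_def cspace_def)
    moreover have "regular_pt {..<l} y"
      unfolding regular_pt_def
    proof (intro conjI ballI inj_onI)
      fix i j assume ij: "i \<in> {..<l}" "j \<in> {..<l}" "y i = y j"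
      show "i = j"
      proof (rule ccontr)
        assume "i \<noteq> j"
        hence "(of_nat j - of_nat i :: complex) \<noteq> 0" by simp
        moreover have "z i - z j = t * (of_nat j - of_nat i)"
          using ij by (simp add: y_def algebra_simps)
        ultimately have "t = (z i - z j) / (of_nat j - of_nat i)" by (simp add: field_simps)
        thus False using t(2) ij by (auto simp: bad_def)
      qed
    next
      fix i assume i: "i \<in> {..<l}"
      show "y i \<notin> set us"
      proof
        assume "y i \<in> set us"
        moreover have "t = (y i - z i) / of_nat (Suc i)"
          using i by (simp add: y_def del: of_nat_Suc)
        ultimately show False using t(2) i by (auto simp: bad_def simp del: of_nat_Suc)
      qed
    qed
    ultimately show "\<exists>z\<in>W'. Q z \<noteq> 0"
      unfolding T(2) Q_def using den_val_regular[OF _ vs, of y] by blast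
  qed (use p in auto)
qed

section \<open>Convergence of the given series on explicit polydiscs\<close>

lemma eta_series_term_eq:
  assumes "R permutes {..<l}"
  shows "((\<lambda>e. cf \<psi> h (map R [0..<l]) e * mon {..<l} z e) has_sum S) UNIV \<longleftrightarrow>
    (eta_series_term \<eta> vop \<Omega> l R \<psi> h z has_sum S) ({..<l} \<rightarrow>\<^sub>E UNIV)"
proof -
  have set: "set (map R [0..<l]) = {..<l}"
    using permutes_image[OF assms] by (simp add: atLeast0LessThan)
  have cf0: "cf \<psi> h (map R [0..<l]) e = 0" if "\<not> supp_in {..<l} e" for e
    using that unfolding cf_def set by simp
  have "((\<lambda>e. cf \<psi> h (map R [0..<l]) e * mon {..<l} z e) has_sum S) UNIV \<longleftrightarrow>
     ((\<lambda>e. cf \<psi> h (map R [0..<l]) e * mon {..<l} z e) has_sum S) {e. supp_in {..<l} e}"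
    by (rule has_sum_cong_neutral) (auto simp: cf0)
  also have "\<dots> \<longleftrightarrow> (eta_series_term \<eta> vop \<Omega> l R \<psi> h z has_sum S) ({..<l} \<rightarrow>\<^sub>E UNIV)"
  proof (rule has_sum_reindex_bij_witness[of _ "\<lambda>j i. if i < l then - j i - int (h i) else 0"
        "\<lambda>e. restrict (\<lambda>i. - e i - int (h i)) {..<l}"])
    fix e :: idx assume e: "e \<in> {e. supp_in {..<l} e}"
    thus "(\<lambda>i. if i < l then - restrict (\<lambda>i. - e i - int (h i)) {..<l} i - int (h i) else 0) = e"
      using e by (auto simp: supp_in_def)
    have "foldr (\<lambda>i. vop (\<psi> (R i)) (restrict (\<lambda>i. - e i - int (h i)) {..<l} (R i))) [0..<l] \<Omega> =
        word \<psi> h (map R [0..<l]) e \<Omega>"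
      unfolding word_def foldr_map
    proof (rule foldr_cong)
      fix Y i assume "i \<in> set [0..<l]"
      hence "R i < l" using permutes_in_image[OF assms, of i] by simp
      thus "vop (\<psi> (R i)) (restrict (\<lambda>i. - e i - int (h i)) {..<l} (R i)) Y = ((\<lambda>i. md (\<psi> i) (h i) (e i)) \<circ> R) i Y"
        by (simp add: md_def)
    qed auto
    thus "eta_series_term \<eta> vop \<Omega> l R \<psi> h z (restrict (\<lambda>i. - e i - int (h i)) {..<l}) =
        cf \<psi> h (map R [0..<l]) e * mon {..<l} z e"
      using e unfolding eta_series_term_def cf_def set mon_def by simp
  qed (auto simp: supp_in_def PiE_def extensional_def)
  finally show ?thesis .
qed

lemma eta_amp_continues:
  assumes "\<forall>a<l. \<psi> a \<in> wt (h a)"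
  shows "continues_eta_series \<eta> vop \<Omega> us l \<psi> h (\<lambda>z. eta_amp (insertions l \<psi> z))"
  unfolding continues_eta_series_def
proof (intro conjI allI impI)
  show "holomorphic_cspace l (\<lambda>z. eta_amp (insertions l \<psi> z)) (cspace l - eta_singularities us l)"
    by (rule eta_amp_holomorphic[OF assms])
  fix R assume R: "R permutes {..<l}"
  define r where "r = Min (insert 1 (norm ` set us))"
  have r: "r > 0" unfolding r_def using us(2) by (subst Min_gr_iff) auto
  have ru: "r \<le> norm u" if "u \<in> set us" for u
    unfolding r_def using that by (intro Min_le) auto
  define k where "k = inv R"
  have kR: "k (R i) = i" for i using permutes_inverses(2)[OF R] by (simp add: k_def)
  have Rk: "R (k i) = i" for i using permutes_inverses(1)[OF R] by (simp add: k_def)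
  have Rl: "R i < l \<longleftrightarrow> i < l" for i using permutes_in_image[OF R, of i] by simp
  \<comment> \<open>Ratio 4 separates the moduli: with relative error below 1/4 the n-th modulus
    exceeds 3/4 s n, while the next is below 5/4 s (n + 1) = 5/16 s n. The largest stays below 5/16
    r, hence inside all |u|.\<close>
  define s where "s = (\<lambda>n::nat. r / 4 ^ (Suc n))"
  have s: "s n > 0" "s (Suc n) = s n / 4" "s n \<le> r / 4" for n
  proof -
    show "s n > 0" using r by (simp add: s_def)
    show "s (Suc n) = s n / 4" by (simp add: s_def)
    have "(4::real) ^ 1 \<le> 4 ^ Suc n" by (rule power_increasing) auto
    thus "s n \<le> r / 4" using r by (simp add: s_def field_simps)
  qed
  have smono: "s n \<le> s m / 4" if "m < n" for m n
  proof -
    have "s n \<le> s (Suc m)"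
    proof (rule lift_Suc_antimono_le[of s])
      show "s (Suc n) \<le> s n" for n using s[of n] by simp
    qed (use that in auto)
    thus ?thesis using s by simp
  qed
  \<comment> \<open>k i is the rank of label i in the ordering R. Coordinates from l on are pinned
    to 0 to stay in \<open>cspace l\<close>, and D is connected as a product of connected
    sets.\<close>
  define B where "B = (\<lambda>i. if i < l then ball (of_real (s (k i))) (s (k i) / 4) else {0::complex})"
  define D where "D = PiE UNIV B"
  have Dz: "3 / 4 * s n < norm (z (R n))" "norm (z (R n)) < 5 / 4 * s n" if "z \<in> D" "n < l" for z n
  proof -
    have "z (R n) \<in> ball (of_real (s n)) (s n / 4)"
      using that by (auto simp: D_def B_def kR Rl PiE_iff dest!: spec[of _ "R n"])
    hence d: "norm (of_real (s n) - z (R n)) < s n / 4" by (simp add: dist_norm)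
    have "norm (complex_of_real (s n)) = s n" using s(1)[of n] by simp
    moreover have "norm (complex_of_real (s n)) - norm (z (R n)) \<le> norm (of_real (s n) - z (R n))"
      "norm (z (R n)) - norm (complex_of_real (s n)) \<le> norm (of_real (s n) - z (R n))"
      by (rule norm_triangle_ineq2, rule norm_triangle_ineq3[THEN abs_le_D2, simplified])
    ultimately show "3 / 4 * s n < norm (z (R n))" "norm (z (R n)) < 5 / 4 * s n" using d by linarith+
  qed
  have DC: "D = cspace l \<inter> PiE UNIV (\<lambda>i. if i < l then ball (of_real (s (k i))) (s (k i) / 4) else UNIV)"
    by (auto simp: D_def B_def cspace_def PiE_iff split: if_splits)
  have lt: "norm (z (R j)) < norm (z (R i))" if "z \<in> D" "i < j" "j < l" for z i j
    using Dz[OF that(1), of i] Dz[OF that(1), of j] smono[OF that(2)] s(1)[of i] that by linarith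
  have nz: "z i \<noteq> 0" "norm (z i) < r" if "z \<in> D" "i < l" for z i
  proof -
    have "k i < l" using Rl[of "k i"] Rk that by simp
    from Dz[OF that(1) this] s(1,3)[of "k i"] r show "z i \<noteq> 0" "norm (z i) < r"
      unfolding Rk by auto
  qed
  have dec: "decreasing z (map R [0..<l])" if "z \<in> D" for z
    unfolding decreasing_def sorted_wrt_map by (rule sorted_wrt_iff_nth_less[THEN iffD2]) (use lt that in auto)
  have reg: "regular_pt {..<l} z" if z: "z \<in> D" for z
    unfolding regular_pt_def
  proof (intro conjI ballI inj_onI)
    fix i j assume ij: "i \<in> {..<l}" "j \<in> {..<l}" "z i = z j"
    have "k i < l" "k j < l" using Rl[of "k i"] Rl[of "k j"] Rk ij by auto
    moreover have "k i = k j"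
      using lt[OF z, of "k i" "k j"] lt[OF z, of "k j" "k i"] calculation ij(3) Rk
      by (metis less_irrefl linorder_neqE_nat)
    ultimately show "i = j" by (metis Rk)
  qed (use nz[OF z] ru in force)
  have os: "distinct (map R [0..<l])" "set (map R [0..<l]) = {..<l}" "mset (map R [0..<l]) = mset [0..<l]"
  proof -
    show d: "distinct (map R [0..<l])"
      using permutes_inj_on[OF R] by (simp add: distinct_map)
    show set: "set (map R [0..<l]) = {..<l}"
      using permutes_image[OF R] by (simp add: atLeast0LessThan)
    show "mset (map R [0..<l]) = mset [0..<l]"
      using d set set_eq_iff_mset_eq_distinct[of "map R [0..<l]" "[0..<l]"] by (simp add: atLeast0LessThan)
  qed
  show "\<exists>D. open_cspace l D \<and> connected D \<and> D \<noteq> {} \<and>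
             D \<subseteq> series_region l R - eta_singularities us l \<and>
             (\<forall>z\<in>D. (eta_series_term \<eta> vop \<Omega> l R \<psi> h z has_sum eta_amp (insertions l \<psi> z)) ({..<l} \<rightarrow>\<^sub>E UNIV))"
  proof (rule exI[of _ D], intro conjI ballI)
    have "open (PiE UNIV (\<lambda>i. if i < l then ball (complex_of_real (s (k i))) (s (k i) / 4) else UNIV))"
      by (rule open_PiE) (auto intro: finite_subset[of _ "{..<l}"] split: if_splits)
    thus "open_cspace l D" unfolding open_cspace_def DC openin_open by blast
    have "connectedin (product_topology (\<lambda>i. euclidean) UNIV) (PiE UNIV B)"
      unfolding connectedin_PiE by (auto simp: B_def)
    thus "connected D" by (simp add: D_def euclidean_product_topology)
    have "(\<lambda>i. if i < l then of_real (s (k i)) else 0) \<in> D"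
      using s by (auto simp: D_def B_def)
    thus "D \<noteq> {}" by blast
    show "D \<subseteq> series_region l R - eta_singularities us l"
    proof
      fix z assume z: "z \<in> D"
      have "z \<in> cspace l" using z DC by blast
      thus "z \<in> series_region l R - eta_singularities us l"
        using regular_iff[of z l] reg[OF z] lt[OF z] by (auto simp: series_region_def)
    qed
    fix z assume z: "z \<in> D"
    have wts: "\<forall>a\<in>set (map R [0..<l]). \<psi> a \<in> wt (h a)" using assms os(2) by auto
    have "((\<lambda>e. cf \<psi> h (map R [0..<l]) e * mon (set (map R [0..<l])) z e) has_sum
        rval (set (map R [0..<l])) (cf \<psi> h (map R [0..<l])) z) UNIV"
    proof (rule cf_has_sum[OF wts os(1) dec[OF z]])
      show "z a \<noteq> 0" if "a \<in> set (map R [0..<l])" for a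
        using that nz(1)[OF z] os(2) by auto
      show "norm (z a) < norm u" if "a \<in> set (map R [0..<l])" "u \<in> set us" for a u
        using nz(2)[OF z, of a] ru[OF that(2)] that(1) os(2) by auto
    qed
    also have "rval (set (map R [0..<l])) (cf \<psi> h (map R [0..<l])) z = rval {..<l} (cf \<psi> h [0..<l]) z"
      using rval_cf_perm[of "map R [0..<l]" \<psi> h z "[0..<l]"] wts os reg[OF z] by simp
    also have "\<dots> = eta_amp (insertions l \<psi> z)"
      using eta_amp_insertions[OF assms reg[OF z]] by simp
    finally show "(eta_series_term \<eta> vop \<Omega> l R \<psi> h z has_sum eta_amp (insertions l \<psi> z)) ({..<l} \<rightarrow>\<^sub>E UNIV)"
      unfolding os(2) eta_series_term_eq[OF R] .
  qed
qed

end

section \<open>Behaviour at infinity\<close>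

lemma bin_deg_pair: "bin_deg i (pair_bin a b) = of_bool (i = a \<or> i = b)"
  and bin_deg_point: "bin_deg i (point_bin a u) = of_bool (i = a)"
  by (auto simp: bin_deg_def pair_bin_def point_bin_def uv_def)

lemma eventually_notin_finite:
  fixes S :: "'a::t1_space set"
  assumes "finite S"
  shows "eventually (\<lambda>w. w \<notin> S) (at p)"
proof -
  have "eventually (\<lambda>w. w \<in> - (S - {p}) - {p}) (at p)"
  proof (rule eventually_at_in_open)
    show "open (- (S - {p}))" using assms by (intro open_Compl finite_imp_closed) simp
  qed simp
  thus ?thesis by eventually_elim auto
qed

lemma tendsto_affine_at_infinity:
  fixes s k :: complex
  shows "((\<lambda>w. (k * inverse w - s) * w) \<longlongrightarrow> k) (at 0)"
proof -
  have "((\<lambda>w::complex. k - s * w) \<longlongrightarrow> k - s * 0) (at 0)" by (intro tendsto_intros)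
  hence "((\<lambda>w. k - s * w) \<longlongrightarrow> k) (at 0)" by simp
  moreover have "eventually (\<lambda>w::complex. k - s * w = (k * inverse w - s) * w) (at 0)"
    using eventually_punctured_disc[OF zero_less_one] by eventually_elim (auto simp: algebra_simps)
  ultimately show ?thesis by (rule Lim_transform_eventually)
qed

text \<open>Each factor grows at infinity in z i exactly like the power \<open>bin_deg i\<close>,
  with a nonzero leading coefficient because the other points are regular; multiplying by the
  corresponding power of w = 1 / z i leaves a nonzero limit.\<close>

lemma bins_val_at_infinity:
  assumes A: "finite A" "i \<in> A" and z: "inj_on z A"
    and M: "\<And>b. b \<in># M \<Longrightarrow> (\<exists>a c. a \<in> A \<and> c \<in> A \<and> a \<noteq> c \<and> b = pair_bin a c) \<or>
       (\<exists>a u. a \<in> A \<and> z a \<noteq> u \<and> b = point_bin a u)"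
  shows "\<exists>L. L \<noteq> 0 \<and> (\<forall>b\<in>#M. bin_deg i b \<ge> 0) \<and>
    ((\<lambda>w. bins_val A (z(i := inverse w)) M * w ^ nat (\<Sum>b\<in>#M. bin_deg i b)) \<longlongrightarrow> L) (at 0)"
  using M
proof (induction M)
  case (add b M)
  obtain L where L: "L \<noteq> 0" "\<forall>b\<in>#M. bin_deg i b \<ge> 0"
    "((\<lambda>w. bins_val A (z(i := inverse w)) M * w ^ nat (\<Sum>b\<in>#M. bin_deg i b)) \<longlongrightarrow> L) (at 0)"
  proof -
    have "(\<exists>a c. a \<in> A \<and> c \<in> A \<and> a \<noteq> c \<and> b' = pair_bin a c) \<or>
       (\<exists>a u. a \<in> A \<and> z a \<noteq> u \<and> b' = point_bin a u)" if "b' \<in># M" for b'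
      by (rule add.prems) (use that in simp)
    from add.IH[OF this] show ?thesis using that by blast
  qed
  have "\<exists>L'. L' \<noteq> 0 \<and> bin_deg i b \<ge> 0 \<and>
     ((\<lambda>w. bin_val A (z(i := inverse w)) b * w ^ nat (bin_deg i b)) \<longlongrightarrow> L') (at 0)"
    using add.prems[of b, simplified]
  proof (elim disjE exE conjE)
    fix a c assume *: "a \<in> A" "c \<in> A" "a \<noteq> c" "b = pair_bin a c"
    consider "a = i" | "c = i" "a \<noteq> i" | "a \<noteq> i" "c \<noteq> i" by blast
    thus ?thesis
    proof cases
      case 1
      have "((\<lambda>w. (1 * inverse w - z c) * w) \<longlongrightarrow> 1) (at 0)" by (rule tendsto_affine_at_infinity)
      thus ?thesis using 1 * A(1) by (intro exI[of _ 1]) (simp add: bin_deg_pair bin_val_pair)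
    next
      case 2
      have "((\<lambda>w. (- 1 * inverse w - (- z a)) * w) \<longlongrightarrow> - 1) (at 0)" by (rule tendsto_affine_at_infinity)
      thus ?thesis using 2 * A(1) by (intro exI[of _ "-1"]) (simp add: bin_deg_pair bin_val_pair)
    next
      case 3
      have "z a - z c \<noteq> 0" using z * by (auto simp: inj_on_def)
      thus ?thesis using 3 * A(1) by (intro exI[of _ "z a - z c"]) (simp add: bin_deg_pair bin_val_pair)
    qed
  next
    fix a u assume *: "a \<in> A" "z a \<noteq> u" "b = point_bin a u"
    show ?thesis
    proof (cases "a = i")
      case True
      have "((\<lambda>w. (1 * inverse w - u) * w) \<longlongrightarrow> 1) (at 0)" by (rule tendsto_affine_at_infinity)
      thus ?thesis using True * A(1) by (intro exI[of _ 1]) (simp add: bin_deg_point bin_val_point)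
    next
      case False
      thus ?thesis using * A(1) by (intro exI[of _ "z a - u"]) (simp add: bin_deg_point bin_val_point)
    qed
  qed
  then obtain L' where L': "L' \<noteq> 0" "bin_deg i b \<ge> 0"
    "((\<lambda>w. bin_val A (z(i := inverse w)) b * w ^ nat (bin_deg i b)) \<longlongrightarrow> L') (at 0)" by blast
  have nonneg: "0 \<le> (\<Sum>b\<in>#M. bin_deg i b)"
    using L(2) by (induction M) auto
  have "((\<lambda>w. (bin_val A (z(i := inverse w)) b * w ^ nat (bin_deg i b)) *
      (bins_val A (z(i := inverse w)) M * w ^ nat (\<Sum>b\<in>#M. bin_deg i b))) \<longlongrightarrow> L' * L) (at 0)"
    by (intro tendsto_mult L L')
  moreover have "bins_val A y (add_mset b M) * w ^ nat (\<Sum>b\<in>#add_mset b M. bin_deg i b) =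
      (bin_val A y b * w ^ nat (bin_deg i b)) * (bins_val A y M * w ^ nat (\<Sum>b\<in>#M. bin_deg i b))" for y w
    using L'(2) nonneg by (simp add: nat_add_distrib power_add mult_ac)
  ultimately have "((\<lambda>w. bins_val A (z(i := inverse w)) (add_mset b M) *
      w ^ nat (\<Sum>b\<in>#add_mset b M. bin_deg i b)) \<longlongrightarrow> L' * L) (at 0)"
    by (simp only:)
  moreover have "\<forall>b'\<in>#add_mset b M. bin_deg i b' \<ge> 0" using L(2) L'(2) by simp
  moreover have "L' * L \<noteq> 0" using L(1) L'(1) by simp
  ultimately show ?case by blast
qed (auto intro!: exI[of _ 1])

lemma pval_at_infinity:
  assumes A: "finite A" "i \<in> A" and P: "lpoly A P" "\<forall>e. P e \<noteq> 0 \<longrightarrow> e i \<le> B"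
  shows "\<exists>L. ((\<lambda>w. pval A P (z(i := inverse w)) * w powi B) \<longlongrightarrow> L) (at 0)"
proof -
  define k where "k = (\<lambda>e. P e * (\<Prod>a\<in>A - {i}. z a powi e a))"
  have "((\<lambda>w. \<Sum>e | P e \<noteq> 0. k e * w ^ nat (B - e i)) \<longlongrightarrow> (\<Sum>e | P e \<noteq> 0. k e * 0 ^ nat (B - e i))) (at 0)"
    by (intro tendsto_intros)
  moreover have "eventually (\<lambda>w. (\<Sum>e | P e \<noteq> 0. k e * w ^ nat (B - e i)) =
      pval A P (z(i := inverse w)) * w powi B) (at 0)"
    using eventually_punctured_disc[OF zero_less_one]
  proof eventually_elim
    case (elim w)
    have "mon A (z(i := inverse w)) e * w powi B = (\<Prod>a\<in>A - {i}. z a powi e a) * w ^ nat (B - e i)"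
      if "P e \<noteq> 0" for e
    proof -
      have "mon A (z(i := inverse w)) e = inverse w powi e i * (\<Prod>a\<in>A - {i}. z a powi e a)"
        unfolding mon_def by (subst prod.remove[OF A]) (auto intro!: prod.cong)
      moreover have "inverse w powi e i * w powi B = w powi (B - e i)"
        using elim by (simp add: power_int_diff power_int_inverse field_simps)
      moreover have "w powi (B - e i) = w ^ nat (B - e i)"
        using P(2) that by (simp add: power_int_def)
      ultimately show ?thesis by (simp add: mult_ac)
    qed
    hence "(\<Sum>e | P e \<noteq> 0. k e * w ^ nat (B - e i)) =
        (\<Sum>e | P e \<noteq> 0. P e * mon A (z(i := inverse w)) e * w powi B)"
      by (intro sum.cong[OF refl]) (simp add: k_def mult.assoc)
    thus ?case by (simp only: pval_def sum_distrib_right)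
  qed
  ultimately show ?thesis by (intro exI) (rule Lim_transform_eventually)
qed

context cft_functional
begin

text \<open>With k points, the truncation bound for exponents of z i is h (k - 1) - h = h k - 2 h,
  against the degree h k of the point factors. The remaining factors contribute equally to numerator
  and denominator, so the quotient is O(z^(-2 h)), as a form of weight h requires.\<close>

lemma eta_amp_at_infinity:
  assumes V: "\<forall>a<l. \<psi> a \<in> V (h a)" and z: "z \<in> cspace l - eta_singularities us l" and i: "i < l"
  shows "nonsingular_at_infinity (\<lambda>z. eta_amp (insertions l \<psi> z)) z i (h i)"
proof -
  define A where "A = {..<l}"
  define os where "os = [0..<l]"
  have os: "distinct os" "set os = A" by (auto simp: os_def A_def)
  have fin: "finite A" "i \<in> A" using i by (auto simp: A_def)
  \<comment> \<open>The degree count needs the explicit truncation of quasiprimary states, not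
    merely some truncation.\<close>
  define vs where "vs = (\<lambda>a. concat (replicate (h a) us))"
  define K where "K = (\<lambda>a. int (h a) * (int (length us) - 1))"
  have vs: "trunc_data \<psi> vs K A"
    unfolding trunc_data_def vs_def K_def using V truncates_V by (auto simp: A_def)
  have wts0: "\<forall>a<l. \<psi> a \<in> wt (h a)" using V V_quasiprimary by blast
  hence wts: "\<forall>a\<in>set os. \<psi> a \<in> wt (h a)" by (auto simp: os A_def)
  have tr: "\<And>a. a \<in> set os \<Longrightarrow> truncates (vs a) (K a) (\<psi> a)"
    using vs by (auto simp: trunc_data_def os)
  define M where "M = den h vs A"
  define P where "P = acts M (cf \<psi> h os)"
  define D where "D = (\<Sum>b\<in>#M. bin_deg i b)"
  define B where "B = D - 2 * int (h i)"
  have dn: "denominator A (cf \<psi> h os) M"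
    using den_lpoly[OF wts os(1) tr] by (simp add: os M_def)
  have reg: "regular_pt A z" using z regular_iff[of z l] by (simp add: A_def)
  have PB: "e i \<le> B" if "P e \<noteq> 0" for e
  proof -
    have "point_bins vs i \<subseteq># (\<Sum>a\<in>A. point_bins vs a)"
      using fin by (subst sum.remove[of _ i]) auto
    hence sub: "point_bins vs i \<subseteq># M"
      unfolding M_def den_def by (meson mset_subset_eq_add_right subset_mset.order_trans)
    have "(\<Sum>b\<in>#point_bins vs i. bin_deg i b) = int (length (vs i))"
      by (simp add: point_bins_def image_mset.compositionality o_def bin_deg_point)
    moreover have "length (vs i) = h i * length us"
      by (simp add: vs_def length_concat sum_list_replicate)
    moreover have "D = (\<Sum>b\<in>#M - point_bins vs i. bin_deg i b) + (\<Sum>b\<in>#point_bins vs i. bin_deg i b)"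
      unfolding D_def by (subst subset_mset.diff_add[OF sub, symmetric]) (simp only: image_mset_union sum_mset.union)
    moreover have "e i \<le> K i - int (h i) + (\<Sum>b\<in>#M - point_bins vs i. bin_deg i b)"
      using den_bound[OF wts os(1), of i vs "K i" e] fin tr that by (simp add: os P_def M_def)
    ultimately show ?thesis by (simp add: B_def K_def algebra_simps)
  qed
  have lp: "lpoly A P" using dn by (simp add: denominator_def P_def)
  obtain L1 where L1: "((\<lambda>w. pval A P (z(i := inverse w)) * w powi B) \<longlongrightarrow> L1) (at 0)"
    using pval_at_infinity[OF fin lp, of B] PB by blast
  obtain L2 where L2: "L2 \<noteq> 0" "\<forall>b\<in>#M. bin_deg i b \<ge> 0"
    "((\<lambda>w. bins_val A (z(i := inverse w)) M * w ^ nat D) \<longlongrightarrow> L2) (at 0)"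
  proof -
    have "(\<exists>a c. a \<in> A \<and> c \<in> A \<and> a \<noteq> c \<and> b = pair_bin a c) \<or>
       (\<exists>a u. a \<in> A \<and> z a \<noteq> u \<and> b = point_bin a u)" if "b \<in># M" for b
      using in_den[OF fin(1) that[unfolded M_def]]
    proof (elim disjE exE conjE)
      fix a u assume *: "a \<in> A" "u \<in> set (vs a)" "b = point_bin a u"
      have "u \<in> set us" using vs * unfolding trunc_data_def truncates_def by blast
      moreover have "z a \<notin> set us" using reg * unfolding regular_pt_def by blast
      ultimately have "z a \<noteq> u" by auto
      thus ?thesis using * by blast
    qed blast
    from bins_val_at_infinity[OF fin _ this] reg that show ?thesis
      unfolding regular_pt_def D_def by blast
  qed
  have D0: "D \<ge> 0" unfolding D_def using L2(2) by (induction M) auto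
  have "((\<lambda>w. (-1) ^ h i * ((pval A P (z(i := inverse w)) * w powi B) / (bins_val A (z(i := inverse w)) M * w ^ nat D)))
      \<longlongrightarrow> (-1) ^ h i * (L1 / L2)) (at 0)"
    by (intro tendsto_intros L1 L2)
  moreover have "eventually (\<lambda>w. (-1) ^ h i * ((pval A P (z(i := inverse w)) * w powi B) / (bins_val A (z(i := inverse w)) M * w ^ nat D))
      = eta_amp (insertions l \<psi> (z(i := inverse w))) * (- inverse (w\<^sup>2)) ^ h i) (at 0)"
  proof -
    have "finite (inverse ` (set us \<union> z ` A))" using fin by auto
    hence "eventually (\<lambda>w. w \<notin> inverse ` (set us \<union> z ` A)) (at (0::complex))"
      by (rule eventually_notin_finite)
    thus ?thesis using eventually_punctured_disc[OF zero_less_one]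
    proof eventually_elim
      case (elim w)
      have nin: "inverse w \<notin> set us \<union> z ` A"
      proof
        assume "inverse w \<in> set us \<union> z ` A"
        hence "inverse (inverse w) \<in> inverse ` (set us \<union> z ` A)" by blast
        thus False using elim by auto
      qed
      have reg': "regular_pt A (z(i := inverse w))"
        unfolding regular_pt_def
      proof (intro conjI ballI)
        show "inj_on (z(i := inverse w)) A"
          by (rule inj_on_fun_updI) (use reg nin in \<open>auto simp: regular_pt_def\<close>)
        show "(z(i := inverse w)) a \<notin> set us" if "a \<in> A" for a
          using that reg nin by (cases "a = i") (auto simp: regular_pt_def)
      qed
      have "eta_amp (insertions l \<psi> (z(i := inverse w))) =
          pval A P (z(i := inverse w)) / bins_val A (z(i := inverse w)) M"
        using eta_amp_insertions[OF wts0, of "z(i := inverse w)"] reg'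
          rval_cf[OF wts os(1), of vs K "z(i := inverse w)"] vs
        by (simp add: os M_def P_def A_def[symmetric] os_def[symmetric])
      moreover have "w powi B / w ^ nat D = inverse (w\<^sup>2) ^ h i"
      proof -
        have "w powi B = w powi D / w powi (2 * int (h i))"
          unfolding B_def using elim by (subst power_int_diff) auto
        also have "w powi D = w ^ nat D" using D0 by (simp add: power_int_def)
        also have "w powi (2 * int (h i)) = (w\<^sup>2) ^ h i"
        proof -
          have "2 * int (h i) = int (2 * h i)" by simp
          thus ?thesis by (simp only: power_int_of_nat power_mult)
        qed
        finally show ?thesis using elim by (simp add: power_inverse divide_inverse)
      qed
      moreover have "x * ((p * s) / (b * t)) = p / b * (x * (s / t))" for x p s b t :: complex by simp
      ultimately show ?case
        unfolding power_minus[of "inverse (w\<^sup>2)"] by metis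
    qed
  qed
  ultimately have "((\<lambda>w. eta_amp (insertions l \<psi> (z(i := inverse w))) * (- inverse (w\<^sup>2)) ^ h i)
      \<longlongrightarrow> (-1) ^ h i * (L1 / L2)) (at 0)"
    by (rule Lim_transform_eventually)
  thus ?thesis unfolding nonsingular_at_infinity_def by blast
qed

end

section \<open>The operator product expansion\<close>

definition poly_family :: "(complex \<Rightarrow> complex \<Rightarrow> complex) \<Rightarrow> (complex \<Rightarrow> complex poly) \<Rightarrow> bool" where
  "poly_family f p \<longleftrightarrow> (\<forall>s y. f s y = poly (p s) y) \<and> (\<forall>q. (\<lambda>s. coeff (p s) q) holomorphic_on UNIV)"

lemma poly_family_const: "g holomorphic_on UNIV \<Longrightarrow> poly_family (\<lambda>s y. g s) (\<lambda>s. [:g s:])"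
  unfolding poly_family_def
proof (intro conjI allI)
  fix q assume "g holomorphic_on UNIV"
  thus "(\<lambda>s. coeff [:g s:] q) holomorphic_on UNIV"
    by (cases q) (simp_all add: holomorphic_on_const)
qed simp

lemma poly_family_shift: "g holomorphic_on UNIV \<Longrightarrow> poly_family (\<lambda>s y. g s + y) (\<lambda>s. [:g s, 1:])"
  unfolding poly_family_def
proof (intro conjI allI)
  fix q assume g: "g holomorphic_on UNIV"
  show "(\<lambda>s. coeff [:g s, 1:] q) holomorphic_on UNIV"
  proof (cases q)
    case (Suc n)
    thus ?thesis by (cases n) (simp_all add: holomorphic_on_const)
  qed (use g in simp)
qed (simp add: add.commute)

lemma poly_family_add:
  "poly_family f p \<Longrightarrow> poly_family g r \<Longrightarrow> poly_family (\<lambda>s y. f s y + g s y) (\<lambda>s. p s + r s)"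
  and poly_family_diff:
  "poly_family f p \<Longrightarrow> poly_family g r \<Longrightarrow> poly_family (\<lambda>s y. f s y - g s y) (\<lambda>s. p s - r s)"
  and poly_family_mult:
  "poly_family f p \<Longrightarrow> poly_family g r \<Longrightarrow> poly_family (\<lambda>s y. f s y * g s y) (\<lambda>s. p s * r s)"
  by (auto simp: poly_family_def coeff_mult intro!: holomorphic_intros)

text \<open>In the application s runs along a complex line of configurations and y is the separation
  z i - z j; the Taylor coefficients in y are then holomorphic in s.\<close>

definition polynomial_family :: "(complex \<Rightarrow> complex \<Rightarrow> complex) \<Rightarrow> bool" where
  "polynomial_family f \<longleftrightarrow> (\<exists>p. poly_family f p)"

lemma polynomial_family_const: "g holomorphic_on UNIV \<Longrightarrow> polynomial_family (\<lambda>s y. g s)"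
  and polynomial_family_shift: "g holomorphic_on UNIV \<Longrightarrow> polynomial_family (\<lambda>s y. g s + y)"
  and polynomial_family_diff:
  "polynomial_family f \<Longrightarrow> polynomial_family g' \<Longrightarrow> polynomial_family (\<lambda>s y. f s y - g' s y)"
  and polynomial_family_mult:
  "polynomial_family f \<Longrightarrow> polynomial_family g' \<Longrightarrow> polynomial_family (\<lambda>s y. f s y * g' s y)"
  and polynomial_family_add:
  "polynomial_family f \<Longrightarrow> polynomial_family g' \<Longrightarrow> polynomial_family (\<lambda>s y. f s y + g' s y)"
  unfolding polynomial_family_def
  using poly_family_const poly_family_shift poly_family_diff poly_family_mult poly_family_add by blast+

lemma polynomial_family_num: "polynomial_family (\<lambda>s y. k)"
  by (rule polynomial_family_const) (rule holomorphic_on_const)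

lemma polynomial_family_sum:
  "(\<And>i. i \<in> I \<Longrightarrow> polynomial_family (f i)) \<Longrightarrow> polynomial_family (\<lambda>s y. \<Sum>i\<in>I. f i s y)"
  by (induction I rule: infinite_finite_induct) (simp_all add: polynomial_family_add polynomial_family_num)

lemma polynomial_family_prod:
  "(\<And>i. i \<in> I \<Longrightarrow> polynomial_family (f i)) \<Longrightarrow> polynomial_family (\<lambda>s y. \<Prod>i\<in>I. f i s y)"
  by (induction I rule: infinite_finite_induct) (simp_all add: polynomial_family_mult polynomial_family_num)

lemma polynomial_family_power:
  "polynomial_family f \<Longrightarrow> polynomial_family (\<lambda>s y. f s y ^ n)"
  by (induction n) (simp_all add: polynomial_family_mult polynomial_family_num)

lemma polynomial_family_mon:
  assumes "\<And>a. a \<in> A \<Longrightarrow> polynomial_family (\<lambda>s y. Z s y a)" "\<And>i. 0 \<le> x i"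
  shows "polynomial_family (\<lambda>s y. mon A (Z s y) x)"
  unfolding mon_nonneg[OF assms(2)] by (intro polynomial_family_prod polynomial_family_power assms)

lemma polynomial_family_pval:
  assumes "\<And>a. a \<in> A \<Longrightarrow> polynomial_family (\<lambda>s y. Z s y a)" "lpoly A c"
  shows "polynomial_family (\<lambda>s y. pval A c (Z s y))"
  unfolding pval_def
  by (intro polynomial_family_sum polynomial_family_mult polynomial_family_num polynomial_family_mon assms)
     (use assms(2) in \<open>auto simp: lpoly_def\<close>)

lemma polynomial_family_bins_val:
  assumes "\<And>a. a \<in> A \<Longrightarrow> polynomial_family (\<lambda>s y. Z s y a)" "\<forall>b\<in>#M. bin_ok A b"
  shows "polynomial_family (\<lambda>s y. bins_val A (Z s y) M)"
  using assms(2)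
proof (induction M)
  case (add b M)
  obtain \<alpha> x \<beta> y where b: "b = (\<alpha>, x, \<beta>, y)" by (metis prod_cases4)
  have "polynomial_family (\<lambda>s y. bin_val A (Z s y) b)"
    unfolding b bin_val.simps
    by (intro polynomial_family_diff polynomial_family_mult polynomial_family_num polynomial_family_mon assms)
       (use add.prems in \<open>auto simp: b\<close>)
  with add show ?case by (simp add: polynomial_family_mult)
qed (simp add: polynomial_family_num)

lemma polynomial_family_holomorphic:
  assumes "polynomial_family f"
  shows "(\<lambda>s. f s 0) holomorphic_on UNIV"
proof -
  obtain p where "poly_family f p" using assms by (auto simp: polynomial_family_def)
  hence "(\<lambda>s. coeff (p s) 0) holomorphic_on UNIV" "\<And>s. f s 0 = coeff (p s) 0"
    by (auto simp: poly_family_def poly_0_coeff_0)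
  thus ?thesis by simp
qed

text \<open>The coefficients of X = F / G are determined recursively by F = X G, and each step
  divides only by the constant term of G.\<close>

lemma fps_quotient_holomorphic:
  fixes F G :: "complex \<Rightarrow> complex fps"
  assumes "\<And>q. (\<lambda>x. fps_nth (F x) q) holomorphic_on S" "\<And>q. (\<lambda>x. fps_nth (G x) q) holomorphic_on S"
    and "\<And>x. x \<in> S \<Longrightarrow> fps_nth (G x) 0 \<noteq> 0"
  shows "(\<lambda>x. fps_nth (F x / G x) q) holomorphic_on S"
proof (induction q rule: less_induct)
  case (less q)
  have eq: "fps_nth (F x / G x) q =
      (fps_nth (F x) q - (\<Sum>i<q. fps_nth (F x / G x) i * fps_nth (G x) (q - i))) / fps_nth (G x) 0" if "x \<in> S" for x
  proof -
    have "is_unit (G x)" using assms(3)[OF that] by simp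
    hence "F x = F x / G x * G x" by simp
    hence "fps_nth (F x) q = (\<Sum>i=0..q. fps_nth (F x / G x) i * fps_nth (G x) (q - i))"
      by (metis fps_mult_nth)
    also have "{0..q} = insert q {..<q}" by auto
    also have "(\<Sum>i\<in>insert q {..<q}. fps_nth (F x / G x) i * fps_nth (G x) (q - i)) =
       fps_nth (F x / G x) q * fps_nth (G x) 0 + (\<Sum>i<q. fps_nth (F x / G x) i * fps_nth (G x) (q - i))"
      by simp
    finally show ?thesis using assms(3)[OF that] by (simp add: field_simps)
  qed
  have "(\<lambda>x. (fps_nth (F x) q - (\<Sum>i<q. fps_nth (F x / G x) i * fps_nth (G x) (q - i))) / fps_nth (G x) 0) holomorphic_on S"
    by (intro holomorphic_intros assms less) auto
  thus ?case by (rule holomorphic_transform) (simp add: eq)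
qed

lemma has_sum_of_fps_expansion:
  assumes "f has_fps_expansion F"
  shows "eventually (\<lambda>y. ((\<lambda>q. y ^ q * fps_nth F q) has_sum f y) UNIV) (at (0::complex))"
proof -
  have "fps_conv_radius F > 0" using assms by (simp add: has_fps_expansion_def)
  then obtain r where r: "0 < ereal r" "ereal r < fps_conv_radius F" using ereal_dense2 by blast
  have "eventually (\<lambda>y. eval_fps F y = f y) (at 0)"
    using assms unfolding has_fps_expansion_def by (auto simp: eventually_at_filter elim: eventually_mono)
  moreover have "eventually (\<lambda>y::complex. 0 < norm y \<and> norm y < r) (at 0)"
    using r by (intro eventually_punctured_disc) simp
  ultimately show ?thesis
  proof eventually_elim
    case (elim y)
    hence y: "ereal (norm y) < fps_conv_radius F" using r(2) by (metis ereal_less_le less_ereal.simps(1) less_trans)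
    have "((\<lambda>q. fps_nth F q * y ^ q) has_sum eval_fps F y) UNIV"
      by (rule norm_summable_imp_has_sum[OF norm_summable_fps[OF y] sums_eval_fps[OF y]])
    thus ?case using elim by (simp add: mult.commute)
  qed
qed

lemma power_series_unique:
  assumes "eventually (\<lambda>y. ((\<lambda>q::nat. y ^ q * a q) has_sum f y) UNIV) (at (0::complex))"
    and "eventually (\<lambda>y. ((\<lambda>q::nat. y ^ q * b q) has_sum f y) UNIV) (at 0)"
  shows "a = b"
proof -
  have *: "eventually (\<lambda>y. ((\<lambda>n::int. y powi n * (if n < 0 then 0 else a (nat n))) has_sum f y) UNIV) (at 0)"
    if "eventually (\<lambda>y. ((\<lambda>q::nat. y ^ q * a q) has_sum f y) UNIV) (at 0)" for a
    using that by eventually_elim (subst has_sum_int_nat[where N = 0], auto)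
  have "(\<lambda>n::int. if n < 0 then 0 else a (nat n)) = (\<lambda>n. if n < 0 then 0 else b (nat n))"
    by (rule powi_series_unique[OF _ _ *[OF assms(1)] *[OF assms(2)], of 0 0]) auto
  from fun_cong[OF this, of "int _"] show ?thesis by auto
qed

text \<open>A complex line through a base point of the region of convergence meets the singularities in finitely
  many points, so identities between rational functions propagate along it.\<close>

lemma line_regular_cofinite:
  fixes z0 z1 :: "nat \<Rightarrow> complex"
  assumes A: "finite A" and "inj_on z0 A" "\<And>a. a \<in> A \<Longrightarrow> z0 a \<notin> S" "finite S"
  shows "finite {t. \<not> (inj_on (\<lambda>a. z0 a + t * (z1 a - z0 a)) A \<and> (\<forall>a\<in>A. z0 a + t * (z1 a - z0 a) \<notin> S))}"
proof -
  have lin: "finite {t::complex. p + t * q = 0}" if "p \<noteq> 0" for p q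
  proof (rule finite_subset)
    show "{t. p + t * q = 0} \<subseteq> {- p / q}"
    proof
      fix t assume "t \<in> {t. p + t * q = 0}"
      hence *: "t * q = - p" by (simp add: add_eq_0_iff)
      with that have "q \<noteq> 0" by auto
      hence "t = t * q / q" by simp
      thus "t \<in> {- p / q}" unfolding * by simp
    qed
  qed simp
  have "finite (\<Union>a\<in>A. \<Union>b\<in>A - {a}. {t. (z0 a - z0 b) + t * ((z1 a - z0 a) - (z1 b - z0 b)) = 0})"
    using A assms(2) by (intro finite_UN_I lin) (auto simp: inj_on_def)
  moreover have "finite (\<Union>a\<in>A. \<Union>s\<in>S. {t. (z0 a - s) + t * (z1 a - z0 a) = 0})"
    using A assms(3,4) by (intro finite_UN_I lin) auto
  ultimately show ?thesis
  proof (rule rev_finite_subset[OF finite_UnI], intro subsetI)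
    fix t assume "t \<in> {t. \<not> (inj_on (\<lambda>a. z0 a + t * (z1 a - z0 a)) A \<and> (\<forall>a\<in>A. z0 a + t * (z1 a - z0 a) \<notin> S))}"
    hence "(\<exists>a\<in>A. \<exists>b\<in>A. a \<noteq> b \<and> z0 a + t * (z1 a - z0 a) = z0 b + t * (z1 b - z0 b)) \<or>
       (\<exists>a\<in>A. \<exists>s\<in>S. z0 a + t * (z1 a - z0 a) = s)"
      unfolding inj_on_def by blast
    thus "t \<in> (\<Union>a\<in>A. \<Union>b\<in>A - {a}. {t. (z0 a - z0 b) + t * ((z1 a - z0 a) - (z1 b - z0 b)) = 0}) \<union>
        (\<Union>a\<in>A. \<Union>s\<in>S. {t. (z0 a - s) + t * (z1 a - z0 a) = 0})"
    proof
      assume "\<exists>a\<in>A. \<exists>b\<in>A. a \<noteq> b \<and> z0 a + t * (z1 a - z0 a) = z0 b + t * (z1 b - z0 b)"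
      then obtain a b where "a \<in> A" "b \<in> A - {a}" "(z0 a - z0 b) + t * ((z1 a - z0 a) - (z1 b - z0 b)) = 0"
        by (force simp: algebra_simps)
      thus ?thesis by blast
    next
      assume "\<exists>a\<in>A. \<exists>s\<in>S. z0 a + t * (z1 a - z0 a) = s"
      then obtain a s where "a \<in> A" "s \<in> S" "(z0 a - s) + t * (z1 a - z0 a) = 0" by force
      thus ?thesis by blast
    qed
  qed
qed

context cft_functional
begin

section \<open>The regularized pair of operators\<close>

lemma pair_bins_split_strong:
  assumes "finite A" "(i, j) \<in> ordered_pairs A"
  obtains N where "pair_bins h A = N + replicate_mset (h i + h j) (pair_bin i j)"
    "\<And>b. b \<in># N \<Longrightarrow> \<exists>a c. (a, c) \<in> ordered_pairs A \<and> (a, c) \<noteq> (i, j) \<and> b = pair_bin a c"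
proof
  let ?N = "(\<Sum>(a, b)\<in>ordered_pairs A - {(i, j)}. replicate_mset (h a + h b) (pair_bin a b))"
  show "pair_bins h A = ?N + replicate_mset (h i + h j) (pair_bin i j)"
    unfolding pair_bins_def
    by (subst sum.remove[OF finite_ordered_pairs[OF assms(1)] assms(2)]) (simp add: add.commute)
  fix b assume "b \<in># ?N"
  moreover have "finite (ordered_pairs A - {(i, j)})" using finite_ordered_pairs[OF assms(1)] by simp
  ultimately obtain a c where "(a, c) \<in> ordered_pairs A - {(i, j)}" "b \<in># replicate_mset (h a + h c) (pair_bin a c)"
    by (subst (asm) set_mset_sum) force+
  thus "\<exists>a c. (a, c) \<in> ordered_pairs A \<and> (a, c) \<noteq> (i, j) \<and> b = pair_bin a c"
    by (auto split: if_splits)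
qed

text \<open>The labels \<open>i < j\<close> carry the two vertex operators that are brought together.\<close>

context
  fixes \<psi> :: "nat \<Rightarrow> 'h" and h :: "nat \<Rightarrow> nat" and i j :: nat and rest :: "nat list"
    and vs :: "nat \<Rightarrow> complex list" and K :: "nat \<Rightarrow> int"
  assumes ij: "i < j" and dist: "distinct (i # j # rest)"
    and wts: "\<forall>a\<in>set (i # j # rest). \<psi> a \<in> wt (h a)"
    and vs: "trunc_data \<psi> vs K (set (i # j # rest))"
begin

definition ope_A where "ope_A = set (i # j # rest)"
definition ope_B where "ope_B = set (j # rest)"
definition ope_order where "ope_order = h i + h j"
text \<open>The state of weight q in the operator product. It accompanies (z i - z j)^(q - h i - h
  j), so q is its exponent after multiplication by the regularizing power, and q = 0 is the most
  singular term.\<close>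

definition ope_state where "ope_state q = md (\<psi> i) (h i) (int q - int (h i + h j)) (\<psi> j)"
definition ope_cf where "ope_cf q = cf (\<psi>(j := ope_state q)) (h(j := q)) (j # rest)"
definition ope_num where "ope_num = acts (den h vs ope_A) (cf \<psi> h (i # j # rest))"
definition ope_series where
  "ope_series = acts (replicate_mset ope_order (pair_bin i j)) (cf \<psi> h (i # j # rest))"
text \<open>The factors left after removing those that vanish at z i = z j; they remain nonzero at
  the collision.\<close>

definition ope_den where "ope_den = den h vs ope_A - replicate_mset ope_order (pair_bin i j)"

lemma ope_state_weight: "ope_state q \<in> wt q"
  using md_weight[of "\<psi> i" "h i" "\<psi> j" "h j" "int q - int (h i + h j)"] wts
  by (simp add: ope_state_def)

lemma ope_wts: "\<forall>a\<in>set (j # rest). (\<psi>(j := ope_state q)) a \<in> wt ((h(j := q)) a)"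
  using wts ope_state_weight by auto

lemma ope_den_split: "den h vs ope_A = ope_den + replicate_mset ope_order (pair_bin i j)"
  and ope_den_mem: "b \<in># ope_den \<Longrightarrow>
    (\<exists>a c. a \<in> ope_A \<and> c \<in> ope_A \<and> a \<noteq> c \<and> (a, c) \<noteq> (i, j) \<and> (a, c) \<noteq> (j, i) \<and> b = pair_bin a c) \<or>
    (\<exists>a u. a \<in> ope_A \<and> u \<in> set (vs a) \<and> b = point_bin a u)"
proof -
  have fin: "finite ope_A" by (simp add: ope_A_def)
  have "(i, j) \<in> ordered_pairs ope_A" using ij by (simp add: ordered_pairs_def ope_A_def)
  then obtain N where N: "pair_bins h ope_A = N + replicate_mset (h i + h j) (pair_bin i j)"
    "\<And>b. b \<in># N \<Longrightarrow> \<exists>a c. (a, c) \<in> ordered_pairs ope_A \<and> (a, c) \<noteq> (i, j) \<and> b = pair_bin a c"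
    using pair_bins_split_strong[OF fin] by blast
  have eq: "ope_den = N + (\<Sum>a\<in>ope_A. point_bins vs a)"
    by (simp add: ope_den_def den_def N(1) ope_order_def)
  show "den h vs ope_A = ope_den + replicate_mset ope_order (pair_bin i j)"
    unfolding eq by (simp add: den_def N(1) ope_order_def)
  show "(\<exists>a c. a \<in> ope_A \<and> c \<in> ope_A \<and> a \<noteq> c \<and> (a, c) \<noteq> (i, j) \<and> (a, c) \<noteq> (j, i) \<and> b = pair_bin a c) \<or>
    (\<exists>a u. a \<in> ope_A \<and> u \<in> set (vs a) \<and> b = point_bin a u)" if "b \<in># ope_den"
  proof -
    have "b \<in># N \<or> b \<in># (\<Sum>a\<in>ope_A. point_bins vs a)" using that by (simp add: eq)
    thus ?thesis
    proof
      assume "b \<in># N"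
      from N(2)[OF this] obtain a c where "(a, c) \<in> ordered_pairs ope_A" "(a, c) \<noteq> (i, j)" "b = pair_bin a c"
        by blast
      moreover have "(a, c) \<noteq> (j, i)" using calculation(1) ij by (auto simp: ordered_pairs_def)
      ultimately show ?thesis by (auto simp: ordered_pairs_def)
    next
      assume "b \<in># (\<Sum>a\<in>ope_A. point_bins vs a)"
      thus ?thesis using fin by (auto simp: set_mset_sum point_bins_def)
    qed
  qed
qed

lemma ope_den_ok: "\<forall>b\<in>#ope_den. bin_ok ope_A b"
  using den_ok[of ope_A h vs] ope_den_split by (auto simp: ope_A_def)

lemma ope_num_lpoly: "lpoly ope_A ope_num"
proof -
  have "denominator (set (i # j # rest)) (cf \<psi> h (i # j # rest)) (den h vs (set (i # j # rest)))"
    by (rule den_lpoly[OF wts dist]) (use vs in \<open>auto simp: trunc_data_def\<close>)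
  thus ?thesis by (simp only: denominator_def ope_num_def ope_A_def)
qed

lemma ope_num_eq: "ope_num = acts ope_den ope_series"
  by (simp add: ope_num_def ope_series_def ope_den_split acts_union)

lemma ope_rval:
  assumes "regular_pt ope_A (z(i := z j + y))"
  shows "y ^ ope_order * rval ope_A (cf \<psi> h (i # j # rest)) (z(i := z j + y)) =
     pval ope_A ope_num (z(i := z j + y)) / bins_val ope_A (z(i := z j + y)) ope_den"
proof -
  let ?Z = "z(i := z j + y)"
  have fin: "finite ope_A" and mem: "i \<in> ope_A" "j \<in> ope_A" by (auto simp: ope_A_def)
  have "bin_val ope_A ?Z (pair_bin i j) = y"
    using bin_val_pair[OF fin mem, of ?Z] ij by simp
  hence "bins_val ope_A ?Z (den h vs ope_A) = bins_val ope_A ?Z ope_den * y ^ ope_order"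
    by (simp add: ope_den_split)
  moreover have "bins_val ope_A ?Z (den h vs ope_A) \<noteq> 0"
    by (rule den_val_regular[OF fin _ assms]) (use vs in \<open>simp add: ope_A_def\<close>)
  moreover have "rval ope_A (cf \<psi> h (i # j # rest)) ?Z = pval ope_A ope_num ?Z / bins_val ope_A ?Z (den h vs ope_A)"
    unfolding ope_num_def unfolding ope_A_def
    by (rule rval_cf[OF wts dist vs]) (use assms in \<open>simp add: ope_A_def\<close>)
  moreover have "s * (p / B) = p / b" if "B = b * s" "B \<noteq> 0" for s p b B :: complex using that by simp
  ultimately show ?thesis by metis
qed

text \<open>Setting z i = z j merges the labels i and j only, and the one pair made equal by this
  has been removed from the denominator.\<close>

lemma ope_den_nonzero:
  assumes "regular_pt ope_B z"
  shows "bins_val ope_A (z(i := z j)) ope_den \<noteq> 0"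
proof -
  have fin: "finite ope_A" by (auto simp: ope_A_def)
  have inj: "inj_on z ope_B" and us: "\<And>a. a \<in> ope_B \<Longrightarrow> z a \<notin> set us"
    using assms by (auto simp: regular_pt_def)
  define f where "f = (\<lambda>a. if a = i then j else a)"
  have Z: "(z(i := z j)) a = z (f a)" for a by (simp add: f_def)
  have fB: "f a \<in> ope_B" if "a \<in> ope_A" for a using that by (auto simp: f_def ope_A_def ope_B_def)
  have "bin_val ope_A (z(i := z j)) b \<noteq> 0" if "b \<in># ope_den" for b
    using ope_den_mem[OF that]
  proof (elim disjE exE conjE)
    fix a c assume *: "a \<in> ope_A" "c \<in> ope_A" "a \<noteq> c" "(a, c) \<noteq> (i, j)" "(a, c) \<noteq> (j, i)" "b = pair_bin a c"
    have "f a \<noteq> f c" using * ij by (auto simp: f_def split: if_splits)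
    hence "z (f a) \<noteq> z (f c)" using inj fB * by (auto simp: inj_on_eq_iff)
    thus ?thesis unfolding *(6) bin_val_pair[OF fin *(1,2)] Z by simp
  next
    fix a u assume *: "a \<in> ope_A" "u \<in> set (vs a)" "b = point_bin a u"
    have "u \<in> set us" using vs * unfolding trunc_data_def truncates_def ope_A_def by blast
    hence "z (f a) \<noteq> u" using us[OF fB[OF *(1)]] by auto
    thus ?thesis unfolding *(3) bin_val_point[OF fin *(1)] Z by simp
  qed
  thus ?thesis by (auto simp: prod_mset_zero_iff)
qed

text \<open>A condition on the points other than z i. The latter may fill a whole annulus around the
  circle of radius |z j|, as a Taylor expansion at z j needs points on both sides of that
  circle.\<close>

definition ope_region :: "(nat \<Rightarrow> complex) \<Rightarrow> bool" where
  "ope_region z \<longleftrightarrow> decreasing z (j # rest) \<and> (\<forall>a\<in>ope_B. z a \<noteq> 0 \<and> (\<forall>u\<in>set us. norm (z a) < norm u))"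

text \<open>With the factors for the pair i, j already multiplied in, no expansion of 1 / (z i - z
  j) takes place, so the series converges irrespective of which of the two moduli is larger.\<close>

lemma ope_series_has_sum:
  assumes reg: "ope_region z"
    and t: "t \<noteq> 0" "\<And>a. a \<in> set rest \<Longrightarrow> norm (z a) < norm t" "\<And>u. u \<in> set us \<Longrightarrow> norm t < norm u"
  shows "((\<lambda>e. ope_series e * mon ope_A (z(i := t)) e) has_sum
     pval ope_A ope_num (z(i := t)) / bins_val ope_A (z(i := t)) ope_den) UNIV"
  unfolding ope_A_def
proof (rule cone_division[OF dist])
  let ?Z = "z(i := t)"
  show "?Z a \<noteq> 0" if "a \<in> set (i # j # rest)" for a
    using that reg t(1) by (auto simp: ope_region_def ope_B_def)
  define S where "S = sum_list (map (\<lambda>a. int (h a)) (i # j # rest))"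
  show "in_cone (i # j # rest) S e" if "ope_series e \<noteq> 0" for e
  proof (rule acts_support[where A = "set (i # j # rest)"])
    show "acts (replicate_mset ope_order (pair_bin i j)) (cf \<psi> h (i # j # rest)) e \<noteq> 0"
      using that by (simp add: ope_series_def)
    show "\<forall>b\<in>#replicate_mset ope_order (pair_bin i j). bin_ok (set (i # j # rest)) b"
      by (auto intro!: bin_ok_pair split: if_splits)
    show "in_cone (i # j # rest) S e" if "cf \<psi> h (i # j # rest) e \<noteq> 0" for e
      unfolding S_def by (rule cf_in_cone[OF wts that])
  qed (rule in_cone_add)
  \<comment> \<open>The relation exempts the pair i, j from the comparison of moduli;
    \<open>ope_den_mem\<close> shows that no remaining factor refers to this pair.\<close>
  have sorted: "sorted_wrt (\<lambda>a b. norm (?Z b) < norm (?Z a) \<or> a = i \<and> b = j) (i # j # rest)"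
  proof -
    have "sorted_wrt (\<lambda>a b. norm (z b) < norm (z a)) (j # rest)"
      using reg by (simp add: ope_region_def decreasing_def)
    hence "sorted_wrt (\<lambda>a b. norm (?Z b) < norm (?Z a) \<or> a = i \<and> b = j) (j # rest)"
      by (rule sorted_wrt_mono_rel[rotated]) (use dist in auto)
    thus ?thesis using t(2) dist by auto
  qed
  fix b assume "b \<in># ope_den"
  from ope_den_mem[OF this, unfolded ope_A_def]
  show "(\<exists>a c pre suf. (b = pair_bin a c \<or> b = pair_bin c a) \<and> i # j # rest = pre @ a # suf \<and> c \<in> set suf \<and>
         norm (?Z c) < norm (?Z a)) \<or> (\<exists>a u. a \<in> set (i # j # rest) \<and> norm (?Z a) < norm u \<and> b = point_bin a u)"
  proof (elim disjE exE conjE)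
    fix a c assume *: "a \<in> set (i # j # rest)" "c \<in> set (i # j # rest)" "a \<noteq> c" "(a, c) \<noteq> (i, j)" "(a, c) \<noteq> (j, i)"
      "b = pair_bin a c"
    show ?thesis
      by (rule sorted_wrt_order[OF sorted *(1-3)]) (use *(4-6) in blast)+
  next
    fix a u assume *: "a \<in> set (i # j # rest)" "u \<in> set (vs a)" "b = point_bin a u"
    have "u \<in> set us" using vs * unfolding trunc_data_def truncates_def by blast
    hence "norm (?Z a) < norm u" using t(3) reg * by (auto simp: ope_region_def ope_B_def)
    thus ?thesis using * by blast
  qed
next
  show "((\<lambda>e. acts ope_den ope_series e * mon (set (i # j # rest)) (z(i := t)) e) has_sum
      pval (set (i # j # rest)) ope_num (z(i := t))) UNIV"
    using pval_has_sum[OF ope_num_lpoly] by (simp add: ope_num_eq ope_A_def)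
qed

text \<open>The Taylor coefficients of the regularized series at \<open>z\<^sub>i = z\<^sub>j\<close> are given by \<open>mode_associativity\<close>.\<close>

lemma ope_coefficient:
  assumes f: "f i = 0"
  shows "((\<lambda>a. (of_int a gchoose q) * ope_series (f(i := a, j := f j + int q - a))) has_sum ope_cf q f) UNIV"
proof -
  have ne: "i \<noteq> j" "i \<notin> set rest" "j \<notin> set rest" using dist by auto
  define X where "X = word \<psi> h rest f \<Omega>"
  obtain p where X: "X \<in> wt p"
    unfolding X_def by (rule word_homogeneous[of rest \<psi> h f]) (use wts in auto)
  define L where "L = (\<lambda>Y. if supp_in (set (j # rest)) f then \<eta> Y else 0)"
  have Ldiff: "L (Y - Z) = L Y - L Z" for Y Z by (simp add: L_def eta.diff)
  define G where "G = (\<lambda>a b. md (\<psi> i) (h i) a (md (\<psi> j) (h j) b X))"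
  have supp: "supp_in (set (i # j # rest)) (f(i := a, j := b)) = supp_in (set (j # rest)) f" for a b
    using f by (auto simp: supp_in_def)
  have wd: "word \<psi> h rest (f(i := a, j := b)) \<Omega> = X" for a b
    unfolding X_def by (rule word_cong) (use ne in auto)
  have cfG: "cf \<psi> h (i # j # rest) (f(i := a, j := b)) = L (G a b)" for a b
    unfolding cf_def supp word_Cons wd L_def G_def using ne by simp
  have ser: "ope_series (f(i := a, j := b)) = L ((dif ^^ ope_order) G a b)" for a b
  proof -
    have upd: "(f(i := a, j := b))(i := a', j := b') = f(i := a', j := b')" for a' b'
      using ne(1) by (auto simp: fun_eq_iff)
    have at: "(f(i := a, j := b)) i = a" "(f(i := a, j := b)) j = b" using ne(1) by auto
    show ?thesis
      unfolding ope_series_def acts_replicate_pair[OF ne(1)] upd at cfG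
      by (rule dif_additive[OF Ldiff, symmetric])
  qed
  note \<psi>ij = wts[THEN bspec, of i] wts[THEN bspec, of j]
  have low: "(dif ^^ ope_order) G a b = 0" if "a < - int (h i + p) \<or> b < - int (h j + p)" for a b
    unfolding G_def ope_order_def by (rule mode_locality_low[OF _ _ X that]) (use \<psi>ij in auto)
  have L0: "L 0 = 0" by (simp add: L_def eta.zero)
  have cfq: "ope_cf q f = L (md (ope_state q) q (f j) X)"
  proof -
    have "word (\<psi>(j := ope_state q)) (h(j := q)) rest f \<Omega> = X"
      unfolding X_def by (rule word_cong) (use ne in auto)
    thus ?thesis by (simp add: ope_cf_def cf_def word_Cons L_def)
  qed
  \<comment> \<open>By \<open>mode_locality_low\<close> the regularized product vanishes unless a is
    in this range: the lower end bounds the exponent of z i, the upper end that of z j.\<close>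
  define I where "I = {- int (h i + p)..f j + int q + int (h j + p)}"
  have "md (ope_state q) q (f j) X =
      (\<Sum>a\<in>I. smul (of_int a gchoose q) ((dif ^^ ope_order) G a (f j + int q - a)))"
    unfolding ope_state_def I_def G_def ope_order_def
    by (rule mode_associativity[OF _ _ X]) (use \<psi>ij in auto)
  hence "ope_cf q f = (\<Sum>a\<in>I. (of_int a gchoose q) * L ((dif ^^ ope_order) G a (f j + int q - a)))"
    unfolding cfq L_def by (simp add: eta.sum eta.scale)
  thus ?thesis
    unfolding ser
    by (intro has_sum_finite_neutralI[of I]) (auto simp: I_def low L0)
qed

text \<open>The powers of z i = w + y are expanded binomially around w = z j. For each power of y,
  the exponents of z i and z j are then regrouped by their sum, and \<open>ope_coefficient\<close>
  recognizes each group as a coefficient of the series with a single composite state at z j.\<close>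

lemma ope_on_region:
  assumes reg: "ope_region z"
  shows "eventually (\<lambda>y. ((\<lambda>q. y ^ q * rval ope_B (ope_cf q) z) has_sum
     pval ope_A ope_num (z(i := z j + y)) / bins_val ope_A (z(i := z j + y)) ope_den) UNIV) (at 0)"
proof -
  have ne: "i \<noteq> j" "i \<notin> set rest" "j \<notin> set rest" using dist by auto
  define w where "w = z j"
  have w0: "w \<noteq> 0" using reg by (simp add: ope_region_def ope_B_def w_def)
  \<comment> \<open>The width of an annulus around |w| that avoids 0, lies outside all remaining
    points and inside all u.\<close>
  define d where "d = Min (insert (norm w) ((\<lambda>a. norm w - norm (z a)) ` set rest \<union> (\<lambda>u. norm u - norm w) ` set us))"
  have d: "d > 0" unfolding d_def
    using reg w0 by (subst Min_gr_iff) (auto simp: ope_region_def ope_B_def w_def decreasing_def)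
  have dle: "d \<le> norm w" "\<And>a. a \<in> set rest \<Longrightarrow> d \<le> norm w - norm (z a)" "\<And>u. u \<in> set us \<Longrightarrow> d \<le> norm u - norm w"
    unfolding d_def by (rule Min_le, simp, simp)+
  define M where "M = mon ope_B z"
  have M: "mon ope_A (z(i := t)) e = t powi e i * M e" for t e
  proof -
    have "ope_A = insert i ope_B" "i \<notin> ope_B" "finite ope_B" using ne by (auto simp: ope_A_def ope_B_def)
    moreover have "mon ope_B (z(i := t)) e = M e"
      unfolding M_def by (rule mon_cong) (use calculation in auto)
    ultimately show ?thesis by (simp add: mon_def)
  qed
  have hs: "((\<lambda>e. (ope_series e * M e) * t powi e i) has_sum
     pval ope_A ope_num (z(i := t)) / bins_val ope_A (z(i := t)) ope_den) UNIV"
    if "norm w - d < norm t" "norm t < norm w + d" for t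
  proof -
    have "((\<lambda>e. ope_series e * mon ope_A (z(i := t)) e) has_sum
       pval ope_A ope_num (z(i := t)) / bins_val ope_A (z(i := t)) ope_den) UNIV"
    proof (rule ope_series_has_sum[OF reg])
      show "t \<noteq> 0" using that dle(1) by auto
      show "norm (z a) < norm t" if "a \<in> set rest" for a
        using \<open>norm w - d < norm t\<close> dle(2)[OF that] by linarith
      show "norm t < norm u" if "u \<in> set us" for u
        using \<open>norm t < norm w + d\<close> dle(3)[OF that] by linarith
    qed
    thus ?thesis by (simp only: M mult_ac)
  qed
  have sm: "(\<lambda>e. norm (ope_series e * M e) * r powi e i) summable_on UNIV"
    if "norm w - d < r" "r < norm w + d" for r :: real
  proof -
    have r0: "r > 0" using that dle(1) by linarith
    have "(\<lambda>e. (ope_series e * M e) * complex_of_real r powi e i) summable_on UNIV"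
      by (rule has_sum_imp_summable, rule hs) (use that r0 in auto)
    thus ?thesis using r0
      unfolding summable_on_iff_abs_summable_on_complex by (simp add: norm_mult norm_power_int)
  qed
  have coef: "infsum (\<lambda>e. (ope_series e * M e) * ((of_int (e i) gchoose q) * w powi (e i - int q))) UNIV =
      rval ope_B (ope_cf q) z"
    if sq: "(\<lambda>e. (ope_series e * M e) * ((of_int (e i) gchoose q) * w powi (e i - int q))) summable_on UNIV" for q
  proof -
    let ?T = "infsum (\<lambda>e. (ope_series e * M e) * ((of_int (e i) gchoose q) * w powi (e i - int q))) UNIV"
    have "((\<lambda>e. (ope_series e * M e) * ((of_int (e i) gchoose q) * w powi (e i - int q))) has_sum ?T) UNIV"
      using sq by simp
    \<comment> \<open>Here a is the exponent of z i. At z i = z j = w the powers w^(e j) and w^(e i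
      - q) combine, so the exponent of the composite insertion is f j = e j + e i - q, and f i is
      reset to 0.\<close>
    also have "?this \<longleftrightarrow> ((\<lambda>(f, a). M f * ((of_int a gchoose q) * ope_series (f(i := a, j := f j + int q - a)))) has_sum ?T)
        ({f. f i = 0} \<times> UNIV)"
    proof (rule has_sum_reindex_bij_witness[of _ "\<lambda>(f, a). f(i := a, j := f j + int q - a)"
          "\<lambda>e. (e(i := 0, j := e j + e i - int q), e i)"])
      fix e :: idx
      show "(case (e(i := 0, j := e j + e i - int q), e i) of (f, a) \<Rightarrow> f(i := a, j := f j + int q - a)) = e"
        using ne(1) by (auto simp: fun_eq_iff)
      have "M (e(i := 0, j := e j + e i - int q)) = M e * w powi (e i - int q)"
      proof -
        have B: "finite ope_B" "j \<in> ope_B" "i \<notin> ope_B" using ne by (auto simp: ope_B_def)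
        have "M (e(i := 0, j := e j + e i - int q)) = w powi (e j + e i - int q) * (\<Prod>a\<in>ope_B - {j}. z a powi e a)"
        proof -
          have "(\<Prod>a\<in>ope_B - {j}. z a powi (e(i := 0, j := e j + e i - int q)) a) = (\<Prod>a\<in>ope_B - {j}. z a powi e a)"
          proof (rule prod.cong[OF refl])
            fix a assume "a \<in> ope_B - {j}"
            hence "a \<noteq> i" "a \<noteq> j" using B(3) by auto
            thus "z a powi (e(i := 0, j := e j + e i - int q)) a = z a powi e a" by simp
          qed
          thus ?thesis
            unfolding M_def mon_def by (subst prod.remove[OF B(1,2)]) (simp add: w_def)
        qed
        moreover have "M e = w powi e j * (\<Prod>a\<in>ope_B - {j}. z a powi e a)"
          unfolding M_def mon_def w_def by (rule prod.remove[OF B(1,2)])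
        moreover have "w powi (e j + e i - int q) = w powi e j * w powi (e i - int q)"
          using w0 power_int_add[of w "e j" "e i - int q"] by (simp add: algebra_simps)
        ultimately show ?thesis by simp
      qed
      moreover have "(e(i := 0, j := e j + e i - int q))(i := e i, j := (e(i := 0, j := e j + e i - int q)) j + int q - e i) = e"
        using ne(1) by (auto simp: fun_eq_iff)
      ultimately show "(case (e(i := 0, j := e j + e i - int q), e i) of (f, a) \<Rightarrow>
            M f * ((of_int a gchoose q) * ope_series (f(i := a, j := f j + int q - a)))) =
          (ope_series e * M e) * ((of_int (e i) gchoose q) * w powi (e i - int q))"
        unfolding case_prod_conv by (simp only: mult_ac)
    next
      fix b :: "idx \<times> int" assume b: "b \<in> {f. f i = 0} \<times> UNIV"
      obtain f a where [simp]: "b = (f, a)" by force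
      have f0: "f i = 0" using b by simp
      define g where "g = f(i := a, j := f j + int q - a)"
      have g: "g i = a" "g j = f j + int q - a" using ne(1) by (auto simp: g_def)
      have "g(i := 0, j := g j + g i - int q) = f"
        unfolding g using ne(1) f0 by (auto simp: g_def fun_eq_iff)
      thus "((case b of (f, a) \<Rightarrow> f(i := a, j := f j + int q - a))(i := 0, j := (case b of (f, a) \<Rightarrow> f(i := a, j := f j + int q - a)) j +
          (case b of (f, a) \<Rightarrow> f(i := a, j := f j + int q - a)) i - int q), (case b of (f, a) \<Rightarrow> f(i := a, j := f j + int q - a)) i) = b"
        using g(1) by (simp only: \<open>b = (f, a)\<close> case_prod_conv g_def[symmetric])
    qed (use ne in auto)
    finally have "((\<lambda>f. M f * ope_cf q f) has_sum ?T) {f. f i = 0}"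
    proof (rule has_sum_SigmaD)
      fix f :: idx assume "f \<in> {f. f i = 0}"
      hence "f i = 0" by simp
      from ope_coefficient[of f q, OF this]
      have "((\<lambda>a. M f * ((of_int a gchoose q) * ope_series (f(i := a, j := f j + int q - a)))) has_sum M f * ope_cf q f) UNIV"
        by (rule has_sum_cmult_right)
      thus "((\<lambda>a. case (f, a) of (f, a) \<Rightarrow> M f * ((of_int a gchoose q) * ope_series (f(i := a, j := f j + int q - a))))
          has_sum M f * ope_cf q f) UNIV"
        unfolding case_prod_conv .
    qed
    also have "?this \<longleftrightarrow> ((\<lambda>f. ope_cf q f * M f) has_sum ?T) UNIV"
      by (rule has_sum_cong_neutral) (use ne in \<open>auto simp: ope_cf_def cf_def supp_in_def mult.commute\<close>)
    finally have 1: "((\<lambda>f. ope_cf q f * M f) has_sum ?T) UNIV" .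
    have 2: "((\<lambda>f. ope_cf q f * M f) has_sum rval ope_B (ope_cf q) z) UNIV"
      unfolding ope_cf_def M_def ope_B_def
      by (rule cf_has_sum[OF ope_wts]) (use dist reg in \<open>auto simp: ope_region_def ope_B_def\<close>)
    show ?thesis by (rule has_sum_unique[OF 1 2])
  qed
  show ?thesis
    using eventually_punctured_disc[OF d]
  proof eventually_elim
    case (elim y)
    have yw: "norm y < norm w" "y \<noteq> 0" using elim dle(1) by auto
    have t: "norm w - d < norm (w + y)" "norm (w + y) < norm w + d"
      using norm_triangle_ineq[of w y] norm_diff_ineq[of w y] elim by linarith+
    have ny: "- d < norm y" "- norm y < d" "norm y < d" using elim d norm_ge_zero[of y] by linarith+
    note E = shifted_series_expansion[OF yw hs[OF t] sm sm]
    have 1: "(\<lambda>e. (ope_series e * M e) * ((of_int (e i) gchoose q) * w powi (e i - int q))) summable_on UNIV" for q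
      by (rule E(1)) (use elim ny in auto)
    have "((\<lambda>q::nat. y ^ q * infsum (\<lambda>e. (ope_series e * M e) * ((of_int (e i) gchoose q) * w powi (e i - int q))) UNIV)
         has_sum pval ope_A ope_num (z(i := w + y)) / bins_val ope_A (z(i := w + y)) ope_den) UNIV"
      by (rule E(2)) (use elim ny in auto)
    hence "((\<lambda>q::nat. y ^ q * rval ope_B (ope_cf q) z)
         has_sum pval ope_A ope_num (z(i := w + y)) / bins_val ope_A (z(i := w + y)) ope_den) UNIV"
      unfolding coef[OF 1] .
    thus ?case unfolding w_def .
  qed
qed

text \<open>Each composite state has its own truncation, hence its own denominator depending on q;
  each such denominator is nonzero at regular points, so the coefficients are holomorphic along the
  line one at a time.\<close>

lemma ope_state_sum_holomorphic:
  assumes g: "\<And>a. a \<in> ope_B \<Longrightarrow> (\<lambda>s. \<zeta> s a) holomorphic_on UNIV"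
    and S: "\<And>s. s \<in> S \<Longrightarrow> regular_pt ope_B (\<zeta> s)"
  shows "(\<lambda>s. rval ope_B (ope_cf q) (\<zeta> s)) holomorphic_on S"
proof -
  have fin: "finite ope_B" and B: "set (j # rest) = ope_B" by (auto simp: ope_B_def)
  have dist': "distinct (j # rest)" using dist by simp
  obtain vs' K' where vs': "trunc_data (\<psi>(j := ope_state q)) vs' K' ope_B" using trunc_data_exists by blast
  define N where "N = den (h(j := q)) vs' ope_B"
  define P where "P = acts N (ope_cf q)"
  have dn: "denominator ope_B (ope_cf q) N"
    using den_lpoly[OF ope_wts dist', of vs' K'] vs'
    by (simp only: trunc_data_def N_def ope_cf_def B)
  have polg: "polynomial_family (\<lambda>s y. \<zeta> s a)" if "a \<in> ope_B" for a
    by (rule polynomial_family_const[OF g[OF that]])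
  have dn': "\<forall>b\<in>#N. bin_ok ope_B b" "lpoly ope_B P"
    using dn unfolding denominator_def P_def by blast+
  have pol: "polynomial_family (\<lambda>s y. pval ope_B P (\<zeta> s))" "polynomial_family (\<lambda>s y. bins_val ope_B (\<zeta> s) N)"
    by (rule polynomial_family_pval[where Z = "\<lambda>s y. \<zeta> s"], erule polg, rule dn')
       (rule polynomial_family_bins_val[where Z = "\<lambda>s y. \<zeta> s"], erule polg, rule dn')
  have nz: "bins_val ope_B (\<zeta> s) N \<noteq> 0" if "s \<in> S" for s
    unfolding N_def by (rule den_val_regular[OF fin vs' S[OF that]])
  have "(\<lambda>s. pval ope_B P (\<zeta> s) / bins_val ope_B (\<zeta> s) N) holomorphic_on S"
    by (rule holomorphic_on_divide)
       (use polynomial_family_holomorphic[OF pol(1)] polynomial_family_holomorphic[OF pol(2)] nz holomorphic_on_subset in auto)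
  thus ?thesis
  proof (rule holomorphic_transform)
    fix s assume "s \<in> S"
    show "pval ope_B P (\<zeta> s) / bins_val ope_B (\<zeta> s) N = rval ope_B (ope_cf q) (\<zeta> s)"
      unfolding P_def by (rule rval_eq[OF dn nz[OF \<open>s \<in> S\<close>], symmetric])
  qed
qed

lemma ope_region_nonempty: "\<exists>z. ope_region z"
proof -
  define r where "r = Min (insert 1 (norm ` set us))"
  have r: "r > 0" unfolding r_def using us(2) by (subst Min_gr_iff) auto
  have ru: "r \<le> norm u" if "u \<in> set us" for u
    unfolding r_def using that by (intro Min_le) auto
  have "\<exists>z :: nat \<Rightarrow> complex. decreasing z os \<and> (\<forall>a\<in>set os. z a \<noteq> 0 \<and> norm (z a) < s)"
    if "distinct os" "s > 0" for os s
    using that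
  proof (induction os arbitrary: s)
    case (Cons a os)
    obtain z where z: "decreasing z os" "\<forall>b\<in>set os. z b \<noteq> 0 \<and> norm (z b) < s / 2"
      using Cons.IH[of "s / 2"] Cons.prems by auto
    have "decreasing (z(a := of_real (s / 2))) (a # os)"
    proof -
      have "sorted_wrt (\<lambda>b c. norm ((z(a := of_real (s / 2))) c) < norm ((z(a := of_real (s / 2))) b)) os"
        using z(1)[unfolded decreasing_def]
        by (rule sorted_wrt_mono_rel[rotated]) (use Cons.prems in auto)
      thus ?thesis using z(2) Cons.prems by (auto simp: decreasing_def)
    qed
    moreover have "\<forall>b\<in>set (a # os). (z(a := of_real (s / 2))) b \<noteq> 0 \<and> norm ((z(a := of_real (s / 2))) b) < s"
      using z(2) Cons.prems by force
    ultimately show ?case by blast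
  qed (simp add: decreasing_def)
  from this[of "j # rest" r] r dist obtain z where
    "decreasing z (j # rest)" "\<forall>a\<in>set (j # rest). z a \<noteq> 0 \<and> norm (z a) < r" by auto
  thus ?thesis using ru unfolding ope_region_def ope_B_def by (meson order_less_le_trans)
qed

lemma ope_region_regular:
  assumes "ope_region z"
  shows "regular_pt ope_B z"
  unfolding regular_pt_def
proof (intro conjI ballI)
  show "inj_on z ope_B"
  proof (rule inj_onI, rule ccontr)
    fix a b assume ab: "a \<in> ope_B" "b \<in> ope_B" "z a = z b" "a \<noteq> b"
    have "sorted_wrt (\<lambda>a b. norm (z b) < norm (z a)) (j # rest)"
      using assms by (simp add: ope_region_def decreasing_def)
    from sorted_wrt_order[OF this ab(1,2,4)[unfolded ope_B_def]] ab(3) show False by auto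
  qed
qed (use assms in \<open>force simp: ope_region_def\<close>)

lemma ope_region_open:
  assumes z: "ope_region z" and g: "\<And>a. continuous (at 0) (\<lambda>s::complex. \<zeta> s a)" and z0: "\<zeta> 0 = z"
  shows "eventually (\<lambda>s. ope_region (\<zeta> s)) (nhds 0)"
proof -
  have tz: "((\<lambda>s. norm (\<zeta> s a)) \<longlongrightarrow> norm (z a)) (nhds 0)" for a
  proof -
    have "((\<lambda>s. \<zeta> s a) \<longlongrightarrow> \<zeta> 0 a) (nhds 0)"
      by (rule iffD1[OF tendsto_at_iff_tendsto_nhds]) (rule g[unfolded isCont_def])
    thus ?thesis using z0 by (intro tendsto_norm) simp
  qed
  have lt: "eventually (\<lambda>s. norm (\<zeta> s a) < norm (\<zeta> s b)) (nhds 0)" if "norm (z a) < norm (z b)" for a b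
    using order_tendstoD[OF tendsto_diff[OF tz[of b] tz[of a]], of 0] that
    by (auto elim: eventually_mono)
  have "eventually (\<lambda>s. \<forall>m<length (j # rest). \<forall>n<length (j # rest). m < n \<longrightarrow>
      norm (\<zeta> s ((j # rest) ! n)) < norm (\<zeta> s ((j # rest) ! m))) (nhds 0)"
  proof -
    have "eventually (\<lambda>s. m < n \<longrightarrow> norm (\<zeta> s ((j # rest) ! n)) < norm (\<zeta> s ((j # rest) ! m))) (nhds 0)"
      if "m < length (j # rest)" "n < length (j # rest)" for m n
    proof (cases "m < n")
      case True
      have "norm (z ((j # rest) ! n)) < norm (z ((j # rest) ! m))"
        using z True that(2) by (simp add: ope_region_def decreasing_def sorted_wrt_iff_nth_less del: sorted_wrt.simps)
      from lt[OF this] show ?thesis by (auto elim: eventually_mono)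
    qed simp
    hence "eventually (\<lambda>s. \<forall>m\<in>{..<length (j # rest)}. \<forall>n\<in>{..<length (j # rest)}. m < n \<longrightarrow>
      norm (\<zeta> s ((j # rest) ! n)) < norm (\<zeta> s ((j # rest) ! m))) (nhds 0)"
      by (intro eventually_ball_finite ballI) auto
    thus ?thesis by eventually_elim auto
  qed
  moreover have "eventually (\<lambda>s. \<forall>a\<in>ope_B. \<forall>u\<in>set us. norm (\<zeta> s a) < norm u) (nhds 0)"
    by (intro eventually_ball_finite ballI order_tendstoD(2)[OF tz])
       (use z in \<open>auto simp: ope_region_def ope_B_def\<close>)
  moreover have "eventually (\<lambda>s. \<forall>a\<in>ope_B. 0 < norm (\<zeta> s a)) (nhds 0)"
    by (intro eventually_ball_finite ballI order_tendstoD(1)[OF tz])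
       (use z in \<open>auto simp: ope_region_def ope_B_def\<close>)
  ultimately show ?thesis
  proof eventually_elim
    case (elim s)
    thus ?case by (auto simp: ope_region_def decreasing_def sorted_wrt_iff_nth_less simp del: sorted_wrt.simps)
  qed
qed

text \<open>The line from a base point z0 at s = 0 to z at s = 1 loses only finitely many points to
  the singularities. What remains of the complex plane is open and connected, so coefficientwise
  equality near s = 0 carries over to s = 1.\<close>

lemma ope_labelled:
  assumes z: "regular_pt ope_B z"
  shows "eventually (\<lambda>y. ((\<lambda>q. y ^ q * rval ope_B (ope_cf q) z) has_sum
     y ^ ope_order * rval ope_A (cf \<psi> h (i # j # rest)) (z(i := z j + y))) UNIV) (at 0)"
proof -
  have ne: "i \<noteq> j" "i \<notin> ope_B" "j \<in> ope_B" "ope_A = insert i ope_B" "finite ope_B"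
    using dist by (auto simp: ope_A_def ope_B_def)
  obtain z0 where z0: "ope_region z0" using ope_region_nonempty by blast
  define \<zeta> where "\<zeta> = (\<lambda>s a. z0 a + s * (z a - z0 a))"
  have \<zeta>0: "\<zeta> 0 = z0" and \<zeta>1: "\<zeta> 1 = z" by (auto simp: \<zeta>_def)
  have hol\<zeta>: "(\<lambda>s. \<zeta> s a) holomorphic_on UNIV" for a
    unfolding \<zeta>_def by (intro holomorphic_intros)
  define S where "S = {s. regular_pt ope_B (\<zeta> s)}"
  have r0: "regular_pt ope_B z0" by (rule ope_region_regular[OF z0])
  have "finite (- S)"
  proof -
    have "finite {t. \<not> (inj_on (\<lambda>a. z0 a + t * (z a - z0 a)) ope_B \<and> (\<forall>a\<in>ope_B. z0 a + t * (z a - z0 a) \<notin> set us))}"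
      by (rule line_regular_cofinite) (use r0 ne in \<open>auto simp: regular_pt_def\<close>)
    also have "\<dots> = - S" by (auto simp: S_def regular_pt_def \<zeta>_def)
    finally show ?thesis .
  qed
  hence S: "open S" "connected S"
    using finite_imp_closed[of "- S"] connected_open_delete_finite[of "UNIV::complex set" "- S"]
    by (simp_all add: open_closed Diff_Compl connected_UNIV)
  define Z where "Z = (\<lambda>s y. (\<zeta> s)(i := \<zeta> s j + y))"
  have polZ: "polynomial_family (\<lambda>s y. Z s y a)" for a
  proof (cases "a = i")
    case True
    have "polynomial_family (\<lambda>s y. \<zeta> s j + y)" by (rule polynomial_family_shift[OF hol\<zeta>])
    thus ?thesis using True by (simp add: Z_def)
  next
    case False
    have "polynomial_family (\<lambda>s y. \<zeta> s a)" by (rule polynomial_family_const[OF hol\<zeta>])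
    thus ?thesis using False by (simp add: Z_def)
  qed
  have "polynomial_family (\<lambda>s y. pval ope_A ope_num (Z s y))"
    by (rule polynomial_family_pval[where Z = Z, OF _ ope_num_lpoly]) (rule polZ)
  then obtain p where p: "poly_family (\<lambda>s y. pval ope_A ope_num (Z s y)) p"
    unfolding polynomial_family_def by blast
  have "polynomial_family (\<lambda>s y. bins_val ope_A (Z s y) ope_den)"
    by (rule polynomial_family_bins_val[where Z = Z, OF _ ope_den_ok]) (rule polZ)
  then obtain r where r: "poly_family (\<lambda>s y. bins_val ope_A (Z s y) ope_den) r"
    unfolding polynomial_family_def by blast
  \<comment> \<open>The power series in y of the regularized amplitude over the parameter s. The
    denominator has nonzero constant term by \<open>ope_den_nonzero\<close>, also outside the region
    where the mode series converge.\<close>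
  define X where "X = (\<lambda>s. fps_of_poly (p s) / fps_of_poly (r s))"
  have r_nz: "fps_nth (fps_of_poly (r s)) 0 \<noteq> 0" if "s \<in> S" for s
  proof -
    have "regular_pt ope_B (\<zeta> s)" using that unfolding S_def by blast
    note nz = ope_den_nonzero[OF this]
    have "fps_nth (fps_of_poly (r s)) 0 = bins_val ope_A (Z s 0) ope_den"
      using r by (simp add: poly_family_def poly_0_coeff_0)
    also have "Z s 0 = (\<zeta> s)(i := \<zeta> s j)" by (simp add: Z_def)
    finally have "fps_nth (fps_of_poly (r s)) 0 = bins_val ope_A ((\<zeta> s)(i := \<zeta> s j)) ope_den" .
    thus ?thesis using nz by metis
  qed
  have holX: "(\<lambda>s. fps_nth (X s) q) holomorphic_on S" for q
    unfolding X_def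
    by (rule fps_quotient_holomorphic[OF _ _ r_nz])
       (use p r in \<open>auto simp: poly_family_def intro: holomorphic_on_subset\<close>)
  have expX: "eventually (\<lambda>y. ((\<lambda>q. y ^ q * fps_nth (X s) q) has_sum
      pval ope_A ope_num (Z s y) / bins_val ope_A (Z s y) ope_den) UNIV) (at 0)" if "s \<in> S" for s
  proof (rule has_sum_of_fps_expansion)
    have e: "poly q has_fps_expansion fps_of_poly q" for q :: "complex poly"
      by (simp add: has_fps_expansion_def)
    have "(\<lambda>y. poly (p s) y / poly (r s) y) has_fps_expansion X s"
      unfolding X_def by (rule has_fps_expansion_divide'[OF e e r_nz[OF that]])
    thus "(\<lambda>y. pval ope_A ope_num (Z s y) / bins_val ope_A (Z s y) ope_den) has_fps_expansion X s"
      using p r by (simp add: poly_family_def)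
  qed
  have eq: "fps_nth (X 1) q = rval ope_B (ope_cf q) (\<zeta> 1)" for q
  proof -
    have "eventually (\<lambda>s. ope_region (\<zeta> s)) (nhds 0)"
      by (rule ope_region_open[where \<zeta> = \<zeta>, OF z0 _ \<zeta>0]) (auto simp: \<zeta>_def intro!: continuous_intros)
    then obtain T where T: "open T" "0 \<in> T" "\<And>s. s \<in> T \<Longrightarrow> ope_region (\<zeta> s)"
      unfolding eventually_nhds by blast
    \<comment> \<open>Identity theorem on S: both sides are holomorphic there, and on the
      neighbourhood T of 0 they are Taylor coefficients of the same function.\<close>
    show ?thesis
    proof (rule analytic_continuation_open[of T S "\<lambda>s. fps_nth (X s) q" "\<lambda>s. rval ope_B (ope_cf q) (\<zeta> s)"])
      show "T \<subseteq> S" using T(3) ope_region_regular by (auto simp: S_def)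
      show "(\<lambda>s. rval ope_B (ope_cf q) (\<zeta> s)) holomorphic_on S"
        by (rule ope_state_sum_holomorphic[OF hol\<zeta>]) (simp add: S_def)
      fix s assume s: "s \<in> T"
      hence "s \<in> S" using \<open>T \<subseteq> S\<close> by blast
      have "(\<lambda>q. fps_nth (X s) q) = (\<lambda>q. rval ope_B (ope_cf q) (\<zeta> s))"
        by (rule power_series_unique[OF expX[OF \<open>s \<in> S\<close>]])
           (use ope_on_region[OF T(3)[OF s]] in \<open>simp only: Z_def\<close>)
      thus "fps_nth (X s) q = rval ope_B (ope_cf q) (\<zeta> s)" by metis
    qed (use T S z holX \<zeta>1 in \<open>auto simp: S_def\<close>)
  qed
  have "1 \<in> S" using z \<zeta>1 by (simp add: S_def)
  have "eventually (\<lambda>y. ((\<lambda>q. y ^ q * rval ope_B (ope_cf q) z) has_sum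
      pval ope_A ope_num (Z 1 y) / bins_val ope_A (Z 1 y) ope_den) UNIV) (at 0)"
    using expX[OF \<open>1 \<in> S\<close>] unfolding eq \<zeta>1 .
  moreover have "eventually (\<lambda>y. y \<notin> (\<lambda>x. x - z j) ` (set us \<union> z ` ope_B)) (at 0)"
    using ne by (intro eventually_notin_finite) auto
  ultimately show ?thesis
  proof eventually_elim
    case (elim y)
    have nin: "z j + y \<notin> set us \<union> z ` ope_B"
    proof
      assume "z j + y \<in> set us \<union> z ` ope_B"
      hence "(z j + y) - z j \<in> (\<lambda>x. x - z j) ` (set us \<union> z ` ope_B)" by blast
      thus False using elim by simp
    qed
    have reg: "regular_pt ope_A (z(i := z j + y))"
      unfolding regular_pt_def ne(4)
    proof (intro conjI ballI)
      have "inj_on (z(i := z j + y)) ope_B"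
        by (rule inj_on_fun_updI) (use z nin in \<open>auto simp: regular_pt_def\<close>)
      moreover have "z j + y \<notin> (z(i := z j + y)) ` (ope_B - {i})"
        using nin by auto
      ultimately show "inj_on (z(i := z j + y)) (insert i ope_B)"
        by (simp only: inj_on_insert fun_upd_same) simp
      show "(z(i := z j + y)) a \<notin> set us" if "a \<in> insert i ope_B" for a
        using that z nin by (cases "a = i") (auto simp: regular_pt_def)
    qed
    show ?case
      unfolding ope_rval[OF reg] using elim(1) by (simp only: Z_def \<zeta>1)
  qed
qed

end

section \<open>From labelled variables back to lists of insertions\<close>

lemma eta_amp_OPE:
  assumes \<phi>: "\<phi> \<in> wt h" and \<xi>: "\<xi> \<in> wt m" and qs: "\<forall>q\<in>set qs. \<exists>n. fst q \<in> wt n"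
    and pts: "distinct (w # map snd qs)" "set (w # map snd qs) \<inter> set us = {}"
  shows "eventually (\<lambda>y. ((\<lambda>q::nat. y ^ q * eta_amp ((vop \<phi> (int m - int q) \<xi>, w) # qs)) has_sum
     y ^ (h + m) * eta_amp ((\<phi>, w + y) # (\<xi>, w) # qs)) UNIV) (at 0)"
proof -
  \<comment> \<open>Labels 0 and 1 are the colliding pair, satisfying the order required of i and j;
    the remaining insertions are shifted by 2. The value z 0 = w is a placeholder, overwritten by w
    + y.\<close>
  define \<psi> where "\<psi> = (\<lambda>a. if a = 0 then \<phi> else if a = 1 then \<xi> else fst (qs ! (a - 2)))"
  define z where "z = (\<lambda>a. if a < 2 then w else snd (qs ! (a - 2)))"
  define d where "d = (\<lambda>a::nat. if a = 0 then h else if a = 1 then m else SOME n. \<psi> a \<in> wt n)"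
  define rest where "rest = map (\<lambda>k. k + 2) [0..<length qs]"
  have dist: "distinct (0 # 1 # rest)" by (auto simp: rest_def distinct_map inj_on_def)
  have wts: "\<forall>a\<in>set (0 # 1 # rest). \<psi> a \<in> wt (d a)"
  proof
    fix a assume a: "a \<in> set (0 # 1 # rest)"
    show "\<psi> a \<in> wt (d a)"
    proof (cases "a < 2")
      case True
      thus ?thesis using \<phi> \<xi> by (auto simp: \<psi>_def d_def less_2_cases_iff)
    next
      case False
      hence "qs ! (a - 2) \<in> set qs" using a by (auto simp: rest_def)
      then obtain n where "\<psi> a \<in> wt n" using qs False by (auto simp: \<psi>_def)
      hence "\<psi> a \<in> wt (SOME n. \<psi> a \<in> wt n)" by (rule someI)
      thus ?thesis using False by (simp add: d_def)
    qed
  qed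
  obtain vs K where vs: "trunc_data \<psi> vs K (set (0 # 1 # rest))" using trunc_data_exists by blast
  note C = zero_less_one dist wts vs
  have list: "map (\<lambda>a. (f a, g a)) rest = qs"
    if "\<And>a. 2 \<le> a \<Longrightarrow> f a = fst (qs ! (a - 2))" "\<And>a. 2 \<le> a \<Longrightarrow> g a = snd (qs ! (a - 2))" for f g
    by (rule nth_equalityI) (simp_all add: rest_def that)
  have zrest: "map z rest = map snd qs"
    by (rule nth_equalityI) (simp_all add: rest_def z_def)
  have regB: "regular_pt (set (1 # rest)) z"
    unfolding regular_pt_def
  proof (intro conjI ballI)
    have z1: "map z (1 # rest) = w # map snd qs" using zrest by (simp add: z_def)
    have "distinct (map z (1 # rest))" unfolding z1 by (rule pts(1))
    thus "inj_on z (set (1 # rest))" unfolding distinct_map by blast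
    fix a assume "a \<in> set (1 # rest)"
    hence "z a \<in> set (map z (1 # rest))" by (simp only: set_map imageI)
    thus "z a \<notin> set us" using pts(2) unfolding z1 by blast
  qed
  have E: "eventually (\<lambda>y. ((\<lambda>q. y ^ q * rval (set (1 # rest)) (cf (\<psi>(1 := md \<phi> h (int q - int (h + m)) \<xi>)) (d(1 := q)) (1 # rest)) z)
      has_sum y ^ (h + m) * rval (set (0 # 1 # rest)) (cf \<psi> d (0 # 1 # rest)) (z(0 := w + y))) UNIV) (at 0)"
  proof -
    have "\<psi> 0 = \<phi>" "\<psi> 1 = \<xi>" "d 0 = h" "d 1 = m" "z 1 = w"
      by (auto simp: \<psi>_def d_def z_def)
    with ope_labelled[OF C, unfolded ope_A_def[OF C] ope_B_def[OF C] ope_cf_def[OF C] ope_state_def[OF C] ope_order_def[OF C], OF regB]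
    show ?thesis by (simp only:)
  qed
  have "eventually (\<lambda>y. y \<notin> (\<lambda>x. x - w) ` (set us \<union> z ` set (1 # rest))) (at 0)"
    by (rule eventually_notin_finite) simp
  with E show ?thesis
  proof eventually_elim
    case (elim y)
    have nin: "w + y \<notin> set us \<union> z ` set (1 # rest)"
    proof
      assume "w + y \<in> set us \<union> z ` set (1 # rest)"
      hence "(w + y) - w \<in> (\<lambda>x. x - w) ` (set us \<union> z ` set (1 # rest))" by (rule imageI)
      thus False using elim(2) by simp
    qed
    have regA: "regular_pt (set (0 # 1 # rest)) (z(0 := w + y))"
      unfolding regular_pt_def
    proof (intro conjI ballI)
      have ins: "set (0 # 1 # rest) = insert 0 (set (1 # rest))" "0 \<notin> set (1 # rest)"
        using dist by auto
      have "inj_on (z(0 := w + y)) (set (1 # rest))"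
        by (rule inj_on_fun_updI) (use regB nin in \<open>auto simp: regular_pt_def\<close>)
      moreover have "w + y \<notin> (z(0 := w + y)) ` (set (1 # rest) - {0})"
        using nin by auto
      ultimately show "inj_on (z(0 := w + y)) (set (0 # 1 # rest))"
        unfolding ins(1) by (simp only: inj_on_insert fun_upd_same) simp
      fix a assume "a \<in> set (0 # 1 # rest)"
      thus "(z(0 := w + y)) a \<notin> set us"
        using nin regB by (cases "a = 0") (auto simp: regular_pt_def)
    qed
    have lhs: "eta_amp ((\<phi>, w + y) # (\<xi>, w) # qs) =
        rval (set (0 # 1 # rest)) (cf \<psi> d (0 # 1 # rest)) (z(0 := w + y))"
    proof -
      have "map (\<lambda>a. (\<psi> a, (z(0 := w + y)) a)) (0 # 1 # rest) = (\<phi>, w + y) # (\<xi>, w) # qs"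
        using list[of \<psi> "z(0 := w + y)"] by (simp add: \<psi>_def z_def)
      thus ?thesis using eta_amp_eq[OF wts dist regA] by (simp only:)
    qed
    have rhs: "eta_amp ((vop \<phi> (int m - int q) \<xi>, w) # qs) =
        rval (set (1 # rest)) (cf (\<psi>(1 := md \<phi> h (int q - int (h + m)) \<xi>)) (d(1 := q)) (1 # rest)) z" for q
    proof -
      define \<psi>' where "\<psi>' = \<psi>(1 := md \<phi> h (int q - int (h + m)) \<xi>)"
      have "md \<phi> h (int q - int (h + m)) \<xi> \<in> wt q"
        using md_weight[OF \<phi> \<xi>, of "int q - int (h + m)"] by simp
      hence w': "\<forall>a\<in>set (1 # rest). \<psi>' a \<in> wt ((d(1 := q)) a)"
        using wts by (auto simp: \<psi>'_def)
      have "vop \<phi> (int m - int q) \<xi> = \<psi>' 1" by (simp add: \<psi>'_def md_def)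
      hence eq: "map (\<lambda>a. (\<psi>' a, z a)) (1 # rest) = (vop \<phi> (int m - int q) \<xi>, w) # qs"
        using list[of \<psi>' z] by (simp add: \<psi>'_def \<psi>_def z_def)
      have "distinct (1 # rest)" using dist by simp
      from eta_amp_eq[OF w' this regB, unfolded eq] show ?thesis unfolding \<psi>'_def .
    qed
    show ?case unfolding lhs rhs by (rule elim(1))
  qed
qed

text \<open>The value does not depend on the order of the labels, so the pair can be listed first
  whichever of i and j is larger. Dividing by y^(h i + h j) shifts the summation from q = 0 to n = -
  h i - h j.\<close>

lemma eta_amp_insertions_OPE:
  assumes wts: "\<forall>a<l. \<psi> a \<in> wt (h a)" and z: "z \<in> cspace l - eta_singularities us l"
    and ij: "i < l" "j < l" "i \<noteq> j"
  shows "eventually (\<lambda>t.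
     ((\<lambda>n. (t - z j) powi n *
          eta_amp ((vop (\<psi> i) (- n - int (h i)) (\<psi> j), z j) #
            map (\<lambda>a. (\<psi> a, z a)) (filter (\<lambda>a. a \<noteq> i \<and> a \<noteq> j) [0..<l])))
       has_sum eta_amp (insertions l \<psi> (z(i := t)))) {- int (h i) - int (h j)..}) (at (z j))"
proof -
  define os where "os = filter (\<lambda>a. a \<noteq> i \<and> a \<noteq> j) [0..<l]"
  define qs where "qs = map (\<lambda>a. (\<psi> a, z a)) os"
  define N where "N = h i + h j"
  have os: "distinct (i # j # os)" "set (i # j # os) = {..<l}" "set (j # os) \<subseteq> {..<l}" "i \<notin> set (j # os)"
    using ij by (auto simp: os_def)
  have reg: "inj_on z {..<l}" "\<And>a. a < l \<Longrightarrow> z a \<notin> set us"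
    using z unfolding regular_iff regular_pt_def by auto
  have sqs: "map snd qs = map z os" by (simp add: qs_def)
  have E: "eventually (\<lambda>y. ((\<lambda>q::nat. y ^ q * eta_amp ((vop (\<psi> i) (int (h j) - int q) (\<psi> j), z j) # qs)) has_sum
     y ^ N * eta_amp ((\<psi> i, z j + y) # (\<psi> j, z j) # qs)) UNIV) (at 0)"
    unfolding N_def
  proof (rule eta_amp_OPE)
    show "\<psi> i \<in> wt (h i)" "\<psi> j \<in> wt (h j)" using wts ij by auto
    show "\<forall>q\<in>set qs. \<exists>n. fst q \<in> wt n" using wts os(3) by (auto simp: qs_def)
    have eq: "z j # map snd qs = map z (j # os)" by (simp add: sqs)
    show "distinct (z j # map snd qs)"
      unfolding eq distinct_map using os(1) inj_on_subset[OF reg(1) os(3)] by simp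
    show "set (z j # map snd qs) \<inter> set us = {}"
      unfolding eq set_map using os(3) reg(2) by blast
  qed
  have "eventually (\<lambda>y. y \<notin> (\<lambda>x. x - z j) ` (set us \<union> z ` {..<l})) (at 0)"
    by (rule eventually_notin_finite) simp
  moreover note eventually_punctured_disc[OF zero_less_one]
  ultimately have "eventually (\<lambda>y. ((\<lambda>n. y powi n *
          eta_amp ((vop (\<psi> i) (- n - int (h i)) (\<psi> j), z j) # qs))
       has_sum eta_amp (insertions l \<psi> (z(i := z j + y)))) {- int (h i) - int (h j)..}) (at 0)"
    using E
  proof eventually_elim
    case (elim y)
    have y0: "y \<noteq> 0" using elim(2) by simp
    have nin: "z j + y \<notin> set us \<union> z ` {..<l}"
    proof
      assume "z j + y \<in> set us \<union> z ` {..<l}"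
      hence "(z j + y) - z j \<in> (\<lambda>x. x - z j) ` (set us \<union> z ` {..<l})" by (rule imageI)
      thus False using elim(1) by simp
    qed
    define z' where "z' = z(i := z j + y)"
    have reg': "regular_pt {..<l} z'"
      unfolding regular_pt_def z'_def
    proof (intro conjI ballI)
      show "inj_on (z(i := z j + y)) {..<l}"
        by (rule inj_on_fun_updI[OF reg(1)]) (use nin in blast)
      fix a assume "a \<in> {..<l}"
      thus "(z(i := z j + y)) a \<notin> set us"
        using nin reg(2) by (cases "a = i") auto
    qed
    have amp: "eta_amp ((\<psi> i, z j + y) # (\<psi> j, z j) # qs) = eta_amp (insertions l \<psi> z')"
    proof -
      have "map (\<lambda>a. (\<psi> a, z' a)) os = qs"
        unfolding qs_def by (rule map_cong[OF refl]) (use os(4) in \<open>auto simp: z'_def\<close>)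
      hence "(\<psi> i, z j + y) # (\<psi> j, z j) # qs = map (\<lambda>a. (\<psi> a, z' a)) (i # j # os)"
        using ij by (simp add: z'_def)
      also have "eta_amp \<dots> = rval (set (i # j # os)) (cf \<psi> h (i # j # os)) z'"
        by (rule eta_amp_eq) (use wts os reg' in auto)
      also have "\<dots> = rval (set (i # j # os)) (cf \<psi> h [0..<l]) z'"
      proof (rule rval_cf_perm)
        show "mset [0..<l] = mset (i # j # os)"
          by (rule set_eq_iff_mset_eq_distinct[THEN iffD1]) (use os in auto)
        show "distinct (i # j # os)" by (rule os(1))
        show "regular_pt (set (i # j # os)) z'" unfolding os(2) by (rule reg')
        show "\<forall>a\<in>set (i # j # os). \<psi> a \<in> wt (h a)" unfolding os(2) using wts by simp
      qed
      also have "\<dots> = eta_amp (insertions l \<psi> z')"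
        unfolding os(2) by (rule eta_amp_insertions[OF wts reg', symmetric])
      finally show ?thesis .
    qed
    define X where "X = (\<lambda>n::int. y powi n * eta_amp ((vop (\<psi> i) (- n - int (h i)) (\<psi> j), z j) # qs))"
    have "((\<lambda>q::nat. inverse (y ^ N) * (y ^ q * eta_amp ((vop (\<psi> i) (int (h j) - int q) (\<psi> j), z j) # qs)))
        has_sum inverse (y ^ N) * (y ^ N * eta_amp (insertions l \<psi> z'))) UNIV"
      by (rule has_sum_cmult_right) (use elim(3) in \<open>simp only: amp\<close>)
    also have "inverse (y ^ N) * (y ^ N * eta_amp (insertions l \<psi> z')) = eta_amp (insertions l \<psi> z')"
      using y0 by simp
    also have "(\<lambda>q::nat. inverse (y ^ N) * (y ^ q * eta_amp ((vop (\<psi> i) (int (h j) - int q) (\<psi> j), z j) # qs))) =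
        (\<lambda>q. X (int q - int N))"
    proof
      fix q
      have "- (int q - int N) - int (h i) = int (h j) - int q" by (simp add: N_def)
      moreover have "y powi (int q - int N) = inverse (y ^ N) * y ^ q"
        using y0 by (simp add: power_int_diff divide_inverse)
      ultimately show "inverse (y ^ N) * (y ^ q * eta_amp ((vop (\<psi> i) (int (h j) - int q) (\<psi> j), z j) # qs)) = X (int q - int N)"
        by (simp only: X_def mult.assoc)
    qed
    finally have "((\<lambda>q. X (int q - int N)) has_sum eta_amp (insertions l \<psi> z')) UNIV" .
    also have "?this \<longleftrightarrow> (X has_sum eta_amp (insertions l \<psi> z')) {- int (h i) - int (h j)..}"
      by (rule has_sum_reindex_bij_witness[of _ "\<lambda>n. nat (n + int N)" "\<lambda>q. int q - int N"])
         (auto simp: N_def)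
    finally show ?case unfolding X_def z'_def .
  qed
  hence "eventually (\<lambda>t. ((\<lambda>n. (t - z j) powi n *
          eta_amp ((vop (\<psi> i) (- n - int (h i)) (\<psi> j), z j) # qs))
       has_sum eta_amp (insertions l \<psi> (z(i := z j + (t - z j))))) {- int (h i) - int (h j)..}) (at (z j))"
    unfolding at_to_0[of "z j"] eventually_filtermap by (simp only: add_diff_cancel_right')
  thus ?thesis by (simp only: add.commute[of "z j"] diff_add_cancel qs_def os_def)
qed

end

text \<open>One F on lists serves all numbers of insertions at once: the right side of the expansion
  has one insertion fewer and a homogeneous state that may lie outside V. The first clause, stated
  for all homogeneous states, identifies these values as continuations of the same series.\<close>

theorem theorem4:
  fixes smul :: "complex \<Rightarrow> 'h::ab_group_add \<Rightarrow> 'h"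
    and V :: "nat \<Rightarrow> 'h set"
    and amp :: "('h \<times> complex) list \<Rightarrow> complex"
    and \<Omega> \<omega> :: 'h
    and vop :: "'h \<Rightarrow> int \<Rightarrow> 'h \<Rightarrow> 'h"
    and c :: complex
    and us :: "complex list"
    and \<eta> :: "'h \<Rightarrow> complex"
  assumes "chiral_cft smul V amp \<Omega> vop \<omega> c"
    and "length us \<ge> 1" and "distinct us" and "0 \<notin> set us"
    and "Vector_Spaces.linear smul (*) \<eta>"
    and "O_space smul V vop (map Some us) \<subseteq> {\<xi>. \<eta> \<xi> = 0}"
  shows "\<exists>F :: ('h \<times> complex) list \<Rightarrow> complex.
    (\<forall>l \<psi> h. (\<forall>a<l. \<psi> a \<in> weight_space smul vop \<omega> (h a)) \<longrightarrow>
       continues_eta_series \<eta> vop \<Omega> us l \<psi> h (\<lambda>z. F (insertions l \<psi> z))) \<and>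
    (\<forall>l \<psi> h. (\<forall>a<l. \<psi> a \<in> V (h a)) \<longrightarrow>
       meromorphic_cspace l (\<lambda>z. F (insertions l \<psi> z)) (cspace l) (eta_singularities us l) \<and>
       (\<forall>z \<in> cspace l - eta_singularities us l. \<forall>i<l.
          nonsingular_at_infinity (\<lambda>z. F (insertions l \<psi> z)) z i (h i)) \<and>
       (\<forall>z \<in> cspace l - eta_singularities us l. \<forall>i<l. \<forall>j<l. i \<noteq> j \<longrightarrow>
          eventually (\<lambda>t.
            ((\<lambda>n. (t - z j) powi n *
                F ((vop (\<psi> i) (- n - int (h i)) (\<psi> j), z j) #
                   map (\<lambda>a. (\<psi> a, z a)) (filter (\<lambda>a. a \<noteq> i \<and> a \<noteq> j) [0..<l])))
             has_sum F (insertions l \<psi> (z(i := t)))) {- int (h i) - int (h j)..})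
          (at (z j))))"
proof -
  interpret T: cft_functional smul V amp \<Omega> vop \<omega> c us \<eta>
    using assms by (intro cft_functional.intro cft_functional_axioms.intro)
  have wt: "\<forall>a<l. \<psi> a \<in> weight_space smul vop \<omega> (h a)" if "\<forall>a<l. \<psi> a \<in> V (h a)" for l \<psi> h
    using that T.V_quasiprimary by blast
  show ?thesis
  proof (intro exI[of _ T.eta_amp] conjI allI impI ballI)
    fix l and \<psi> :: "nat \<Rightarrow> 'h" and h
    assume "\<forall>a<l. \<psi> a \<in> weight_space smul vop \<omega> (h a)"
    thus "continues_eta_series \<eta> vop \<Omega> us l \<psi> h (\<lambda>z. T.eta_amp (insertions l \<psi> z))"
      by (rule T.eta_amp_continues)
  next
    fix l and \<psi> :: "nat \<Rightarrow> 'h" and h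
    assume "\<forall>a<l. \<psi> a \<in> V (h a)"
    thus "meromorphic_cspace l (\<lambda>z. T.eta_amp (insertions l \<psi> z)) (cspace l) (eta_singularities us l)"
      by (rule T.eta_amp_meromorphic[OF wt])
  next
    fix l and \<psi> :: "nat \<Rightarrow> 'h" and h z i
    assume "\<forall>a<l. \<psi> a \<in> V (h a)" "z \<in> cspace l - eta_singularities us l" "i < l"
    thus "nonsingular_at_infinity (\<lambda>z. T.eta_amp (insertions l \<psi> z)) z i (h i)"
      by (rule T.eta_amp_at_infinity)
  next
    fix l and \<psi> :: "nat \<Rightarrow> 'h" and h z i j
    assume "\<forall>a<l. \<psi> a \<in> V (h a)" "z \<in> cspace l - eta_singularities us l" "i < l" "j < l" "i \<noteq> j"
    thus "eventually (\<lambda>t.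
            ((\<lambda>n. (t - z j) powi n *
                T.eta_amp ((vop (\<psi> i) (- n - int (h i)) (\<psi> j), z j) #
                   map (\<lambda>a. (\<psi> a, z a)) (filter (\<lambda>a. a \<noteq> i \<and> a \<noteq> j) [0..<l])))
             has_sum T.eta_amp (insertions l \<psi> (z(i := t)))) {- int (h i) - int (h j)..}) (at (z j))"
      by (rule T.eta_amp_insertions_OPE[OF wt])
  qed
qed

end
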